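(* Let $\beta>\beta_c$, $c_\lambda>0$, $\lambda=c_\lambda/N$. The sequence $\big(N^{-4/3}|\Lambda^-(\mathscr I)|\big)_{N\ge1}$ is uniformly tight under $\mu^\pm_{\lambda,N}$. Moreover there exists $K=K(\beta,c_\lambda)>0$ such that $$\mu^\pm_{\lambda,N}\big(N^{-4/3}|\Lambda^-(\mathscr I)|\notin[K^{-1},K]\big)\le \exp\big(-N^{\frac13-o(1)}\big),$$ where $o(1)$ denotes a quantity tending to $0$ as $N\to\infty$.
   Context: Standing setup. $\beta_c=\log(1+\sqrt2)$. For finite $\Lambda\subset\mathbb Z^2$, boundary condition $\eta\in\{\pm1\}^{\mathbb Z^2\setminus\Lambda}$, the Ising measure on $\{\pm1\}^\Lambda$ is $\mu^\eta_{\beta,\lambda,\Lambda}(\sigma)\propto\exp\big(-2\beta\big(\sum_{v\sim w,\,v,w\in\Lambda}\mathbf 1\{\sigma_v\ne\sigma_w\}+\sum_{v\sim w,\,v\in\Lambda,w\notin\Lambda}\mathbf 1\{\sigma_v\ne\eta_w\}\big)+\lambda\sum_{v\in\Lambda}\sigma_v\big)$; $\beta$ is fixed and suppressed. $\Lambda_N=\{0,\dots,N\}^2$; $\mu^\pm_{\lambda,N}$ uses the Dobrushin boundary condition: $+$ at outside sites with $y\ge0$, $-$ at outside sites with $y<0$. The interface $\mathscr I$ is the unique path component, joining $(-\tfrac12,-\tfrac12)$ to $(N+\tfrac12,-\tfrac12)$, of the set of dual edges (in $(\mathbb Z^2)^*=\mathbb Z^2+(\tfrac12,\tfrac12)$)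 separating differing spins, after decomposition into edge-disjoint paths and loops by the south-east splitting rule (at a dual vertex of degree 3 or 4 the pair of edges south and east of it is split from the others, likewise north and west). $\Lambda^-(\mathscr I)$ is the set of sites of $\Lambda_N$ lying below $\mathscr I$, i.e. the minus sites of the unique configuration (with the same boundary condition) whose set of separating dual edges is exactly $\mathscr I$. *)

theory Defs
  imports "HOL-Analysis.Analysis"
begin

definition beta_c :: real where "beta_c = ln (1 + sqrt 2)"

type_synonym site = "int \<times> int"

definition box :: "nat \<Rightarrow> site set" where
  "box N = {0..int N} \<times> {0..int N}"

definition dob :: "site \<Rightarrow> int" where
  "dob v = (if snd v \<ge> 0 then 1 else -1)"

definition configs :: "nat \<Rightarrow> (site \<Rightarrow> int) set" where
  "configs N = {\<sigma>. (\<forall>v\<in>box N. \<sigma> v \<in> {-1, 1}) \<and> (\<forall>v. v \<notin> box N \<longrightarrow> \<sigma> v = dob v)}"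

definition nn_edges :: "nat \<Rightarrow> (site \<times> site) set" where
  "nn_edges N = {(v, w). (w = (fst v + 1, snd v) \<or> w = (fst v, snd v + 1))
                          \<and> (v \<in> box N \<or> w \<in> box N)}"

definition hamiltonian :: "nat \<Rightarrow> (site \<Rightarrow> int) \<Rightarrow> real" where
  "hamiltonian N \<sigma> = real (card {(v, w) \<in> nn_edges N. \<sigma> v \<noteq> \<sigma> w})"

definition ising_weight :: "real \<Rightarrow> real \<Rightarrow> nat \<Rightarrow> (site \<Rightarrow> int) \<Rightarrow> real" where
  "ising_weight \<beta> lam N \<sigma> =
     exp (- 2 * \<beta> * hamiltonian N \<sigma> + lam * (\<Sum>v\<in>box N. real_of_int (\<sigma> v)))"

definition ising_prob :: "real \<Rightarrow> real \<Rightarrow> nat \<Rightarrow> ((site \<Rightarrow> int) set) \<Rightarrow> real" where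
  "ising_prob \<beta> lam N A =
     (\<Sum>\<sigma>\<in>configs N \<inter> A. ising_weight \<beta> lam N \<sigma>) / (\<Sum>\<sigma>\<in>configs N. ising_weight \<beta> lam N \<sigma>)"

text \<open>Dual vertices: the integer pair (a,b) stands for (a+1/2, b+1/2).
  A dual edge is the two-element set of its endpoints.\<close>
type_synonym dvert = "int \<times> int"

definition dual_edge :: "site \<Rightarrow> site \<Rightarrow> dvert set" where
  "dual_edge v w =
     (if w = (fst v + 1, snd v) then {(fst v, snd v - 1), v}
      else {(fst v - 1, snd v), v})"

definition sep_edges :: "nat \<Rightarrow> (site \<Rightarrow> int) \<Rightarrow> dvert set set" where
  "sep_edges N \<sigma> = {dual_edge v w | v w. (v, w) \<in> nn_edges N \<and> \<sigma> v \<noteq> \<sigma> w}"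

definition ddeg :: "dvert set set \<Rightarrow> dvert \<Rightarrow> nat" where
  "ddeg E u = card {e\<in>E. u \<in> e}"

definition south_e :: "dvert \<Rightarrow> dvert set" where "south_e u = {u, (fst u, snd u - 1)}"
definition north_e :: "dvert \<Rightarrow> dvert set" where "north_e u = {u, (fst u, snd u + 1)}"
definition east_e  :: "dvert \<Rightarrow> dvert set" where "east_e u = {u, (fst u + 1, snd u)}"
definition west_e  :: "dvert \<Rightarrow> dvert set" where "west_e u = {u, (fst u - 1, snd u)}"

text \<open>Two distinct edges of E meeting at u are joined at u (south-east splitting rule):
  at a vertex of degree 2 they are always joined; at a vertex of degree 3 or 4 only the
  south/east pair and the north/west pair are joined.\<close>
definition joined_at :: "dvert set set \<Rightarrow> dvert \<Rightarrow> dvert set \<Rightarrow> dvert set \<Rightarrow> bool" where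
  "joined_at E u e f \<longleftrightarrow> e \<in> E \<and> f \<in> E \<and> e \<noteq> f \<and> u \<in> e \<and> u \<in> f \<and>
     (ddeg E u = 2 \<or> {e, f} = {south_e u, east_e u} \<or> {e, f} = {north_e u, west_e u})"

definition joined :: "dvert set set \<Rightarrow> dvert set \<Rightarrow> dvert set \<Rightarrow> bool" where
  "joined E e f \<longleftrightarrow> (\<exists>u. joined_at E u e f)"

text \<open>The interface: the component (after splitting) of the separating edges that
  contains the edge at the dual vertex (-1/2,-1/2), i.e. the path joining
  (-1/2,-1/2) to (N+1/2,-1/2).\<close>
definition interface :: "nat \<Rightarrow> (site \<Rightarrow> int) \<Rightarrow> dvert set set" where
  "interface N \<sigma> =
     {f. \<exists>e. e \<in> sep_edges N \<sigma> \<and> (-1, -1) \<in> e \<and> (joined (sep_edges N \<sigma>))\<^sup>*\<^sup>* e f}"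

definition minus_region :: "nat \<Rightarrow> (site \<Rightarrow> int) \<Rightarrow> site set" where
  "minus_region N \<sigma> =
     (let \<tau> = (THE \<tau>. \<tau> \<in> configs N \<and> sep_edges N \<tau> = interface N \<sigma>)
      in {v \<in> box N. \<tau> v = -1})"

end

theory Submission imports Defs "HOL-Real_Asymp.Real_Asymp"
begin

text \<open>
  Write \<open>z = exp (- 2 * \<beta>)\<close>; the assumption on \<open>\<beta>\<close> gives \<open>5 * z < 1\<close>, so Peierls sums with at most three continuations
  per step converge. Cut a configuration along its interface \<open>I\<close>. Given \<open>I\<close>, the rest is an Ising model with
  plus boundary condition, with infinite couplings along \<open>I\<close>, and with the field reversed below \<open>I\<close>.

  At zero field the weights of the interfaces are summed exactly by the transfer matrix of a strip: conjugation by it acts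
  linearly on the fermion operators, and the second difference in the time direction is a Jacobi matrix. The total weight
  is at most \<open>exp (- \<tau> N)\<close> up to a power of \<open>N\<close>; confinement to height \<open>m\<close> costs only a factor
  \<open>exp (- O(N / m\<^sup>2 + m))\<close>; weakening the horizontal edges above height \<open>J\<close> gains \<open>exp (- gap N / J\<^sup>2)\<close>.

  The inequalities of Griffiths and Ginibre transfer this to the field \<open>c / N\<close>. With \<open>m = N powr (1/3)\<close> the
  partition function is at least \<open>exp (- \<tau> N - O(N powr (1/3)))\<close>, while an interface of area \<open>a\<close> pays \<open>exp (- l0 * a)\<close>
  with \<open>l0\<close> of order \<open>1 / N\<close>: this is the upper tail. For the lower tail, an interface of small area either has few edges above
  height \<open>J = \<eta> N powr (1/3)\<close>, and pays \<open>exp (- gap N / (2 J\<^sup>2))\<close> by the layered estimate, or it has long thin fingers, and flipping the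
  spins inside the fingers gains a factor exponential in \<open>N\<close>. The error \<open>o(1)\<close> in the exponent can be taken to be \<open>0\<close>.
\<close>

section \<open>Symmetric differences and characters\<close>

text \<open>The obstacle is that a field of order \<open>1 / N\<close> on \<open>N^2\<close> sites
  has total effect of order \<open>N\<close>, far above the required precision
  \<open>N^(1/3)\<close>. Hence nothing is estimated absolutely: a partition function with an
  interface is always compared with the plus partition function at the same field, where the bulk
  effect cancels. Freezing the edges along an interface of length \<open>n\<close> leaves an error
  \<open>exp (const * n / N)\<close>, which is bounded because \<open>n = O(N)\<close>. Only the
  reversed field below the interface survives, and area \<open>N^(4/3)\<close> at field
  \<open>1 / N\<close> gives \<open>N^(1/3)\<close>. Reversing the field also endangers the Peierls
  argument, since a loop of length \<open>k\<close> may enclose about \<open>k * N\<close> reversed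
  sites. For large \<open>c\<close> this cost is not small, so Ginibre's inequality first lowers the
  reversed field to some \<open>l0 \<le> c / N\<close> for which it is. The correlation inequalities
  become uniform once configurations are sets of minus sites under symmetric difference: a
  duplicated system is written in terms of \<open>Y\<close> and \<open>Y \<triangle> T\<close>, and
  everything reduces to nonnegative Fourier coefficients.\<close>

definition sdiff :: "'a set \<Rightarrow> 'a set \<Rightarrow> 'a set" (infixl "\<triangle>" 65)
  where "A \<triangle> B = (A - B) \<union> (B - A)"

lemma in_sdiff [simp]: "x \<in> A \<triangle> B \<longleftrightarrow> (x \<in> A) \<noteq> (x \<in> B)"
  by (auto simp: sdiff_def)

lemma sdiff_assoc: "A \<triangle> B \<triangle> C = A \<triangle> (B \<triangle> C)"
  by (rule set_eqI) auto

lemma sdiff_commute: "A \<triangle> B = B \<triangle> A"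
  by (rule set_eqI) auto

lemma sdiff_self [simp]: "A \<triangle> A = {}"
  by (rule set_eqI) auto

lemma sdiff_empty [simp]: "A \<triangle> {} = A" "{} \<triangle> A = A"
  by (rule set_eqI; auto)+

lemma sdiff_cancel [simp]: "A \<triangle> B \<triangle> B = A" "B \<triangle> (B \<triangle> A) = A"
  by (rule set_eqI; auto)+

lemma finite_sdiff [simp]: "finite A \<Longrightarrow> finite B \<Longrightarrow> finite (A \<triangle> B)"
  by (simp add: sdiff_def)

lemma sdiff_subset: "A \<subseteq> C \<Longrightarrow> B \<subseteq> C \<Longrightarrow> A \<triangle> B \<subseteq> C"
  by (auto simp: sdiff_def)

lemma sdiff_disjoint: "A \<inter> B = {} \<Longrightarrow> A \<triangle> B = A \<union> B"
  by (auto simp: sdiff_def)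

lemma bij_betw_sdiff_Pow: "T \<subseteq> B \<Longrightarrow> bij_betw (\<lambda>Y. Y \<triangle> T) (Pow B) (Pow B)"
  by (rule bij_betwI[where g = "\<lambda>Y. Y \<triangle> T"]) (auto simp: sdiff_def)

lemma card_sdiff_parity:
  assumes "finite A" "finite B" shows "even (card (A \<triangle> B)) \<longleftrightarrow> even (card A + card B)"
proof -
  have "card (A \<triangle> B) = card (A - B) + card (B - A)"
    unfolding sdiff_def using assms by (intro card_Un_disjoint) auto
  moreover have "card A = card (A - B) + card (A \<inter> B)" "card B = card (B - A) + card (A \<inter> B)"
    using assms card_Diff_subset_Int[of A B] card_Diff_subset_Int[of B A]
    by (metis add.commute card_Int_Diff, metis add.commute card_Int_Diff inf_commute)
  ultimately show ?thesis by auto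
qed

text \<open>If \<open>Y\<close> is the set of minus spins, this is the product of the spins over
  \<open>A\<close>; for finite \<open>A\<close> it is a character of the group of sets under
  symmetric difference.\<close>

definition chi :: "'a set \<Rightarrow> 'a set \<Rightarrow> real" where
  "chi A Y = (if even (card (A \<inter> Y)) then 1 else -1)"

lemma chi_empty [simp]: "chi {} Y = 1" "chi A {} = 1"
  by (simp_all add: chi_def)

lemma chi_cases: "chi A Y = 1 \<or> chi A Y = -1"
  by (simp add: chi_def)

lemma chi_square [simp]: "chi A Y * chi A Y = 1"
  by (simp add: chi_def)

lemma chi_singleton [simp]: "chi {v} Y = (if v \<in> Y then -1 else 1)"
  by (simp add: chi_def)

lemma chi_sdiff_right: "finite A \<Longrightarrow> chi A (Y \<triangle> Z) = chi A Y * chi A Z"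
proof -
  assume "finite A"
  moreover have "A \<inter> (Y \<triangle> Z) = (A \<inter> Y) \<triangle> (A \<inter> Z)" by (rule set_eqI) auto
  ultimately show ?thesis by (simp add: chi_def card_sdiff_parity)
qed

lemma chi_commute: "chi A Y = chi Y A"
  by (simp add: chi_def Int_commute)

lemma chi_sdiff_left: "finite A \<Longrightarrow> finite B \<Longrightarrow> chi (A \<triangle> B) Y = chi A Y * chi B Y"
proof -
  assume "finite A" "finite B"
  moreover have "(A \<triangle> B) \<inter> Y = (A \<inter> Y) \<triangle> (B \<inter> Y)" by (rule set_eqI) auto
  ultimately show ?thesis by (simp add: chi_def card_sdiff_parity)
qed

text \<open>Nonnegative combinations of characters: closed under products, and with nonnegative sums over all subsets.\<close>

inductive_set pd :: "('a set \<Rightarrow> real) set" where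
  pd_chi: "finite A \<Longrightarrow> chi A \<in> pd"
| pd_add: "f \<in> pd \<Longrightarrow> g \<in> pd \<Longrightarrow> (\<lambda>Y. f Y + g Y) \<in> pd"
| pd_scale: "f \<in> pd \<Longrightarrow> c \<ge> 0 \<Longrightarrow> (\<lambda>Y. c * f Y) \<in> pd"

lemma pd_const: "c \<ge> 0 \<Longrightarrow> (\<lambda>Y. c) \<in> pd"
  using pd_scale[OF pd_chi[of "{}"], of c] by simp

lemma pd_affine: "finite A \<Longrightarrow> a \<ge> 0 \<Longrightarrow> b \<ge> 0 \<Longrightarrow> (\<lambda>Y. a + b * chi A Y) \<in> pd"
  by (intro pd_add pd_const pd_scale pd_chi)

lemma pd_mult_chi: "f \<in> pd \<Longrightarrow> finite A \<Longrightarrow> (\<lambda>Y. f Y * chi A Y) \<in> pd"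
proof (induction rule: pd.induct)
  case (pd_chi B)
  have "(\<lambda>Y. chi B Y * chi A Y) = chi (B \<triangle> A)"
    using pd_chi by (simp add: chi_sdiff_left fun_eq_iff)
  then show ?case using pd_chi by (simp add: pd.pd_chi)
next
  case (pd_add f g)
  then show ?case using pd.pd_add[of "\<lambda>Y. f Y * chi A Y" "\<lambda>Y. g Y * chi A Y"]
    by (simp add: distrib_right)
next
  case (pd_scale f c)
  then show ?case using pd.pd_scale[of "\<lambda>Y. f Y * chi A Y" c]
    by (simp add: mult.assoc)
qed

lemma pd_mult: "g \<in> pd \<Longrightarrow> f \<in> pd \<Longrightarrow> (\<lambda>Y. f Y * g Y) \<in> pd"
proof (induction rule: pd.induct)
  case (pd_chi B)
  then show ?case by (simp add: pd_mult_chi)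
next
  case (pd_add g h)
  then show ?case using pd.pd_add[of "\<lambda>Y. f Y * g Y" "\<lambda>Y. f Y * h Y"]
    by (simp add: distrib_left)
next
  case (pd_scale g c)
  then show ?case using pd.pd_scale[of "\<lambda>Y. f Y * g Y" c]
    by (simp add: mult.left_commute)
qed

lemma pd_prod: "(\<And>i. i \<in> I \<Longrightarrow> f i \<in> pd) \<Longrightarrow> (\<lambda>Y. \<Prod>i\<in>I. f i Y) \<in> pd"
proof (induction I rule: infinite_finite_induct)
  case (insert i I)
  then show ?case using pd_mult[of "\<lambda>Y. \<Prod>i\<in>I. f i Y" "f i"] by auto
qed (auto intro: pd_const)

text \<open>The empty set is the neutral element of the group, and all characters equal 1
  there.\<close>

lemma pd_bound: "f \<in> pd \<Longrightarrow> \<bar>f Y\<bar> \<le> f {}"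
proof (induction rule: pd.induct)
  case (pd_chi A)
  then show ?case using chi_cases[of A Y] by auto
next
  case (pd_add f g)
  then show ?case by linarith
next
  case (pd_scale f c)
  then show ?case by (simp add: abs_mult mult_left_mono)
qed

text \<open>Flipping one site of \<open>A \<inter> B\<close> changes the sign of every summand, so
  the sum vanishes unless \<open>A\<close> misses \<open>B\<close>.\<close>

lemma sum_chi_nonneg:
  assumes "finite A" "finite B" shows "(\<Sum>Y\<in>Pow B. chi A Y) \<ge> 0"
proof (cases "A \<inter> B = {}")
  case True
  then have "chi A Y = 1" if "Y \<in> Pow B" for Y
    using that by (simp add: chi_def) (metis Int_mono card.empty even_zero order_refl subset_empty)
  then show ?thesis by (simp add: sum_nonneg)
next
  case False
  then obtain v where v: "v \<in> A" "v \<in> B" by auto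
  have "(\<Sum>Y\<in>Pow B. chi A Y) = (\<Sum>Y\<in>Pow B. chi A (Y \<triangle> {v}))"
    by (rule sum.reindex_bij_betw[OF bij_betw_sdiff_Pow, symmetric]) (use v in auto)
  also have "\<dots> = - (\<Sum>Y\<in>Pow B. chi A Y)"
    using v assms by (simp add: chi_sdiff_right sum_negf chi_commute[of A "{v}"])
  finally show ?thesis by simp
qed

lemma pd_sum_nonneg: "f \<in> pd \<Longrightarrow> finite B \<Longrightarrow> (\<Sum>Y\<in>Pow B. f Y) \<ge> 0"
proof (induction rule: pd.induct)
  case (pd_scale f c)
  then show ?case by (simp add: sum_distrib_left[symmetric])
qed (auto simp: sum_chi_nonneg sum.distrib)

text \<open>The coefficient of \<open>chi A\<close> is multiplied by \<open>1 - chi A T\<close>,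
  which is 0 or 2. This is what makes duplication work: the difference of an observable between two
  copies of the system is again a nonnegative combination of characters.\<close>

lemma pd_diff_shift: "f \<in> pd \<Longrightarrow> (\<lambda>Y. f Y - f (Y \<triangle> T)) \<in> pd"
proof (induction rule: pd.induct)
  case (pd_chi A)
  have "(\<lambda>Y. chi A Y - chi A (Y \<triangle> T)) = (\<lambda>Y. (1 - chi A T) * chi A Y)"
    using pd_chi by (simp add: chi_sdiff_right fun_eq_iff algebra_simps)
  then show ?case using pd_chi chi_cases[of A T] by (auto intro!: pd.pd_scale pd.pd_chi)
next
  case (pd_add f g)
  then show ?case using pd.pd_add[of "\<lambda>Y. f Y - f (Y \<triangle> T)" "\<lambda>Y. g Y - g (Y \<triangle> T)"]
    by (simp add: algebra_simps)
next
  case (pd_scale f c)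
  then show ?case using pd.pd_scale[of "\<lambda>Y. f Y - f (Y \<triangle> T)" c]
    by (simp add: algebra_simps)
qed

section \<open>The transfer matrix of a strip\<close>

text \<open>A set of heights encodes the horizontal dual edges met by one column of sites; \<open>opA j\<close> and \<open>opB j\<close> are the
  two Jordan--Wigner fermions at height \<open>j\<close>.\<close>

definition opA :: "nat \<Rightarrow> (nat set \<Rightarrow> real) \<Rightarrow> nat set \<Rightarrow> real" where
  "opA j f = (\<lambda>S. chi {..<j} S * f (S \<triangle> {j}))"

definition opB :: "nat \<Rightarrow> (nat set \<Rightarrow> real) \<Rightarrow> nat set \<Rightarrow> real" where
  "opB j f = (\<lambda>S. chi {..j} S * f (S \<triangle> {j}))"

text \<open>A vertical dual edge of weight \<open>z\<close> between two neighbouring columns ends at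
  two consecutive heights and toggles the horizontal edge at both.\<close>

definition opE :: "real \<Rightarrow> nat \<Rightarrow> (nat set \<Rightarrow> real) \<Rightarrow> nat set \<Rightarrow> real" where
  "opE z j f = (\<lambda>S. f S + z * f (S \<triangle> {j, Suc j}))"

primrec opD :: "real \<Rightarrow> nat \<Rightarrow> (nat set \<Rightarrow> real) \<Rightarrow> nat set \<Rightarrow> real" where
  "opD z 0 f = f"
| "opD z (Suc k) f = opE z k (opD z k f)"

definition hw :: "(nat \<Rightarrow> real) \<Rightarrow> nat \<Rightarrow> nat set \<Rightarrow> real" where
  "hw g m S = (\<Prod>i\<le>m. if i \<in> S then g i else 1)"

definition opH :: "(nat \<Rightarrow> real) \<Rightarrow> nat \<Rightarrow> (nat set \<Rightarrow> real) \<Rightarrow> nat set \<Rightarrow> real" where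
  "opH g m f = (\<lambda>S. hw g m S * f S)"

text \<open>\<open>g j\<close> is the square root of the weight of a horizontal edge. Half of the
  weight of a column is put on either side, so that conjugation leads to the symmetric matrix
  \<open>tT\<close>.\<close>

definition opV :: "real \<Rightarrow> (nat \<Rightarrow> real) \<Rightarrow> nat \<Rightarrow> (nat set \<Rightarrow> real) \<Rightarrow> nat set \<Rightarrow> real" where
  "opV z g m f = opH g m (opD z m (opH g m f))"

lemma chi_atMost_lessThan: "chi {..j::nat} S = (if j \<in> S then - chi {..<j} S else chi {..<j} S)"
proof -
  have "{..j} = {..<j} \<triangle> {j}" by (rule set_eqI) auto
  then show ?thesis by (simp add: chi_sdiff_left)
qed

lemma chi_Suc: "chi {..<Suc j} S = chi {..j} S"
  by (simp add: lessThan_Suc_atMost)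

definition linop :: "((nat set \<Rightarrow> real) \<Rightarrow> nat set \<Rightarrow> real) \<Rightarrow> bool" where
  "linop F \<longleftrightarrow> (\<forall>a b f h. F (\<lambda>S. a * f S + b * h S) = (\<lambda>S. a * F f S + b * F h S))"

lemma linopI: "(\<And>a b f h. F (\<lambda>S. a * f S + b * h S) = (\<lambda>S. a * F f S + b * F h S)) \<Longrightarrow> linop F"
  unfolding linop_def by blast

lemma linopD: "linop F \<Longrightarrow> F (\<lambda>S. a * f S + b * h S) = (\<lambda>S. a * F f S + b * F h S)"
  unfolding linop_def by blast

lemma linop_scale: assumes "linop F" shows "F (\<lambda>S. a * f S) = (\<lambda>S. a * F f S)"
proof -
  have "F (\<lambda>S. a * f S + 0 * f S) = (\<lambda>S. a * F f S + 0 * F f S)" by (rule linopD[OF assms])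
  then show ?thesis by simp
qed

lemma linop_add: assumes "linop F" shows "F (\<lambda>S. f S + h S) = (\<lambda>S. F f S + F h S)"
proof -
  have "F (\<lambda>S. 1 * f S + 1 * h S) = (\<lambda>S. 1 * F f S + 1 * F h S)" by (rule linopD[OF assms])
  then show ?thesis by simp
qed

lemma linop_diff: assumes "linop F" shows "F (\<lambda>S. f S - h S) = (\<lambda>S. F f S - F h S)"
proof -
  have "F (\<lambda>S. 1 * f S + (-1) * h S) = (\<lambda>S. 1 * F f S + (-1) * F h S)" by (rule linopD[OF assms])
  then show ?thesis by simp
qed

lemma linop_zero: assumes "linop F" shows "F (\<lambda>S. 0) = (\<lambda>S. 0)"
proof -
  have "F (\<lambda>S. 0 * (0::real)) = (\<lambda>S. 0 * F (\<lambda>S. 0) S)" by (rule linop_scale[OF assms])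
  then show ?thesis by simp
qed

lemma linop_sum:
  assumes "linop F" shows "F (\<lambda>S. \<Sum>i\<in>I. c i * f i S) = (\<lambda>S. \<Sum>i\<in>I. c i * F (f i) S)"
proof (induction I rule: infinite_finite_induct)
  case (insert i I)
  have "F (\<lambda>S. \<Sum>i\<in>insert i I. c i * f i S) = F (\<lambda>S. c i * f i S + 1 * (\<Sum>i\<in>I. c i * f i S))"
    using insert(1,2) by simp
  also have "\<dots> = (\<lambda>S. c i * F (f i) S + 1 * F (\<lambda>S. \<Sum>i\<in>I. c i * f i S) S)"
    by (rule linopD[OF assms])
  finally show ?case using insert by simp
qed (simp_all add: linop_zero[OF assms])

lemma linop_A: "linop (opA j)"
  by (rule linopI, rule ext) (simp add: opA_def algebra_simps)

lemma linop_E: "linop (opE z j)"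
  by (rule linopI, rule ext) (simp add: opE_def algebra_simps)

lemma linop_H: "linop (opH g m)"
  by (rule linopI, rule ext) (simp add: opH_def algebra_simps)

lemma linop_comp:
  assumes "linop F" "linop G" shows "linop (\<lambda>f. F (G f))"
proof (rule linopI)
  fix a b f h
  have "F (G (\<lambda>S. a * f S + b * h S)) = F (\<lambda>S. a * G f S + b * G h S)"
    by (rule arg_cong[OF linopD[OF assms(2)]])
  also have "\<dots> = (\<lambda>S. a * F (G f) S + b * F (G h) S)"
    by (rule linopD[OF assms(1)])
  finally show "F (G (\<lambda>S. a * f S + b * h S)) = (\<lambda>S. a * F (G f) S + b * F (G h) S)" .
qed

lemma linop_D: "linop (opD z k)"
proof (induction k)
  case 0
  then show ?case by (intro linopI) simp
next
  case (Suc k)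
  have "opD z (Suc k) = (\<lambda>f. opE z k (opD z k f))" by (rule ext) simp
  then show ?case using linop_comp[OF linop_E[of z k] Suc] by (simp only:)
qed

lemma linop_V: "linop (opV z g m)"
proof -
  have "opV z g m = (\<lambda>f. opH g m (opD z m (opH g m f)))" by (rule ext) (rule opV_def)
  then show ?thesis
    using linop_comp[OF linop_H[of g m] linop_comp[OF linop_D[of z m] linop_H[of g m]]] by (simp only:)
qed

lemma linop_funpow: assumes "linop F" shows "linop (F ^^ n)"
proof (induction n)
  case 0
  then show ?case by (intro linopI) simp
next
  case (Suc n)
  have "F ^^ Suc n = (\<lambda>f. F ((F ^^ n) f))" by (rule ext) simp
  then show ?case using linop_comp[OF assms Suc] by (simp only:)
qed

lemma sdiff_pair_comm: "S \<triangle> A \<triangle> B = S \<triangle> B \<triangle> A"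
  by (rule set_eqI) auto

lemma chi_lt_pair: "chi {..<i} {j, Suc j} = (if i = Suc j then -1 else 1)"
proof -
  have "{..<i} \<inter> {j, Suc j} = (if i \<le> j then {} else if i = Suc j then {j} else {j, Suc j})" by auto
  then show ?thesis by (auto simp: chi_def)
qed

lemma chi_le_pair: "chi {..i} {j, Suc j} = (if i = j then -1 else 1)"
  using chi_lt_pair[of "Suc i" j] by (simp add: chi_Suc del: lessThan_Suc)

lemma A_E_commute:
  assumes "i \<noteq> Suc j" shows "opA i (opE z j f) = opE z j (opA i f)"
proof
  fix S
  have "S \<triangle> {j, Suc j} \<triangle> {i} = S \<triangle> {i} \<triangle> {j, Suc j}" by (rule sdiff_pair_comm)
  then show "opA i (opE z j f) S = opE z j (opA i f) S"
    using assms by (simp add: opA_def opE_def chi_sdiff_right chi_lt_pair distrib_left)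
qed

lemma B_E_commute:
  assumes "i \<noteq> j" shows "opB i (opE z j f) = opE z j (opB i f)"
proof
  fix S
  have "S \<triangle> {j, Suc j} \<triangle> {i} = S \<triangle> {i} \<triangle> {j, Suc j}" by (rule sdiff_pair_comm)
  then show "opB i (opE z j f) S = opE z j (opB i f) S"
    using assms by (simp add: opB_def opE_def chi_sdiff_right chi_le_pair distrib_left)
qed

lemma pair_toggle: "S \<triangle> {j, Suc j} \<triangle> {j} = S \<triangle> {Suc j}" "S \<triangle> {j, Suc j} \<triangle> {Suc j} = S \<triangle> {j}"
   "S \<triangle> {j} \<triangle> {j, Suc j} = S \<triangle> {Suc j}" "S \<triangle> {Suc j} \<triangle> {j, Suc j} = S \<triangle> {j}"
  by (rule set_eqI; auto)+

text \<open>With \<open>z = tanh x\<close> these are \<open>cosh (2 * x)\<close> and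
  \<open>sinh (2 * x)\<close>. Up to a scalar, \<open>opE z j\<close> is the exponential of
  \<open>x\<close> times the toggle of a pair of heights, so conjugation by it is a hyperbolic
  rotation by \<open>2 * x\<close>.\<close>

definition Ck :: "real \<Rightarrow> real" where "Ck z = (1 + z\<^sup>2) / (1 - z\<^sup>2)"
definition Sk :: "real \<Rightarrow> real" where "Sk z = 2 * z / (1 - z\<^sup>2)"

lemma CkSk:
  assumes "z\<^sup>2 \<noteq> 1"
  shows "Ck z - z * Sk z = 1" "Sk z - z * Ck z = z"
proof -
  have nz: "1 - z\<^sup>2 \<noteq> 0" using assms by simp
  have "Ck z - z * Sk z = (1 - z\<^sup>2) / (1 - z\<^sup>2)"
    unfolding Ck_def Sk_def by (simp add: diff_divide_distrib[symmetric] power2_eq_square)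
  then show "Ck z - z * Sk z = 1" using nz by simp
  have "Sk z - z * Ck z = z * (1 - z\<^sup>2) / (1 - z\<^sup>2)"
    unfolding Ck_def Sk_def by (simp add: diff_divide_distrib[symmetric] algebra_simps)
  then show "Sk z - z * Ck z = z" using nz by simp
qed

text \<open>The pair toggle is, up to sign, the product of \<open>opB j\<close> and
  \<open>opA (Suc j)\<close>. It anticommutes with these two fermions and commutes with all others,
  so conjugation mixes exactly this pair.\<close>

lemma A_E_Suc:
  assumes "z\<^sup>2 \<noteq> 1"
  shows "opA (Suc j) (opE z j f) = opE z j (\<lambda>S. Ck z * opA (Suc j) f S + Sk z * opB j f S)"
    and "opE z j (opA (Suc j) f) = (\<lambda>S. Ck z * opA (Suc j) (opE z j f) S - Sk z * opB j (opE z j f) S)"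
    and "opB j (opE z j f) = opE z j (\<lambda>S. Ck z * opB j f S + Sk z * opA (Suc j) f S)"
    and "opE z j (opB j f) = (\<lambda>S. Ck z * opB j (opE z j f) S - Sk z * opA (Suc j) (opE z j f) S)"
proof -
  note simps = opA_def opB_def opE_def chi_Suc chi_sdiff_right chi_le_pair pair_toggle
  have key: "x + z * y = Ck z * (x - z * y) + Sk z * (y - z * x)" for x y :: real
  proof -
    have "Ck z * (x - z * y) + Sk z * (y - z * x) = (Ck z - z * Sk z) * x + (Sk z - z * Ck z) * y"
      by (simp add: algebra_simps)
    then show ?thesis using CkSk[OF assms] by simp
  qed
  have key2: "x - z * y = Ck z * (x + z * y) - Sk z * (y + z * x)" for x y :: real
  proof -
    have "Ck z * (x + z * y) - Sk z * (y + z * x) = (Ck z - z * Sk z) * x - (Sk z - z * Ck z) * y"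
      by (simp add: algebra_simps)
    then show ?thesis using CkSk[OF assms] by simp
  qed
  have k1: "c * (p + z * q) = Ck z * (c * p) + Sk z * (c * q) + z * (Ck z * (- (c * q)) + Sk z * (- (c * p)))" for c p q
    using key[of "c * p" "c * q"] by (simp add: algebra_simps)
  have k2: "c * p + z * (- (c * q)) = Ck z * (c * (p + z * q)) - Sk z * (c * (q + z * p))" for c p q
    using key2[of "c * p" "c * q"] by (simp add: algebra_simps)
  show "opA (Suc j) (opE z j f) = opE z j (\<lambda>S. Ck z * opA (Suc j) f S + Sk z * opB j f S)"
  proof
    fix S show "opA (Suc j) (opE z j f) S = opE z j (\<lambda>S. Ck z * opA (Suc j) f S + Sk z * opB j f S) S"
      using k1[of "chi {..j} S" "f (S \<triangle> {Suc j})" "f (S \<triangle> {j})"] by (simp add: simps)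
  qed
  show "opB j (opE z j f) = opE z j (\<lambda>S. Ck z * opB j f S + Sk z * opA (Suc j) f S)"
  proof
    fix S show "opB j (opE z j f) S = opE z j (\<lambda>S. Ck z * opB j f S + Sk z * opA (Suc j) f S) S"
      using k1[of "chi {..j} S" "f (S \<triangle> {j})" "f (S \<triangle> {Suc j})"] by (simp add: simps)
  qed
  show "opE z j (opA (Suc j) f) = (\<lambda>S. Ck z * opA (Suc j) (opE z j f) S - Sk z * opB j (opE z j f) S)"
  proof
    fix S show "opE z j (opA (Suc j) f) S = Ck z * opA (Suc j) (opE z j f) S - Sk z * opB j (opE z j f) S"
      using k2[of "chi {..j} S" "f (S \<triangle> {Suc j})" "f (S \<triangle> {j})"] by (simp add: simps)
  qed
  show "opE z j (opB j f) = (\<lambda>S. Ck z * opB j (opE z j f) S - Sk z * opA (Suc j) (opE z j f) S)"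
  proof
    fix S show "opE z j (opB j f) S = Ck z * opB j (opE z j f) S - Sk z * opA (Suc j) (opE z j f) S"
      using k2[of "chi {..j} S" "f (S \<triangle> {j})" "f (S \<triangle> {Suc j})"] by (simp add: simps)
  qed
qed

lemma A_D_commute: "j = 0 \<or> j > k \<Longrightarrow> opA j (opD z k f) = opD z k (opA j f)"
  by (induction k) (auto simp: A_E_commute)

lemma B_D_commute: "j \<ge> k \<Longrightarrow> opB j (opD z k f) = opD z k (opB j f)"
  by (induction k) (auto simp: B_E_commute)

text \<open>Among the factors of \<open>opD\<close> only \<open>opE z j\<close> fails to commute
  with \<open>opA (Suc j)\<close> and \<open>opB j\<close>, and it maps their span to itself; its
  rotation is therefore that of the whole product.\<close>

lemma A_D:
  assumes z: "z\<^sup>2 \<noteq> 1"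
  shows "j < k \<Longrightarrow> opA (Suc j) (opD z k f) = opD z k (\<lambda>S. Ck z * opA (Suc j) f S + Sk z * opB j f S)"
    and "j < k \<Longrightarrow> opB j (opD z k f) = opD z k (\<lambda>S. Ck z * opB j f S + Sk z * opA (Suc j) f S)"
    and "j < k \<Longrightarrow> opD z k (opA (Suc j) f) = (\<lambda>S. Ck z * opA (Suc j) (opD z k f) S - Sk z * opB j (opD z k f) S)"
    and "j < k \<Longrightarrow> opD z k (opB j f) = (\<lambda>S. Ck z * opB j (opD z k f) S - Sk z * opA (Suc j) (opD z k f) S)"
proof (induction k)
  case (Suc k)
  note A = A_D_commute[of "Suc k" k z f] and B = B_D_commute[of k k z f]
  { case 1 show ?case
    proof (cases "j = k")
      case True
      show ?thesis unfolding opD.simps True A_E_Suc(1)[OF z] linopD[OF linop_D[of z k]] using A B by simp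
    qed (use 1 Suc in \<open>simp add: A_E_commute\<close>) }
  { case 2 show ?case
    proof (cases "j = k")
      case True
      show ?thesis unfolding opD.simps True A_E_Suc(3)[OF z] linopD[OF linop_D[of z k]] using A B by simp
    qed (use 2 Suc in \<open>simp add: B_E_commute\<close>) }
  { case 3 show ?case
    proof (cases "j = k")
      case True
      show ?thesis unfolding opD.simps True using A B A_E_Suc(2)[OF z, of k "opD z k f"] by simp
    next
      case False
      then have "opD z k (opA (Suc j) f) = (\<lambda>S. Ck z * opA (Suc j) (opD z k f) S + (- Sk z) * opB j (opD z k f) S)"
        using 3 Suc(3) by simp
      then show ?thesis using False linopD[OF linop_E, of z k "Ck z" _ "- Sk z"]
        by (simp add: A_E_commute B_E_commute)
    qed }
  { case 4 show ?case
    proof (cases "j = k")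
      case True
      show ?thesis unfolding opD.simps True using A B A_E_Suc(4)[OF z, of k "opD z k f"] by simp
    next
      case False
      then have "opD z k (opB j f) = (\<lambda>S. Ck z * opB j (opD z k f) S + (- Sk z) * opA (Suc j) (opD z k f) S)"
        using 4 Suc(4) by simp
      then show ?thesis using False linopD[OF linop_E, of z k "Ck z" _ "- Sk z"]
        by (simp add: A_E_commute B_E_commute)
    qed }
qed auto

text \<open>\<open>cosh\<close> and \<open>sinh\<close> of \<open>- ln (g j)\<close>: the
  coefficients of the rotation by which the diagonal factor \<open>opH\<close> mixes
  \<open>opA j\<close> with \<open>opB j\<close>.\<close>

definition cL :: "(nat \<Rightarrow> real) \<Rightarrow> nat \<Rightarrow> real" where "cL g j = (1 / g j + g j) / 2"
definition sL :: "(nat \<Rightarrow> real) \<Rightarrow> nat \<Rightarrow> real" where "sL g j = (1 / g j - g j) / 2"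

lemma hw_toggle:
  assumes "j \<le> m" "g j > 0"
  shows "hw g m (S \<triangle> {j}) = (if j \<in> S then 1 / g j else g j) * hw g m S"
proof -
  have r: "{..m} = insert j ({..m} - {j})" using assms by auto
  have "(\<Prod>i\<in>{..m} - {j}. if i \<in> S \<triangle> {j} then g i else 1) = (\<Prod>i\<in>{..m} - {j}. if i \<in> S then g i else 1)"
    by (rule prod.cong) auto
  then show ?thesis
    unfolding hw_def by (subst (1 2) r, subst (1 2) prod.insert) (use assms in auto)
qed

lemma opB_eq: "opB j f S = (if j \<in> S then - opA j f S else opA j f S)"
  by (simp add: opA_def opB_def chi_atMost_lessThan)

text \<open>Toggling \<open>j\<close> multiplies the diagonal weight by \<open>1 / g j\<close> or by
  \<open>g j\<close> according to whether \<open>j \<in> S\<close>, and the same alternative decides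
  the relative sign of \<open>opA j\<close> and \<open>opB j\<close>. So the factor is
  \<open>cL g j\<close> plus or minus \<open>sL g j\<close>.\<close>

lemma A_H:
  assumes "j \<le> m" "g j > 0"
  shows "opA j (opH g m f) S = hw g m S * (cL g j * opA j f S - sL g j * opB j f S)"
    and "opB j (opH g m f) S = hw g m S * (cL g j * opB j f S - sL g j * opA j f S)"
    and "hw g m S * opA j f S = cL g j * opA j (opH g m f) S + sL g j * opB j (opH g m f) S"
    and "hw g m S * opB j f S = cL g j * opB j (opH g m f) S + sL g j * opA j (opH g m f) S"
proof -
  have c: "cL g j - sL g j = g j" "cL g j + sL g j = 1 / g j"
    by (auto simp: cL_def sL_def field_simps)
  have e: "1 / g j * w = cL g j * w + sL g j * w" "g j * w = cL g j * w - sL g j * w" for w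
    using c by (metis distrib_right, metis left_diff_distrib)
  have A: "opA j (opH g m f) S = (if j \<in> S then 1 / g j else g j) * (hw g m S * opA j f S)"
    unfolding opA_def opH_def using hw_toggle[of j m g S] assms by (simp add: mult_ac)
  have p: "x * y = hw g m S * (cL g j * u - sL g j * v)"
    if "x = cL g j - sL g j \<and> v = u \<or> x = cL g j + sL g j \<and> v = - u" "y = hw g m S * u" for x y u v
    using that by (elim disjE conjE, simp_all only:) (simp_all add: algebra_simps)
  have q: "w = cL g j * (x * w) + sL g j * (y * (x * w))"
    if "x = g j \<and> y = 1 \<or> x = 1 / g j \<and> y = -1" for w x y
  proof -
    have "(cL g j + sL g j * y) * x = 1"
      using that c assms by auto
    then have "w * 1 = w * ((cL g j + sL g j * y) * x)" by simp
    then show ?thesis by (simp add: algebra_simps)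
  qed
  show "opA j (opH g m f) S = hw g m S * (cL g j * opA j f S - sL g j * opB j f S)"
    unfolding A opB_eq by (rule p) (use c in auto)
  show "opB j (opH g m f) S = hw g m S * (cL g j * opB j f S - sL g j * opA j f S)"
    unfolding A opB_eq
    using e(1)[of "hw g m S * opA j f S"] e(2)[of "hw g m S * opA j f S"]
    by (cases "j \<in> S") (simp_all add: algebra_simps)
  show "hw g m S * opA j f S = cL g j * opA j (opH g m f) S + sL g j * opB j (opH g m f) S"
    using q[of "if j \<in> S then 1 / g j else g j" "if j \<in> S then -1 else 1" "hw g m S * opA j f S"]
    unfolding opB_eq A by (auto split: if_splits)
  show "hw g m S * opB j f S = cL g j * opB j (opH g m f) S + sL g j * opA j (opH g m f) S"
    using q[of "if j \<in> S then 1 / g j else g j" "if j \<in> S then -1 else 1" "hw g m S * opA j f S"]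
    unfolding opB_eq A by (auto split: if_splits)
qed

context
  fixes z :: real and g :: "nat \<Rightarrow> real" and m :: nat
begin

text \<open>No vertical edge leads below height 0 or above height \<open>m\<close>, so the rotation
  is trivial at these ends. The coefficient 0 also neutralizes the truncated index
  \<open>j - 1\<close> at \<open>j = 0\<close> and the index \<open>Suc j\<close> at
  \<open>j = m\<close>.\<close>

definition ca :: "nat \<Rightarrow> real" where "ca j = (if j = 0 then 1 else Ck z)"
definition sa :: "nat \<Rightarrow> real" where "sa j = (if j = 0 then 0 else Sk z)"
definition cb :: "nat \<Rightarrow> real" where "cb j = (if j = m then 1 else Ck z)"
definition sb :: "nat \<Rightarrow> real" where "sb j = (if j = m then 0 else Sk z)"

text \<open>The conjugation matrix split by type: \<open>tT\<close> collects the coefficients of the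
  operators \<open>opA k\<close>, and \<open>tQ\<close> those of the operators
  \<open>opB k\<close>.\<close>

definition tT :: "(nat \<Rightarrow> real) \<Rightarrow> nat \<Rightarrow> real" where
  "tT a j = (ca j * (cL g j)\<^sup>2 + cb j * (sL g j)\<^sup>2) * a j - sa j * cL g j * sL g (j - 1) * a (j - 1)
     - sb j * sL g j * cL g (Suc j) * a (Suc j)"

definition tQ :: "(nat \<Rightarrow> real) \<Rightarrow> nat \<Rightarrow> real" where
  "tQ b j = (ca j + cb j) * cL g j * sL g j * b j - sa j * cL g j * cL g (j - 1) * b (j - 1)
     - sb j * sL g j * sL g (Suc j) * b (Suc j)"

lemma A_D':
  assumes "z\<^sup>2 \<noteq> 1" "j \<le> m"
  shows "opA j (opD z m f) = opD z m (\<lambda>S. ca j * opA j f S + sa j * opB (j - 1) f S)"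
    and "opB j (opD z m f) = opD z m (\<lambda>S. cb j * opB j f S + sb j * opA (Suc j) f S)"
    and "opD z m (opA j f) = (\<lambda>S. ca j * opA j (opD z m f) S - sa j * opB (j - 1) (opD z m f) S)"
    and "opD z m (opB j f) = (\<lambda>S. cb j * opB j (opD z m f) S - sb j * opA (Suc j) (opD z m f) S)"
proof -
  show "opA j (opD z m f) = opD z m (\<lambda>S. ca j * opA j f S + sa j * opB (j - 1) f S)"
    using A_D(1)[OF assms(1), of "j - 1" m f] A_D_commute[of 0 m z f] assms(2)
    by (cases "j = 0") (auto simp: ca_def sa_def)
  show "opB j (opD z m f) = opD z m (\<lambda>S. cb j * opB j f S + sb j * opA (Suc j) f S)"
    using A_D(2)[OF assms(1), of j m f] B_D_commute[of m j z f] assms(2)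
    by (cases "j = m") (auto simp: cb_def sb_def)
  show "opD z m (opA j f) = (\<lambda>S. ca j * opA j (opD z m f) S - sa j * opB (j - 1) (opD z m f) S)"
    using A_D(3)[OF assms(1), of "j - 1" m f] A_D_commute[of 0 m z f] assms(2)
    by (cases "j = 0") (auto simp: ca_def sa_def)
  show "opD z m (opB j f) = (\<lambda>S. cb j * opB j (opD z m f) S - sb j * opA (Suc j) (opD z m f) S)"
    using A_D(4)[OF assms(1), of j m f] B_D_commute[of m j z f] assms(2)
    by (cases "j = m") (auto simp: cb_def sb_def)
qed

lemma A_V:
  assumes z: "z\<^sup>2 \<noteq> 1" and j: "j \<le> m" and g: "\<And>i. g i > 0"
  shows "opA j (opV z g m f) = opV z g m (\<lambda>S. tT (\<lambda>k. opA k f S) j - tQ (\<lambda>k. opB k f S) j)"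
proof -
  define h where "h = opH g m f"
  define F where "F = opD z m h"
  define c s where "c = cL g j" and "s = sL g j"
  have "opA j (opV z g m f) = opA j (opH g m F)"
    by (simp add: opV_def F_def h_def)
  also have "\<dots> = opH g m (\<lambda>S. c * opA j F S - s * opB j F S)"
    unfolding opH_def[of _ _ "\<lambda>S. c * opA j F S - s * opB j F S"]
    by (rule ext) (simp add: A_H[where g = g, OF j g] c_def s_def)
  also have "(\<lambda>S. c * opA j F S - s * opB j F S)
     = opD z m (\<lambda>S. c * (ca j * opA j h S + sa j * opB (j - 1) h S) - s * (cb j * opB j h S + sb j * opA (Suc j) h S))"
    unfolding F_def A_D'[OF z j] linop_diff[OF linop_D[of z m]] linop_scale[OF linop_D[of z m]] by (rule refl)
  also have "(\<lambda>S. c * (ca j * opA j h S + sa j * opB (j - 1) h S) - s * (cb j * opB j h S + sb j * opA (Suc j) h S))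
      = opH g m (\<lambda>S. tT (\<lambda>k. opA k f S) j - tQ (\<lambda>k. opB k f S) j)"
  proof
    fix S
    have 1: "sa j * opB (j - 1) h S = sa j * (hw g m S * (cL g (j - 1) * opB (j - 1) f S - sL g (j - 1) * opA (j - 1) f S))"
      using A_H(2)[of "j - 1" m g f S] j g by (simp add: h_def)
    have 2: "sb j * opA (Suc j) h S = sb j * (hw g m S * (cL g (Suc j) * opA (Suc j) f S - sL g (Suc j) * opB (Suc j) f S))"
      using A_H(1)[of "Suc j" m g f S] j g by (cases "j = m") (auto simp: h_def sb_def)
    show "c * (ca j * opA j h S + sa j * opB (j - 1) h S) - s * (cb j * opB j h S + sb j * opA (Suc j) h S)
      = opH g m (\<lambda>S. tT (\<lambda>k. opA k f S) j - tQ (\<lambda>k. opB k f S) j) S"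
      unfolding 1 2 opH_def tT_def tQ_def unfolding h_def A_H(1,2)[where g = g, OF j g] c_def s_def
      by (simp add: algebra_simps power2_eq_square)
  qed
  finally show ?thesis by (simp add: opV_def)
qed

text \<open>Compared with \<open>A_V\<close> the rotations run backwards, so every hyperbolic sine
  changes sign; \<open>tT\<close> is even in them and \<open>tQ\<close> is odd.\<close>

lemma V_A:
  assumes z: "z\<^sup>2 \<noteq> 1" and j: "j \<le> m" and g: "\<And>i. g i > 0"
  shows "opV z g m (opA j f) = (\<lambda>S. tT (\<lambda>k. opA k (opV z g m f) S) j + tQ (\<lambda>k. opB k (opV z g m f) S) j)"
proof -
  define h where "h = opH g m f"
  define F where "F = opD z m h"
  have V: "opV z g m f = opH g m F" by (simp add: opV_def F_def h_def)
  define c s where "c = cL g j" and "s = sL g j"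
  have "opH g m (opA j f) = (\<lambda>S. c * opA j h S + s * opB j h S)"
    unfolding opH_def[of _ _ "opA j f"] A_H(3)[where g = g, OF j g] by (simp add: c_def s_def h_def)
  then have "opD z m (opH g m (opA j f)) = (\<lambda>S. c * opD z m (opA j h) S + s * opD z m (opB j h) S)"
    by (simp only: linopD[OF linop_D[of z m]])
  also have "\<dots> = (\<lambda>S. c * (ca j * opA j F S - sa j * opB (j - 1) F S) + s * (cb j * opB j F S - sb j * opA (Suc j) F S))"
    unfolding A_D'(3,4)[OF z j] F_def by (rule refl)
  finally have D: "opD z m (opH g m (opA j f)) =
     (\<lambda>S. c * (ca j * opA j F S - sa j * opB (j - 1) F S) + s * (cb j * opB j F S - sb j * opA (Suc j) F S))" .
  show ?thesis
  proof
    fix S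
    have 1: "sa j * (hw g m S * opB (j - 1) F S) = sa j * (cL g (j - 1) * opB (j - 1) (opH g m F) S + sL g (j - 1) * opA (j - 1) (opH g m F) S)"
      using A_H(4)[of "j - 1" m g S F] j g by simp
    have 2: "sb j * (hw g m S * opA (Suc j) F S) = sb j * (cL g (Suc j) * opA (Suc j) (opH g m F) S + sL g (Suc j) * opB (Suc j) (opH g m F) S)"
      using A_H(3)[of "Suc j" m g S F] j g by (cases "j = m") (auto simp: sb_def)
    have "opV z g m (opA j f) S = c * ca j * (hw g m S * opA j F S) - c * (sa j * (hw g m S * opB (j - 1) F S))
       + s * cb j * (hw g m S * opB j F S) - s * (sb j * (hw g m S * opA (Suc j) F S))"
      unfolding opV_def D by (simp add: opH_def algebra_simps)
    also have "\<dots> = tT (\<lambda>k. opA k (opH g m F) S) j + tQ (\<lambda>k. opB k (opH g m F) S) j"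
      unfolding 1 2 A_H(3,4)[where g = g, OF j g] tT_def tQ_def c_def s_def
      by (simp add: algebra_simps power2_eq_square)
    finally show "opV z g m (opA j f) S = tT (\<lambda>k. opA k (opV z g m f) S) j + tQ (\<lambda>k. opB k (opV z g m f) S) j"
      by (simp add: V)
  qed
qed

text \<open>The second difference in the time direction no longer involves the operators \<open>opB\<close>.\<close>

lemma V_A_second_order:
  assumes z: "z\<^sup>2 \<noteq> 1" and j: "j \<le> m" and g: "\<And>i. g i > 0"
  shows "opA j (opV z g m (opV z g m f)) S + opV z g m (opV z g m (opA j f)) S
       = 2 * tT (\<lambda>k. opV z g m (opA k (opV z g m f)) S) j"
proof -
  define h where "h = opV z g m f"
  let ?T = "\<lambda>S. tT (\<lambda>k. opA k h S) j" and ?Q = "\<lambda>S. tQ (\<lambda>k. opB k h S) j"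
  have "opA j (opV z g m h) S + opV z g m (opV z g m (opA j f)) S
      = opV z g m (\<lambda>S. ?T S - ?Q S) S + opV z g m (\<lambda>S. ?T S + ?Q S) S"
    unfolding A_V[OF z j g] V_A[where f = f, OF z j g] h_def by (rule refl)
  also have "\<dots> = 2 * opV z g m ?T S"
    unfolding linop_diff[OF linop_V] linop_add[OF linop_V] by simp
  also have "opV z g m ?T S = tT (\<lambda>k. opV z g m (opA k h) S) j"
    unfolding tT_def linop_diff[OF linop_V] linop_scale[OF linop_V] by simp
  finally show ?thesis by (simp add: h_def)
qed

end

section \<open>The vacuum vector and bounds by nonnegative Fourier coefficients\<close>

definition vac :: "nat \<Rightarrow> nat set \<Rightarrow> real" where "vac m = hw (\<lambda>_. 0) m"

lemma vac_eq: "vac m S = (if S \<inter> {..m} = {} then 1 else 0)"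
proof (cases "S \<inter> {..m} = {}")
  case True
  then have "hw (\<lambda>_. 0) m S = (\<Prod>i\<le>m. 1)" unfolding hw_def by (intro prod.cong) auto
  then show ?thesis using True by (simp add: vac_def)
qed (auto simp: vac_def hw_def)

lemma pd_hw:
  assumes "\<And>i. 0 \<le> g i" "\<And>i. g i \<le> 1" shows "hw g m \<in> pd"
proof -
  have "(\<lambda>S. \<Prod>i\<in>{..m}. (1 + g i) / 2 + (1 - g i) / 2 * chi {i} S) \<in> pd"
  proof (rule pd_prod)
    fix i
    show "(\<lambda>S. (1 + g i) / 2 + (1 - g i) / 2 * chi {i} S) \<in> pd"
      using assms[of i] by (intro pd_affine) auto
  qed
  moreover have "hw g m = (\<lambda>S. \<Prod>i\<in>{..m}. (1 + g i) / 2 + (1 - g i) / 2 * chi {i} S)"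
    unfolding hw_def by (rule ext, rule prod.cong) (auto simp: field_simps)
  ultimately show ?thesis by simp
qed

lemma pd_shift_add: "f \<in> pd \<Longrightarrow> 0 \<le> z \<Longrightarrow> z \<le> 1 \<Longrightarrow> (\<lambda>S. f S + z * f (S \<triangle> T)) \<in> pd"
proof (induction rule: pd.induct)
  case (pd_chi A)
  have "(\<lambda>S. chi A S + z * chi A (S \<triangle> T)) = (\<lambda>S. (1 + z * chi A T) * chi A S)"
    using pd_chi by (simp add: chi_sdiff_right fun_eq_iff algebra_simps)
  moreover have "1 + z * chi A T \<ge> 0" using chi_cases[of A T] pd_chi by auto
  ultimately show ?case using pd_chi by (auto intro!: pd.pd_scale pd.pd_chi)
next
  case (pd_add f g)
  then show ?case using pd.pd_add[of "\<lambda>S. f S + z * f (S \<triangle> T)" "\<lambda>S. g S + z * g (S \<triangle> T)"]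
    by (simp add: algebra_simps)
next
  case (pd_scale f c)
  then show ?case using pd.pd_scale[of "\<lambda>S. f S + z * f (S \<triangle> T)" c]
    by (simp add: algebra_simps)
qed

lemma pd_opV:
  assumes "0 \<le> z" "z \<le> 1" "\<And>i. 0 \<le> g i" "\<And>i. g i \<le> 1" "f \<in> pd"
  shows "opV z g m f \<in> pd"
proof -
  have H: "opH g m h \<in> pd" if "h \<in> pd" for h
    unfolding opH_def using pd_mult[OF that pd_hw[OF assms(3,4)]] .
  have D: "opD z k h \<in> pd" if "h \<in> pd" for k h
    using that by (induction k) (auto simp: opE_def intro!: pd_shift_add assms)
  show ?thesis unfolding opV_def by (intro H D assms)
qed

lemma pd_opV_funpow:
  assumes "0 \<le> z" "z \<le> 1" "\<And>i. 0 \<le> g i" "\<And>i. g i \<le> 1" "f \<in> pd"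
  shows "(opV z g m ^^ n) f \<in> pd"
  by (induction n) (auto intro!: pd_opV assms)

lemma pd_vac: "vac m \<in> pd"
  unfolding vac_def by (rule pd_hw) auto

text \<open>A shift by \<open>T\<close> only multiplies each character by a sign, and the functional
  is nonnegative on characters. The purpose is to bound the amplitude of two fermions created on the
  vacuum by the plus partition function.\<close>

lemma functional_shift_bound:
  assumes "f \<in> pd" "linop F" "\<And>A. finite A \<Longrightarrow> F (chi A) {} \<ge> 0"
  shows "\<bar>F (\<lambda>S. f (S \<triangle> T)) {}\<bar> \<le> F f {}"
  using assms(1)
proof (induction rule: pd.induct)
  case (pd_chi A)
  have "(\<lambda>S. chi A (S \<triangle> T)) = (\<lambda>S. chi A T * chi A S)"
    using pd_chi by (simp add: chi_sdiff_right fun_eq_iff)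
  then show ?case using linop_scale[OF assms(2), of "chi A T" "chi A"] assms(3)[OF pd_chi] chi_cases[of A T]
    by auto
next
  case (pd_add f g)
  then show ?case unfolding linop_add[OF assms(2)] by linarith
next
  case (pd_scale f c)
  then show ?case unfolding linop_scale[OF assms(2)] by (simp add: abs_mult mult_left_mono)
qed

lemma opV_funpow_shift_bound:
  assumes "0 \<le> z" "z \<le> 1" "\<And>i. 0 \<le> g i" "\<And>i. g i \<le> 1" "f \<in> pd"
  shows "\<bar>(opV z g m ^^ n) (\<lambda>S. f (S \<triangle> T)) {}\<bar> \<le> (opV z g m ^^ n) f {}"
proof (rule functional_shift_bound[OF assms(5) linop_funpow[OF linop_V]])
  fix A :: "nat set" assume "finite A"
  then have "(opV z g m ^^ n) (chi A) \<in> pd" by (intro pd_opV_funpow assms pd_chi)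
  from pd_bound[OF this, of "{}"] show "(opV z g m ^^ n) (chi A) {} \<ge> 0" by linarith
qed

lemma opA_vac: assumes "i \<le> m" shows "opA i (vac m) S = vac m (S \<triangle> {i})"
proof (cases "(S \<triangle> {i}) \<inter> {..m} = {}")
  case True
  have "x \<notin> S" if "x < i" for x
  proof -
    have "x \<notin> S \<triangle> {i}" using True that assms by fastforce
    then show ?thesis using that by simp
  qed
  then have "{..<i} \<inter> S = {}" by blast
  then show ?thesis by (simp add: opA_def chi_def)
qed (simp add: opA_def vac_eq)

text \<open>The sign depends on \<open>S\<close> only through its elements below \<open>j\<close>,
  and these are determined wherever the shifted vacuum does not vanish; so only a global sign
  remains.\<close>

lemma opA_opA_vac:
  assumes "i \<le> m" "j \<le> m"
  shows "opA j (opA i (vac m)) = (\<lambda>S. chi {..<j} {i} * vac m (S \<triangle> ({i} \<triangle> {j})))"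
proof
  fix S
  have sh: "S \<triangle> {j} \<triangle> {i} = S \<triangle> ({i} \<triangle> {j})" by (rule set_eqI) auto
  have e: "opA j (opA i (vac m)) S = chi {..<j} S * vac m (S \<triangle> ({i} \<triangle> {j}))"
    unfolding opA_def[of j] opA_vac[OF assms(1)] sh ..
  show "opA j (opA i (vac m)) S = chi {..<j} {i} * vac m (S \<triangle> ({i} \<triangle> {j}))"
  proof (cases "(S \<triangle> ({i} \<triangle> {j})) \<inter> {..m} = {}")
    case True
    have "x \<in> S \<longleftrightarrow> x = i" if "x < j" for x
    proof -
      have "x \<notin> S \<triangle> ({i} \<triangle> {j})" using True that assms by fastforce
      then show ?thesis using that by simp
    qed
    then have "{..<j} \<inter> S = {..<j} \<inter> {i}" by blast
    then show ?thesis unfolding e by (simp add: chi_def)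
  qed (simp add: e vac_eq)
qed

lemma chi_lessThan_singleton: "chi {..<i::nat} {j} = (if j < i then -1 else 1)"
proof -
  have "{..<i} \<inter> {j} = (if j < i then {j} else {})" by auto
  then show ?thesis by (simp add: chi_def)
qed

lemma opA_square: "opA i (opA i f) = f"
proof
  fix S
  have "opA i (opA i f) S = (chi {..<i} S * chi {..<i} S) * f S"
    unfolding opA_def by (simp add: chi_sdiff_right chi_lessThan_singleton del: chi_square)
  then show "opA i (opA i f) S = f S" by simp
qed

lemma opA_anticommute:
  assumes "i \<noteq> j" shows "opA i (opA j f) S = - opA j (opA i f) S"
proof -
  have "S \<triangle> {i} \<triangle> {j} = S \<triangle> {j} \<triangle> {i}" by (rule sdiff_pair_comm)
  then have "opA i (opA j f) S = chi {..<j} {i} * (chi {..<i} S * chi {..<j} S * f (S \<triangle> {j} \<triangle> {i}))"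
    "opA j (opA i f) S = chi {..<i} {j} * (chi {..<i} S * chi {..<j} S * f (S \<triangle> {j} \<triangle> {i}))"
    by (simp_all add: opA_def chi_sdiff_right)
  moreover have "chi {..<j} {i} = - chi {..<i} {j}"
    using assms by (auto simp: chi_lessThan_singleton)
  ultimately show ?thesis by simp
qed

section \<open>Upper bounds for the one-fermion amplitude\<close>

lemma tridiagonal_bilinear:
  fixes v w :: "nat \<Rightarrow> real"
  shows "(\<Sum>j\<le>m. v j * (sa z j * p j * w (j - 1))) = (\<Sum>j<m. Sk z * p (Suc j) * v (Suc j) * w j)"
    and "(\<Sum>j\<le>m. v j * (sb z m j * q j * w (Suc j))) = (\<Sum>j<m. Sk z * q j * v j * w (Suc j))"
proof -
  show "(\<Sum>j\<le>m. v j * (sa z j * p j * w (j - 1))) = (\<Sum>j<m. Sk z * p (Suc j) * v (Suc j) * w j)"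
    unfolding sum.atMost_shift by (simp add: sa_def mult_ac)
  show "(\<Sum>j\<le>m. v j * (sb z m j * q j * w (Suc j))) = (\<Sum>j<m. Sk z * q j * v j * w (Suc j))"
    unfolding lessThan_Suc_atMost[symmetric] sum.lessThan_Suc
    by (simp add: sb_def mult_ac)
qed

lemma tT_bilinear:
  "(\<Sum>j\<le>m. v j * tT z g m w j) = (\<Sum>j\<le>m. (ca z j * (cL g j)\<^sup>2 + cb z m j * (sL g j)\<^sup>2) * v j * w j)
     - (\<Sum>j<m. Sk z * (sL g j * cL g (Suc j)) * (v (Suc j) * w j + v j * w (Suc j)))"
proof -
  have "(\<Sum>j\<le>m. v j * tT z g m w j) = (\<Sum>j\<le>m. (ca z j * (cL g j)\<^sup>2 + cb z m j * (sL g j)\<^sup>2) * v j * w j)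
     - (\<Sum>j\<le>m. v j * (sa z j * (cL g j * sL g (j - 1)) * w (j - 1)))
     - (\<Sum>j\<le>m. v j * (sb z m j * (sL g j * cL g (Suc j)) * w (Suc j)))"
    unfolding sum_subtractf[symmetric] tT_def by (rule sum.cong) (auto simp: algebra_simps)
  also have "(\<Sum>j\<le>m. v j * (sa z j * (cL g j * sL g (j - 1)) * w (j - 1)))
      = (\<Sum>j<m. Sk z * (sL g j * cL g (Suc j)) * (v (Suc j) * w j))"
    unfolding tridiagonal_bilinear(1)[where p = "\<lambda>j. cL g j * sL g (j - 1)"]
    by (intro sum.cong refl) (simp add: algebra_simps)
  also have "(\<Sum>j\<le>m. v j * (sb z m j * (sL g j * cL g (Suc j)) * w (Suc j)))
      = (\<Sum>j<m. Sk z * (sL g j * cL g (Suc j)) * (v j * w (Suc j)))"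
    unfolding tridiagonal_bilinear(2)[where q = "\<lambda>j. sL g j * cL g (Suc j)"]
    by (intro sum.cong refl) (simp add: algebra_simps)
  finally show ?thesis by (simp add: distrib_left sum.distrib)
qed

lemma tT_symmetric: "(\<Sum>j\<le>m. v j * tT z g m w j) = (\<Sum>j\<le>m. w j * tT z g m v j)"
  unfolding tT_bilinear by (simp add: mult_ac add.commute)

lemma tTQ_quadratic:
  "(\<Sum>j\<le>m. v j * (tT z g m v j + tQ z g m v j))
     = (\<Sum>j\<le>m. (ca z j * cL g j + cb z m j * sL g j) * (cL g j + sL g j) * (v j)\<^sup>2)
     - (\<Sum>j<m. Sk z * (cL g (Suc j) * (cL g j + sL g j) + sL g j * (cL g (Suc j) + sL g (Suc j))) * (v j * v (Suc j)))"
proof -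
  let ?p = "\<lambda>j. cL g j * (cL g (j - 1) + sL g (j - 1))" and ?q = "\<lambda>j. sL g j * (cL g (Suc j) + sL g (Suc j))"
  have "(\<Sum>j\<le>m. v j * (tT z g m v j + tQ z g m v j))
     = (\<Sum>j\<le>m. (ca z j * cL g j + cb z m j * sL g j) * (cL g j + sL g j) * (v j)\<^sup>2)
     - (\<Sum>j\<le>m. v j * (sa z j * ?p j * v (j - 1)))
     - (\<Sum>j\<le>m. v j * (sb z m j * ?q j * v (Suc j)))"
    unfolding sum_subtractf[symmetric] tT_def tQ_def
    by (rule sum.cong) (auto simp: algebra_simps power2_eq_square)
  also have "(\<Sum>j\<le>m. v j * (sa z j * ?p j * v (j - 1)))
     = (\<Sum>j<m. Sk z * (cL g (Suc j) * (cL g j + sL g j)) * (v j * v (Suc j)))"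
    unfolding tridiagonal_bilinear(1)[where p = ?p] by (intro sum.cong refl) (simp add: algebra_simps)
  also have "(\<Sum>j\<le>m. v j * (sb z m j * ?q j * v (Suc j))) = (\<Sum>j<m. Sk z * ?q j * (v j * v (Suc j)))"
    unfolding tridiagonal_bilinear(2)[where q = ?q] by (intro sum.cong refl) (simp add: algebra_simps)
  finally have "(\<Sum>j\<le>m. v j * (tT z g m v j + tQ z g m v j))
     = (\<Sum>j\<le>m. (ca z j * cL g j + cb z m j * sL g j) * (cL g j + sL g j) * (v j)\<^sup>2)
     - ((\<Sum>j<m. Sk z * (cL g (Suc j) * (cL g j + sL g j)) * (v j * v (Suc j)))
       + (\<Sum>j<m. Sk z * ?q j * (v j * v (Suc j))))"
    by linarith
  then show ?thesis unfolding sum.distrib[symmetric] by (simp add: algebra_simps)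
qed

text \<open>The second-order recursion is factored: \<open>w\<close> annihilates the solution
  \<open>exp (\<epsilon> * x)\<close> and grows at least by the factor \<open>exp \<epsilon>\<close>
  per step towards 0. The condition at \<open>M\<close> serves to make the starting value
  \<open>w M\<close> at least \<open>u M\<close>.\<close>

lemma exp_cosh_descent:
  fixes u :: "nat \<Rightarrow> real"
  assumes rec: "\<And>x. 0 < x \<Longrightarrow> x < M \<Longrightarrow> u (x - 1) + u (Suc x) \<ge> 2 * cosh \<epsilon> * u x"
    and bd: "u (M - 1) \<ge> 2 * u M" and M: "M \<ge> 1" and nn: "\<And>x. u x \<ge> 0" and e: "\<epsilon> \<ge> 0"
  shows "u M \<le> exp (- \<epsilon> * (real M - 1)) * u 0"
proof -
  define w where "w x = u (x - 1) - exp (- \<epsilon>) * u x" for x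
  have step: "w x \<ge> exp \<epsilon> * w (Suc x)" if "0 < x" "x < M" for x
  proof -
    have "exp \<epsilon> * w (Suc x) = exp \<epsilon> * u x - (exp \<epsilon> * exp (- \<epsilon>)) * u (Suc x)"
      by (simp add: w_def algebra_simps)
    then have "exp \<epsilon> * w (Suc x) = exp \<epsilon> * u x - u (Suc x)"
      by (simp add: exp_minus)
    moreover have "w x = u (x - 1) - exp (- \<epsilon>) * u x" by (simp add: w_def)
    moreover have "2 * cosh \<epsilon> * u x = exp \<epsilon> * u x + exp (- \<epsilon>) * u x"
      by (simp add: cosh_def algebra_simps)
    ultimately show ?thesis using rec[OF that] by linarith
  qed
  have "w (M - k) \<ge> exp (\<epsilon> * k) * w M" if "k \<le> M - 1" for k
    using that
  proof (induction k)
    case (Suc k)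
    have "w (M - Suc k) \<ge> exp \<epsilon> * w (Suc (M - Suc k))" using Suc.prems by (intro step) auto
    also have "Suc (M - Suc k) = M - k" using Suc.prems by auto
    also have "exp \<epsilon> * w (M - k) \<ge> exp \<epsilon> * (exp (\<epsilon> * k) * w M)"
      using Suc by (intro mult_left_mono) auto
    finally show ?case by (simp add: exp_add algebra_simps)
  qed simp
  from this[of "M - 1"] M have 1: "w 1 \<ge> exp (\<epsilon> * (real M - 1)) * w M" by (simp add: of_nat_diff)
  have "exp (- \<epsilon>) * u M \<le> 1 * u M" using e nn by (intro mult_right_mono) auto
  then have "w M \<ge> u M" using bd by (simp add: w_def)
  then have "exp (\<epsilon> * (real M - 1)) * u M \<le> exp (\<epsilon> * (real M - 1)) * w M" by simp
  also have "\<dots> \<le> w 1" by (rule 1)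
  also have "\<dots> \<le> u 0" using nn[of 1] by (simp add: w_def)
  finally have "exp (- \<epsilon> * (real M - 1)) * (exp (\<epsilon> * (real M - 1)) * u M) \<le> exp (- \<epsilon> * (real M - 1)) * u 0"
    by (intro mult_left_mono) auto
  then show ?thesis by (simp add: exp_add[symmetric] flip: mult.assoc)
qed

text \<open>A fermion at height \<open>j\<close> inserted at time \<open>x\<close>. At
  \<open>x = M\<close> this is an ordinary entry of the transfer matrix; at \<open>x = 0\<close>,
  for \<open>\<delta> = opA 0 (vac m)\<close>, two fermions act on the vacuum. The recursion in
  \<open>x\<close> connects these two quantities.\<close>

definition amp :: "real \<Rightarrow> (nat \<Rightarrow> real) \<Rightarrow> nat \<Rightarrow> nat \<Rightarrow> (nat set \<Rightarrow> real) \<Rightarrow> nat \<Rightarrow> nat \<Rightarrow> real" where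
  "amp z g m M \<delta> x j = (opV z g m ^^ (M - x)) (opA j ((opV z g m ^^ x) \<delta>)) {}"

lemma amp_rec:
  assumes z1: "z\<^sup>2 \<noteq> 1" and g: "\<And>i. g i > 0" and x: "0 < x" "x < M" and j: "j \<le> m"
  shows "amp z g m M \<delta> (x - 1) j + amp z g m M \<delta> (Suc x) j = 2 * tT z g m (amp z g m M \<delta> x) j"
proof -
  let ?V = "opV z g m" and ?a = "amp z g m M \<delta>"
  define y n where "y = x - 1" and "n = M - Suc x"
  have n: "x = Suc y" "M - x = Suc n" "M - (x - 1) = Suc (Suc n)" "M - Suc x = n"
    using x by (auto simp: y_def n_def)
  define X where "X = (?V ^^ y) \<delta>"
  have Vx: "(?V ^^ x) \<delta> = ?V X" "(?V ^^ Suc x) \<delta> = ?V (?V X)" "(?V ^^ (x - 1)) \<delta> = X"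
    by (simp_all add: n(1) X_def)
  have Vn: "(?V ^^ Suc n) h = (?V ^^ n) (?V h)" for h by (simp add: funpow_swap1)
  have Vnn: "(?V ^^ Suc (Suc n)) h = (?V ^^ n) (?V (?V h))" for h by (simp add: funpow_swap1)
  note L = linop_funpow[OF linop_V[of z g m], of n]
  have "?a (Suc x) j + ?a (x - 1) j = (?V ^^ n) (opA j (?V (?V X))) {} + (?V ^^ n) (?V (?V (opA j X))) {}"
    unfolding amp_def n(2-4) Vx Vnn ..
  also have "\<dots> = (?V ^^ n) (\<lambda>S. opA j (?V (?V X)) S + ?V (?V (opA j X)) S) {}"
    by (rule linop_add[OF L, THEN fun_cong, symmetric])
  also have "\<dots> = (?V ^^ n) (\<lambda>S. 2 * tT z g m (\<lambda>k. ?V (opA k (?V X)) S) j) {}"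
    unfolding V_A_second_order[where f = X, OF z1 j g] ..
  also have "\<dots> = 2 * (?V ^^ n) (\<lambda>S. tT z g m (\<lambda>k. ?V (opA k (?V X)) S) j) {}"
    by (rule linop_scale[OF L, THEN fun_cong])
  also have "(?V ^^ n) (\<lambda>S. tT z g m (\<lambda>k. ?V (opA k (?V X)) S) j) {}
      = tT z g m (\<lambda>k. (?V ^^ n) (?V (opA k (?V X))) {}) j"
    unfolding tT_def by (simp only: linop_diff[OF L] linop_scale[OF L])
  also have "(\<lambda>k. (?V ^^ n) (?V (opA k (?V X))) {}) = ?a x"
    by (rule ext) (simp only: amp_def n(2-4) Vx Vn)
  finally show ?thesis by simp
qed

lemma amp_last: "amp z g m M \<delta> M j = (opV z g m ^^ M) \<delta> {j}"
  by (simp add: amp_def opA_def)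

text \<open>At the empty set the signs of \<open>opA\<close> and \<open>opB\<close> are trivial, so
  both fermions have the same amplitude and the first-order relation closes up with
  \<open>tT + tQ\<close>. This supplies the end condition that a second-order recursion
  requires.\<close>

lemma amp_boundary:
  assumes z1: "z\<^sup>2 \<noteq> 1" and g: "\<And>i. g i > 0" and M: "M \<ge> 1" and j: "j \<le> m"
  shows "amp z g m M \<delta> (M - 1) j = tT z g m (amp z g m M \<delta> M) j + tQ z g m (amp z g m M \<delta> M) j"
proof -
  let ?V = "opV z g m" and ?a = "amp z g m M \<delta>"
  define X where "X = (?V ^^ (M - 1)) \<delta>"
  have VX: "?V X = (?V ^^ M) \<delta>" using M by (cases M) (auto simp: X_def)
  have "?a (M - 1) j = ?V (opA j X) {}" using M by (simp add: amp_def X_def)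
  also have "\<dots> = tT z g m (\<lambda>k. opA k (?V X) {}) j + tQ z g m (\<lambda>k. opB k (?V X) {}) j"
    unfolding V_A[OF z1 j g] ..
  also have "(\<lambda>k. opA k (?V X) {}) = ?a M" by (rule ext) (simp add: amp_last VX opA_def)
  also have "(\<lambda>k. opB k (?V X) {}) = ?a M" by (rule ext) (simp add: amp_last VX opB_def)
  finally show ?thesis .
qed

text \<open>The Euclidean norm over the heights turns the vector recursion into a scalar one, by the
  lower bounds on the quadratic forms and Cauchy-Schwarz. At \<open>x = 0\<close> each of the
  \<open>m + 1\<close> components is at most the plus amplitude, whence
  \<open>sqrt (m + 1)\<close>.\<close>

lemma opV_amplitude_upper:
  assumes z: "0 < z" "z < 1" and g: "\<And>i. 0 < g i" "\<And>i. g i \<le> 1" and M: "M \<ge> 1" and e: "\<epsilon> \<ge> 0"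
    and form: "\<And>v. (\<Sum>j\<le>m. v j * tT z g m v j) \<ge> cosh \<epsilon> * (\<Sum>j\<le>m. (v j)\<^sup>2)"
    and bform: "\<And>v. (\<Sum>j\<le>m. v j * (tT z g m v j + tQ z g m v j)) \<ge> 2 * (\<Sum>j\<le>m. (v j)\<^sup>2)"
  shows "\<bar>(opV z g m ^^ M) (opA 0 (vac m)) {0}\<bar>
     \<le> exp (- \<epsilon> * (real M - 1)) * (sqrt (real m + 1) * (opV z g m ^^ M) (vac m) {})"
proof -
  have z1: "z\<^sup>2 \<noteq> 1" using z by (simp add: power2_eq_1_iff)
  let ?V = "opV z g m"
  define \<delta> where "\<delta> = opA 0 (vac m)"
  define a where "a = amp z g m M \<delta>"
  define u where "u x = L2_set (a x) {..m}" for x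
  have usq: "(u x)\<^sup>2 = (\<Sum>j\<le>m. (a x j)\<^sup>2)" for x by (simp add: u_def L2_set_def sum_nonneg)
  have unn: "u x \<ge> 0" for x by (simp add: u_def)
  have CS: "(\<Sum>j\<le>m. a x j * a y j) \<le> u x * u y" for x y
  proof -
    have "(\<Sum>j\<le>m. a x j * a y j) \<le> (\<Sum>j\<le>m. \<bar>a x j\<bar> * \<bar>a y j\<bar>)"
      by (rule sum_mono) (metis abs_ge_self abs_mult)
    also have "\<dots> \<le> u x * u y" unfolding u_def by (rule L2_set_mult_ineq)
    finally show ?thesis .
  qed
  have rec: "a (x - 1) j + a (Suc x) j = 2 * tT z g m (a x) j" if "0 < x" "x < M" "j \<le> m" for x j
    unfolding a_def using z1 g(1) that by (rule amp_rec)
  have R: "u (x - 1) + u (Suc x) \<ge> 2 * cosh \<epsilon> * u x" if "0 < x" "x < M" for x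
  proof (cases "u x = 0")
    case True then show ?thesis using unn by (simp add: add_nonneg_nonneg)
  next
    case False
    then have pos: "u x > 0" using unn[of x] by linarith
    have "2 * cosh \<epsilon> * (u x)\<^sup>2 \<le> 2 * (\<Sum>j\<le>m. a x j * tT z g m (a x) j)"
      using form[of "a x"] unfolding usq by simp
    also have "\<dots> = (\<Sum>j\<le>m. a x j * a (x - 1) j + a x j * a (Suc x) j)"
      unfolding sum_distrib_left
    proof (rule sum.cong)
      fix j assume "j \<in> {..m}"
      then have "a x j * (2 * tT z g m (a x) j) = a x j * (a (x - 1) j + a (Suc x) j)"
        using rec[OF that, of j] by simp
      then show "2 * (a x j * tT z g m (a x) j) = a x j * a (x - 1) j + a x j * a (Suc x) j"
        by (simp add: algebra_simps)
    qed simp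
    also have "\<dots> \<le> u x * u (x - 1) + u x * u (Suc x)"
      unfolding sum.distrib using CS by (intro add_mono) auto
    finally have "u x * (2 * cosh \<epsilon> * u x) \<le> u x * (u (x - 1) + u (Suc x))"
      by (simp add: algebra_simps power2_eq_square)
    then show ?thesis using pos by simp
  qed
  have B: "u (M - 1) \<ge> 2 * u M"
  proof (cases "u M = 0")
    case True then show ?thesis using unn by simp
  next
    case False
    then have pos: "u M > 0" using unn[of M] by linarith
    have e: "a (M - 1) j = tT z g m (a M) j + tQ z g m (a M) j" if "j \<le> m" for j
      unfolding a_def using z1 g(1) M that by (rule amp_boundary)
    have "2 * (u M)\<^sup>2 \<le> (\<Sum>j\<le>m. a M j * (tT z g m (a M) j + tQ z g m (a M) j))"
      using bform[of "a M"] unfolding usq by simp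
    also have "\<dots> = (\<Sum>j\<le>m. a M j * a (M - 1) j)"
      by (intro sum.cong refl) (simp only: e atMost_iff)
    also have "\<dots> \<le> u M * u (M - 1)" by (rule CS)
    finally have "u M * (2 * u M) \<le> u M * u (M - 1)" by (simp add: power2_eq_square algebra_simps)
    then show ?thesis using pos by simp
  qed
  define Z where "Z = (?V ^^ M) (vac m) {}"
  have a0: "\<bar>a 0 j\<bar> \<le> Z" if "j \<le> m" for j
  proof -
    have "a 0 j = chi {..<j} {0} * (?V ^^ M) (\<lambda>S. vac m (S \<triangle> ({0} \<triangle> {j}))) {}"
      unfolding a_def amp_def \<delta>_def using opA_opA_vac[of 0 m j] that
      by (simp add: linop_scale[OF linop_funpow[OF linop_V]])
    moreover have "\<bar>(?V ^^ M) (\<lambda>S. vac m (S \<triangle> ({0} \<triangle> {j}))) {}\<bar> \<le> Z"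
      unfolding Z_def by (rule opV_funpow_shift_bound) (use z g pd_vac in \<open>auto simp: less_imp_le\<close>)
    ultimately show ?thesis using chi_cases[of "{..<j}" "{0}"] by auto
  qed
  have Znn: "Z \<ge> 0" using a0[of 0] by auto
  have "(u 0)\<^sup>2 \<le> (\<Sum>j\<le>m. Z\<^sup>2)" unfolding usq
    by (rule sum_mono) (use a0 in \<open>auto simp: abs_le_square_iff[symmetric] intro: order_trans[OF _ abs_ge_self]\<close>)
  also have "\<dots> = (sqrt (real m + 1) * Z)\<^sup>2" by (simp add: power_mult_distrib)
  finally have "u 0 \<le> sqrt (real m + 1) * Z" using Znn by (auto intro: power2_le_imp_le)
  moreover have "\<bar>a M 0\<bar> \<le> u M"
  proof -
    have "(a M 0)\<^sup>2 \<le> (u M)\<^sup>2" unfolding usq by (rule member_le_sum) auto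
    then show ?thesis using unn[of M] abs_le_square_iff[of "a M 0" "u M"] by simp
  qed
  moreover have "u M \<le> exp (- \<epsilon> * (real M - 1)) * u 0" using R B M unn e by (rule exp_cosh_descent)
  moreover have "a M 0 = (?V ^^ M) (opA 0 (vac m)) {0}" by (simp add: a_def \<delta>_def amp_last)
  ultimately have "\<bar>(?V ^^ M) (opA 0 (vac m)) {0}\<bar> \<le> exp (- \<epsilon> * (real M - 1)) * u 0" by linarith
  also have "\<dots> \<le> exp (- \<epsilon> * (real M - 1)) * (sqrt (real m + 1) * Z)"
    using \<open>u 0 \<le> sqrt (real m + 1) * Z\<close> by (intro mult_left_mono) auto
  finally show ?thesis by (simp add: Z_def)
qed

text \<open>Onsager's surface tension of a horizontal interface,
  \<open>2 * \<beta> + ln (tanh \<beta>)\<close> for \<open>z = exp (- 2 * \<beta>)\<close>.\<close>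

definition tau :: "real \<Rightarrow> real" where "tau z = ln ((1 - z) / (z * (1 + z)))"

definition gz :: "real \<Rightarrow> real \<Rightarrow> nat \<Rightarrow> nat \<Rightarrow> real" where
  "gz z \<theta> J j = sqrt z * (if j < J then 1 else exp (- \<theta>))"

text \<open>The symbol of the bulk part of \<open>tT\<close> at zero momentum, that is, the diagonal
  minus twice the hopping, as \<open>bulk_eq\<close> shows. Damping by \<open>\<theta>\<close>
  shifts the rate by \<open>2 * \<theta>\<close>.\<close>

definition bulk :: "real \<Rightarrow> real \<Rightarrow> nat \<Rightarrow> nat \<Rightarrow> real" where
  "bulk z \<theta> J j = cosh (if j < J then tau z else tau z + 2 * \<theta>)"

lemma cL_sL_square:
  assumes "g j \<noteq> 0"
  shows "(cL g j)\<^sup>2 + (sL g j)\<^sup>2 = (1 / (g j)\<^sup>2 + (g j)\<^sup>2) / 2" "cL g j * sL g j = (1 / (g j)\<^sup>2 - (g j)\<^sup>2) / 4"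
    "cL g j + sL g j = 1 / g j" "(cL g j)\<^sup>2 = (1 / (g j)\<^sup>2 + 2 + (g j)\<^sup>2) / 4"
  unfolding cL_def sL_def using assms by (auto simp: field_simps power2_eq_square)

lemma Ck_Sk_bounds:
  assumes "0 < z" "z \<le> 1 / 5"
  shows "Ck z - Sk z = (1 - z) / (1 + z)" "Ck z + Sk z = (1 + z) / (1 - z)" "Ck z \<ge> 1" "0 \<le> Sk z" "Sk z \<le> 1 / 2"
    "Ck z - 1 \<le> Sk z" "Ck z \<le> 2" "Ck z - 1 = 2 * z\<^sup>2 / (1 - z\<^sup>2)"
proof -
  have f: "1 - z\<^sup>2 = (1 - z) * (1 + z)" by (simp add: algebra_simps power2_eq_square)
  have p: "1 - z > 0" "1 + z > 0" using assms by auto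
  have z2: "z\<^sup>2 \<le> 1 / 25" using power_mono[of z "1/5" 2] assms by (simp add: power2_eq_square)
  show "Ck z - Sk z = (1 - z) / (1 + z)"
  proof -
    have "Ck z - Sk z = ((1 - z) * (1 - z)) / ((1 - z) * (1 + z))"
      unfolding Ck_def Sk_def f diff_divide_distrib[symmetric] by (simp add: algebra_simps power2_eq_square)
    then show ?thesis using p by simp
  qed
  show "Ck z + Sk z = (1 + z) / (1 - z)"
  proof -
    have "Ck z + Sk z = ((1 + z) * (1 + z)) / ((1 - z) * (1 + z))"
      unfolding Ck_def Sk_def f add_divide_distrib[symmetric] by (simp add: algebra_simps power2_eq_square)
    then show ?thesis using p by simp
  qed
  show e: "Ck z - 1 = 2 * z\<^sup>2 / (1 - z\<^sup>2)" using z2 unfolding Ck_def by (simp add: field_simps)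
  show "Ck z \<ge> 1" "0 \<le> Sk z" using z2 assms unfolding Ck_def Sk_def by auto
  show "Sk z \<le> 1 / 2" "Ck z \<le> 2" unfolding Sk_def Ck_def using z2 assms by (auto simp: field_simps)
  show "Ck z - 1 \<le> Sk z" unfolding e Sk_def using z2 assms
    by (intro divide_right_mono) (auto simp: power2_eq_square mult_left_le)
qed

lemma quadratic_geometric_mean:
  fixes p q r x y :: real
  assumes "p \<ge> 0" "q \<ge> 0" "r \<ge> 0" "r\<^sup>2 \<le> p * q"
  shows "2 * r * x * y \<le> p * x\<^sup>2 + q * y\<^sup>2"
proof -
  have r: "r \<le> sqrt p * sqrt q" using assms by (metis real_le_rsqrt real_sqrt_mult)
  have "2 * r * x * y \<le> 2 * r * (\<bar>x\<bar> * \<bar>y\<bar>)"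
    using assms(3) by (metis abs_ge_self abs_mult mult.assoc mult_left_mono zero_le_mult_iff zero_le_numeral)
  also have "\<dots> \<le> 2 * (sqrt p * sqrt q) * (\<bar>x\<bar> * \<bar>y\<bar>)" using r by (intro mult_right_mono) auto
  also have "\<dots> \<le> (sqrt p * \<bar>x\<bar>)\<^sup>2 + (sqrt q * \<bar>y\<bar>)\<^sup>2"
    using zero_le_power2[of "sqrt p * \<bar>x\<bar> - sqrt q * \<bar>y\<bar>"] by (simp add: power2_diff mult_ac)
  finally show ?thesis using assms by (simp add: power_mult_distrib)
qed

context
  fixes z \<theta> :: real and J m :: nat and g :: "nat \<Rightarrow> real"
  assumes z: "0 < z" "z \<le> 1 / 5" and th: "\<theta> \<ge> 0" and m: "m \<ge> 1" and J: "J \<ge> 1"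
  defines "g \<equiv> gz z \<theta> J"
begin

lemma gz_facts:
  shows "g j > 0" "g j \<le> 1" "(g j)\<^sup>2 \<le> 1/5" "g (Suc j) \<le> g j" "j < J \<Longrightarrow> (g j)\<^sup>2 = z"
    "j \<ge> J \<Longrightarrow> (g j)\<^sup>2 = z * exp (- 2 * \<theta>)"
proof -
  have e: "exp (- \<theta>) \<le> 1" using th by simp
  show "g j > 0" using z by (simp add: g_def gz_def)
  show a: "j < J \<Longrightarrow> (g j)\<^sup>2 = z" using z by (simp add: g_def gz_def)
  have "(exp (- \<theta>))\<^sup>2 = exp (- 2 * \<theta>)" by (simp add: power2_eq_square flip: exp_add)
  then show b: "j \<ge> J \<Longrightarrow> (g j)\<^sup>2 = z * exp (- 2 * \<theta>)" using z by (simp add: g_def gz_def power_mult_distrib)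
  have "z * exp (- 2 * \<theta>) \<le> z * 1" using z th by (intro mult_left_mono) auto
  then have "z * exp (- 2 * \<theta>) \<le> 1 / 5" using z by linarith
  then show "(g j)\<^sup>2 \<le> 1/5" using a b z by (cases "j < J") auto
  then have "(g j)\<^sup>2 \<le> 1\<^sup>2" by simp
  then show "g j \<le> 1" by (rule power2_le_imp_le) simp
  show "g (Suc j) \<le> g j" unfolding g_def gz_def using e z by auto
qed

lemma cL_sL_facts:
  shows "sL g j > 0" "cL g j > 0" "sL g j \<le> cL g j" "sL g j * cL g (Suc j) \<le> cL g j * sL g (Suc j)"
proof -
  note gf = gz_facts[of j] gz_facts[of "Suc j"]
  have "1 / g j > 1" using gf(1,3) power2_less_imp_less[of "g j" 1] by auto
  moreover have "g j < 1" using gf(1,3) power2_less_imp_less[of "g j" 1] by auto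
  ultimately show "sL g j > 0" unfolding sL_def by auto
  show "cL g j > 0" "sL g j \<le> cL g j" unfolding cL_def sL_def using gf(1) by (auto intro!: add_pos_pos)
  have "cL g j * sL g (Suc j) - sL g j * cL g (Suc j) = (g j / g (Suc j) - g (Suc j) / g j) / 2"
    unfolding cL_def sL_def using gf by (simp add: field_simps)
  moreover have "g j / g (Suc j) \<ge> 1" "g (Suc j) / g j \<le> 1" using gf by auto
  then have "(g j / g (Suc j) - g (Suc j) / g j) / 2 \<ge> 0" by simp
  ultimately have "0 \<le> cL g j * sL g (Suc j) - sL g j * cL g (Suc j)" by (simp only:)
  then show "sL g j * cL g (Suc j) \<le> cL g j * sL g (Suc j)" by simp
qed

text \<open>The diagonal is at least \<open>1 / (g j)^2 \<ge> 5\<close>, and because of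
  \<open>Sk z \<le> 1 / 2\<close> the off-diagonal terms take away at most half of it. The remaining
  5/2 exceeds the 2 demanded by \<open>exp_cosh_descent\<close>.\<close>

lemma tTQ_form: "(\<Sum>j\<le>m. v j * (tT z g m v j + tQ z g m v j)) \<ge> 2 * (\<Sum>j\<le>m. (v j)\<^sup>2)"
proof -
  note C = Ck_Sk_bounds[OF z]
  define e where "e j = 1 / g j" for j
  have e: "cL g j + sL g j = e j" "e j > 0" "(e j)\<^sup>2 \<ge> 5" for j
  proof -
    show "cL g j + sL g j = e j" using gz_facts(1)[of j] by (simp add: cL_sL_square e_def)
    show "e j > 0" using gz_facts(1)[of j] by (simp add: e_def)
    have "1 / (g j)\<^sup>2 \<ge> 1 / (1 / 5)" using gz_facts(1,3)[of j] by (intro divide_left_mono) auto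
    then show "(e j)\<^sup>2 \<ge> 5" by (simp add: e_def power_one_over)
  qed
  have ca: "ca z j \<ge> 1" and cb: "cb z m j \<ge> 1" for j using C by (auto simp: ca_def cb_def)
  have d: "(ca z j * cL g j + cb z m j * sL g j) * (cL g j + sL g j) * (v j)\<^sup>2 \<ge> (e j * v j)\<^sup>2" for j
  proof -
    have "ca z j * cL g j + cb z m j * sL g j \<ge> 1 * cL g j + 1 * sL g j"
      using cL_sL_facts(1,2)[of j] ca[of j] cb[of j] by (intro add_mono mult_right_mono) auto
    then have "(ca z j * cL g j + cb z m j * sL g j) * e j \<ge> e j * e j"
      using e[of j] by (intro mult_right_mono) auto
    then have "(ca z j * cL g j + cb z m j * sL g j) * e j * (v j)\<^sup>2 \<ge> e j * e j * (v j)\<^sup>2"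
      by (rule mult_right_mono) simp
    then show ?thesis using e[of j] by (simp add: power2_eq_square mult_ac)
  qed
  have o: "Sk z * (cL g (Suc j) * (cL g j + sL g j) + sL g j * (cL g (Suc j) + sL g (Suc j))) * (v j * v (Suc j))
     \<le> (1/2) * (((e j * v j)\<^sup>2 + (e (Suc j) * v (Suc j))\<^sup>2) / 2)" for j
  proof -
    define q where "q = cL g (Suc j) * (cL g j + sL g j) + sL g j * (cL g (Suc j) + sL g (Suc j))"
    have q: "q \<ge> 0" "q \<le> e j * e (Suc j)"
    proof -
      show "q \<ge> 0" unfolding q_def using cL_sL_facts(1,2)[of j] cL_sL_facts(1,2)[of "Suc j"]
        by (intro add_nonneg_nonneg mult_nonneg_nonneg) auto
      have "e j * e (Suc j) - q = cL g j * sL g (Suc j) - sL g j * cL g (Suc j)"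
        unfolding q_def e(1)[symmetric] by (simp add: algebra_simps)
      then show "q \<le> e j * e (Suc j)" using cL_sL_facts(4)[of j] by linarith
    qed
    have "Sk z * q * (v j * v (Suc j)) \<le> Sk z * q * (\<bar>v j\<bar> * \<bar>v (Suc j)\<bar>)"
      using C q by (intro mult_left_mono) (auto simp flip: abs_mult)
    also have "\<dots> \<le> (1/2) * (e j * e (Suc j)) * (\<bar>v j\<bar> * \<bar>v (Suc j)\<bar>)"
      using C q by (intro mult_right_mono mult_mono) auto
    also have "\<dots> = (1/2) * ((e j * \<bar>v j\<bar>) * (e (Suc j) * \<bar>v (Suc j)\<bar>))" by simp
    also have "\<dots> \<le> (1/2) * (((e j * \<bar>v j\<bar>)\<^sup>2 + (e (Suc j) * \<bar>v (Suc j)\<bar>)\<^sup>2) / 2)"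
      using zero_le_power2[of "e j * \<bar>v j\<bar> - e (Suc j) * \<bar>v (Suc j)\<bar>"] unfolding power2_diff by simp
    finally show ?thesis by (simp add: q_def power_mult_distrib)
  qed
  define E where "E j = (e j * v j)\<^sup>2" for j
  have "(\<Sum>j<m. E j + E (Suc j)) \<le> 2 * (\<Sum>j\<le>m. E j)"
  proof -
    have "(\<Sum>j<m. E j) \<le> (\<Sum>j\<le>m. E j)" by (rule sum_mono2) (auto simp: E_def)
    moreover have "(\<Sum>j<m. E (Suc j)) \<le> (\<Sum>j\<le>m. E j)" unfolding sum.atMost_shift by (simp add: E_def)
    ultimately show ?thesis by (simp add: sum.distrib)
  qed
  moreover have "(\<Sum>j<m. Sk z * (cL g (Suc j) * (cL g j + sL g j) + sL g j * (cL g (Suc j) + sL g (Suc j))) * (v j * v (Suc j)))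
     \<le> (\<Sum>j<m. (1/4) * (E j + E (Suc j)))"
    by (rule sum_mono) (use o in \<open>simp add: E_def\<close>)
  moreover have "(\<Sum>j\<le>m. (ca z j * cL g j + cb z m j * sL g j) * (cL g j + sL g j) * (v j)\<^sup>2) \<ge> (\<Sum>j\<le>m. E j)"
    by (rule sum_mono) (use d in \<open>simp add: E_def\<close>)
  moreover have "(\<Sum>j\<le>m. E j) \<ge> (\<Sum>j\<le>m. 5 * (v j)\<^sup>2)"
    by (rule sum_mono) (use e in \<open>auto simp: E_def power_mult_distrib intro!: mult_right_mono\<close>)
  ultimately have "(\<Sum>j\<le>m. v j * (tT z g m v j + tQ z g m v j)) \<ge> 5 / 2 * (\<Sum>j\<le>m. (v j)\<^sup>2)"
    unfolding tTQ_quadratic sum_distrib_left[symmetric] by linarith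
  moreover have "(\<Sum>j\<le>m. (v j)\<^sup>2) \<ge> 0" by (simp add: sum_nonneg)
  ultimately show ?thesis by linarith
qed

text \<open>With \<open>G = (g j)^2\<close> and \<open>k = (1 - z) / (1 + z)\<close> the left side
  is \<open>(k / G + G / k) / 2\<close>, the \<open>cosh\<close> of \<open>ln (k / G)\<close>; for
  \<open>G = z\<close> this logarithm is \<open>tau z\<close>. It is Onsager's dispersion relation
  at zero momentum.\<close>

lemma bulk_eq: "Ck z * ((cL g j)\<^sup>2 + (sL g j)\<^sup>2) - 2 * (Sk z * (cL g j * sL g j)) = bulk z \<theta> J j"
proof -
  note C = Ck_Sk_bounds[OF z]
  define G where "G = (g j)\<^sup>2"
  define k where "k = (1 - z) / (1 + z)"
  have Gp: "G > 0" and gn: "g j \<noteq> 0" using gz_facts(1)[of j] by (auto simp: G_def)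
  have kp: "k > 0" using z by (simp add: k_def)
  have k': "(1 + z) / (1 - z) = 1 / k" by (simp add: k_def)
  have t: "tau z = ln (k / z)" by (simp add: tau_def k_def mult.commute)
  have "(if j < J then tau z else tau z + 2 * \<theta>) = ln (k / G)"
  proof (cases "j < J")
    case True then show ?thesis by (simp add: t G_def gz_facts)
  next
    case False
    then have "k / G = k / z * exp (2 * \<theta>)" by (simp add: G_def gz_facts exp_minus field_simps)
    then have "ln (k / G) = ln (k / z) + 2 * \<theta>" using ln_mult[of "k / z" "exp (2 * \<theta>)"] kp z by (simp only:) simp
    then show ?thesis using False by (simp add: t)
  qed
  then have "bulk z \<theta> J j = (k / G + G / k) / 2" unfolding bulk_def using kp Gp by (simp add: cosh_ln_real field_simps)
  moreover have "Ck z * ((cL g j)\<^sup>2 + (sL g j)\<^sup>2) - 2 * (Sk z * (cL g j * sL g j))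
     = ((Ck z - Sk z) * (1 / G) + (Ck z + Sk z) * G) / 2"
    unfolding cL_sL_square(1,2)[of g j, OF gn] G_def[symmetric]
    by (simp add: algebra_simps add_divide_distrib diff_divide_distrib)
  ultimately show ?thesis unfolding C(1,2) k_def[symmetric] k' by simp
qed

text \<open>Completing squares turns the hopping into gradients, kept only below \<open>J\<close>,
  where the hopping is exactly 1/2. At the bottom the missing half bond gains
  \<open>p 0 = 1 / 2\<close> and the missing rotation loses \<open>c0 \<le> 1 / 4\<close>; the
  surplus 1/4 is the repulsion by the wall, from which the gap will come. At the top the loss
  \<open>sm\<close> is covered by \<open>p m\<close>.\<close>

lemma tT_form:
  "(\<Sum>j\<le>m. v j * tT z g m v j) \<ge> (\<Sum>j\<le>m. bulk z \<theta> J j * (v j)\<^sup>2) + (v 0)\<^sup>2 / 4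
     + (\<Sum>j<m. if Suc j < J then (v j - v (Suc j))\<^sup>2 / 2 else 0)"
proof -
  note C = Ck_Sk_bounds[OF z]
  define p where "p j = Sk z * (cL g j * sL g j)" for j
  define c0 where "c0 = (Ck z - 1) * (cL g 0)\<^sup>2"
  define sm where "sm = (Ck z - 1) * (sL g m)\<^sup>2"
  have pnn: "p j \<ge> 0" for j using C cL_sL_facts(1,2)[of j] by (simp add: p_def)
  have phalf: "p j = 1 / 2" if "j < J" for j
  proof -
    have "p j = (2 * z / (1 - z\<^sup>2)) * ((1 / z - z) / 4)"
      using that gz_facts(1)[of j] unfolding p_def Sk_def
      by (subst cL_sL_square(2)) (auto simp: gz_facts(5))
    also have "1 / z - z = (1 - z\<^sup>2) / z" using z by (simp add: field_simps power2_eq_square)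
    also have "(2 * z / (1 - z\<^sup>2)) * ((1 - z\<^sup>2) / z / 4) = 1 / 2"
    proof -
      have "z\<^sup>2 \<le> (1 / 5)\<^sup>2" using z by (intro power_mono) auto
      then have "1 - z\<^sup>2 \<noteq> 0" by (simp add: power2_eq_square)
      then show ?thesis using z by simp
    qed
    finally show ?thesis .
  qed
  have diag: "(\<Sum>j\<le>m. (ca z j * (cL g j)\<^sup>2 + cb z m j * (sL g j)\<^sup>2) * v j * v j)
     = (\<Sum>j\<le>m. Ck z * ((cL g j)\<^sup>2 + (sL g j)\<^sup>2) * (v j)\<^sup>2) - c0 * (v 0)\<^sup>2 - sm * (v m)\<^sup>2"
  proof -
    have "(\<Sum>j\<le>m. (ca z j * (cL g j)\<^sup>2 + cb z m j * (sL g j)\<^sup>2) * v j * v j)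
      = (\<Sum>j\<le>m. Ck z * ((cL g j)\<^sup>2 + (sL g j)\<^sup>2) * (v j)\<^sup>2 - (if j = 0 then c0 * (v 0)\<^sup>2 else 0) - (if j = m then sm * (v m)\<^sup>2 else 0))"
      using m by (intro sum.cong refl) (auto simp: ca_def cb_def c0_def sm_def algebra_simps power2_eq_square)
    then show ?thesis by (simp add: sum_subtractf)
  qed
  have pair: "Sk z * (sL g j * cL g (Suc j)) * (v (Suc j) * v j + v j * v (Suc j))
     \<le> p j * (v j)\<^sup>2 + p (Suc j) * (v (Suc j))\<^sup>2 - (if Suc j < J then (v j - v (Suc j))\<^sup>2 / 2 else 0)" for j
  proof (cases "Suc j < J")
    case True
    then have "cL g (Suc j) = cL g j" "j < J" by (auto simp: cL_def g_def gz_def)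
    then have a: "Sk z * (sL g j * cL g (Suc j)) = 1/2" using phalf[of j] by (simp add: p_def mult_ac)
    have b: "p j = 1/2" "p (Suc j) = 1/2" using True phalf[of j] phalf[of "Suc j"] by simp_all
    show ?thesis unfolding a b using True by (simp add: power2_eq_square algebra_simps diff_divide_distrib add_divide_distrib)
  next
    case False
    \<comment> \<open>At or above the jump of \<open>g\<close> the coefficients are no longer
      constant, but since \<open>g\<close> decreases the hopping is still at most the geometric mean
      of \<open>p j\<close> and \<open>p (Suc j)\<close>.\<close>
    define r where "r = Sk z * (sL g j * cL g (Suc j))"
    have rn: "r \<ge> 0" unfolding r_def using C cL_sL_facts(1,2)[of j] cL_sL_facts(1,2)[of "Suc j"] by simp
    have "r\<^sup>2 = (Sk z)\<^sup>2 * (sL g j * cL g (Suc j)) * (sL g j * cL g (Suc j))"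
      by (simp add: r_def power2_eq_square mult_ac)
    also have "\<dots> \<le> (Sk z)\<^sup>2 * (sL g j * cL g (Suc j)) * (cL g j * sL g (Suc j))"
      using cL_sL_facts(4)[of j] cL_sL_facts(1,2)[of j] cL_sL_facts(1,2)[of "Suc j"]
      by (intro mult_left_mono) auto
    also have "\<dots> = p j * p (Suc j)" by (simp add: p_def power2_eq_square mult_ac)
    finally have "2 * r * v j * v (Suc j) \<le> p j * (v j)\<^sup>2 + p (Suc j) * (v (Suc j))\<^sup>2"
      by (intro quadratic_geometric_mean pnn rn)
    then show ?thesis using False unfolding r_def[symmetric] by (simp add: algebra_simps)
  qed
  have "(\<Sum>j<m. Sk z * (sL g j * cL g (Suc j)) * (v (Suc j) * v j + v j * v (Suc j)))
     \<le> (\<Sum>j<m. p j * (v j)\<^sup>2 + p (Suc j) * (v (Suc j))\<^sup>2 - (if Suc j < J then (v j - v (Suc j))\<^sup>2 / 2 else 0))"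
    by (rule sum_mono) (rule pair)
  also have "\<dots> = (\<Sum>j<m. p j * (v j)\<^sup>2) + (\<Sum>j<m. p (Suc j) * (v (Suc j))\<^sup>2)
      - (\<Sum>j<m. if Suc j < J then (v j - v (Suc j))\<^sup>2 / 2 else 0)"
    by (simp add: sum.distrib sum_subtractf)
  also have "(\<Sum>j<m. p j * (v j)\<^sup>2) = (\<Sum>j\<le>m. p j * (v j)\<^sup>2) - p m * (v m)\<^sup>2"
    by (simp add: lessThan_Suc_atMost[symmetric])
  also have "(\<Sum>j<m. p (Suc j) * (v (Suc j))\<^sup>2) = (\<Sum>j\<le>m. p j * (v j)\<^sup>2) - p 0 * (v 0)\<^sup>2"
    unfolding sum.atMost_shift by simp
  finally have off: "(\<Sum>j<m. Sk z * (sL g j * cL g (Suc j)) * (v (Suc j) * v j + v j * v (Suc j)))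
     \<le> 2 * (\<Sum>j\<le>m. p j * (v j)\<^sup>2) - p m * (v m)\<^sup>2 - p 0 * (v 0)\<^sup>2
       - (\<Sum>j<m. if Suc j < J then (v j - v (Suc j))\<^sup>2 / 2 else 0)" by linarith
  have b: "(\<Sum>j\<le>m. Ck z * ((cL g j)\<^sup>2 + (sL g j)\<^sup>2) * (v j)\<^sup>2) - 2 * (\<Sum>j\<le>m. p j * (v j)\<^sup>2) = (\<Sum>j\<le>m. bulk z \<theta> J j * (v j)\<^sup>2)"
    unfolding bulk_eq[symmetric] p_def sum_distrib_left sum_subtractf[symmetric]
    by (intro sum.cong refl) (simp add: algebra_simps)
  have "sm \<le> p m"
  proof -
    have "(Ck z - 1) * (sL g m * sL g m) \<le> Sk z * (cL g m * sL g m)"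
      using C cL_sL_facts(1,2,3)[of m] by (intro mult_mono) auto
    then show ?thesis by (simp add: sm_def p_def power2_eq_square)
  qed
  then have sm: "sm * (v m)\<^sup>2 \<le> p m * (v m)\<^sup>2" by (intro mult_right_mono) auto
  have "c0 \<le> 1 / 4"
  proof -
    have z2: "z\<^sup>2 \<le> 1 / 25" using power_mono[of z "1/5" 2] z by (simp add: power2_eq_square)
    have "g 0 \<noteq> 0" using gz_facts(1)[of 0] by simp
    then have "c0 = (2 * z\<^sup>2 / (1 - z\<^sup>2)) * ((1 / z + 2 + z) / 4)"
      unfolding c0_def C(8) using J gz_facts(5)[of 0] by (subst cL_sL_square(4)) auto
    also have "\<dots> = (z + 2 * z\<^sup>2 + z ^ 3) / (2 * (1 - z\<^sup>2))"
      using z z2 by (simp add: field_simps power2_eq_square power3_eq_cube)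
    also have "\<dots> \<le> 1 / 4"
    proof -
      have "z ^ 3 \<le> 1 / 125" using power_mono[of z "1/5" 3] z by (simp add: power3_eq_cube)
      then show ?thesis using z z2 by (simp add: divide_le_eq)
    qed
    finally show ?thesis .
  qed
  then have "c0 * (v 0)\<^sup>2 \<le> (1/4) * (v 0)\<^sup>2" by (intro mult_right_mono) auto
  moreover have "p 0 * (v 0)\<^sup>2 = (1/2) * (v 0)\<^sup>2" using phalf[of 0] J by simp
  ultimately show ?thesis unfolding tT_bilinear diag using off b sm by linarith
qed

end

section \<open>Decay rates of the homogeneous and of the layered strip\<close>

lemma tau_bounds:
  assumes "0 < z" "z \<le> 1 / 5" shows "tau z \<ge> 1" "sinh (tau z) \<ge> 1" "exp (tau z) = (1 - z) / (z * (1 + z))"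
proof -
  have p: "0 < (1 - z) / (z * (1 + z))" using assms by simp
  then show e: "exp (tau z) = (1 - z) / (z * (1 + z))" by (simp add: tau_def)
  have "z * z \<le> (1/5) * (1/5)" using assms by (intro mult_mono) auto
  then have "3 * (z * (1 + z)) \<le> 1 - z" using assms by (simp add: algebra_simps)
  then have 3: "3 \<le> (1 - z) / (z * (1 + z))" using assms by (simp add: pos_le_divide_eq)
  then have "exp 1 \<le> exp (tau z)" using exp_le unfolding e by linarith
  then show t1: "tau z \<ge> 1" by simp
  have "exp (- tau z) \<le> 1 / 3" unfolding exp_minus e using 3 p le_imp_inverse_le[OF 3] by (simp add: inverse_eq_divide)
  then show "sinh (tau z) \<ge> 1" unfolding sinh_def e using 3 by simp
qed

lemma opV_upper_homogeneous:
  assumes z: "0 < z" "z \<le> 1 / 5" and m: "m \<ge> 1" and M: "M \<ge> 1"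
  shows "\<bar>(opV z (gz z 0 1) m ^^ M) (opA 0 (vac m)) {0}\<bar>
     \<le> exp (- tau z * (real M - 1)) * (sqrt (real m + 1) * (opV z (gz z 0 1) m ^^ M) (vac m) {})"
proof (rule opV_amplitude_upper)
  fix v
  have "(\<Sum>j\<le>m. bulk z 0 1 j * (v j)\<^sup>2) \<le> (\<Sum>j\<le>m. v j * tT z (gz z 0 1) m v j)"
  proof -
    have "(\<Sum>j\<le>m. bulk z 0 1 j * (v j)\<^sup>2) + (v 0)\<^sup>2 / 4 \<le> (\<Sum>j\<le>m. v j * tT z (gz z 0 1) m v j)"
      using tT_form[OF z order_refl m order_refl, of v] by simp
    then show ?thesis using zero_le_power2[of "v 0"] by linarith
  qed
  moreover have "bulk z 0 1 j = cosh (tau z)" for j by (simp add: bulk_def)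
  ultimately show "cosh (tau z) * (\<Sum>j\<le>m. (v j)\<^sup>2) \<le> (\<Sum>j\<le>m. v j * tT z (gz z 0 1) m v j)"
    by (simp add: sum_distrib_left)
qed (use z M gz_facts[OF z order_refl m order_refl] tTQ_form[OF z order_refl m order_refl] tau_bounds[OF z] in auto)

text \<open>Each \<open>v j\<close> is reached from the pinned end \<open>v 0\<close> in fewer than
  \<open>J\<close> steps; Cauchy-Schwarz and summation over \<open>j < J\<close> then give a gap of
  order \<open>1 / J^2\<close>.\<close>

lemma discrete_poincare:
  fixes v :: "nat \<Rightarrow> real"
  assumes "J \<ge> 1" "J \<le> Suc m"
  shows "(\<Sum>j<J. (v j)\<^sup>2) / (8 * (real J)\<^sup>2) \<le> (v 0)\<^sup>2 / 4 + (\<Sum>j<m. if Suc j < J then (v j - v (Suc j))\<^sup>2 / 2 else 0)"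
proof -
  define D where "D = (\<Sum>j<m. if Suc j < J then (v j - v (Suc j))\<^sup>2 / 2 else 0)"
  have sub: "(\<Sum>i<j. (v i - v (Suc i))\<^sup>2) \<le> 2 * D" if "j < J" for j
  proof -
    have "(\<Sum>i<j. (v i - v (Suc i))\<^sup>2) = (\<Sum>i<j. if Suc i < J then (v i - v (Suc i))\<^sup>2 else 0)"
      using that by (intro sum.cong) auto
    also have "\<dots> \<le> (\<Sum>i<m. if Suc i < J then (v i - v (Suc i))\<^sup>2 else 0)"
      using that assms by (intro sum_mono2) auto
    also have "\<dots> = 2 * D" unfolding D_def sum_distrib_left by (intro sum.cong) auto
    finally show ?thesis .
  qed
  have D0: "D \<ge> 0" unfolding D_def by (intro sum_nonneg) auto
  have pt: "(v j)\<^sup>2 \<le> 2 * (v 0)\<^sup>2 + 4 * real J * D" if "j < J" for j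
  proof -
    have "v 0 - v j = (\<Sum>i<j. v i - v (Suc i))" by (induction j) auto
    then have "(v 0 - v j)\<^sup>2 \<le> real j * (\<Sum>i<j. (v i - v (Suc i))\<^sup>2)"
      using Cauchy_Schwarz_ineq_sum[of "\<lambda>_. 1" "\<lambda>i. v i - v (Suc i)" "{..<j}"] by simp
    also have "\<dots> \<le> real J * (2 * D)" using that sub[OF that] by (intro mult_mono) (auto intro: sum_nonneg)
    finally have a: "(v 0 - v j)\<^sup>2 \<le> 2 * real J * D" by simp
    have "(v j)\<^sup>2 \<le> 2 * (v 0)\<^sup>2 + 2 * (v 0 - v j)\<^sup>2"
      using zero_le_power2[of "2 * v 0 - v j"] by (simp add: power2_eq_square algebra_simps)
    then show ?thesis using a by simp
  qed
  have "(\<Sum>j<J. (v j)\<^sup>2) \<le> (\<Sum>j<J. 2 * (v 0)\<^sup>2 + 4 * real J * D)" by (rule sum_mono) (use pt in auto)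
  also have "\<dots> = real J * (2 * (v 0)\<^sup>2) + (real J)\<^sup>2 * (4 * D)" by (simp add: power2_eq_square algebra_simps)
  also have "\<dots> \<le> (real J)\<^sup>2 * (2 * (v 0)\<^sup>2) + (real J)\<^sup>2 * (4 * D)"
    using assms by (intro add_right_mono mult_right_mono) (auto simp: power2_eq_square)
  also have "\<dots> \<le> 8 * (real J)\<^sup>2 * ((v 0)\<^sup>2 / 4 + D)" using D0 by (simp add: algebra_simps)
  finally show ?thesis using assms unfolding D_def[symmetric] by (simp add: pos_divide_le_eq mult.commute)
qed

lemma cosh_add_le:
  assumes "0 \<le> t" "0 \<le> d" "d \<le> (1::real)"
  shows "cosh (t + d) \<le> cosh t + d * exp (t + 1)"
proof -
  have "cosh (t + d) - cosh t = (exp (t + d) - exp t + exp (- (t + d)) - exp (- t)) / 2" by (simp add: cosh_def field_simps)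
  also have "\<dots> \<le> (exp (t + d) - exp t) / 2" using assms by simp
  also have "exp (t + d) - exp t \<le> d * exp (t + 1)"
  proof -
    have "exp (t + d) - exp t = exp (t + d) * (1 - exp (- d))" by (simp add: algebra_simps flip: exp_add)
    also have "\<dots> \<le> exp (t + d) * d" using exp_ge_add_one_self[of "- d"] by (intro mult_left_mono) auto
    also have "\<dots> \<le> exp (t + 1) * d" using assms by (intro mult_right_mono) auto
    finally show ?thesis by (simp add: mult.commute)
  qed
  finally have "cosh (t + d) - cosh t \<le> d * exp (t + 1) / 2" by simp
  moreover have "d * exp (t + 1) \<ge> 0" using assms by simp
  ultimately show ?thesis by linarith
qed

text \<open>Chosen so that, by \<open>cosh_add_le\<close>, raising the rate from
  \<open>tau z\<close> to \<open>tau z + gap z / J^2\<close> raises its \<open>cosh\<close> by at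
  most \<open>1 / (8 * J^2)\<close>, the constant of \<open>discrete_poincare\<close>.\<close>

definition gap :: "real \<Rightarrow> real" where "gap z = exp (- (tau z + 1)) / 8"

lemma gap_pos: "gap z > 0" by (simp add: gap_def)

text \<open>The quadratic form is lifted by the same amount \<open>q\<close> at all heights: below
  \<open>J\<close> by the Poincare inequality, from \<open>J\<close> on by the damping, whose
  strength \<open>1 / J^2\<close> is chosen to match.\<close>

lemma opV_upper_layered:
  assumes z: "0 < z" "z \<le> 1 / 5" and m: "m \<ge> 1" and M: "M \<ge> 1" and J: "J \<ge> 1" "J \<le> Suc m"
  defines "\<theta> \<equiv> 1 / (real J)\<^sup>2"
  shows "\<bar>(opV z (gz z \<theta> J) m ^^ M) (opA 0 (vac m)) {0}\<bar>
     \<le> exp (- (tau z + gap z / (real J)\<^sup>2) * (real M - 1)) * (sqrt (real m + 1) * (opV z (gz z \<theta> J) m ^^ M) (vac m) {})"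
proof (rule opV_amplitude_upper)
  have th: "\<theta> \<ge> 0" by (simp add: \<theta>_def)
  note F = gz_facts[OF z th m J(1)] tTQ_form[OF z th m J(1)] tau_bounds[OF z]
  have g0: "gap z / (real J)\<^sup>2 \<ge> 0" using gap_pos[of z] by simp
  show "0 < z" "z < 1" "1 \<le> M" using z M by auto
  show "0 < gz z \<theta> J i" "gz z \<theta> J i \<le> 1" for i using F by auto
  show "0 \<le> tau z + gap z / (real J)\<^sup>2" using F g0 by linarith
  fix v :: "nat \<Rightarrow> real"
  show "2 * (\<Sum>j\<le>m. (v j)\<^sup>2) \<le> (\<Sum>j\<le>m. v j * (tT z (gz z \<theta> J) m v j + tQ z (gz z \<theta> J) m v j))"
    using F by auto
  define q where "q = 1 / (8 * (real J)\<^sup>2)"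
  have qc: "cosh (tau z + gap z / (real J)\<^sup>2) \<le> cosh (tau z) + q"
  proof -
    have "gap z \<le> 1" 
    proof -
      have "exp (- (tau z + 1)) \<le> 1" using tau_bounds[OF z] by simp
      then show ?thesis unfolding gap_def by linarith
    qed
    moreover have "(real J)\<^sup>2 \<ge> 1" using J by simp
    ultimately have "gap z / (real J)\<^sup>2 \<le> 1" by (simp add: divide_le_eq)
    then have "cosh (tau z + gap z / (real J)\<^sup>2) \<le> cosh (tau z) + gap z / (real J)\<^sup>2 * exp (tau z + 1)"
      using g0 tau_bounds[OF z] by (intro cosh_add_le) auto
    also have "gap z / (real J)\<^sup>2 * exp (tau z + 1) = q"
    proof -
      have "exp (- (tau z + 1)) * exp (tau z + 1) = 1" unfolding exp_minus by simp
      then have "gap z * exp (tau z + 1) = 1 / 8" unfolding gap_def times_divide_eq_left by (simp only:)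
      moreover have "gap z / (real J)\<^sup>2 * exp (tau z + 1) = (gap z * exp (tau z + 1)) / (real J)\<^sup>2" by simp
      ultimately have "gap z / (real J)\<^sup>2 * exp (tau z + 1) = (1 / 8) / (real J)\<^sup>2" by (simp only:)
      then show ?thesis by (simp add: q_def)
    qed
    finally show ?thesis .
  qed
  have bq: "bulk z \<theta> J j \<ge> cosh (tau z) + (if j < J then 0 else q)" for j
  proof (cases "j < J")
    case False
    have "exp (tau z) * (1 + 2 * \<theta>) + exp (- tau z) * (1 - 2 * \<theta>)
        \<le> exp (tau z) * exp (2 * \<theta>) + exp (- tau z) * exp (- (2 * \<theta>))"
      using exp_ge_add_one_self[of "2 * \<theta>"] exp_ge_add_one_self[of "- (2 * \<theta>)"]
      by (intro add_mono mult_left_mono) auto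
    then have "cosh (tau z) + 2 * \<theta> * sinh (tau z) \<le> cosh (tau z + 2 * \<theta>)"
      unfolding cosh_def sinh_def minus_add_distrib exp_add by (simp add: field_simps)
    moreover have "2 * \<theta> * 1 \<le> 2 * \<theta> * sinh (tau z)" using tau_bounds[OF z] th by (intro mult_left_mono) auto
    ultimately have "cosh (tau z + 2 * \<theta>) \<ge> cosh (tau z) + 2 * \<theta>" by simp
    moreover have "2 * \<theta> \<ge> q" unfolding \<theta>_def q_def using J by (simp add: field_simps)
    ultimately show ?thesis using False by (simp add: bulk_def)
  qed (simp add: bulk_def)
  have "cosh (tau z + gap z / (real J)\<^sup>2) * (\<Sum>j\<le>m. (v j)\<^sup>2) \<le> (cosh (tau z) + q) * (\<Sum>j\<le>m. (v j)\<^sup>2)"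
    using qc by (intro mult_right_mono sum_nonneg) auto
  also have "(cosh (tau z) + q) * (\<Sum>j\<le>m. (v j)\<^sup>2) = (\<Sum>j\<le>m. (cosh (tau z) + (if j < J then 0 else q)) * (v j)\<^sup>2)
      + q * (\<Sum>j\<le>m. if j < J then (v j)\<^sup>2 else 0)"
    unfolding sum_distrib_left sum.distrib[symmetric] by (intro sum.cong) (auto simp: algebra_simps)
  also have "\<dots> \<le> (\<Sum>j\<le>m. bulk z \<theta> J j * (v j)\<^sup>2) + q * (\<Sum>j\<le>m. if j < J then (v j)\<^sup>2 else 0)"
    using bq by (intro add_right_mono sum_mono mult_right_mono) auto
  also have "(\<Sum>j\<le>m. if j < J then (v j)\<^sup>2 else 0) = (\<Sum>j<J. (v j)\<^sup>2)"
    using J by (intro sum.mono_neutral_cong_right) auto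
  finally have "cosh (tau z + gap z / (real J)\<^sup>2) * (\<Sum>j\<le>m. (v j)\<^sup>2)
    \<le> (\<Sum>j\<le>m. bulk z \<theta> J j * (v j)\<^sup>2) + q * (\<Sum>j<J. (v j)\<^sup>2)" .
  moreover have "q * (\<Sum>j<J. (v j)\<^sup>2) \<le> (v 0)\<^sup>2 / 4 + (\<Sum>j<m. if Suc j < J then (v j - v (Suc j))\<^sup>2 / 2 else 0)"
    using discrete_poincare[OF J, of v] by (simp add: q_def)
  ultimately show "cosh (tau z + gap z / (real J)\<^sup>2) * (\<Sum>j\<le>m. (v j)\<^sup>2) \<le> (\<Sum>j\<le>m. v j * tT z (gz z \<theta> J) m v j)"
    using tT_form[OF z th m J(1), of v] by linarith
qed

section \<open>Lower bound for the one-fermion amplitude\<close>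

definition opAs :: "nat \<Rightarrow> (nat \<Rightarrow> real) \<Rightarrow> (nat set \<Rightarrow> real) \<Rightarrow> nat set \<Rightarrow> real" where
  "opAs m \<psi> f = (\<lambda>S. \<Sum>i\<le>m. \<psi> i * opA i f S)"

text \<open>These are the Clifford relations: the cross terms cancel because different
  \<open>opA i\<close> anticommute, and each \<open>opA i\<close> squares to the identity.\<close>

lemma opAs_opAs: "opAs m \<psi> (opAs m \<psi> f) S = (\<Sum>i\<le>m. (\<psi> i)\<^sup>2) * f S"
proof -
  define t where "t i j = \<psi> i * \<psi> j * opA i (opA j f) S" for i j
  have "opAs m \<psi> (opAs m \<psi> f) S = (\<Sum>i\<le>m. \<Sum>j\<le>m. t i j)"
    unfolding opAs_def linop_sum[OF linop_A] by (simp add: t_def sum_distrib_left mult.assoc)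
  moreover have "t i j + t j i = (if i = j then 2 * (\<psi> i)\<^sup>2 * f S else 0)" for i j
  proof (cases "i = j")
    case True
    then show ?thesis by (simp add: t_def opA_square power2_eq_square)
  next
    case False
    have "t i j + t j i = \<psi> i * \<psi> j * (opA i (opA j f) S + opA j (opA i f) S)"
      by (simp add: t_def algebra_simps)
    also have "opA i (opA j f) S + opA j (opA i f) S = 0"
      unfolding opA_anticommute[OF False, of f S] by simp
    finally show ?thesis using False by simp
  qed
  then have "(\<Sum>i\<le>m. \<Sum>j\<le>m. t i j) + (\<Sum>i\<le>m. \<Sum>j\<le>m. t j i) = (\<Sum>i\<le>m. 2 * (\<psi> i)\<^sup>2 * f S)"
    unfolding sum.distrib[symmetric] by simp
  moreover have "(\<Sum>i\<le>m. \<Sum>j\<le>m. t j i) = (\<Sum>i\<le>m. \<Sum>j\<le>m. t i j)" by (rule sum.swap)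
  ultimately show ?thesis by (simp add: sum_distrib_right sum_distrib_left[symmetric] mult.assoc)
qed

text \<open>Counterpart of \<open>exp_cosh_descent\<close> in the other direction. Here
  \<open>w\<close> is multiplied by exactly \<open>exp \<epsilon>\<close> per step, and recovering
  \<open>y\<close> from \<open>w\<close> accumulates these terms, which costs the linear
  factor.\<close>

lemma cosh_recursion_bound:
  fixes y :: "nat \<Rightarrow> real"
  assumes rec: "\<And>x. 0 < x \<Longrightarrow> x < M \<Longrightarrow> y (x - 1) + y (Suc x) = 2 * cosh \<epsilon> * y x"
    and B: "\<bar>y M\<bar> \<le> B" "\<bar>y (M - 1)\<bar> \<le> B" and e: "\<epsilon> \<ge> 0" and M: "M \<ge> 1"
  shows "\<bar>y 0\<bar> \<le> 2 * (real M + 1) * exp (\<epsilon> * M) * B"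
proof -
  have B0: "B \<ge> 0" using B by linarith
  define w where "w x = y (x - 1) - exp (- \<epsilon>) * y x" for x
  have e1: "exp (- \<epsilon>) \<le> 1" using e by simp
  have step: "w x = exp \<epsilon> * w (Suc x)" if "0 < x" "x < M" for x
  proof -
    have "exp \<epsilon> * w (Suc x) = exp \<epsilon> * y x - (exp \<epsilon> * exp (- \<epsilon>)) * y (Suc x)"
      by (simp add: w_def algebra_simps)
    then have "exp \<epsilon> * w (Suc x) = exp \<epsilon> * y x - y (Suc x)"
      by (simp add: exp_minus)
    moreover have "w x = y (x - 1) - exp (- \<epsilon>) * y x" by (simp add: w_def)
    moreover have "2 * cosh \<epsilon> * y x = exp \<epsilon> * y x + exp (- \<epsilon>) * y x"
      by (simp add: cosh_def algebra_simps)
    ultimately show ?thesis using rec[OF that] by linarith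
  qed
  have w: "\<bar>w (M - k)\<bar> \<le> exp (\<epsilon> * k) * (2 * B)" if "k \<le> M - 1" for k
    using that
  proof (induction k)
    case 0
    have "\<bar>exp (- \<epsilon>) * y M\<bar> \<le> 1 * B" unfolding abs_mult using e1 B by (intro mult_mono) auto
    then have "\<bar>w M\<bar> \<le> 2 * B" using B unfolding w_def by linarith
    then show ?case by simp
  next
    case (Suc k)
    have "w (M - Suc k) = exp \<epsilon> * w (Suc (M - Suc k))" using Suc.prems by (intro step) auto
    also have "Suc (M - Suc k) = M - k" using Suc.prems by auto
    finally have "\<bar>w (M - Suc k)\<bar> = exp \<epsilon> * \<bar>w (M - k)\<bar>" by (simp add: abs_mult)
    also have "\<dots> \<le> exp \<epsilon> * (exp (\<epsilon> * k) * (2 * B))" using Suc by (intro mult_left_mono) auto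
    finally show ?case by (simp add: exp_add algebra_simps)
  qed
  have "\<bar>y (M - k)\<bar> \<le> 2 * (real k + 1) * exp (\<epsilon> * k) * B" if "k \<le> M" for k
    using that
  proof (induction k)
    case 0
    show ?case using B B0 by simp
  next
    case (Suc k)
    have "M - Suc k = (M - k) - 1" by simp
    then have "y (M - Suc k) = w (M - k) + exp (- \<epsilon>) * y (M - k)" by (simp add: w_def)
    then have "\<bar>y (M - Suc k)\<bar> \<le> \<bar>w (M - k)\<bar> + \<bar>exp (- \<epsilon>) * y (M - k)\<bar>" by linarith
    also have "\<bar>exp (- \<epsilon>) * y (M - k)\<bar> \<le> 1 * \<bar>y (M - k)\<bar>"
      unfolding abs_mult using e1 by (intro mult_right_mono) auto
    also have "\<bar>w (M - k)\<bar> + 1 * \<bar>y (M - k)\<bar> \<le> exp (\<epsilon> * k) * (2 * B) + 2 * (real k + 1) * exp (\<epsilon> * k) * B"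
      using Suc w[of k] by (intro add_mono) auto
    also have "\<dots> = 2 * (real k + 2) * B * exp (\<epsilon> * k)" by (simp add: algebra_simps)
    also have "\<dots> \<le> 2 * (real k + 2) * B * exp (\<epsilon> * Suc k)"
      using e B0 by (intro mult_left_mono) (auto simp: algebra_simps)
    finally show ?case by (simp add: algebra_simps)
  qed
  from this[of M] show ?thesis by simp
qed

section \<open>Entrywise comparison of powers of the transfer matrix\<close>

lemma opE_mono_id: "0 \<le> z \<Longrightarrow> (\<And>S. 0 \<le> f S) \<Longrightarrow> f S \<le> opE z j f S"
  by (simp add: opE_def)

lemma opD_mono_id:
  assumes "0 \<le> z" "\<And>S. 0 \<le> f S" shows "f S \<le> opD z k f S" "0 \<le> opD z k f S"
proof -
  have "f S \<le> opD z k f S \<and> 0 \<le> opD z k f S" for S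
  proof (induction k arbitrary: S)
    case (Suc k)
    have "opD z k f S \<le> opE z k (opD z k f) S" using Suc assms(1) by (intro opE_mono_id) auto
    then show ?case using Suc[of S] by (metis opD.simps(2) order_trans)
  qed (use assms in auto)
  then show "f S \<le> opD z k f S" "0 \<le> opD z k f S" by auto
qed

lemma opD_mono:
  assumes "0 \<le> z" "\<And>S. f S \<le> h S" shows "opD z k f S \<le> opD z k h S"
  by (induction k arbitrary: S) (use assms in \<open>auto simp: opE_def intro!: add_mono mult_left_mono\<close>)

text \<open>The toggles of \<open>{0, 1}\<close>, \<open>{1, 2}\<close> and so on telescope: the
  term that uses the first \<open>j\<close> factors of \<open>opD\<close> exchanges height 0 for
  height \<open>j\<close>.\<close>

lemma opD_toggle_lower:
  assumes z: "0 \<le> z" "z \<le> 1" and f: "\<And>S. 0 \<le> f S" and j: "j \<le> m"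
  shows "z ^ m * f (S \<triangle> {0} \<triangle> {j}) \<le> opD z m f S"
proof -
  have "z ^ k * f (S \<triangle> {0} \<triangle> {k}) \<le> opD z k f S" for k S
  proof (induction k arbitrary: S)
    case (Suc k)
    have "S \<triangle> {k, Suc k} \<triangle> {0} \<triangle> {k} = S \<triangle> {0} \<triangle> {Suc k}" by (rule set_eqI) auto
    then have "z ^ Suc k * f (S \<triangle> {0} \<triangle> {Suc k}) = z * (z ^ k * f (S \<triangle> {k, Suc k} \<triangle> {0} \<triangle> {k}))" by simp
    also have "\<dots> \<le> z * opD z k f (S \<triangle> {k, Suc k})" using z by (intro mult_left_mono Suc) auto
    also have "\<dots> \<le> opD z (Suc k) f S" using opD_mono_id(2)[OF z(1) f] by (simp add: opE_def)
    finally show ?case .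
  qed simp
  from this[of j S] have "z ^ j * f (S \<triangle> {0} \<triangle> {j}) \<le> opD z j f S" .
  moreover have "z ^ m * f (S \<triangle> {0} \<triangle> {j}) \<le> z ^ j * f (S \<triangle> {0} \<triangle> {j})"
    using z f j by (intro mult_right_mono power_decreasing) auto
  moreover have "opD z j f S \<le> opD z m f S"
    using j
  proof (induction m rule: dec_induct)
    case (step n)
    have "opD z n f S \<le> opE z n (opD z n f) S" using z opD_mono_id(2)[OF z(1) f] by (intro opE_mono_id) auto
    then show ?case using step by simp
  qed simp
  ultimately show ?thesis by linarith
qed

lemma hw_lower:
  assumes "0 \<le> c" "c \<le> 1" "\<And>i. c \<le> g i" shows "c ^ Suc m \<le> hw g m S"
proof -
  have "(\<Prod>i\<le>m. c) \<le> (\<Prod>i\<le>m. if i \<in> S then g i else 1)" using assms by (intro prod_mono) auto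
  then show ?thesis by (simp add: hw_def)
qed

lemma hw_nonneg: "(\<And>i. 0 \<le> g i) \<Longrightarrow> 0 \<le> hw g m S"
  unfolding hw_def by (intro prod_nonneg) auto

lemma opV_mono:
  assumes "0 \<le> z" "\<And>i. 0 \<le> g i" "\<And>S. f S \<le> h S" shows "opV z g m f S \<le> opV z g m h S"
  unfolding opV_def opH_def using assms by (intro mult_left_mono opD_mono hw_nonneg) auto

lemma opV_funpow_mono:
  assumes "0 \<le> z" "\<And>i. 0 \<le> g i" "\<And>S. f S \<le> h S" shows "(opV z g m ^^ n) f S \<le> (opV z g m ^^ n) h S"
  by (induction n arbitrary: S) (use assms in \<open>auto intro!: opV_mono\<close>)

lemma opV_funpow_nonneg:
  assumes "0 \<le> z" "\<And>i. 0 \<le> g i" "\<And>S. 0 \<le> f S" shows "0 \<le> (opV z g m ^^ n) f S"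
proof -
  have "(opV z g m ^^ n) (\<lambda>S. 0) S \<le> (opV z g m ^^ n) f S" by (rule opV_funpow_mono) (use assms in auto)
  then show ?thesis using linop_zero[OF linop_funpow[OF linop_V[of z g m]], of n] by simp
qed

text \<open>The two diagonal factors together are at least \<open>z ^ (m + 1)\<close> and the chain
  of toggles is at least \<open>z ^ m\<close>. This serves to replace an arbitrary end height by 0
  at the price of one more column.\<close>

lemma opV_toggle_lower:
  assumes z: "0 < z" "z \<le> 1" and f: "\<And>S. 0 \<le> f S" and ij: "i = 0 \<or> j = 0" "i \<le> m" "j \<le> m"
    and g: "\<And>i. g i = sqrt z"
  shows "z ^ (2 * m + 1) * f (S \<triangle> {i} \<triangle> {j}) \<le> opV z g m f S"
proof -
  have h: "sqrt z ^ Suc m \<le> hw g m T" for T by (rule hw_lower) (use z g in auto)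
  have hn: "0 \<le> hw g m T" for T by (rule hw_nonneg) (use z g in auto)
  define k where "k = (if i = 0 then j else i)"
  have k: "k \<le> m" "S \<triangle> {i} \<triangle> {j} = S \<triangle> {0} \<triangle> {k}"
    using ij sdiff_pair_comm[of S "{i}" "{j}"] by (auto simp: k_def)
  have "z ^ (2 * m + 1) * f (S \<triangle> {i} \<triangle> {j}) = sqrt z ^ Suc m * (z ^ m * (sqrt z ^ Suc m * f (S \<triangle> {0} \<triangle> {k})))"
  proof -
    have "sqrt z ^ Suc m * sqrt z ^ Suc m = z ^ Suc m"
      using z by (metis power_mult_distrib real_sqrt_mult_self abs_of_pos)
    moreover have "z ^ (2 * m + 1) = z ^ Suc m * z ^ m" by (simp add: mult_2 power_add)
    ultimately have "z ^ (2 * m + 1) = (sqrt z ^ Suc m * sqrt z ^ Suc m) * z ^ m" by (simp only:)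
    then show ?thesis unfolding k(2) by (simp only: mult_ac)
  qed
  also have "\<dots> \<le> sqrt z ^ Suc m * (z ^ m * (hw g m (S \<triangle> {0} \<triangle> {k}) * f (S \<triangle> {0} \<triangle> {k})))"
    using z f h by (intro mult_left_mono mult_right_mono) auto
  also have "\<dots> \<le> sqrt z ^ Suc m * opD z m (opH g m f) S"
  proof (rule mult_left_mono)
    show "z ^ m * (hw g m (S \<triangle> {0} \<triangle> {k}) * f (S \<triangle> {0} \<triangle> {k})) \<le> opD z m (opH g m f) S"
      using opD_toggle_lower[of z "opH g m f" k m S] z f hn k by (simp add: opH_def)
  qed (use z in auto)
  also have "\<dots> \<le> hw g m S * opD z m (opH g m f) S"
    using h f hn z by (intro mult_right_mono opD_mono_id) (auto simp: opH_def)
  finally show ?thesis by (simp add: opV_def opH_def)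
qed

lemma opD_upper:
  assumes "0 \<le> z" "z \<le> 1" "\<And>S. \<bar>f S\<bar> \<le> c" shows "\<bar>opD z k f S\<bar> \<le> 2 ^ k * c"
proof (induction k arbitrary: S)
  case (Suc k)
  have "\<bar>opD z (Suc k) f S\<bar> \<le> \<bar>opD z k f S\<bar> + z * \<bar>opD z k f (S \<triangle> {k, Suc k})\<bar>"
    using assms by (simp add: opE_def abs_mult abs_triangle_ineq[THEN order_trans])
  also have "z * \<bar>opD z k f (S \<triangle> {k, Suc k})\<bar> \<le> 1 * (2 ^ k * c)"
    using assms Suc by (intro mult_mono) auto
  finally show ?case using Suc[of S] by simp
qed (use assms in auto)

lemma opV_upper:
  assumes "0 \<le> z" "z \<le> 1" "\<And>i. 0 \<le> g i" "\<And>i. g i \<le> 1" "\<And>S. \<bar>f S\<bar> \<le> c"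
  shows "\<bar>opV z g m f S\<bar> \<le> 2 ^ m * c"
proof -
  have h: "0 \<le> hw g m T" "hw g m T \<le> 1" for T
    using hw_nonneg[of g m T] prod_mono[of "{..m}" "\<lambda>i. if i \<in> T then g i else 1" "\<lambda>_. 1"] assms by (auto simp: hw_def)
  have H: "\<bar>hw g m T * x\<bar> \<le> \<bar>x\<bar>" for T x
    using h[of T] by (simp add: abs_mult mult_left_le_one_le)
  have "\<bar>opH g m f T\<bar> \<le> c" for T unfolding opH_def using H assms(5) order_trans by blast
  then have "\<bar>opD z m (opH g m f) S\<bar> \<le> 2 ^ m * c" by (intro opD_upper assms)
  then show ?thesis unfolding opV_def opH_def[of _ _ "opD z m _"] using H order_trans by blast
qed

lemma gz_homogeneous: "gz z 0 1 = (\<lambda>_. sqrt z)" "gz z 0 (Suc 0) = (\<lambda>_. sqrt z)"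
  by (rule ext, simp add: gz_def)+

text \<open>Reflection coefficients of the lower and of the upper wall: twice the defects
  \<open>(Ck z - 1) * c^2\<close> and \<open>(Ck z - 1) * s^2\<close> of the diagonal of
  \<open>tT\<close>, where \<open>c\<close> and \<open>s\<close> are the constant values of
  \<open>cL\<close> and \<open>sL\<close>.\<close>

definition rho0 :: "real \<Rightarrow> real" where "rho0 z = z * (1 + z) / (1 - z)"
definition rho1 :: "real \<Rightarrow> real" where "rho1 z = z * (1 - z) / (1 + z)"

text \<open>The combination of sines with \<open>wave z k (- 1) = rho0 z * wave z k 0\<close>, so
  that the condition at the lower wall holds for every \<open>k\<close>; the upper wall quantizes
  \<open>k\<close>.\<close>

definition wave :: "real \<Rightarrow> real \<Rightarrow> int \<Rightarrow> real" where
  "wave z k j = sin (k * (real_of_int j + 1)) - rho0 z * sin (k * real_of_int j)"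

lemma wave_rec: "wave z k (j - 1) + wave z k (j + 1) = 2 * cos k * wave z k j"
proof -
  have "sin (k * (x - 1)) + sin (k * (x + 1)) = 2 * cos k * sin (k * x)" for x
    by (simp add: algebra_simps sin_add sin_diff)
  from arg_cong[OF this[of "real_of_int j"], of "\<lambda>t. rho0 z * t"] this[of "real_of_int j + 1"]
  show ?thesis by (simp add: wave_def algebra_simps)
qed

text \<open>The mismatch \<open>h\<close> at the upper wall vanishes at \<open>k = 0\<close> with
  positive slope and is nonpositive at \<open>pi / (m + 1)\<close>, so it has a root in between. A
  frequency of order \<open>1 / m\<close> is what limits the cost of confinement to
  \<open>N / m^2\<close>.\<close>

lemma wave_quantization:
  assumes z: "0 < z" "z \<le> 1 / 5" and m: "m \<ge> 1"
  shows "\<exists>k. 0 < k \<and> k \<le> pi / (real m + 1) \<and> wave z k (int m + 1) = rho1 z * wave z k (int m)"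
proof -
  define h where "h k = wave z k (int m + 1) - rho1 z * wave z k (int m)" for k
  define n where "n = real m + 1"
  have n: "n \<ge> 2" using m by (simp add: n_def)
  have r0: "0 \<le> rho0 z" "rho0 z \<le> 1 / 2" and r1: "0 \<le> rho1 z" "rho1 z \<le> 1 / 2"
  proof -
    have "z * (1 + z) \<le> (1/5) * (1 + 1/5)" "z * (1 - z) \<le> (1/5) * 1" using z by (intro mult_mono; simp)+
    then show "0 \<le> rho0 z" "rho0 z \<le> 1 / 2" "0 \<le> rho1 z" "rho1 z \<le> 1 / 2"
      using z by (auto simp: rho0_def rho1_def divide_le_eq)
  qed
  have hn: "h k = (sin (k * (n + 1)) - rho0 z * sin (k * n)) - rho1 z * (sin (k * n) - rho0 z * sin (k * (n - 1)))" for k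
    by (simp add: h_def wave_def n_def algebra_simps)
  define d where "d = (n + 1 - rho0 z * n) - rho1 z * (n - rho0 z * (n - 1))"
  have "(h has_real_derivative d) (at 0)"
    unfolding hn d_def by (auto intro!: derivative_eq_intros)
  moreover have "d > 0"
  proof -
    have "rho0 z * n \<le> (1/2) * n" using r0 n by (intro mult_right_mono) auto
    moreover have "rho1 z * (n - rho0 z * (n - 1)) \<le> (1/2) * n"
    proof (rule mult_mono)
      define t where "t = rho0 z * (n - 1)"
      have "t \<le> 1 * (n - 1)" "0 \<le> t"
        unfolding t_def using r0 n by (intro mult_right_mono mult_nonneg_nonneg; simp)+
      then show "n - rho0 z * (n - 1) \<le> n" "0 \<le> n - rho0 z * (n - 1)" by (simp_all add: t_def[symmetric])
    qed (use r1 in auto)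
    ultimately show ?thesis by (simp add: d_def)
  qed
  ultimately obtain e where e: "e > 0" "\<And>x. 0 < x \<Longrightarrow> x < e \<Longrightarrow> h 0 < h (0 + x)"
    using DERIV_pos_inc_right[of h d 0] by blast
  define x where "x = min (e / 2) (pi / n)"
  have x: "0 < x" "x < e" "x \<le> pi / n" using e n by (auto simp: x_def)
  have hx: "h x > 0" using e(2)[OF x(1,2)] by (simp add: hn)
  have hp: "h (pi / n) \<le> 0"
  proof -
    have s: "sin (pi / n) \<ge> 0" using n by (intro sin_ge_zero) (auto simp: divide_le_eq)
    have "pi / n * (n + 1) = pi / n + pi" "pi / n * n = pi" "pi / n * (n - 1) = pi - pi / n"
      using n by (auto simp: field_simps)
    then have "sin (pi / n * (n + 1)) = - sin (pi / n)" "sin (pi / n * n) = 0" "sin (pi / n * (n - 1)) = sin (pi / n)"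
      by (simp_all only: sin_periodic_pi sin_pi sin_pi_minus)
    then have "h (pi / n) = - (1 - rho1 z * rho0 z) * sin (pi / n)"
      unfolding hn by (simp only:) (simp add: algebra_simps)
    moreover have "rho1 z * rho0 z \<le> (1/2) * (1/2)" using r0 r1 by (intro mult_mono) auto
    ultimately show ?thesis using s by (simp add: mult_le_0_iff)
  qed
  have "continuous_on {x..pi / n} h" unfolding hn by (intro continuous_intros)
  then obtain k where "x \<le> k" "k \<le> pi / n" "h k = 0"
    using IVT2'[of h "pi / n" 0 x] hp hx x by auto
  then show ?thesis using x by (intro exI[of _ k]) (auto simp: h_def n_def)
qed

text \<open>The values of the wave at the ghost heights \<open>- 1\<close> and \<open>m + 1\<close>
  absorb the defects of the diagonal at the walls; what is left is a matrix with diagonal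
  \<open>cosh (tau z) + 1\<close> and hopping 1/2.\<close>

lemma wave_eigenvector:
  assumes z: "0 < z" "z \<le> 1 / 5" and m: "m \<ge> 1" and j: "j \<le> m"
    and q: "wave z k (int m + 1) = rho1 z * wave z k (int m)"
  shows "tT z (gz z 0 1) m (\<lambda>i. wave z k (int i)) j = (cosh (tau z) + 1 - cos k) * wave z k (int j)"
proof -
  define g where "g = gz z 0 1"
  note G = gz_facts[OF z order_refl m order_refl, folded g_def]
  have g2: "(g i)\<^sup>2 = z" for i using z by (simp add: g_def gz_homogeneous)
  have gn: "g i \<noteq> 0" for i using G(1)[of i] by simp
  have const: "cL g i = cL g 0" "sL g i = sL g 0" for i
    by (simp_all add: cL_def sL_def g_def gz_homogeneous)
  define c s where "c = cL g 0" and "s = sL g 0"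
  have z2: "z\<^sup>2 \<le> (1 / 5)\<^sup>2" using z by (intro power_mono) auto
  then have d: "1 - z\<^sup>2 \<noteq> 0" by (simp add: power2_eq_square)
  have f: "1 - z\<^sup>2 = (1 - z) * (1 + z)" by (simp add: algebra_simps power2_eq_square)
  have cs: "Sk z * (c * s) = 1 / 2"
  proof -
    have "c * s = ((1 - z\<^sup>2) / z) / 4"
      unfolding c_def s_def cL_sL_square(2)[of g 0, OF gn] g2 using z by (simp add: field_simps power2_eq_square)
    then show ?thesis using d z by (simp add: Sk_def)
  qed
  have c2: "c\<^sup>2 = (1 + z)\<^sup>2 / (4 * z)" and s2: "s\<^sup>2 = (1 - z)\<^sup>2 / (4 * z)"
  proof -
    show c2: "c\<^sup>2 = (1 + z)\<^sup>2 / (4 * z)" unfolding c_def cL_sL_square(4)[of g 0, OF gn] g2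
      using z by (simp add: field_simps power2_eq_square)
    have "s\<^sup>2 = (1 / z + z) / 2 - c\<^sup>2" using cL_sL_square(1)[of g 0, OF gn] unfolding c_def s_def g2 by linarith
    also have "\<dots> = (1 - z)\<^sup>2 / (4 * z)" unfolding c2 using z by (simp add: field_simps power2_eq_square)
    finally show "s\<^sup>2 = (1 - z)\<^sup>2 / (4 * z)" .
  qed
  have p: "1 - z > 0" "1 + z > 0" using z by auto
  have bc: "(Ck z - 1) * c\<^sup>2 = rho0 z / 2" "(Ck z - 1) * s\<^sup>2 = rho1 z / 2"
    unfolding Ck_Sk_bounds(8)[OF z] c2 s2 f rho0_def rho1_def using p z
    by (simp_all add: power2_eq_square divide_simps)
  have bulk: "Ck z * (c\<^sup>2 + s\<^sup>2) = cosh (tau z) + 1"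
    using bulk_eq[OF z order_refl m order_refl, of 0] cs by (simp add: c_def s_def g_def bulk_def)
  define w where "w i = wave z k (int i)" for i
  have off: "Sk z * c * s = 1/2" "Sk z * s * c = 1/2" using cs by (simp_all add: mult_ac)
  have left: "ca z j * c\<^sup>2 * w j - sa z j * c * s * w (j - 1) = Ck z * c\<^sup>2 * w j - wave z k (int j - 1) / 2"
  proof (cases "j = 0")
    case True
    have "wave z k (- 1) = rho0 z * w 0" by (simp add: wave_def w_def)
    then have "wave z k (int j - 1) / 2 = (Ck z - 1) * c\<^sup>2 * w j" using True bc(1) by simp
    then show ?thesis using True by (simp add: ca_def sa_def algebra_simps)
  next
    case False
    then have "w (j - 1) = wave z k (int j - 1)" by (simp add: w_def of_nat_diff)
    then show ?thesis using False off by (simp add: ca_def sa_def)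
  qed
  have right: "cb z m j * s\<^sup>2 * w j - sb z m j * s * c * w (Suc j) = Ck z * s\<^sup>2 * w j - wave z k (int j + 1) / 2"
  proof (cases "j = m")
    case True
    have "wave z k (int j + 1) / 2 = (Ck z - 1) * s\<^sup>2 * w j" using True bc(2) q by (simp add: w_def)
    then show ?thesis using True by (simp add: cb_def sb_def algebra_simps)
  next
    case False
    have "w (Suc j) = wave z k (int j + 1)" by (simp add: w_def add.commute)
    then show ?thesis using False off by (simp add: cb_def sb_def)
  qed
  have "tT z g m w j = (ca z j * c\<^sup>2 * w j - sa z j * c * s * w (j - 1)) + (cb z m j * s\<^sup>2 * w j - sb z m j * s * c * w (Suc j))"
    unfolding tT_def const[of j] const[of "j - 1"] const[of "Suc j"] c_def s_def by (simp add: algebra_simps)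
  also have "\<dots> = Ck z * (c\<^sup>2 + s\<^sup>2) * w j - (wave z k (int j - 1) + wave z k (int j + 1)) / 2"
    unfolding left right by (simp add: algebra_simps add_divide_distrib)
  also have "\<dots> = (cosh (tau z) + 1 - cos k) * w j"
    unfolding bulk wave_rec by (simp add: w_def algebra_simps)
  finally have "tT z g m w j = (cosh (tau z) + 1 - cos k) * w j" .
  moreover have "w = (\<lambda>i. wave z k (int i))" by (rule ext) (simp add: w_def)
  ultimately show ?thesis by (simp only: g_def)
qed

lemma sum_abs_square_le:
  fixes \<psi> :: "nat \<Rightarrow> real" shows "(\<Sum>i\<le>m. \<bar>\<psi> i\<bar>)\<^sup>2 \<le> (real m + 1) * (\<Sum>i\<le>m. (\<psi> i)\<^sup>2)"
  using Cauchy_Schwarz_ineq_sum[of "\<lambda>_. 1" "\<lambda>i. \<bar>\<psi> i\<bar>" "{..m}"] by (simp add: add.commute)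

lemma tTQ_bound:
  assumes z: "0 < z" "z \<le> 1 / 5" and j: "j \<le> m" and a: "\<And>i. i \<le> m \<Longrightarrow> \<bar>a i\<bar> \<le> A"
  shows "\<bar>tT z (gz z 0 1) m a j + tQ z (gz z 0 1) m a j\<bar> \<le> 5 / z * A"
proof -
  define g where "g = gz z 0 1"
  note C = Ck_Sk_bounds[OF z]
  have A: "A \<ge> 0" using a[of 0] by linarith
  have const: "cL g i = cL g 0" "sL g i = sL g 0" for i
    by (simp_all add: cL_def sL_def g_def gz_homogeneous)
  define c s where "c = cL g 0" and "s = sL g 0"
  have g0: "g 0 = sqrt z" by (simp add: g_def gz_homogeneous)
  have "sqrt z \<le> 1" using z by simp
  then have "sqrt z \<le> 1 / sqrt z" using z by (simp add: le_divide_eq)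
  then have cs: "c \<ge> 0" "s \<ge> 0" using z by (auto simp: c_def s_def cL_def sL_def g0)
  have cs3: "c + s = 1 / sqrt z" using cL_sL_square(3)[of g 0] z by (simp add: c_def s_def g0)
  have cs2: "(c + s)\<^sup>2 = 1 / z" unfolding cs3 using z by (simp add: power_one_over)
  have co: "0 \<le> ca z j" "ca z j \<le> 2" "0 \<le> sa z j" "sa z j \<le> 1/2" "0 \<le> cb z m j" "cb z m j \<le> 2" "0 \<le> sb z m j" "sb z m j \<le> 1/2"
    using C by (auto simp: ca_def sa_def cb_def sb_def)
  define p q r where "p = (ca z j * c + cb z m j * s) * (c + s)" and "q = sa z j * c * (c + s)" and "r = sb z m j * s * (c + s)"
  have "tT z g m a j + tQ z g m a j = p * a j - q * a (j - 1) - r * a (Suc j)"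
    unfolding tT_def tQ_def p_def q_def r_def const[of j] const[of "j - 1"] const[of "Suc j"] c_def s_def
    by (simp add: algebra_simps power2_eq_square)
  also have "\<bar>\<dots>\<bar> \<le> \<bar>p * a j\<bar> + \<bar>q * a (j - 1)\<bar> + \<bar>r * a (Suc j)\<bar>" by linarith
  also have "\<dots> \<le> 2 / z * A + (1 / 2) / z * A + (1 / 2) / z * A"
  proof -
    have pn: "p \<ge> 0" "q \<ge> 0" "r \<ge> 0" unfolding p_def q_def r_def using cs(1,2) co by (auto intro!: mult_nonneg_nonneg add_nonneg_nonneg)
    have "ca z j * c + cb z m j * s \<le> 2 * c + 2 * s" using co cs by (intro add_mono mult_right_mono) auto
    then have "p \<le> (2 * (c + s)) * (c + s)" unfolding p_def using cs(1,2) by (intro mult_right_mono) auto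
    also have "\<dots> = 2 * (c + s)\<^sup>2" by (simp add: power2_eq_square)
    finally have p: "p \<le> 2 / z" unfolding cs2 by simp
    have "sa z j * c \<le> (1/2) * (c + s)" "sb z m j * s \<le> (1/2) * (c + s)" using co cs by (intro mult_mono; simp)+
    then have "q \<le> ((1/2) * (c + s)) * (c + s)" "r \<le> ((1/2) * (c + s)) * (c + s)"
      unfolding q_def r_def using cs(1,2) by (intro mult_right_mono; simp)+
    moreover have "((1/2) * (c + s)) * (c + s) = (1/2) * (c + s)\<^sup>2" by (simp add: power2_eq_square)
    ultimately have qr: "q \<le> (1/2) / z" "r \<le> (1/2) / z" unfolding cs2 by simp_all
    have "\<bar>p * a j\<bar> \<le> 2 / z * A" "\<bar>q * a (j - 1)\<bar> \<le> (1/2) / z * A"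
      unfolding abs_mult using pn p qr a[of j] a[of "j - 1"] j A z by (intro mult_mono; simp)+
    moreover have "\<bar>r * a (Suc j)\<bar> \<le> (1/2) / z * A"
    proof (cases "j = m")
      case True
      then have "r = 0" by (simp add: r_def sb_def)
      then show ?thesis using A z by simp
    next
      case False
      then show ?thesis unfolding abs_mult using pn qr a[of "Suc j"] j A z by (intro mult_mono) auto
    qed
    ultimately show ?thesis by linarith
  qed
  also have "\<dots> = 3 / z * A" by (simp add: field_simps)
  also have "\<dots> \<le> 5 / z * A" using A z by (intro mult_right_mono divide_right_mono) auto
  finally show ?thesis by (simp add: g_def)
qed

text \<open>Pairing the amplitudes with the eigenvector gives a scalar \<open>y\<close> that obeys
  an exact recursion. By the Clifford relations \<open>y 0\<close> is the squared norm of the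
  eigenvector times the plus amplitude, while \<open>y M\<close> and \<open>y (M - 1)\<close> are
  controlled by one-fermion entries. Hence the plus amplitude exceeds these entries by at most
  \<open>exp (\<epsilon> * M)\<close> and a polynomial.\<close>

lemma opV_lower_homogeneous:
  assumes z: "0 < z" "z \<le> 1 / 5" and m: "m \<ge> 1" and M: "M \<ge> 1"
  defines "g \<equiv> gz z 0 1"
  shows "(opV z g m ^^ (M + 2)) (vac m) {} * exp (- (tau z + (pi / (real m + 1))\<^sup>2 / 2) * M) * (z ^ (2 * m + 1))\<^sup>2
    \<le> 4 ^ m * (10 / z * (real M + 1) * (real m + 1)) * (opV z g m ^^ (M + 2)) (opA 0 (vac m)) {0}"
proof -
  let ?V = "opV z g m"
  note G = gz_facts[OF z order_refl m order_refl, folded g_def]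
  have gs: "g i = sqrt z" for i by (simp add: g_def gz_homogeneous)
  have z1: "z\<^sup>2 \<noteq> 1" using z by (simp add: power2_eq_1_iff)
  have gpos: "0 < g i" "0 \<le> g i" "g i \<le> 1" for i using G(1,2)[of i] by auto
  obtain k where k: "0 < k" "k \<le> pi / (real m + 1)" "wave z k (int m + 1) = rho1 z * wave z k (int m)"
    using wave_quantization[OF z m] by blast
  define \<psi> where "\<psi> i = wave z k (int i)" for i
  have eig: "tT z g m \<psi> j = (cosh (tau z) + 1 - cos k) * \<psi> j" if "j \<le> m" for j
    using wave_eigenvector[OF z m that k(3)] unfolding g_def \<psi>_def .
  define \<epsilon> where "\<epsilon> = arcosh (cosh (tau z) + 1 - cos k)"
  have ce: "cosh \<epsilon> = cosh (tau z) + 1 - cos k"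
    unfolding \<epsilon>_def by (rule cosh_arcosh_real) (use cosh_real_ge_1[of "tau z"] cos_le_one[of k] in linarith)
  have e0: "\<epsilon> \<ge> 0" unfolding \<epsilon>_def by (rule arcosh_nonneg_real) (use cosh_real_ge_1[of "tau z"] cos_le_one[of k] in linarith)
  \<comment> \<open>Convexity of \<open>cosh\<close> with slope \<open>sinh (tau z) \<ge> 1\<close>,
    set against \<open>1 - cos k \<le> k^2 / 2\<close>.\<close>
  have eb: "\<epsilon> \<le> tau z + (pi / (real m + 1))\<^sup>2 / 2"
  proof -
    define d where "d = k\<^sup>2 / 2"
    have d: "d \<ge> 0" by (simp add: d_def)
    have "cos k \<ge> 1 - d"
    proof -
      have "\<bar>sin (k / 2)\<bar> \<le> \<bar>k / 2\<bar>" by (rule abs_sin_x_le_abs_x)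
      then have "(sin (k / 2))\<^sup>2 \<le> (k / 2)\<^sup>2" by (simp only: abs_le_square_iff)
      then show ?thesis using cos_double_sin[of "k / 2"] by (simp add: d_def power2_eq_square)
    qed
    have t: "exp (tau z) * (1 + d) + exp (- tau z) * (1 - d) \<le> exp (tau z) * exp d + exp (- tau z) * exp (- d)"
      using exp_ge_add_one_self[of d] exp_ge_add_one_self[of "- d"]
      by (intro add_mono mult_left_mono) auto
    then have "cosh (tau z) + d * sinh (tau z) \<le> cosh (tau z + d)"
      unfolding cosh_def sinh_def minus_add_distrib exp_add by (simp add: field_simps)
    moreover have "d * 1 \<le> d * sinh (tau z)" using tau_bounds[OF z] d by (intro mult_left_mono) auto
    ultimately have "cosh \<epsilon> \<le> cosh (tau z + d)" using \<open>cos k \<ge> 1 - d\<close> unfolding ce by linarith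
    then have "\<epsilon> \<le> tau z + d" using e0 d tau_bounds[OF z] by (subst (asm) cosh_real_nonneg_le_iff) auto
    moreover have "k\<^sup>2 \<le> (pi / (real m + 1))\<^sup>2" using k by (intro power_mono) auto
    ultimately show ?thesis by (simp add: d_def)
  qed
  define \<delta> where "\<delta> = opAs m \<psi> (vac m)"
  define a where "a = amp z g m M \<delta>"
  define y where "y x = (\<Sum>j\<le>m. \<psi> j * a x j)" for x
  \<comment> \<open>\<open>E\<close> will dominate every one-fermion entry: one spare column at each
    end, which is why the power is \<open>M + 2\<close>, moves the heights \<open>i\<close> and
    \<open>j\<close> to 0 at cost \<open>z ^ (2 * m + 1)\<close> each.\<close>
  define E where "E = (?V ^^ (M + 2)) (opA 0 (vac m)) {0} / (z ^ (2 * m + 1))\<^sup>2"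
  define P where "P = (\<Sum>i\<le>m. \<bar>\<psi> i\<bar>)"
  have rec: "y (x - 1) + y (Suc x) = 2 * cosh \<epsilon> * y x" if "0 < x" "x < M" for x
  proof -
    have "y (x - 1) + y (Suc x) = (\<Sum>j\<le>m. \<psi> j * (2 * tT z g m (a x) j))"
      unfolding y_def sum.distrib[symmetric]
      using amp_rec[OF z1 gpos(1) that] by (intro sum.cong) (simp_all add: a_def distrib_left[symmetric])
    also have "\<dots> = 2 * (\<Sum>j\<le>m. a x j * tT z g m \<psi> j)"
      unfolding tT_symmetric[where v = "a x"] by (simp add: sum_distrib_left mult_ac)
    also have "(\<Sum>j\<le>m. a x j * tT z g m \<psi> j) = (\<Sum>j\<le>m. cosh \<epsilon> * (\<psi> j * a x j))"
      by (intro sum.cong refl) (simp add: eig ce)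
    finally show ?thesis by (simp add: y_def sum_distrib_left mult.assoc)
  qed
  have single_nn: "0 \<le> opA i (vac m) S" if "i \<le> m" for i S by (simp add: opA_vac[OF that] vac_eq)
  have entry: "0 \<le> (?V ^^ M) (opA i (vac m)) {j}" "(?V ^^ M) (opA i (vac m)) {j} \<le> E" if ij: "i \<le> m" "j \<le> m" for i j
  proof -
    let ?b = "z ^ (2 * m + 1)"
    have bp: "?b > 0" using z by simp
    show "0 \<le> (?V ^^ M) (opA i (vac m)) {j}"
      by (rule opV_funpow_nonneg) (use z gpos single_nn[OF ij(1)] in auto)
    have 1: "?b * opA i (vac m) S \<le> ?V (opA 0 (vac m)) S" for S
    proof -
      have "S \<triangle> {0} \<triangle> {i} \<triangle> {0} = S \<triangle> {i}" by (rule set_eqI) auto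
      then have "opA i (vac m) S = opA 0 (vac m) (S \<triangle> {0} \<triangle> {i})"
        by (simp add: opA_vac[OF ij(1)] opA_vac[OF le0])
      then show ?thesis
        using opV_toggle_lower[of z "opA 0 (vac m)" 0 i m g S] z single_nn[OF le0] ij gs by simp
    qed
    have "?b * (?V ^^ M) (opA i (vac m)) S = (?V ^^ M) (\<lambda>S. ?b * opA i (vac m) S) S" for S
      unfolding linop_scale[OF linop_funpow[OF linop_V[of z g m], of M]] ..
    also have "\<dots> S \<le> (?V ^^ M) (?V (opA 0 (vac m))) S" for S
      by (rule opV_funpow_mono) (use z gpos 1 in auto)
    finally have 2: "?b * (?V ^^ M) (opA i (vac m)) S \<le> (?V ^^ Suc M) (opA 0 (vac m)) S" for S
      by (simp add: funpow_swap1)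
    define F where "F = (?V ^^ Suc M) (opA 0 (vac m))"
    have Fn: "0 \<le> F S" for S unfolding F_def
      by (rule opV_funpow_nonneg) (use z gpos single_nn[OF le0] in auto)
    have "{0} \<triangle> {0} \<triangle> {j} = {j}" by (rule set_eqI) auto
    then have "?b * F {j} \<le> ?V F {0}"
      using opV_toggle_lower[of z F 0 j m g "{0}"] z Fn ij gs by simp
    moreover have "?b * (?b * (?V ^^ M) (opA i (vac m)) {j}) \<le> ?b * F {j}"
      using 2[of "{j}"] bp by (intro mult_left_mono) (auto simp: F_def)
    ultimately have "?b\<^sup>2 * (?V ^^ M) (opA i (vac m)) {j} \<le> (?V ^^ (M + 2)) (opA 0 (vac m)) {0}"
      by (simp add: F_def power2_eq_square mult_ac)
    then show "(?V ^^ M) (opA i (vac m)) {j} \<le> E"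
    proof -
      have b2: "0 < ?b\<^sup>2" using bp by (rule zero_less_power)
      assume "?b\<^sup>2 * (?V ^^ M) (opA i (vac m)) {j} \<le> (?V ^^ (M + 2)) (opA 0 (vac m)) {0}"
      then show ?thesis unfolding E_def pos_le_divide_eq[OF b2] by (simp only: mult.commute)
    qed
  qed
  have E0: "E \<ge> 0" using entry[of 0 0] by linarith
  have P0: "P \<ge> 0" by (simp add: P_def sum_nonneg)
  have aM: "\<bar>a M j\<bar> \<le> P * E" if "j \<le> m" for j
  proof -
    have "a M j = (\<Sum>i\<le>m. \<psi> i * (?V ^^ M) (opA i (vac m)) {j})"
      unfolding a_def amp_last \<delta>_def opAs_def linop_sum[OF linop_funpow[OF linop_V]] ..
    also have "\<bar>\<dots>\<bar> \<le> (\<Sum>i\<le>m. \<bar>\<psi> i * (?V ^^ M) (opA i (vac m)) {j}\<bar>)" by (rule sum_abs)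
    also have "\<dots> \<le> (\<Sum>i\<le>m. \<bar>\<psi> i\<bar> * E)"
      using entry that unfolding abs_mult by (intro sum_mono mult_mono) auto
    finally show ?thesis by (simp add: P_def sum_distrib_right)
  qed
  have aM1: "\<bar>a (M - 1) j\<bar> \<le> 5 / z * (P * E)" if "j \<le> m" for j
    using amp_boundary[OF z1 gpos(1) M that, where \<delta> = \<delta>] tTQ_bound[OF z that aM] unfolding a_def g_def by simp
  have comb: "\<bar>\<Sum>j\<le>m. \<psi> j * b j\<bar> \<le> P * B" if "\<And>j. j \<le> m \<Longrightarrow> \<bar>b j\<bar> \<le> B" for b B
  proof -
    have "\<bar>\<Sum>j\<le>m. \<psi> j * b j\<bar> \<le> (\<Sum>j\<le>m. \<bar>\<psi> j\<bar> * \<bar>b j\<bar>)" unfolding abs_mult[symmetric] by (rule sum_abs)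
    also have "\<dots> \<le> (\<Sum>j\<le>m. \<bar>\<psi> j\<bar> * B)" using that by (intro sum_mono mult_left_mono) auto
    finally show ?thesis by (simp add: P_def sum_distrib_right)
  qed
  have "P * E * 1 \<le> P * E * (5 / z)" using z P0 E0 by (intro mult_left_mono) (auto simp: pos_le_divide_eq)
  then have yM: "\<bar>y M\<bar> \<le> P * (5 / z * (P * E))" and yM1: "\<bar>y (M - 1)\<bar> \<le> P * (5 / z * (P * E))"
    unfolding y_def using aM aM1 by (intro comb; force simp: mult_ac intro: order_trans)+
  have "\<bar>y 0\<bar> \<le> 2 * (real M + 1) * exp (\<epsilon> * M) * (P * (5 / z * (P * E)))"
    by (rule cosh_recursion_bound[OF rec yM yM1 e0 M])
  also have "\<dots> = 10 / z * (real M + 1) * exp (\<epsilon> * M) * E * P\<^sup>2" by (simp add: power2_eq_square field_simps)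
  also have "\<dots> \<le> 10 / z * (real M + 1) * exp (\<epsilon> * M) * E * ((real m + 1) * (\<Sum>i\<le>m. (\<psi> i)\<^sup>2))"
    unfolding P_def using sum_abs_square_le E0 z by (intro mult_left_mono) auto
  finally have y0: "\<bar>y 0\<bar> \<le> 10 / z * (real M + 1) * exp (\<epsilon> * M) * E * ((real m + 1) * (\<Sum>i\<le>m. (\<psi> i)\<^sup>2))" .
  define Z where "Z = (?V ^^ M) (vac m) {}"
  have "y 0 = (?V ^^ M) (opAs m \<psi> \<delta>) {}"
    unfolding y_def a_def amp_def opAs_def linop_sum[OF linop_funpow[OF linop_V]] by simp
  also have "opAs m \<psi> \<delta> = (\<lambda>S. (\<Sum>i\<le>m. (\<psi> i)\<^sup>2) * vac m S)"
    unfolding \<delta>_def by (rule ext) (rule opAs_opAs)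
  finally have "y 0 = (\<Sum>i\<le>m. (\<psi> i)\<^sup>2) * Z"
    unfolding linop_scale[OF linop_funpow[OF linop_V]] Z_def .
  moreover have psi: "(\<Sum>i\<le>m. (\<psi> i)\<^sup>2) > 0"
  proof -
    have "k < pi" using k(2) m by (intro le_less_trans[OF k(2)]) (simp add: divide_less_eq)
    then have "\<psi> 0 > 0" using k(1) by (simp add: \<psi>_def wave_def sin_gt_zero)
    then have "0 < (\<psi> 0)\<^sup>2" by simp
    also have "\<dots> \<le> (\<Sum>i\<le>m. (\<psi> i)\<^sup>2)" by (rule member_le_sum) auto
    finally show ?thesis .
  qed
  ultimately have "(\<Sum>i\<le>m. (\<psi> i)\<^sup>2) * Z \<le> (\<Sum>i\<le>m. (\<psi> i)\<^sup>2) * (10 / z * (real M + 1) * exp (\<epsilon> * M) * E * (real m + 1))"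
    using y0 by (simp add: mult_ac)
  then have Zb: "Z \<le> 10 / z * (real M + 1) * exp (\<epsilon> * M) * E * (real m + 1)"
    by (rule mult_left_le_imp_le[OF _ psi])
  \<comment> \<open>The plus amplitude has to be lengthened by the same two columns, each of which
    multiplies it by at most \<open>2 ^ m\<close>.\<close>
  have Z2: "(?V ^^ (M + 2)) (vac m) {} \<le> 4 ^ m * Z"
  proof -
    have vb: "\<bar>(?V ^^ M) (vac m) S\<bar> \<le> Z" for S
      unfolding Z_def using z gpos by (intro pd_bound pd_opV_funpow pd_vac) auto
    have z': "0 \<le> z" "z \<le> 1" using z by auto
    have v1: "\<bar>?V ((?V ^^ M) (vac m)) S\<bar> \<le> 2 ^ m * Z" for S
      by (rule opV_upper[OF z' gpos(2,3) vb])
    have "\<bar>?V (?V ((?V ^^ M) (vac m))) {}\<bar> \<le> 2 ^ m * (2 ^ m * Z)"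
      by (rule opV_upper[OF z' gpos(2,3) v1])
    moreover have "(2::real) ^ m * (2 ^ m * Z) = 4 ^ m * Z" by (simp add: mult.assoc[symmetric] power_mult_distrib[symmetric])
    ultimately show ?thesis by simp
  qed
  define X where "X = exp (- (tau z + (pi / (real m + 1))\<^sup>2 / 2) * M)"
  have X: "X * exp (\<epsilon> * M) \<le> 1"
  proof -
    have "\<epsilon> * M \<le> (tau z + (pi / (real m + 1))\<^sup>2 / 2) * M" using eb by (intro mult_right_mono) auto
    then have "- (tau z + (pi / (real m + 1))\<^sup>2 / 2) * M + \<epsilon> * M \<le> 0" by (simp only: mult_minus_left)
    then show ?thesis unfolding X_def exp_add[symmetric] by (simp only: exp_le_one_iff)
  qed
  have "(?V ^^ (M + 2)) (vac m) {} * X \<le> 4 ^ m * (10 / z * (real M + 1) * exp (\<epsilon> * M) * E * (real m + 1)) * X"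
    using Z2 Zb by (intro mult_right_mono order_trans[OF Z2] mult_left_mono) (auto simp: X_def)
  also have "\<dots> = 4 ^ m * (10 / z * (real M + 1) * (real m + 1)) * E * (X * exp (\<epsilon> * M))" by (simp add: mult_ac)
  also have "\<dots> \<le> 4 ^ m * (10 / z * (real M + 1) * (real m + 1)) * E * 1"
    using X E0 z by (intro mult_left_mono) auto
  finally have "(?V ^^ (M + 2)) (vac m) {} * X * (z ^ (2 * m + 1))\<^sup>2
     \<le> 4 ^ m * (10 / z * (real M + 1) * (real m + 1)) * E * (z ^ (2 * m + 1))\<^sup>2"
    by (intro mult_right_mono) auto
  also have "\<dots> = 4 ^ m * (10 / z * (real M + 1) * (real m + 1)) * (?V ^^ (M + 2)) (opA 0 (vac m)) {0}"
    unfolding E_def using z by simp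
  finally show ?thesis unfolding X_def .
qed

section \<open>Correlation inequalities\<close>

definition up :: "site \<Rightarrow> site" where "up v = (fst v, snd v + 1)"
definition rt :: "site \<Rightarrow> site" where "rt v = (fst v + 1, snd v)"
text \<open>Dual edges are indexed by primal sites: \<open>hE v\<close> separates \<open>v\<close>
  from \<open>up v\<close>, and \<open>vE v\<close> separates \<open>v\<close> from
  \<open>rt v\<close>. As a dual vertex, \<open>v\<close> stands for the upper right corner of the
  site \<open>v\<close>.\<close>

definition hE :: "site \<Rightarrow> dvert set" where "hE v = {(fst v - 1, snd v), v}"
definition vE :: "site \<Rightarrow> dvert set" where "vE v = {(fst v, snd v - 1), v}"

lemma edge_inject [simp]: "hE v = hE w \<longleftrightarrow> v = w" "vE v = vE w \<longleftrightarrow> v = w" "hE v \<noteq> vE w" "vE w \<noteq> hE v"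
  by (auto simp: hE_def vE_def doubleton_eq_iff prod_eq_iff)

definition bd :: "site set \<Rightarrow> dvert set set" where
  "bd Y = hE ` {v. (v \<in> Y) \<noteq> (up v \<in> Y)} \<union> vE ` {v. (v \<in> Y) \<noteq> (rt v \<in> Y)}"

lemma in_bd [simp]:
  "hE v \<in> bd Y \<longleftrightarrow> (v \<in> Y) \<noteq> (up v \<in> Y)" "vE v \<in> bd Y \<longleftrightarrow> (v \<in> Y) \<noteq> (rt v \<in> Y)"
  unfolding bd_def by (auto simp: image_iff)

definition lattice_edges :: "dvert set set" where "lattice_edges = range hE \<union> range vE"

lemma bd_subset_lattice: "bd Y \<subseteq> lattice_edges"
  by (auto simp: bd_def lattice_edges_def)

lemma lattice_edges_cases:
  assumes "e \<in> lattice_edges" obtains v where "e = hE v" | v where "e = vE v"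
  using assms by (auto simp: lattice_edges_def)

lemma edge_set_eqI:
  assumes "E \<subseteq> lattice_edges" "F \<subseteq> lattice_edges" "\<And>v. hE v \<in> E \<longleftrightarrow> hE v \<in> F" "\<And>v. vE v \<in> E \<longleftrightarrow> vE v \<in> F"
  shows "E = F"
proof (rule set_eqI)
  fix e show "e \<in> E \<longleftrightarrow> e \<in> F"
    using assms by (cases "e \<in> lattice_edges") (auto elim: lattice_edges_cases)
qed

lemma sdiff_subset_lattice: "E \<subseteq> lattice_edges \<Longrightarrow> F \<subseteq> lattice_edges \<Longrightarrow> E \<triangle> F \<subseteq> lattice_edges"
  by (rule sdiff_subset)

text \<open>Taking boundaries is linear over the field with two elements, which turns flipping spins
  into symmetric differences of contours.\<close>

lemma bd_sdiff: "bd (Y \<triangle> Z) = bd Y \<triangle> bd Z"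
proof (intro edge_set_eqI sdiff_subset_lattice bd_subset_lattice)
  fix v
  show "hE v \<in> bd (Y \<triangle> Z) \<longleftrightarrow> hE v \<in> bd Y \<triangle> bd Z"
    by (cases "v \<in> Y"; cases "v \<in> Z"; cases "up v \<in> Y"; cases "up v \<in> Z"; simp)
  show "vE v \<in> bd (Y \<triangle> Z) \<longleftrightarrow> vE v \<in> bd Y \<triangle> bd Z"
    by (cases "v \<in> Y"; cases "v \<in> Z"; cases "rt v \<in> Y"; cases "rt v \<in> Z"; simp)
qed

definition Ed :: "nat \<Rightarrow> dvert set set" where
  "Ed N = hE ` ({0..int N} \<times> {-1..int N}) \<union> vE ` ({-1..int N} \<times> {0..int N})"

lemma finite_Ed [simp]: "finite (Ed N)" and finite_box [simp]: "finite (box N)"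
  by (auto simp: Ed_def box_def)

lemma in_Ed [simp]:
  "hE v \<in> Ed N \<longleftrightarrow> v \<in> {0..int N} \<times> {-1..int N}" "vE v \<in> Ed N \<longleftrightarrow> v \<in> {-1..int N} \<times> {0..int N}"
  unfolding Ed_def by (auto simp: image_iff)

lemma Ed_lattice: "Ed N \<subseteq> lattice_edges"
  by (auto simp: Ed_def lattice_edges_def)

lemma card_Ed: "card (Ed N) \<le> 2 * (N + 2)\<^sup>2"
proof -
  have "card (Ed N) \<le> card ({0..int N} \<times> {-1..int N}) + card ({-1..int N} \<times> {0..int N})"
    unfolding Ed_def by (intro order_trans[OF card_Un_le] add_mono card_image_le) auto
  also have "\<dots> = 2 * ((N + 1) * (N + 2))" by (simp add: card_cartesian_product nat_add_distrib)
  also have "\<dots> \<le> 2 * (N + 2)\<^sup>2" by (simp add: power2_eq_square)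
  finally show ?thesis .
qed

lemma bd_subset_Ed: assumes "Y \<subseteq> box N" shows "bd Y \<subseteq> Ed N"
proof
  fix e assume e: "e \<in> bd Y"
  then have "e \<in> lattice_edges" using bd_subset_lattice by blast
  then show "e \<in> Ed N"
  proof (cases rule: lattice_edges_cases)
    case (1 v)
    then have "(v \<in> Y) \<noteq> (up v \<in> Y)" using e by simp
    then have "v \<in> box N \<or> up v \<in> box N" using assms by (cases "v \<in> Y") auto
    then show ?thesis unfolding 1 in_Ed by (auto simp: box_def up_def mem_Times_iff)
  next
    case (2 v)
    then have "(v \<in> Y) \<noteq> (rt v \<in> Y)" using e by simp
    then have "v \<in> box N \<or> rt v \<in> box N" using assms by (cases "v \<in> Y") auto
    then show ?thesis unfolding 2 in_Ed by (auto simp: box_def rt_def mem_Times_iff)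
  qed
qed

lemma finite_bd: "Y \<subseteq> box N \<Longrightarrow> finite (bd Y)"
  by (rule finite_subset[OF bd_subset_Ed finite_Ed])

definition sg :: "dvert set \<Rightarrow> site set \<Rightarrow> real" where "sg e Y = (if e \<in> bd Y then -1 else 1)"

lemma chi_pair: assumes "v \<noteq> w" shows "chi {v, w} Y = chi {v} Y * chi {w} Y"
proof -
  have "{v} \<triangle> {w} = {v, w}" using assms unfolding sdiff_def by blast
  then show ?thesis using chi_sdiff_left[of "{v}" "{w}" Y] by (simp only: finite.intros)
qed

lemma sg_chi: assumes "e \<in> lattice_edges" obtains A where "finite A" "sg e = chi A"
proof -
  from assms show thesis
  proof (cases rule: lattice_edges_cases)
    case (1 v)
    have "v \<noteq> up v" by (simp add: up_def prod_eq_iff)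
    then have "sg e Y = chi {v, up v} Y" for Y unfolding 1 sg_def in_bd chi_pair[OF \<open>v \<noteq> up v\<close>] by simp
    then show ?thesis by (intro that[of "{v, up v}"]) auto
  next
    case (2 v)
    have "v \<noteq> rt v" by (simp add: rt_def prod_eq_iff)
    then have "sg e Y = chi {v, rt v} Y" for Y unfolding 2 sg_def in_bd chi_pair[OF \<open>v \<noteq> rt v\<close>] by simp
    then show ?thesis by (intro that[of "{v, rt v}"]) auto
  qed
qed

lemma sg_sdiff: "sg e (Y \<triangle> T) = sg e Y * sg e T"
  unfolding sg_def bd_sdiff in_sdiff by (cases "e \<in> bd Y"; cases "e \<in> bd T"; simp)

lemma pd_sg: "e \<in> lattice_edges \<Longrightarrow> a \<ge> 0 \<Longrightarrow> b \<ge> 0 \<Longrightarrow> (\<lambda>Y. a + b * sg e Y) \<in> pd"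
  by (elim sg_chi) (simp add: pd_affine)

definition field :: "nat \<Rightarrow> (site \<Rightarrow> real) \<Rightarrow> site set \<Rightarrow> real" where
  "field N h Y = (\<Sum>v\<in>box N. h v * chi {v} Y)"

text \<open>Any edge weight that depends only on whether the two spins agree is affine in
  \<open>sg e\<close>. Negative \<open>be\<close> encodes an antiferromagnetic edge, as produced by
  the Dobrushin condition, and \<open>al = be\<close> an infinite coupling.\<close>

definition GW :: "nat \<Rightarrow> (dvert set \<Rightarrow> real) \<Rightarrow> (dvert set \<Rightarrow> real) \<Rightarrow> (site \<Rightarrow> real) \<Rightarrow> site set \<Rightarrow> real" where
  "GW N al be h Y = (\<Prod>e\<in>Ed N. al e + be e * sg e Y) * exp (field N h Y)"

lemma pd_exp_sum:
  assumes "finite V" "\<And>v. v \<in> V \<Longrightarrow> k v \<ge> 0"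
  shows "(\<lambda>Y. exp (\<Sum>v\<in>V. k v * chi {v} Y)) \<in> pd"
proof -
  have "(\<lambda>Y. \<Prod>v\<in>V. cosh (k v) + sinh (k v) * chi {v} Y) \<in> pd"
    using assms by (intro pd_prod pd_affine) auto
  moreover have "exp (\<Sum>v\<in>V. k v * chi {v} Y) = (\<Prod>v\<in>V. cosh (k v) + sinh (k v) * chi {v} Y)" for Y
    unfolding exp_sum[OF assms(1)] by (rule prod.cong) (auto simp: cosh_plus_sinh cosh_minus_sinh)
  ultimately show ?thesis by simp
qed

text \<open>Sites are added one at a time by the addition theorems; \<open>sinh\<close> and
  \<open>cosh\<close> are carried together because these theorems mix them.\<close>

lemma pd_sinh_sum:
  assumes "finite V" "\<And>v. v \<in> V \<Longrightarrow> k v \<ge> 0"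
  shows "(\<lambda>Y. sinh (\<Sum>v\<in>V. k v * chi {v} Y)) \<in> pd \<and> (\<lambda>Y. cosh (\<Sum>v\<in>V. k v * chi {v} Y)) \<in> pd"
  using assms
proof (induction V)
  case empty
  show ?case using pd_const[of 0] pd_const[of 1] by simp
next
  case (insert v V)
  let ?S = "\<lambda>Y. \<Sum>v\<in>V. k v * chi {v} Y"
  have kv: "k v \<ge> 0" using insert by auto
  have IH: "(\<lambda>Y. sinh (?S Y)) \<in> pd" "(\<lambda>Y. cosh (?S Y)) \<in> pd" using insert by auto
  have c: "cosh (k v * chi {v} Y) = cosh (k v)" "sinh (k v * chi {v} Y) = sinh (k v) * chi {v} Y" for Y
    by auto
  have 1: "(\<lambda>Y. sinh (k v) * chi {v} Y) \<in> pd" using kv by (intro pd_scale pd_chi) auto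
  have 2: "(\<lambda>Y. sinh (?S Y) * cosh (k v)) \<in> pd" "(\<lambda>Y. cosh (?S Y) * cosh (k v)) \<in> pd"
    using IH by (auto intro!: pd_mult pd_const)
  have 3: "(\<lambda>Y. cosh (?S Y) * (sinh (k v) * chi {v} Y)) \<in> pd" "(\<lambda>Y. sinh (?S Y) * (sinh (k v) * chi {v} Y)) \<in> pd"
    using pd_mult[OF 1 IH(2)] pd_mult[OF 1 IH(1)] by auto
  have s: "(\<Sum>v\<in>insert v V. k v * chi {v} Y) = ?S Y + k v * chi {v} Y" for Y
    using insert by simp
  show ?case unfolding s sinh_add cosh_add c
    using pd_add[OF 2(1) 3(1)] pd_add[OF 2(2) 3(2)] by (simp add: mult_ac)
qed

lemma exp_field_shift:
  "exp (field N h Y) * exp (field N h' (Y \<triangle> T)) = exp (\<Sum>v\<in>box N. (h v + h' v * chi {v} T) * chi {v} Y)"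
  unfolding field_def exp_add[symmetric] sum.distrib[symmetric]
  by (rule arg_cong[of _ _ exp], rule sum.cong) (auto simp: chi_sdiff_right algebra_simps)

text \<open>For fixed \<open>T\<close> the factor of an edge is affine in \<open>sg e Y\<close>,
  with coefficients \<open>al * al' + be * be' * s\<close> and
  \<open>be * al' + al * be' * s\<close> for the sign \<open>s = sg e T\<close>. The hypothesis says
  that both are nonnegative for either sign.\<close>

lemma pd_edge_pair:
  assumes "\<And>e. e \<in> Ed N \<Longrightarrow> \<bar>be e * be' e\<bar> \<le> al e * al' e \<and> \<bar>al e * be' e\<bar> \<le> be e * al' e"
  shows "(\<lambda>Y. (\<Prod>e\<in>Ed N. al e + be e * sg e Y) * (\<Prod>e\<in>Ed N. al' e + be' e * sg e (Y \<triangle> T))) \<in> pd"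
proof -
  have "(\<lambda>Y. \<Prod>e\<in>Ed N. (al e + be e * sg e Y) * (al' e + be' e * sg e (Y \<triangle> T))) \<in> pd"
  proof (rule pd_prod)
    fix e assume e: "e \<in> Ed N"
    have eq: "(al e + be e * sg e Y) * (al' e + be' e * sg e (Y \<triangle> T))
      = (al e * al' e + be e * be' e * sg e T) + (be e * al' e + al e * be' e * sg e T) * sg e Y" for Y
    proof -
      have ss: "sg e Y * (sg e Y * x) = x" "sg e Y * sg e Y = 1" for x by (simp_all add: sg_def)
      show ?thesis unfolding sg_sdiff by (simp add: algebra_simps ss)
    qed
    show "(\<lambda>Y. (al e + be e * sg e Y) * (al' e + be' e * sg e (Y \<triangle> T))) \<in> pd"
      unfolding eq using assms[OF e] e Ed_lattice by (intro pd_sg) (auto simp: sg_def)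
  qed
  then show ?thesis by (simp add: prod.distrib)
qed

text \<open>Ginibre's duplication: the second copy is written as \<open>Y \<triangle> T\<close>, and
  for each fixed \<open>T\<close> the summand is a product of functions in \<open>pd\<close>. The
  primed parameters may have any sign as long as they are dominated, so Dobrushin and plus boundary
  conditions can be compared.\<close>

theorem gks_ratio:
  assumes ab: "\<And>e. e \<in> Ed N \<Longrightarrow> \<bar>be e * be' e\<bar> \<le> al e * al' e \<and> \<bar>al e * be' e\<bar> \<le> be e * al' e"
    and h: "\<And>v. v \<in> box N \<Longrightarrow> \<bar>h' v\<bar> \<le> h v" and f: "f \<in> pd"
  shows "(\<Sum>Y\<in>Pow (box N). GW N al' be' h' Y * f Y) * (\<Sum>Y\<in>Pow (box N). GW N al be h Y)
       \<le> (\<Sum>Y\<in>Pow (box N). GW N al be h Y * f Y) * (\<Sum>Y\<in>Pow (box N). GW N al' be' h' Y)"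
proof -
  let ?P = "Pow (box N)" and ?w = "GW N al be h" and ?w' = "GW N al' be' h'"
  have "(\<Sum>Y\<in>?P. \<Sum>Y'\<in>?P. ?w Y * ?w' Y' * (f Y - f Y')) = (\<Sum>Y\<in>?P. \<Sum>T\<in>?P. ?w Y * ?w' (Y \<triangle> T) * (f Y - f (Y \<triangle> T)))"
  proof (rule sum.cong[OF refl])
    fix Y assume "Y \<in> ?P"
    then have "bij_betw (\<lambda>T. Y \<triangle> T) ?P ?P" using bij_betw_sdiff_Pow[of Y "box N"] by (simp add: sdiff_commute)
    then show "(\<Sum>Y'\<in>?P. ?w Y * ?w' Y' * (f Y - f Y')) = (\<Sum>T\<in>?P. ?w Y * ?w' (Y \<triangle> T) * (f Y - f (Y \<triangle> T)))"
      by (rule sum.reindex_bij_betw[symmetric])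
  qed
  also have "\<dots> = (\<Sum>T\<in>?P. \<Sum>Y\<in>?P. ?w Y * ?w' (Y \<triangle> T) * (f Y - f (Y \<triangle> T)))" by (rule sum.swap)
  also have "\<dots> \<ge> 0"
  proof (rule sum_nonneg)
    fix T
    have e: "(\<lambda>Y. exp (\<Sum>v\<in>box N. (h v + h' v * chi {v} T) * chi {v} Y)) \<in> pd"
      by (rule pd_exp_sum) (use h in \<open>force simp: abs_le_iff\<close>)+
    have eq: "?w Y * ?w' (Y \<triangle> T) = ((\<Prod>e\<in>Ed N. al e + be e * sg e Y) * (\<Prod>e\<in>Ed N. al' e + be' e * sg e (Y \<triangle> T)))
       * exp (\<Sum>v\<in>box N. (h v + h' v * chi {v} T) * chi {v} Y)" for Y
      unfolding GW_def exp_field_shift[symmetric] by simp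
    have "(\<lambda>Y. ?w Y * ?w' (Y \<triangle> T)) \<in> pd"
      unfolding eq by (rule pd_mult[OF e pd_edge_pair[OF ab]])
    from pd_mult[OF pd_diff_shift[OF f] this]
    show "(\<Sum>Y\<in>?P. ?w Y * ?w' (Y \<triangle> T) * (f Y - f (Y \<triangle> T))) \<ge> 0"
      by (rule pd_sum_nonneg) simp
  qed
  finally have "0 \<le> (\<Sum>Y\<in>?P. \<Sum>Y'\<in>?P. ?w Y * ?w' Y' * (f Y - f Y'))" .
  also have "\<dots> = (\<Sum>Y\<in>?P. \<Sum>Y'\<in>?P. (?w Y * f Y) * ?w' Y' - ?w Y * (?w' Y' * f Y'))"
    by (intro sum.cong refl) (simp add: algebra_simps)
  also have "\<dots> = (\<Sum>Y\<in>?P. ?w Y * f Y) * (\<Sum>Y\<in>?P. ?w' Y) - (\<Sum>Y\<in>?P. ?w Y) * (\<Sum>Y\<in>?P. ?w' Y * f Y)"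
    unfolding sum_subtractf sum_product ..
  finally show ?thesis by (simp add: mult.commute)
qed

text \<open>After duplication the difference of the two products is a function in \<open>pd\<close>
  times \<open>2 * sinh\<close> of a sum with coefficients
  \<open>l - l0 * chi {v} T \<ge> 0\<close>. In quotient form the result says that reversing the
  field \<open>l\<close> on \<open>R\<close> costs at least as much as turning \<open>l0\<close>
  into \<open>- l0\<close> there with no field elsewhere.\<close>

theorem ginibre_field_flip:
  assumes ab: "\<And>e. e \<in> Ed N \<Longrightarrow> \<bar>be e\<bar> \<le> al e \<and> 0 \<le> be e" and l: "0 \<le> l0" "l0 \<le> l" and R: "R \<subseteq> box N"
  shows "(\<Sum>Y\<in>Pow (box N). GW N al be (\<lambda>v. if v \<in> R then - l else l) Y)
       * (\<Sum>Y\<in>Pow (box N). GW N al be (\<lambda>v. if v \<in> R then l0 else 0) Y)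
     \<le> (\<Sum>Y\<in>Pow (box N). GW N al be (\<lambda>v. l) Y)
       * (\<Sum>Y\<in>Pow (box N). GW N al be (\<lambda>v. if v \<in> R then - l0 else 0) Y)"
proof -
  let ?P = "Pow (box N)" 
  define h2 where "h2 = (\<lambda>v. if v \<in> R then - l else l)"
  define h3 where "h3 = (\<lambda>v. if v \<in> R then l0 else 0)"
  define h4 where "h4 = (\<lambda>v. if v \<in> R then - l0 else 0)"
  define G where "G Y Y' = GW N al be (\<lambda>v. l) Y * GW N al be h4 Y' - GW N al be h2 Y * GW N al be h3 Y'" for Y Y'
  have finR: "finite R" using R finite_box finite_subset by blast
  have "(\<Sum>Y\<in>?P. \<Sum>Y'\<in>?P. G Y Y') = (\<Sum>Y\<in>?P. \<Sum>T\<in>?P. G Y (Y \<triangle> T))"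
  proof (rule sum.cong[OF refl])
    fix Y assume "Y \<in> ?P"
    then have "bij_betw (\<lambda>T. Y \<triangle> T) ?P ?P" using bij_betw_sdiff_Pow[of Y "box N"] by (simp add: sdiff_commute)
    then show "(\<Sum>Y'\<in>?P. G Y Y') = (\<Sum>T\<in>?P. G Y (Y \<triangle> T))"
      by (rule sum.reindex_bij_betw[symmetric])
  qed
  also have "\<dots> = (\<Sum>T\<in>?P. \<Sum>Y\<in>?P. G Y (Y \<triangle> T))" by (rule sum.swap)
  also have "\<dots> \<ge> 0"
  proof (rule sum_nonneg)
    fix T
    let ?L = "\<lambda>Y. \<Sum>v\<in>box N - R. l * chi {v} Y"
    let ?S = "\<lambda>Y. \<Sum>v\<in>R. (l - l0 * chi {v} T) * chi {v} Y"
    let ?Q = "\<lambda>Y. (\<Prod>e\<in>Ed N. al e + be e * sg e Y) * (\<Prod>e\<in>Ed N. al e + be e * sg e (Y \<triangle> T))"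
    have split: "(\<Sum>v\<in>box N. F v) = (\<Sum>v\<in>box N - R. F v) + (\<Sum>v\<in>R. F v)" for F :: "site \<Rightarrow> real"
      using R by (simp add: sum.subset_diff)
    have 1: "exp (field N (\<lambda>v. l) Y) * exp (field N h4 (Y \<triangle> T)) = exp (?L Y) * exp (?S Y)" for Y
      unfolding exp_field_shift split exp_add
      by (intro arg_cong2[of _ _ _ _ "(*)"] arg_cong[of _ _ exp] sum.cong) (auto simp: h4_def)
    have 2: "exp (field N h2 Y) * exp (field N h3 (Y \<triangle> T)) = exp (?L Y) * exp (- ?S Y)" for Y
      unfolding exp_field_shift split exp_add sum_negf[symmetric]
      by (intro arg_cong2[of _ _ _ _ "(*)"] arg_cong[of _ _ exp] sum.cong) (auto simp: h2_def h3_def)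
    have eq: "G Y (Y \<triangle> T) = ?Q Y * (exp (?L Y) * (2 * sinh (?S Y)))" for Y
    proof -
      have "G Y (Y \<triangle> T) = ?Q Y * (exp (field N (\<lambda>v. l) Y) * exp (field N h4 (Y \<triangle> T)) - exp (field N h2 Y) * exp (field N h3 (Y \<triangle> T)))"
        unfolding G_def GW_def by (simp add: algebra_simps)
      then show ?thesis unfolding 1 2 by (simp add: sinh_def algebra_simps)
    qed
    have t: "l - l0 * chi {v} T \<ge> 0" for v using l by auto
    have Q: "?Q \<in> pd" 
    proof (rule pd_edge_pair)
      fix e assume "e \<in> Ed N"
      then have "0 \<le> be e" "be e \<le> al e" using ab[of e] by auto
      then show "\<bar>be e * be e\<bar> \<le> al e * al e \<and> \<bar>al e * be e\<bar> \<le> be e * al e"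
        by (simp add: abs_mult mult_mono mult.commute)
    qed
    have E: "(\<lambda>Y. exp (?L Y)) \<in> pd" using l by (intro pd_exp_sum) auto
    have S: "(\<lambda>Y. 2 * sinh (?S Y)) \<in> pd" using pd_sinh_sum[OF finR t, of "\<lambda>v. v"] by (intro pd_scale) auto
    have "(\<lambda>Y. G Y (Y \<triangle> T)) \<in> pd" unfolding eq by (rule pd_mult[OF pd_mult[OF S E] Q])
    then show "(\<Sum>Y\<in>?P. G Y (Y \<triangle> T)) \<ge> 0" by (rule pd_sum_nonneg) simp
  qed
  finally have "0 \<le> (\<Sum>Y\<in>?P. \<Sum>Y'\<in>?P. G Y Y')" .
  then show ?thesis
    unfolding G_def sum_subtractf sum_product[symmetric] by (simp add: h2_def h3_def h4_def)
qed

section \<open>Partition functions of the box\<close>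

definition pw :: "(dvert set \<Rightarrow> real) \<Rightarrow> dvert set set \<Rightarrow> real" where "pw q E = (\<Prod>e\<in>E. q e)"

definition Bot :: "nat \<Rightarrow> dvert set set" where "Bot N = hE ` ({0..int N} \<times> {-1})"

lemma hE_Bot [simp]: "hE v \<in> Bot N \<longleftrightarrow> v \<in> {0..int N} \<times> {-1}" and vE_Bot [simp]: "vE v \<notin> Bot N"
  unfolding Bot_def by (auto simp: image_iff)

lemma Bot_subset: "Bot N \<subseteq> Ed N" by (auto simp: Bot_def)

lemma Bot_lattice: "Bot N \<subseteq> lattice_edges" using Bot_subset Ed_lattice by blast

text \<open>Here \<open>Y\<close> is the set of minus sites, so \<open>bd Y\<close> separates differing spins under plus boundary conditions; the Dobrushin
  boundary condition toggles the edges in \<open>Bot N\<close>.\<close>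

definition Xi :: "nat \<Rightarrow> (dvert set \<Rightarrow> real) \<Rightarrow> (site \<Rightarrow> real) \<Rightarrow> real" where
  "Xi N q h = (\<Sum>Y\<in>Pow (box N). pw q (bd Y) * exp (field N h Y))"

definition Zd :: "nat \<Rightarrow> (dvert set \<Rightarrow> real) \<Rightarrow> (site \<Rightarrow> real) \<Rightarrow> real" where
  "Zd N q h = (\<Sum>Y\<in>Pow (box N). pw q (bd Y \<triangle> Bot N) * exp (field N h Y))"

section \<open>From powers of the transfer matrix to sums over configurations of a strip\<close>

definition strip :: "nat \<Rightarrow> nat \<Rightarrow> site set" where "strip N m = {0..int N} \<times> {0..<int m}"

text \<open>The heights of the horizontal edges met by a column with minus sites \<open>C\<close>.
  Height \<open>j\<close> is the edge between the rows \<open>j - 1\<close> and \<open>j\<close>, so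
  a column of \<open>m\<close> sites has the heights 0 to \<open>m\<close>.\<close>

definition dC :: "nat set \<Rightarrow> nat set" where "dC C = C \<triangle> Suc ` C"

lemma dC_sdiff: "dC (C \<triangle> C') = dC C \<triangle> dC C'"
proof -
  have "Suc ` (C \<triangle> C') = Suc ` C \<triangle> Suc ` C'"
  proof (rule set_eqI)
    fix j show "j \<in> Suc ` (C \<triangle> C') \<longleftrightarrow> j \<in> Suc ` C \<triangle> Suc ` C'" by (cases j) (auto simp: image_iff)
  qed
  then show ?thesis unfolding dC_def
    by (metis sdiff_assoc sdiff_pair_comm)
qed

lemma in_dC: "j \<in> dC C \<longleftrightarrow> (j \<in> C) \<noteq> (j > 0 \<and> j - 1 \<in> C)"
  unfolding dC_def in_sdiff by (cases j) (auto simp: image_iff)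

lemma dC_insert: "k \<notin> T \<Longrightarrow> dC (insert k T) = dC T \<triangle> {k, Suc k}"
proof -
  assume "k \<notin> T"
  then have "insert k T = T \<triangle> {k}" by (auto simp: sdiff_def)
  moreover have "dC {k} = {k, Suc k}" by (auto simp: dC_def sdiff_def)
  ultimately show ?thesis by (simp add: dC_sdiff)
qed

text \<open>In the expansion of the product, \<open>T\<close> is the set of rows whose vertical edge
  is used, that is, in which two neighbouring columns differ.\<close>

lemma opD_expand: "opD z m f S = (\<Sum>T\<in>Pow {..<m}. z ^ card T * f (S \<triangle> dC T))"
proof (induction m arbitrary: S)
  case 0
  then show ?case by (simp add: dC_def)
next
  case (Suc m)
  have P: "Pow {..<Suc m} = Pow {..<m} \<union> insert m ` Pow {..<m}"
    unfolding lessThan_Suc Pow_insert ..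
  have "(\<Sum>T\<in>Pow {..<Suc m}. z ^ card T * f (S \<triangle> dC T)) = (\<Sum>T\<in>Pow {..<m}. z ^ card T * f (S \<triangle> dC T))
     + (\<Sum>T\<in>insert m ` Pow {..<m}. z ^ card T * f (S \<triangle> dC T))"
    unfolding P by (rule sum.union_disjoint) auto
  also have "(\<Sum>T\<in>insert m ` Pow {..<m}. z ^ card T * f (S \<triangle> dC T)) = (\<Sum>T\<in>Pow {..<m}. z ^ card (insert m T) * f (S \<triangle> dC (insert m T)))"
    by (subst sum.reindex) (auto simp: inj_on_def dest!: insert_ident[THEN iffD1, rotated -1])
  also have "\<dots> = (\<Sum>T\<in>Pow {..<m}. z * (z ^ card T * f ((S \<triangle> {m, Suc m}) \<triangle> dC T)))"
  proof (rule sum.cong[OF refl])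
    fix T assume T: "T \<in> Pow {..<m}"
    then have "m \<notin> T" "finite T" using finite_subset by auto
    moreover have "S \<triangle> (dC T \<triangle> {m, Suc m}) = S \<triangle> {m, Suc m} \<triangle> dC T"
      using sdiff_pair_comm sdiff_assoc by metis
    ultimately show "z ^ card (insert m T) * f (S \<triangle> dC (insert m T)) = z * (z ^ card T * f (S \<triangle> {m, Suc m} \<triangle> dC T))"
      by (simp add: dC_insert)
  qed
  finally show ?case by (simp add: opE_def Suc sum_distrib_left)
qed

lemma dC_empty_iff: "C \<subseteq> {..<m} \<Longrightarrow> dC C \<inter> {..m} = {} \<longleftrightarrow> C = {}"
proof
  assume C: "C \<subseteq> {..<m}" and e: "dC C \<inter> {..m} = {}"
  show "C = {}"
  proof (rule ccontr)
    assume "C \<noteq> {}"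
    define k where "k = (LEAST k. k \<in> C)"
    have k: "k \<in> C" unfolding k_def using \<open>C \<noteq> {}\<close> by (metis LeastI_ex all_not_in_conv)
    have "k - 1 \<notin> C" if "k > 0" using not_less_Least[of "k - 1" "\<lambda>k. k \<in> C"] that unfolding k_def by simp
    then have "k \<in> dC C" using k by (auto simp: in_dC)
    moreover have "k \<in> {..m}" using k C by auto
    ultimately show False using e by blast
  qed
qed (simp add: dC_def)

lemma sum_Pow_sdiff: "C \<subseteq> A \<Longrightarrow> (\<Sum>T\<in>Pow A. F T) = (\<Sum>T\<in>Pow A. F (C \<triangle> T))"
  using sum.reindex_bij_betw[OF bij_betw_sdiff_Pow[of C A], of F] by (simp add: sdiff_commute)

lemma sum_Pow_Un:
  assumes "A \<inter> B = {}"
  shows "(\<Sum>Y\<in>Pow (A \<union> B). F Y) = (\<Sum>Y\<in>Pow A. \<Sum>Z\<in>Pow B. F (Y \<union> Z))"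
proof -
  have "(\<Sum>Y\<in>Pow A. \<Sum>Z\<in>Pow B. F (Y \<union> Z)) = (\<Sum>p\<in>Pow A \<times> Pow B. F (fst p \<union> snd p))"
    unfolding sum.cartesian_product by (simp add: case_prod_beta)
  also have "\<dots> = (\<Sum>Y\<in>Pow (A \<union> B). F Y)"
  proof (rule sum.reindex_bij_betw)
    show "bij_betw (\<lambda>p. fst p \<union> snd p) (Pow A \<times> Pow B) (Pow (A \<union> B))"
    proof (rule bij_betwI[where g = "\<lambda>Y. (Y \<inter> A, Y \<inter> B)"])
      fix p assume "p \<in> Pow A \<times> Pow B"
      then show "((fst p \<union> snd p) \<inter> A, (fst p \<union> snd p) \<inter> B) = p" using assms by (cases p) auto
    qed auto
  qed
  finally show ?thesis ..
qed

definition col :: "nat \<Rightarrow> nat \<Rightarrow> site set \<Rightarrow> nat set" where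
  "col m i Y = {y. y < m \<and> (int i, int y) \<in> Y}"

text \<open>The left neighbour of column 0 lies outside the box, where the spins beside the strip
  are plus.\<close>

definition lcol :: "nat \<Rightarrow> nat \<Rightarrow> site set \<Rightarrow> nat set" where
  "lcol m i Y = (if i = 0 then {} else col m (i - 1) Y)"

definition cols :: "nat \<Rightarrow> nat \<Rightarrow> site set" where "cols m x = {0..<int x} \<times> {0..<int m}"

context
  fixes z :: real and g :: "nat \<Rightarrow> real" and m :: nat and b :: "nat set"
begin

text \<open>\<open>b\<close> is the set of heights toggled by the boundary condition:
  \<open>{}\<close> for plus, and \<open>{0}\<close> for Dobrushin, where row 0 meets the minus
  spins below. The square reunites the two halves of the weight of a column.\<close>

definition Hw :: "nat set \<Rightarrow> real" where "Hw C = (hw g m (dC C \<triangle> b))\<^sup>2"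

definition HD :: "(nat set \<Rightarrow> real) \<Rightarrow> nat set \<Rightarrow> real" where
  "HD f = (\<lambda>S. (hw g m S)\<^sup>2 * opD z m f S)"

definition colwt :: "nat \<Rightarrow> site set \<Rightarrow> real" where
  "colwt x Y = (\<Prod>i<x. Hw (col m i Y) * z ^ card (lcol m i Y \<triangle> col m i Y))"

lemma HD_column: "C \<subseteq> {..<m} \<Longrightarrow> opD z m f (dC C \<triangle> b) = (\<Sum>C'\<in>Pow {..<m}. z ^ card (C' \<triangle> C) * f (dC C' \<triangle> b))"
proof -
  assume C: "C \<subseteq> {..<m}"
  have "opD z m f (dC C \<triangle> b) = (\<Sum>T\<in>Pow {..<m}. z ^ card T * f (dC C \<triangle> b \<triangle> dC T))" by (rule opD_expand)
  also have "\<dots> = (\<Sum>T\<in>Pow {..<m}. z ^ card (C \<triangle> T) * f (dC C \<triangle> b \<triangle> dC (C \<triangle> T)))"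
    by (rule sum_Pow_sdiff[OF C])
  also have "\<dots> = (\<Sum>T\<in>Pow {..<m}. z ^ card (T \<triangle> C) * f (dC T \<triangle> b))"
  proof (rule sum.cong[OF refl])
    fix T
    have "dC C \<triangle> b \<triangle> dC (C \<triangle> T) = dC T \<triangle> b"
      unfolding dC_sdiff by (rule set_eqI) (simp only: in_sdiff, argo)
    then show "z ^ card (C \<triangle> T) * f (dC C \<triangle> b \<triangle> dC (C \<triangle> T)) = z ^ card (T \<triangle> C) * f (dC T \<triangle> b)"
      by (simp add: sdiff_commute)
  qed
  finally show ?thesis .
qed

lemma col_extend:
  assumes "Y \<subseteq> cols m x" "C \<subseteq> {..<m}"
  defines "Y' \<equiv> Y \<union> (\<lambda>y. (int x, int y)) ` C"
  shows "col m x Y' = C" "i < x \<Longrightarrow> col m i Y' = col m i Y" "i \<le> x \<Longrightarrow> lcol m i Y' = lcol m i Y"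
proof -
  show "col m x Y' = C" using assms by (auto simp: col_def cols_def)
  show 1: "i < x \<Longrightarrow> col m i Y' = col m i Y" for i using assms by (auto simp: col_def cols_def)
  show "i \<le> x \<Longrightarrow> lcol m i Y' = lcol m i Y" using 1[of "i - 1"] by (auto simp: lcol_def)
qed

text \<open>The function \<open>G\<close> of the last column is arbitrary so that the induction can
  absorb the new column into it.\<close>

lemma HD_funpow_column:
  "(\<Sum>C\<in>Pow {..<m}. G C * (HD ^^ x) (\<lambda>S. vac m (S \<triangle> b)) (dC C \<triangle> b)) = (\<Sum>Y\<in>Pow (cols m x). colwt x Y * G (lcol m x Y))"
proof (induction x arbitrary: G)
  case 0
  have "(\<Sum>C\<in>Pow {..<m}. G C * (HD ^^ 0) (\<lambda>S. vac m (S \<triangle> b)) (dC C \<triangle> b)) = (\<Sum>C\<in>Pow {..<m}. if C = {} then G C else 0)"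
    by (intro sum.cong refl) (auto simp: vac_eq dC_empty_iff)
  also have "\<dots> = G {}" by (subst sum.delta) auto
  finally show ?case by (simp add: colwt_def lcol_def cols_def)
next
  case (Suc x)
  let ?F = "(HD ^^ x) (\<lambda>S. vac m (S \<triangle> b))"
  let ?emb = "\<lambda>C. (\<lambda>y. (int x, int y)) ` C"
  have "(\<Sum>C\<in>Pow {..<m}. G C * (HD ^^ Suc x) (\<lambda>S. vac m (S \<triangle> b)) (dC C \<triangle> b))
     = (\<Sum>C\<in>Pow {..<m}. \<Sum>C'\<in>Pow {..<m}. G C * Hw C * z ^ card (C' \<triangle> C) * ?F (dC C' \<triangle> b))"
    by (intro sum.cong refl) (simp add: HD_def HD_column Hw_def sum_distrib_left mult.assoc)
  also have "\<dots> = (\<Sum>C'\<in>Pow {..<m}. \<Sum>C\<in>Pow {..<m}. G C * Hw C * z ^ card (C' \<triangle> C) * ?F (dC C' \<triangle> b))"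
    by (rule sum.swap)
  also have "\<dots> = (\<Sum>C'\<in>Pow {..<m}. (\<Sum>C\<in>Pow {..<m}. G C * Hw C * z ^ card (C' \<triangle> C)) * ?F (dC C' \<triangle> b))"
    by (simp add: sum_distrib_right)
  also have "\<dots> = (\<Sum>Y\<in>Pow (cols m x). colwt x Y * (\<Sum>C\<in>Pow {..<m}. G C * Hw C * z ^ card (lcol m x Y \<triangle> C)))"
    by (rule Suc)
  also have "\<dots> = (\<Sum>Y\<in>Pow (cols m x). \<Sum>C\<in>Pow {..<m}. colwt x Y * (G C * Hw C * z ^ card (lcol m x Y \<triangle> C)))"
    by (simp add: sum_distrib_left)
  also have "\<dots> = (\<Sum>Y\<in>Pow (cols m x). \<Sum>C\<in>Pow {..<m}. colwt (Suc x) (Y \<union> ?emb C) * G (lcol m (Suc x) (Y \<union> ?emb C)))"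
  proof (intro sum.cong refl)
    fix Y C assume YC: "Y \<in> Pow (cols m x)" "C \<in> Pow {..<m}"
    then have YC': "Y \<subseteq> cols m x" "C \<subseteq> {..<m}" by auto
    note ce = col_extend[OF YC']
    have "colwt x (Y \<union> ?emb C) = colwt x Y" unfolding colwt_def
      by (intro prod.cong refl) (simp add: ce)
    moreover have "lcol m (Suc x) (Y \<union> ?emb C) = C" by (simp add: lcol_def ce)
    ultimately show "colwt x Y * (G C * Hw C * z ^ card (lcol m x Y \<triangle> C)) = colwt (Suc x) (Y \<union> ?emb C) * G (lcol m (Suc x) (Y \<union> ?emb C))"
      unfolding colwt_def by (simp add: ce)
  qed
  also have "\<dots> = (\<Sum>Y\<in>Pow (cols m x). \<Sum>Z\<in>Pow ({int x} \<times> {0..<int m}). colwt (Suc x) (Y \<union> Z) * G (lcol m (Suc x) (Y \<union> Z)))"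
  proof (rule sum.cong[OF refl])
    fix Y
    have img: "?emb ` Pow {..<m} = Pow ({int x} \<times> {0..<int m})"
    proof -
      have "(\<lambda>y. (int x, int y)) ` {..<m} = {int x} \<times> {0..<int m}"
        using image_int_atLeastLessThan[of 0 m] by (auto simp: lessThan_atLeast0 image_iff set_eq_iff)
      then show ?thesis by (metis image_Pow_surj)
    qed
    have inj: "inj_on ?emb (Pow {..<m})" by (rule inj_on_image_Pow) (auto simp: inj_on_def)
    show "(\<Sum>C\<in>Pow {..<m}. colwt (Suc x) (Y \<union> ?emb C) * G (lcol m (Suc x) (Y \<union> ?emb C)))
      = (\<Sum>Z\<in>Pow ({int x} \<times> {0..<int m}). colwt (Suc x) (Y \<union> Z) * G (lcol m (Suc x) (Y \<union> Z)))"
      unfolding img[symmetric] by (subst sum.reindex[OF inj]) simp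
  qed
  also have "\<dots> = (\<Sum>Y\<in>Pow (cols m x \<union> {int x} \<times> {0..<int m}). colwt (Suc x) Y * G (lcol m (Suc x) Y))"
    by (rule sum_Pow_Un[symmetric]) (auto simp: cols_def)
  also have "cols m x \<union> {int x} \<times> {0..<int m} = cols m (Suc x)" by (auto simp: cols_def)
  finally show ?case .
qed

text \<open>There are \<open>x + 1\<close> gaps around \<open>x\<close> columns, whence the
  exponent. The two outer half weights belong to no column of the box and remain as the
  prefactor.\<close>

lemma opV_transfer_sum:
  "(opV z g m ^^ Suc x) (\<lambda>S. vac m (S \<triangle> b)) b = (hw g m b)\<^sup>2 * (\<Sum>Y\<in>Pow (cols m x). colwt x Y * z ^ card (lcol m x Y))"
proof -
  let ?v = "\<lambda>S. vac m (S \<triangle> b)"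
  have hv: "opH g m ?v = (\<lambda>S. hw g m b * ?v S)"
  proof
    fix S
    show "opH g m ?v S = hw g m b * ?v S"
    proof (cases "(S \<triangle> b) \<inter> {..m} = {}")
      case True
      have "i \<in> S \<longleftrightarrow> i \<in> b" if "i \<le> m" for i
      proof -
        have "i \<notin> S \<triangle> b" using True that by blast
        then show ?thesis by simp
      qed
      then have "hw g m S = hw g m b" unfolding hw_def by (intro prod.cong refl) auto
      then show ?thesis by (simp add: opH_def)
    qed (simp add: opH_def vac_eq)
  qed
  have "opH g m ((opV z g m ^^ x) f) = (HD ^^ x) (opH g m f)" for f
  proof (induction x)
    case (Suc x)
    have "opH g m ((opV z g m ^^ Suc x) f) = HD (opH g m ((opV z g m ^^ x) f))"
      by (rule ext) (simp add: opV_def opH_def HD_def power2_eq_square mult.assoc)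
    then show ?case using Suc by simp
  qed simp
  then have "(opV z g m ^^ Suc x) ?v b = hw g m b * opD z m ((HD ^^ x) (opH g m ?v)) b"
    by (simp add: opV_def opH_def[of _ _ "opD z m _"])
  also have "(HD ^^ x) (opH g m ?v) = (\<lambda>S. hw g m b * (HD ^^ x) ?v S)"
  proof -
    have "linop HD" unfolding HD_def
      by (rule linopI) (simp add: linopD[OF linop_D[of z m]] fun_eq_iff algebra_simps)
    then show ?thesis unfolding hv by (intro linop_scale linop_funpow)
  qed
  also have "opD z m (\<lambda>S. hw g m b * (HD ^^ x) ?v S) b = hw g m b * opD z m ((HD ^^ x) ?v) b"
    unfolding linop_scale[OF linop_D[of z m]] ..
  also have "opD z m ((HD ^^ x) ?v) b = (\<Sum>C\<in>Pow {..<m}. z ^ card C * (HD ^^ x) ?v (dC C \<triangle> b))"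
    using HD_column[of "{}" "(HD ^^ x) ?v"] by (simp add: dC_def)
  also have "\<dots> = (\<Sum>Y\<in>Pow (cols m x). colwt x Y * z ^ card (lcol m x Y))"
    by (rule HD_funpow_column)
  finally show ?thesis by (simp add: power2_eq_square)
qed

end

lemma hw_square: "(hw g m S)\<^sup>2 = (\<Prod>j\<in>S \<inter> {..m}. (g j)\<^sup>2)"
proof -
  have "(hw g m S)\<^sup>2 = (\<Prod>j\<le>m. if j \<in> S then (g j)\<^sup>2 else 1)"
    unfolding hw_def prod_power_distrib by (rule prod.cong) auto
  also have "\<dots> = (\<Prod>j\<in>{..m} \<inter> S. (g j)\<^sup>2)"
    by (rule prod.inter_restrict[symmetric]) simp
  finally show ?thesis by (simp add: Int_commute)
qed

lemma in_strip_nat: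
  assumes "Y \<subseteq> strip N m" "x \<ge> 0"
  shows "(x, y) \<in> Y \<longleftrightarrow> y \<ge> 0 \<and> nat y \<in> col m (nat x) Y"
proof
  assume a: "(x, y) \<in> Y"
  then have "(x, y) \<in> strip N m" using assms by blast
  then have "0 \<le> y" "y < int m" by (auto simp: strip_def)
  then show "y \<ge> 0 \<and> nat y \<in> col m (nat x) Y" using a assms(2) by (auto simp: col_def)
qed (use assms(2) in \<open>auto simp: col_def\<close>)

text \<open>The separating edges are sorted into horizontal ones by column and vertical ones by gap.
  Gap \<open>i\<close> lies to the left of column \<open>i\<close>, so \<open>i\<close> runs up to
  \<open>Suc N\<close>, where the last column faces plus spins.\<close>

lemma pw_strip:
  assumes m: "m \<le> Suc N" and Y: "Y \<subseteq> strip N m" and b: "b = {} \<and> Bt = {} \<or> b = {0} \<and> Bt = Bot N"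
    and qh: "\<And>x j. j \<le> m \<Longrightarrow> q (hE (x, int j - 1)) = (g j)\<^sup>2" and qv: "\<And>v. q (vE v) = z"
  shows "pw q (bd Y \<triangle> Bt) = colwt z g m b (Suc N) Y * z ^ card (lcol m (Suc N) Y)"
proof -
  define A where "A i = (dC (col m i Y) \<triangle> b) \<inter> {..m}" for i
  define B where "B i = lcol m i Y \<triangle> (if i \<le> N then col m i Y else {})" for i
  define H where "H = (\<lambda>(i, j). hE (int i, int j - 1)) ` (SIGMA i:{..N}. A i)"
  define V where "V = (\<lambda>(i, y). vE (int i - 1, int y)) ` (SIGMA i:{..Suc N}. B i)"
  have colm: "col m i Y \<subseteq> {..<m}" for i by (auto simp: col_def)
  have finA: "finite (A i)" for i by (simp add: A_def)
  have Bsub: "B i \<subseteq> {..<m}" for i using colm by (auto simp: B_def lcol_def sdiff_def)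
  then have finB: "finite (B i)" for i using finite_subset by blast
  have injH: "inj_on (\<lambda>(i, j). hE (int i, int j - 1)) (SIGMA i:{..N}. A i)" by (auto simp: inj_on_def)
  have injV: "inj_on (\<lambda>(i, y). vE (int i - 1, int y)) (SIGMA i:{..Suc N}. B i)" by (auto simp: inj_on_def)
  have "bd Y \<triangle> Bt = H \<union> V"
  proof (rule edge_set_eqI)
    show "bd Y \<triangle> Bt \<subseteq> lattice_edges" using b Bot_lattice by (intro sdiff_subset_lattice bd_subset_lattice) auto
    show "H \<union> V \<subseteq> lattice_edges" by (auto simp: H_def V_def lattice_edges_def)
  next
    fix v :: site
    obtain x y where v: "v = (x, y)" by (cases v)
    have HV: "hE v \<in> H \<union> V \<longleftrightarrow> (\<exists>i j. i \<le> N \<and> j \<in> A i \<and> x = int i \<and> y = int j - 1)"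
      by (auto simp: H_def V_def v image_iff)
    show "hE v \<in> bd Y \<triangle> Bt \<longleftrightarrow> hE v \<in> H \<union> V"
    proof (cases "0 \<le> x \<and> x \<le> int N \<and> -1 \<le> y \<and> y < int m")
      case True
      define i j where "i = nat x" and "j = nat (y + 1)"
      have ij: "i \<le> N" "j \<le> m" "x = int i" "y = int j - 1" using True by (auto simp: i_def j_def)
      have R: "hE v \<in> H \<union> V \<longleftrightarrow> j \<in> A i" unfolding HV using ij by auto
      have u: "up v \<in> Y \<longleftrightarrow> j \<in> col m i Y"
        using in_strip_nat[OF Y, of x "y + 1"] ij by (simp add: v up_def)
      have w: "v \<in> Y \<longleftrightarrow> j > 0 \<and> j - 1 \<in> col m i Y"
        using in_strip_nat[OF Y, of x y] ij by (cases j) (auto simp: v)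
      have bb: "j \<in> b \<longleftrightarrow> hE v \<in> Bt" using b ij by (auto simp: v)
      have "j \<in> A i \<longleftrightarrow> ((j \<in> col m i Y) \<noteq> (j > 0 \<and> j - 1 \<in> col m i Y)) \<noteq> (j \<in> b)"
        unfolding A_def using ij(2) by (simp only: Int_iff in_sdiff in_dC atMost_iff simp_thms)
      then show ?thesis unfolding R in_sdiff in_bd u w bb by argo
    next
      case False
      have "\<not> (hE v \<in> H \<union> V)"
      proof
        assume "hE v \<in> H \<union> V"
        then obtain i j where ij: "i \<le> N" "j \<in> A i" "x = int i" "y = int j - 1" using HV by blast
        have "j < m \<or> j = m" using ij(2) by (auto simp: A_def)
        with False ij show False by auto
      qed
      moreover have "\<not> (hE v \<in> bd Y \<triangle> Bt)"
      proof -
        have "v \<notin> Y"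
        proof
          assume "v \<in> Y"
          then have "v \<in> strip N m" using Y by blast
          then show False using False by (auto simp: strip_def v)
        qed
        moreover have "up v \<notin> Y"
        proof
          assume "up v \<in> Y"
          then have "up v \<in> strip N m" using Y by blast
          then show False using False by (auto simp: strip_def v up_def)
        qed
        moreover have "hE v \<notin> Bt"
        proof
          assume "hE v \<in> Bt"
          then have "0 \<le> x" "x \<le> int N" "y = -1" using b by (auto simp: v)
          then show False using False by auto
        qed
        ultimately show ?thesis by simp
      qed
      ultimately show ?thesis by blast
    qed
    have VV: "vE v \<in> H \<union> V \<longleftrightarrow> (\<exists>i k. i \<le> Suc N \<and> k \<in> B i \<and> x = int i - 1 \<and> y = int k)"
      by (auto simp: H_def V_def v image_iff)
    show "vE v \<in> bd Y \<triangle> Bt \<longleftrightarrow> vE v \<in> H \<union> V"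
    proof (cases "-1 \<le> x \<and> x \<le> int N \<and> 0 \<le> y")
      case True
      define i k where "i = nat (x + 1)" and "k = nat y"
      have ik: "i \<le> Suc N" "x = int i - 1" "y = int k" using True by (auto simp: i_def k_def)
      have R: "vE v \<in> H \<union> V \<longleftrightarrow> k \<in> B i" unfolding VV using ik by auto
      have u: "rt v \<in> Y \<longleftrightarrow> k \<in> (if i \<le> N then col m i Y else {})"
      proof (cases "i \<le> N")
        case True
        then show ?thesis using in_strip_nat[OF Y, of "x + 1" y] ik by (simp add: v rt_def)
      next
        case False
        have "rt v \<notin> strip N m" using False ik by (auto simp: strip_def v rt_def)
        then show ?thesis using Y False by auto
      qed
      have w: "v \<in> Y \<longleftrightarrow> k \<in> lcol m i Y"
      proof (cases "i = 0")
        case True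
        have "v \<notin> strip N m" using True ik by (auto simp: strip_def v)
        then show ?thesis using Y True by (auto simp: lcol_def)
      next
        case False
        then have "nat x = i - 1" "x \<ge> 0" using ik by auto
        then show ?thesis using in_strip_nat[OF Y, of x y] ik False by (simp add: v lcol_def)
      qed
      have "vE v \<notin> Bt" using b by auto
      then show ?thesis unfolding R in_sdiff in_bd u w B_def by argo
    next
      case False
      have "\<not> (vE v \<in> H \<union> V)" using False unfolding VV by auto
      moreover have "v \<notin> Y"
      proof
        assume "v \<in> Y"
        then have "v \<in> strip N m" using Y by blast
        then show False using False by (auto simp: strip_def v)
      qed
      moreover have "rt v \<notin> Y"
      proof
        assume "rt v \<in> Y"
        then have "rt v \<in> strip N m" using Y by blast
        then show False using False by (auto simp: strip_def v rt_def)
      qed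
      moreover have "vE v \<notin> Bt" using b by auto
      ultimately show ?thesis by simp
    qed
  qed
  then have "pw q (bd Y \<triangle> Bt) = pw q H * pw q V"
    unfolding pw_def using finA finB
    by (simp only:) (rule prod.union_disjoint, auto simp: H_def V_def)
  also have "pw q H = (\<Prod>i\<le>N. Hw g m b (col m i Y))"
  proof -
    have "pw q H = (\<Prod>(i, j)\<in>(SIGMA i:{..N}. A i). q (hE (int i, int j - 1)))"
      unfolding pw_def H_def by (subst prod.reindex[OF injH]) (simp add: case_prod_beta)
    also have "\<dots> = (\<Prod>i\<le>N. \<Prod>j\<in>A i. q (hE (int i, int j - 1)))"
      using finA by (subst prod.Sigma) auto
    also have "\<dots> = (\<Prod>i\<le>N. Hw g m b (col m i Y))"
      unfolding Hw_def hw_square A_def by (intro prod.cong refl) (use qh in auto)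
    finally show ?thesis .
  qed
  also have "pw q V = (\<Prod>i\<le>Suc N. z ^ card (B i))"
  proof -
    have "pw q V = (\<Prod>(i, j)\<in>(SIGMA i:{..Suc N}. B i). q (vE (int i - 1, int j)))"
      unfolding pw_def V_def by (subst prod.reindex[OF injV]) (simp add: case_prod_beta)
    also have "\<dots> = (\<Prod>i\<le>Suc N. \<Prod>j\<in>B i. q (vE (int i - 1, int j)))"
      using finB by (subst prod.Sigma) auto
    finally show ?thesis by (simp add: qv)
  qed
  also have "(\<Prod>i\<le>Suc N. z ^ card (B i)) = (\<Prod>i\<le>N. z ^ card (lcol m i Y \<triangle> col m i Y)) * z ^ card (lcol m (Suc N) Y)"
    by (simp add: B_def)
  finally show ?thesis
    by (simp add: colwt_def lessThan_Suc_atMost prod.distrib mult.assoc)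
qed

lemma strip_cols: "strip N m = cols m (Suc N)"
  by (auto simp: strip_def cols_def)

lemma transfer_plus:
  assumes m: "m \<le> Suc N"
    and qh: "\<And>x j. j \<le> m \<Longrightarrow> q (hE (x, int j - 1)) = (g j)\<^sup>2" and qv: "\<And>v. q (vE v) = z"
  shows "(\<Sum>Y\<in>Pow (strip N m). pw q (bd Y)) = (opV z g m ^^ (N + 2)) (vac m) {}"
proof -
  have "(\<Sum>Y\<in>Pow (strip N m). pw q (bd Y)) = (\<Sum>Y\<in>Pow (cols m (Suc N)). colwt z g m {} (Suc N) Y * z ^ card (lcol m (Suc N) Y))"
    unfolding strip_cols using pw_strip[OF m _ _ qh qv, of _ "{}" "{}"] by (intro sum.cong refl) (auto simp: strip_cols)
  then show ?thesis using opV_transfer_sum[where z = z and g = g and m = m and x = "Suc N" and b = "{}"] by (simp add: hw_def)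
qed

text \<open>At both ends the state is the single height 0, whose two half weights \<open>g 0\<close>
  account for the prefactor.\<close>

lemma transfer_dobrushin:
  assumes m: "m \<le> Suc N"
    and qh: "\<And>x j. j \<le> m \<Longrightarrow> q (hE (x, int j - 1)) = (g j)\<^sup>2" and qv: "\<And>v. q (vE v) = z"
  shows "(g 0)\<^sup>2 * (\<Sum>Y\<in>Pow (strip N m). pw q (bd Y \<triangle> Bot N)) = (opV z g m ^^ (N + 2)) (opA 0 (vac m)) {0}"
proof -
  have "(\<Sum>Y\<in>Pow (strip N m). pw q (bd Y \<triangle> Bot N)) = (\<Sum>Y\<in>Pow (cols m (Suc N)). colwt z g m {0} (Suc N) Y * z ^ card (lcol m (Suc N) Y))"
    unfolding strip_cols using pw_strip[OF m _ _ qh qv, of _ "{0}" "Bot N"] by (intro sum.cong refl) (auto simp: strip_cols)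
  moreover have "opA 0 (vac m) = (\<lambda>S. vac m (S \<triangle> {0}))" by (rule ext) (simp add: opA_vac)
  moreover have "(hw g m {0})\<^sup>2 = (g 0)\<^sup>2" by (simp add: hw_square)
  ultimately show ?thesis using opV_transfer_sum[where z = z and g = g and m = m and x = "Suc N" and b = "{0}"] by simp
qed

lemma box_strip: "box N = strip N (Suc N)"
  by (auto simp: box_def strip_def)

lemma Xi_zero: "Xi N q (\<lambda>_. 0) = (\<Sum>Y\<in>Pow (box N). pw q (bd Y))"
  and Zd_zero: "Zd N q (\<lambda>_. 0) = (\<Sum>Y\<in>Pow (box N). pw q (bd Y \<triangle> Bot N))"
  by (simp_all add: Xi_def Zd_def field_def)

text \<open>The edge \<open>hE v\<close> has height \<open>snd v + 1\<close>; on horizontal edges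
  the weight is the square of \<open>gz\<close>.\<close>

definition layered :: "real \<Rightarrow> real \<Rightarrow> nat \<Rightarrow> dvert set \<Rightarrow> real" where
  "layered z \<theta> J e = (if e \<in> hE ` {v. snd v + 1 \<ge> int J} then z * exp (- 2 * \<theta>) else z)"

lemma layered_simps [simp]:
  "layered z \<theta> J (hE v) = (if snd v + 1 \<ge> int J then z * exp (- 2 * \<theta>) else z)" "layered z \<theta> J (vE v) = z"
  unfolding layered_def by (auto simp: image_iff)

lemma layered_gz:
  assumes "z \<ge> 0" shows "layered z \<theta> J (hE (x, int j - 1)) = (gz z \<theta> J j)\<^sup>2"
proof -
  have "(exp (- \<theta>))\<^sup>2 = exp (- 2 * \<theta>)" by (simp add: power2_eq_square flip: exp_add)
  then show ?thesis using assms by (auto simp: gz_def power_mult_distrib)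
qed

theorem dobrushin_upper:
  assumes z: "0 < z" "z \<le> 1 / 5"
  shows "Zd N (\<lambda>_. z) (\<lambda>_. 0) \<le> 1 / z * sqrt (real N + 2) * exp (- tau z * (real N + 1)) * Xi N (\<lambda>_. z) (\<lambda>_. 0)"
proof -
  have q: "(\<lambda>_. z) (hE (x, int j - 1)) = (gz z 0 1 j)\<^sup>2" for x :: int and j using z by (simp add: gz_homogeneous)
  have "z * Zd N (\<lambda>_. z) (\<lambda>_. 0) = (opV z (gz z 0 1) (Suc N) ^^ (N + 2)) (opA 0 (vac (Suc N))) {0}"
    unfolding Zd_zero box_strip using transfer_dobrushin[OF order_refl q refl] z by (simp add: gz_homogeneous)
  moreover have "Xi N (\<lambda>_. z) (\<lambda>_. 0) = (opV z (gz z 0 1) (Suc N) ^^ (N + 2)) (vac (Suc N)) {}"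
    unfolding Xi_zero box_strip by (rule transfer_plus[OF order_refl q refl])
  ultimately have "z * Zd N (\<lambda>_. z) (\<lambda>_. 0) \<le> exp (- tau z * (real (N + 2) - 1)) * (sqrt (real (Suc N) + 1) * Xi N (\<lambda>_. z) (\<lambda>_. 0))"
    using opV_upper_homogeneous[OF z, of "Suc N" "N + 2"] by (simp only:) linarith
  then show ?thesis using z by (simp add: field_simps)
qed

theorem dobrushin_layered_upper:
  assumes z: "0 < z" "z \<le> 1 / 5" and J: "J \<ge> 1" "J \<le> N + 2"
  defines "q \<equiv> layered z (1 / (real J)\<^sup>2) J"
  shows "Zd N q (\<lambda>_. 0) \<le> 1 / z * sqrt (real N + 2) * exp (- (tau z + gap z / (real J)\<^sup>2) * (real N + 1)) * Xi N q (\<lambda>_. 0)"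
proof -
  let ?g = "gz z (1 / (real J)\<^sup>2) J"
  have q: "q (hE (x, int j - 1)) = (?g j)\<^sup>2" for x j unfolding q_def by (rule layered_gz) (use z in simp)
  have qv: "q (vE v) = z" for v by (simp add: q_def)
  have "(?g 0)\<^sup>2 * Zd N q (\<lambda>_. 0) = (opV z ?g (Suc N) ^^ (N + 2)) (opA 0 (vac (Suc N))) {0}"
    unfolding Zd_zero box_strip by (rule transfer_dobrushin[OF order_refl q qv])
  moreover have "(?g 0)\<^sup>2 = z" using J z by (simp add: gz_def)
  moreover have "Xi N q (\<lambda>_. 0) = (opV z ?g (Suc N) ^^ (N + 2)) (vac (Suc N)) {}"
    unfolding Xi_zero box_strip by (rule transfer_plus[OF order_refl q qv])
  ultimately have "z * Zd N q (\<lambda>_. 0) \<le> exp (- (tau z + gap z / (real J)\<^sup>2) * (real (N + 2) - 1)) * (sqrt (real (Suc N) + 1) * Xi N q (\<lambda>_. 0))"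
    using opV_upper_layered[OF z _ _ J(1), of "Suc N" "N + 2"] J by simp
  then show ?thesis using z by (simp add: field_simps)
qed

theorem dobrushin_strip_lower:
  assumes z: "0 < z" "z \<le> 1 / 5" and m: "1 \<le> m" "m \<le> Suc N" and N: "N \<ge> 1"
  shows "(\<Sum>Y\<in>Pow (strip N m). pw (\<lambda>_. z) (bd Y)) * exp (- (tau z + (pi / (real m + 1))\<^sup>2 / 2) * N) * (z ^ (2 * m + 1))\<^sup>2
    \<le> 4 ^ m * (10 * (real N + 1) * (real m + 1)) * (\<Sum>Y\<in>Pow (strip N m). pw (\<lambda>_. z) (bd Y \<triangle> Bot N))"
proof -
  have q: "(\<lambda>_. z) (hE (x, int j - 1)) = (gz z 0 1 j)\<^sup>2" for x :: int and j using z by (simp add: gz_homogeneous)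
  have D: "z * (\<Sum>Y\<in>Pow (strip N m). pw (\<lambda>_. z) (bd Y \<triangle> Bot N)) = (opV z (gz z 0 1) m ^^ (N + 2)) (opA 0 (vac m)) {0}"
    using transfer_dobrushin[OF m(2) q refl] z by (simp add: gz_homogeneous)
  have P: "(\<Sum>Y\<in>Pow (strip N m). pw (\<lambda>_. z) (bd Y)) = (opV z (gz z 0 1) m ^^ (N + 2)) (vac m) {}"
    by (rule transfer_plus[OF m(2) q refl])
  have "4 ^ m * (10 / z * (real N + 1) * (real m + 1)) * (z * x) = 4 ^ m * (10 * (real N + 1) * (real m + 1)) * x" for x
    using z by simp
  from opV_lower_homogeneous[OF z m(1) N, folded P D, unfolded this] show ?thesis .
qed

section \<open>The splitting rule\<close>

lemma compass_edges:
  "east_e u = hE (rt u)" "west_e u = hE u" "north_e u = vE (up u)" "south_e u = vE u"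
  by (auto simp: east_e_def west_e_def north_e_def south_e_def hE_def vE_def up_def rt_def)

lemma rt_up [simp]: "rt (up u) = up (rt u)" "rt u \<noteq> u" "up u \<noteq> u" "u \<noteq> rt u" "u \<noteq> up u" "rt u = rt v \<longleftrightarrow> u = v" "up u = up v \<longleftrightarrow> u = v"
  by (auto simp: rt_def up_def prod_eq_iff)

definition star :: "dvert \<Rightarrow> dvert set set" where "star u = {hE (rt u), hE u, vE (up u), vE u}"

lemma star_iff:
  assumes "e \<in> lattice_edges" shows "u \<in> e \<longleftrightarrow> e \<in> star u"
  using assms
proof (rule lattice_edges_cases)
  fix v assume e: "e = hE v"
  have "v = rt u \<or> v = u \<longleftrightarrow> u \<in> hE v" by (auto simp: hE_def rt_def prod_eq_iff)
  then show ?thesis unfolding e star_def by simp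
next
  fix v assume e: "e = vE v"
  have "v = up u \<or> v = u \<longleftrightarrow> u \<in> vE v" by (auto simp: vE_def up_def prod_eq_iff)
  then show ?thesis unfolding e star_def by simp
qed

lemma star_lattice: "star u \<subseteq> lattice_edges"
  by (auto simp: star_def lattice_edges_def)

lemma finite_star [simp]: "finite (star u)" and card_star: "card (star u) = 4"
  by (simp_all add: star_def)

lemma ddeg_star:
  assumes "E \<subseteq> lattice_edges" shows "ddeg E u = card (E \<inter> star u)"
proof -
  have "u \<in> e \<longleftrightarrow> e \<in> star u" if "e \<in> E" for e
    by (rule star_iff) (use assms that in blast)
  then have "{e \<in> E. u \<in> e} = E \<inter> star u" by blast
  then show ?thesis by (simp only: ddeg_def)
qed

lemma ddeg_sum:
  assumes "E \<subseteq> lattice_edges"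
  shows "ddeg E u = of_bool (hE (rt u) \<in> E) + of_bool (hE u \<in> E) + of_bool (vE (up u) \<in> E) + of_bool (vE u \<in> E)"
proof -
  have "card (E \<inter> A) = (\<Sum>e\<in>A. of_bool (e \<in> E))" if "finite A" for A
    using that by (induction A rule: finite_induct) (auto simp: Int_insert_right)
  then have "ddeg E u = (\<Sum>e\<in>star u. of_bool (e \<in> E))"
    unfolding ddeg_star[OF assms] by (simp only: finite_star)
  also have "\<dots> = of_bool (hE (rt u) \<in> E) + (of_bool (hE u \<in> E) + (of_bool (vE (up u) \<in> E) + of_bool (vE u \<in> E)))"
    unfolding star_def by simp
  finally show ?thesis by (simp only: add.assoc)
qed

lemma even_ddeg_sdiff:
  assumes "E \<subseteq> lattice_edges" "F \<subseteq> lattice_edges"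
  shows "even (ddeg (E \<triangle> F) u) \<longleftrightarrow> even (ddeg E u + ddeg F u)"
proof -
  have "(E \<triangle> F) \<inter> star u = (E \<inter> star u) \<triangle> (F \<inter> star u)" by (auto simp: sdiff_def)
  then show ?thesis
    using assms by (simp add: ddeg_star sdiff_subset_lattice card_sdiff_parity)
qed

lemma even_ddeg_bd: "even (ddeg (bd Y) u)"
  unfolding ddeg_sum[OF bd_subset_lattice] in_bd rt_up(1)
  by (cases "u \<in> Y"; cases "rt u \<in> Y"; cases "up u \<in> Y"; cases "up (rt u) \<in> Y"; simp)

lemma ddeg_le_4: "E \<subseteq> lattice_edges \<Longrightarrow> ddeg E u \<le> 4"
  using card_mono[OF finite_star, of "E \<inter> star u" u] by (simp add: ddeg_star card_star)

lemma odd_ddeg_Bot: "odd (ddeg (Bot N) u) \<longleftrightarrow> u = (-1, -1) \<or> u = (int N, -1)"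
  unfolding ddeg_sum[OF Bot_lattice] by (cases u) (auto simp: rt_def)

lemma ddeg_corner:
  assumes "E \<subseteq> Ed N" "u = (-1, -1) \<or> u = (int N, -1)" shows "ddeg E u \<le> 2"
proof -
  have E: "E \<subseteq> lattice_edges" using assms Ed_lattice by blast
  have "e \<notin> E" if "e \<notin> Ed N" for e using that assms by blast
  then have "hE (rt u) \<notin> E \<or> hE u \<notin> E" "vE u \<notin> E"
    using assms(2) by (auto simp: rt_def)
  then show ?thesis unfolding ddeg_sum[OF E] by auto
qed

text \<open>Degree 3 is excluded because separating edges have even degree away from the two bottom
  corners. At degrees 2 and 4 every edge has a partner under the splitting rule, at degree 1 it has
  none.\<close>

definition split_ok :: "dvert set set \<Rightarrow> bool" where
  "split_ok E \<longleftrightarrow> E \<subseteq> lattice_edges \<and> finite E \<and> (\<forall>u. ddeg E u \<in> {0, 1, 2, 4})"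

lemma split_okD: assumes "split_ok E" shows "E \<subseteq> lattice_edges" "finite E" "ddeg E u \<in> {0, 1, 2, 4}"
  using assms unfolding split_ok_def by blast+

lemma even_le_4: "even (n::nat) \<Longrightarrow> n \<le> 4 \<Longrightarrow> n \<in> {0, 2, 4}"
  by (auto elim!: evenE)

lemma split_ok_bd: "Y \<subseteq> box N \<Longrightarrow> split_ok (bd Y)"
  unfolding split_ok_def
  using even_le_4[OF even_ddeg_bd ddeg_le_4[OF bd_subset_lattice], of Y] bd_subset_lattice finite_bd
  by blast

lemma dob_edges:
  assumes "Y \<subseteq> box N"
  shows "bd Y \<triangle> Bot N \<subseteq> Ed N" "odd (ddeg (bd Y \<triangle> Bot N) u) \<longleftrightarrow> u = (-1, -1) \<or> u = (int N, -1)"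
    "u = (-1, -1) \<or> u = (int N, -1) \<Longrightarrow> ddeg (bd Y \<triangle> Bot N) u = 1" "split_ok (bd Y \<triangle> Bot N)"
proof -
  show E: "bd Y \<triangle> Bot N \<subseteq> Ed N" using bd_subset_Ed[OF assms] Bot_subset by (rule sdiff_subset)
  have odd: "odd (ddeg (bd Y \<triangle> Bot N) u) \<longleftrightarrow> u = (-1, -1) \<or> u = (int N, -1)" for u
    using even_ddeg_sdiff[OF bd_subset_lattice Bot_lattice, of Y N u] even_ddeg_bd[of Y u] odd_ddeg_Bot[of N u] by simp
  show "odd (ddeg (bd Y \<triangle> Bot N) u) \<longleftrightarrow> u = (-1, -1) \<or> u = (int N, -1)" by (rule odd)
  have one: "ddeg (bd Y \<triangle> Bot N) u = 1" if "u = (-1, -1) \<or> u = (int N, -1)" for u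
  proof -
    have "ddeg (bd Y \<triangle> Bot N) u \<le> 2" using that by (rule ddeg_corner[OF E])
    moreover have "odd (ddeg (bd Y \<triangle> Bot N) u)" using odd[of u] that by blast
    ultimately show ?thesis by (cases "ddeg (bd Y \<triangle> Bot N) u = 2") (auto elim: oddE)
  qed
  then show "u = (-1, -1) \<or> u = (int N, -1) \<Longrightarrow> ddeg (bd Y \<triangle> Bot N) u = 1" .
  have L: "bd Y \<triangle> Bot N \<subseteq> lattice_edges" using E Ed_lattice by blast
  have "ddeg (bd Y \<triangle> Bot N) u \<in> {0, 1, 2, 4}" for u
  proof (cases "u = (-1, -1) \<or> u = (int N, -1)")
    case True
    then show ?thesis using one by simp
  next
    case False
    then have "even (ddeg (bd Y \<triangle> Bot N) u)" using odd[of u] by blast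
    then show ?thesis using even_le_4[OF _ ddeg_le_4[OF L], of u] by blast
  qed
  then show "split_ok (bd Y \<triangle> Bot N)" unfolding split_ok_def using L finite_subset[OF E finite_Ed] by blast
qed

lemma joined_at_sym: "joined_at E u e f \<Longrightarrow> joined_at E u f e"
  by (auto simp: joined_at_def insert_commute)

lemma joined_sym: "joined E e f \<Longrightarrow> joined E f e"
  by (auto simp: joined_def dest: joined_at_sym)

lemma joined_at_star: "E \<subseteq> lattice_edges \<Longrightarrow> joined_at E u e f \<Longrightarrow> e \<in> E \<inter> star u \<and> f \<in> E \<inter> star u \<and> e \<noteq> f"
  unfolding joined_at_def using star_iff by blast

lemma pair_cases:
  assumes "{e, f} = {vE u, hE (rt u)} \<or> {e, f} = {vE (up u), hE u}" "{e, f'} = {vE u, hE (rt u)} \<or> {e, f'} = {vE (up u), hE u}"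
  shows "f = f'"
  using assms by (auto simp: doubleton_eq_iff)

lemma pair_eq:
  assumes "p = {vE u, hE (rt u)} \<or> p = {vE (up u), hE u}" "e \<in> p"
  shows "e \<noteq> f \<and> f \<in> p \<longleftrightarrow> {e, f} = {vE u, hE (rt u)} \<or> {e, f} = {vE (up u), hE u}"
proof -
  have ne: "vE u \<noteq> vE (up u)" "hE u \<noteq> hE (rt u)" "vE u \<noteq> hE w" for w by simp_all
  have "p = {vE u, hE (rt u)} \<and> (e = vE u \<or> e = hE (rt u)) \<or> p = {vE (up u), hE u} \<and> (e = vE (up u) \<or> e = hE u)"
    using assms by blast
  then show ?thesis by (elim disjE conjE) (auto simp: doubleton_eq_iff)
qed

lemma joined_at_unique:
  assumes E: "E \<subseteq> lattice_edges" and f: "joined_at E u e f" "joined_at E u e f'"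
  shows "f = f'"
proof (cases "ddeg E u = 2")
  case True
  then have "card (E \<inter> star u) = 2" using E by (simp add: ddeg_star)
  then obtain x y where "E \<inter> star u = {x, y}" by (auto simp: card_2_iff)
  then show ?thesis using joined_at_star[OF E f(1)] joined_at_star[OF E f(2)] by auto
next
  case False
  then show ?thesis using f pair_cases[of e f u f'] unfolding joined_at_def compass_edges by blast
qed

lemma joined_at_exists:
  assumes E: "E \<subseteq> lattice_edges" and d: "ddeg E u = 2 \<or> ddeg E u = 4" and e: "e \<in> E" "u \<in> e"
  shows "\<exists>f. joined_at E u e f"
proof -
  have es: "e \<in> E \<inter> star u" using e E star_iff by blast
  from d show ?thesis
  proof
    assume d: "ddeg E u = 2"
    then have "card (E \<inter> star u) = 2" using E by (simp add: ddeg_star)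
    then obtain f where "f \<in> E \<inter> star u" "f \<noteq> e" using es by (auto simp: card_2_iff)
    moreover have "u \<in> f" using \<open>f \<in> E \<inter> star u\<close> E star_iff by blast
    ultimately have "joined_at E u e f" using e d by (auto simp: joined_at_def)
    then show ?thesis ..
  next
    assume "ddeg E u = 4"
    then have "E \<inter> star u = star u" using E card_subset_eq[OF finite_star, of "E \<inter> star u" u] by (simp add: ddeg_star card_star)
    then have sub: "star u \<subseteq> E" by blast
    then have inE: "vE u \<in> E" "hE (rt u) \<in> E" "vE (up u) \<in> E" "hE u \<in> E" by (auto simp: star_def)
    have u: "u \<in> vE u" "u \<in> hE (rt u)" "u \<in> vE (up u)" "u \<in> hE u"
      by (auto simp: vE_def hE_def rt_def up_def)
    have "joined_at E u (vE u) (hE (rt u))" "joined_at E u (hE (rt u)) (vE u)"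
       "joined_at E u (vE (up u)) (hE u)" "joined_at E u (hE u) (vE (up u))"
      using inE u by (auto simp: joined_at_def compass_edges)
    then show ?thesis using es by (auto simp: star_def)
  qed
qed

definition jclosed :: "dvert set set \<Rightarrow> dvert set set \<Rightarrow> bool" where
  "jclosed E K \<longleftrightarrow> K \<subseteq> E \<and> (\<forall>e\<in>K. \<forall>f. joined E e f \<longrightarrow> f \<in> K)"

lemma jclosedD: "jclosed E K \<Longrightarrow> K \<subseteq> E" "jclosed E K \<Longrightarrow> e \<in> K \<Longrightarrow> joined_at E u e f \<Longrightarrow> f \<in> K"
  unfolding jclosed_def joined_def by blast+

lemma jclosed_Union: "(\<And>K. K \<in> \<K> \<Longrightarrow> jclosed E K) \<Longrightarrow> jclosed E (\<Union>\<K>)"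
  unfolding jclosed_def by blast

definition comp :: "dvert set set \<Rightarrow> dvert set \<Rightarrow> dvert set set" where
  "comp E e = {f. (joined E)\<^sup>*\<^sup>* e f}"

lemma comp_refl [simp]: "e \<in> comp E e" by (simp add: comp_def)

lemma comp_step: "f \<in> comp E e \<Longrightarrow> joined E f g \<Longrightarrow> g \<in> comp E e"
  unfolding comp_def mem_Collect_eq by (rule rtranclp.rtrancl_into_rtrancl)

lemma joinedD: "joined E e f \<Longrightarrow> e \<in> E \<and> f \<in> E"
  unfolding joined_def joined_at_def by blast

lemma comp_minimal: assumes "jclosed E K" "e \<in> K" shows "comp E e \<subseteq> K"
proof
  fix f assume "f \<in> comp E e"
  then have "(joined E)\<^sup>*\<^sup>* e f" by (simp only: comp_def mem_Collect_eq)
  then show "f \<in> K"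
  proof (induction rule: rtranclp_induct)
    case (step y w)
    then show ?case using assms(1) unfolding jclosed_def by blast
  qed (rule assms)
qed

lemma comp_subset: "e \<in> E \<Longrightarrow> comp E e \<subseteq> E"
  by (rule comp_minimal) (unfold jclosed_def, blast dest: joinedD)

lemma jclosed_comp: "e \<in> E \<Longrightarrow> jclosed E (comp E e)"
  unfolding jclosed_def using comp_subset comp_step by blast

lemma comp_sym: assumes "f \<in> comp E e" shows "e \<in> comp E f"
proof -
  have "(joined E)\<^sup>*\<^sup>* e f" using assms by (simp only: comp_def mem_Collect_eq)
  moreover have "symp ((joined E)\<^sup>*\<^sup>*)" by (rule symp_rtranclp, rule sympI, rule joined_sym)
  ultimately have "(joined E)\<^sup>*\<^sup>* f e" by (rule sympD[rotated])
  then show ?thesis by (simp only: comp_def mem_Collect_eq)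
qed

lemma comp_trans: "b \<in> comp E a \<Longrightarrow> comp E b \<subseteq> comp E a"
  unfolding comp_def subset_iff mem_Collect_eq using rtranclp_trans[of "joined E" a b] by blast

lemma comp_eq: "f \<in> comp E e \<Longrightarrow> comp E f = comp E e"
  using comp_trans[of f E e] comp_trans[of e E f] comp_sym[of f E e] by simp

text \<open>At a vertex where the degree in \<open>E\<close> is even, all edges come in joined
  pairs, and a union of components keeps each pair whole.\<close>

lemma jclosed_even:
  assumes E: "split_ok E" and K: "jclosed E K" and u: "even (ddeg E u)"
  shows "even (ddeg K u)"
proof -
  note E' = split_okD[OF E]
  have KE: "K \<subseteq> E" and KL: "K \<subseteq> lattice_edges" using jclosedD(1)[OF K] E'(1) by blast+
  have part: "f \<in> K" if "e \<in> K" "joined_at E u e f" for e f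
    using jclosedD(2)[OF K that] .
  have "ddeg E u = 0 \<or> ddeg E u = 2 \<or> ddeg E u = 4" using E'(3)[of u] u by auto
  then consider "K \<inter> star u = {}" | "ddeg E u = 2" "K \<inter> star u \<noteq> {}" | "ddeg E u = 4" "K \<inter> star u \<noteq> {}"
  proof cases
    assume "K \<inter> star u = {}" then show ?thesis using that(1) by blast
  next
    assume ne: "K \<inter> star u \<noteq> {}"
    then have "card (E \<inter> star u) \<noteq> 0" using KE E'(2) by auto
    then have "ddeg E u \<noteq> 0" by (simp only: ddeg_star[OF E'(1)] not_False_eq_True)
    then show ?thesis using \<open>ddeg E u = 0 \<or> ddeg E u = 2 \<or> ddeg E u = 4\<close> ne that(2,3) by (elim disjE) simp_all
  qed
  then show ?thesis
  proof cases
    case 1 then show ?thesis by (simp add: ddeg_star[OF KL])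
  next
    case 2
    then obtain e where e: "e \<in> K" "e \<in> star u" by blast
    have ue: "u \<in> e" using e KL star_iff by blast
    obtain f where f: "joined_at E u e f" using joined_at_exists[OF E'(1) _ _ ue] 2 e KE by blast
    then have "f \<in> K" using part e by blast
    have fs: "f \<in> star u" "e \<noteq> f" using joined_at_star[OF E'(1) f] by auto
    have c2: "card (E \<inter> star u) = 2" using 2 E' by (simp add: ddeg_star)
    have "{e, f} \<subseteq> E \<inter> star u" using e f fs KE \<open>f \<in> K\<close> by auto
    then have "{e, f} = E \<inter> star u" using c2 fs by (intro card_subset_eq) auto
    then have "K \<inter> star u = {e, f}" using e \<open>f \<in> K\<close> fs KE by blast
    then show ?thesis using fs by (simp add: ddeg_star[OF KL])
  next
    case 3
    then have "E \<inter> star u = star u" using E' card_subset_eq[OF finite_star, of "E \<inter> star u" u] by (simp add: ddeg_star card_star)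
    then have sub: "star u \<subseteq> E" by blast
    then have inE: "vE u \<in> E" "hE (rt u) \<in> E" "vE (up u) \<in> E" "hE u \<in> E" by (auto simp: star_def)
    have us: "u \<in> vE u" "u \<in> hE (rt u)" "u \<in> vE (up u)" "u \<in> hE u"
      by (auto simp: vE_def hE_def rt_def up_def)
    have "joined_at E u (vE u) (hE (rt u))" "joined_at E u (vE (up u)) (hE u)"
      using inE us by (auto simp: joined_at_def compass_edges)
    then have "vE u \<in> K \<longleftrightarrow> hE (rt u) \<in> K" "vE (up u) \<in> K \<longleftrightarrow> hE u \<in> K"
      using part joined_at_sym by blast+
    then show ?thesis unfolding ddeg_sum[OF KL] by simp
  qed
qed

definition corner_pairs :: "dvert \<Rightarrow> dvert set set set" where
  "corner_pairs u = {{}, {vE u, hE (rt u)}, {vE (up u), hE u}}"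

text \<open>The edges that have to stay out of the rest of the configuration for \<open>K\<close> to survive the splitting rule.\<close>

definition Dl :: "dvert set set \<Rightarrow> dvert set set" where
  "Dl K = K \<union> {f. \<exists>u. f \<in> star u \<and> K \<inter> star u \<notin> corner_pairs u}"

text \<open>The edge itself and four edges at each of its two ends:
  \<open>1 + 2 * 4 = 9\<close>.\<close>

lemma card_Dl:
  assumes "finite K" "K \<subseteq> lattice_edges" shows "finite (Dl K)" "card (Dl K) \<le> 9 * card K"
proof -
  have 2: "card e = 2" "finite e" if "e \<in> lattice_edges" for e
    using that by (auto elim!: lattice_edges_cases simp: hE_def vE_def prod_eq_iff card_insert_if)
  have finU: "finite (\<Union>K)" using assms 2 by (intro finite_Union) auto
  have "card (\<Union>K) \<le> (\<Sum>e\<in>K. card e)" using card_UN_le[OF assms(1), of "\<lambda>e. e"] by simp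
  also have "\<dots> = (\<Sum>e\<in>K. 2)" using assms 2 by (intro sum.cong) auto
  finally have cU: "card (\<Union>K) \<le> 2 * card K" by simp
  have sub: "Dl K \<subseteq> K \<union> (\<Union>u\<in>\<Union>K. star u)"
  proof
    fix f assume "f \<in> Dl K"
    then consider "f \<in> K" | u where "f \<in> star u" "K \<inter> star u \<notin> corner_pairs u" by (auto simp: Dl_def)
    then show "f \<in> K \<union> (\<Union>u\<in>\<Union>K. star u)"
    proof cases
      case 2
      then obtain e where "e \<in> K" "e \<in> star u" by (auto simp: corner_pairs_def)
      then have "u \<in> \<Union>K" using assms star_iff by blast
      then show ?thesis using 2 by blast
    qed simp
  qed
  have fin: "finite (K \<union> (\<Union>u\<in>\<Union>K. star u))" by (rule finite_UnI[OF assms(1) finite_UN_I[OF finU finite_star]])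
  then show "finite (Dl K)" using sub finite_subset by blast
  have "card (Dl K) \<le> card K + card (\<Union>u\<in>\<Union>K. star u)"
    by (rule order_trans[OF card_mono[OF fin sub] card_Un_le])
  also have "card (\<Union>u\<in>\<Union>K. star u) \<le> (\<Sum>u\<in>\<Union>K. card (star u))" by (rule card_UN_le[OF finU])
  also have "\<dots> = 4 * card (\<Union>K)" by (simp add: card_star)
  finally show "card (Dl K) \<le> 9 * card K" using cU by linarith
qed

text \<open>Suppose a foreign edge meets \<open>K\<close> at \<open>u\<close>. At degree 2 it would
  be joined to \<open>K\<close>; at degree 4 each joined pair lies wholly inside or outside
  \<open>K\<close>, so \<open>K\<close> has exactly one corner pair at \<open>u\<close>. Together
  with \<open>joined_Un_Dl\<close> this turns the property of being a union of components into a
  constraint on the remaining edges alone.\<close>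

lemma jclosed_avoids_Dl:
  assumes E: "split_ok E" and K: "jclosed E K"
  shows "(E - K) \<inter> Dl K = {}"
proof (rule ccontr)
  note E' = split_okD[OF E]
  have KE: "K \<subseteq> E" and KL: "K \<subseteq> lattice_edges" using jclosedD(1)[OF K] E'(1) by blast+
  have part: "f \<in> K" if "e \<in> K" "joined_at E u e f" for e f u
    using jclosedD(2)[OF K that] .
  assume "(E - K) \<inter> Dl K \<noteq> {}"
  then obtain f u where f: "f \<in> E" "f \<notin> K" "f \<in> star u" "K \<inter> star u \<notin> corner_pairs u" by (auto simp: Dl_def)
  then obtain e where e: "e \<in> K" "e \<in> star u" by (auto simp: corner_pairs_def)
  have "{e, f} \<subseteq> E \<inter> star u" "e \<noteq> f" using e f KE by auto
  then have "2 \<le> card (E \<inter> star u)" using card_mono[of "E \<inter> star u" "{e, f}"] by simp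
  then have "ddeg E u \<ge> 2" using E' by (simp add: ddeg_star)
  then consider "ddeg E u = 2" | "ddeg E u = 4" using E'(3)[of u] by auto
  then show False
  proof cases
    case 1
    have "u \<in> e" "u \<in> f" using e f KL E' star_iff by blast+
    then have "joined_at E u e f" using 1 e f KE \<open>e \<noteq> f\<close> by (auto simp: joined_at_def)
    then show False using part e f by blast
  next
    case 2
    then have "E \<inter> star u = star u" using E' card_subset_eq[OF finite_star, of "E \<inter> star u" u] by (simp add: ddeg_star card_star)
    then have sub: "star u \<subseteq> E" by blast
    then have inE: "vE u \<in> E" "hE (rt u) \<in> E" "vE (up u) \<in> E" "hE u \<in> E" by (auto simp: star_def)
    have us: "u \<in> vE u" "u \<in> hE (rt u)" "u \<in> vE (up u)" "u \<in> hE u"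
      by (auto simp: vE_def hE_def rt_def up_def)
    have "joined_at E u (vE u) (hE (rt u))" "joined_at E u (vE (up u)) (hE u)"
      using inE us by (auto simp: joined_at_def compass_edges)
    then have "vE u \<in> K \<longleftrightarrow> hE (rt u) \<in> K" "vE (up u) \<in> K \<longleftrightarrow> hE u \<in> K"
      using part joined_at_sym by blast+
    moreover have "\<not> (vE u \<in> K \<and> vE (up u) \<in> K \<and> hE u \<in> K \<and> hE (rt u) \<in> K)" using f by (auto simp: star_def)
    ultimately have "K \<inter> star u = {} \<or> K \<inter> star u = {vE u, hE (rt u)} \<or> K \<inter> star u = {vE (up u), hE u}"
      unfolding star_def by auto
    then show False using f by (auto simp: corner_pairs_def)
  qed
qed

text \<open>Where \<open>F\<close> meets a vertex of \<open>K\<close>, the edges of \<open>K\<close>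
  there form one corner pair. This pair is joined in \<open>K\<close> because the degree is 2, and
  in the union because of the splitting rule.\<close>

lemma joined_at_Un_Dl:
  assumes L: "K \<subseteq> lattice_edges" "F \<subseteq> lattice_edges" and fin: "finite K" "finite F" and D: "F \<inter> Dl K = {}" and e: "e \<in> K"
  shows "joined_at (K \<union> F) u e f \<longleftrightarrow> joined_at K u e f"
proof -
  have disj: "F \<inter> K = {}" using D by (auto simp: Dl_def)
  have LU: "K \<union> F \<subseteq> lattice_edges" using L by auto
  have IU: "(K \<union> F) \<inter> star u = (K \<inter> star u) \<union> (F \<inter> star u)" by blast
  show ?thesis
  proof (cases "F \<inter> star u = {} \<or> e \<notin> star u")
    case True
    then show ?thesis
    proof
      assume "e \<notin> star u"
      then show ?thesis using joined_at_star[OF LU, of u e f] joined_at_star[OF L(1), of u e f] by simp argo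
    next
      assume F: "F \<inter> star u = {}"
      then have d: "ddeg (K \<union> F) u = ddeg K u" using L LU by (simp add: ddeg_star IU)
      have "\<not> (f \<in> F \<and> u \<in> f)" using F L star_iff[of f u] by blast
      then show ?thesis unfolding joined_at_def d using e by simp argo
    qed
  next
    case False
    then obtain f' where f': "f' \<in> F" "f' \<in> star u" and es: "e \<in> star u" by blast
    have "K \<inter> star u \<in> corner_pairs u" using f' D unfolding Dl_def by blast
    moreover have "K \<inter> star u \<noteq> {}" using e es by blast
    ultimately have "K \<inter> star u = {vE u, hE (rt u)} \<or> K \<inter> star u = {vE (up u), hE u}"
      by (simp add: corner_pairs_def)
    then obtain p where p: "K \<inter> star u = p" "p = {vE u, hE (rt u)} \<or> p = {vE (up u), hE u}" by blast
    have cp: "card p = 2" "finite p" using p(2) by auto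
    have dK: "ddeg K u = 2" unfolding ddeg_star[OF L(1)] p(1) by (rule cp)
    have "card ((K \<union> F) \<inter> star u) \<ge> card (insert f' p)"
      unfolding IU p(1) by (rule card_mono) (use f' cp fin in auto)
    moreover have "f' \<notin> p" using p(1) f' disj by blast
    ultimately have dU: "ddeg (K \<union> F) u \<noteq> 2" unfolding ddeg_star[OF LU] using cp by simp
    have ep: "e \<in> p" using p e es by blast
    have eL: "u \<in> e" using star_iff[of e u] e es L(1) by blast
    have fL: "u \<in> f" if "f \<in> p" using star_iff[of f u] that p(1) L(1) by blast
    have fK: "f \<in> K" if "f \<in> p" using that p(1) by blast
    have A: "joined_at (K \<union> F) u e f \<longleftrightarrow> e \<noteq> f \<and> f \<in> p"
      unfolding joined_at_def compass_edges pair_eq[OF p(2) ep, symmetric] using dU eL fL fK e by blast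
    have B: "joined_at K u e f \<longleftrightarrow> e \<noteq> f \<and> f \<in> p"
    proof
      assume "joined_at K u e f"
      then show "e \<noteq> f \<and> f \<in> p" using joined_at_star[OF L(1)] p(1) by blast
    next
      assume "e \<noteq> f \<and> f \<in> p"
      then show "joined_at K u e f" unfolding joined_at_def using e dK eL fL fK by blast
    qed
    show ?thesis using A B by simp
  qed
qed

lemma comp_eq_jclosed:
  assumes K: "jclosed E K" and j: "\<And>e f. e \<in> K \<Longrightarrow> joined E e f \<longleftrightarrow> joined K e f" and e: "e \<in> K"
  shows "comp E e = comp K e"
proof
  show "comp E e \<subseteq> comp K e"
  proof
    fix f assume "f \<in> comp E e"
    then have "(joined E)\<^sup>*\<^sup>* e f" by (simp only: comp_def mem_Collect_eq)
    then have "f \<in> comp K e \<and> f \<in> K"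
    proof (induction rule: rtranclp_induct)
      case base show ?case using e by simp
    next
      case (step y w)
      then have "joined K y w" using j by blast
      then show ?case using step.IH comp_step joinedD by blast
    qed
    then show "f \<in> comp K e" ..
  qed
  show "comp K e \<subseteq> comp E e"
  proof
    fix f assume "f \<in> comp K e"
    then have "(joined K)\<^sup>*\<^sup>* e f" by (simp only: comp_def mem_Collect_eq)
    then have "f \<in> comp E e \<and> f \<in> K"
    proof (induction rule: rtranclp_induct)
      case base show ?case using e by simp
    next
      case (step y w)
      then have "joined E y w" using j by blast
      then show ?case using step comp_step joinedD by blast
    qed
    then show "f \<in> comp E e" ..
  qed
qed

lemma joined_Un_Dl:
  assumes "K \<subseteq> lattice_edges" "F \<subseteq> lattice_edges" "finite K" "finite F" "F \<inter> Dl K = {}"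
  shows "e \<in> K \<Longrightarrow> joined (K \<union> F) e f \<longleftrightarrow> joined K e f" "jclosed (K \<union> F) K" "e \<in> K \<Longrightarrow> comp (K \<union> F) e = comp K e"
proof -
  show 1: "e \<in> K \<Longrightarrow> joined (K \<union> F) e f \<longleftrightarrow> joined K e f" for e f
    unfolding joined_def using joined_at_Un_Dl[OF assms] by simp
  show 2: "jclosed (K \<union> F) K" unfolding jclosed_def using 1 joinedD by blast
  show "e \<in> K \<Longrightarrow> comp (K \<union> F) e = comp K e" using comp_eq_jclosed[OF 2 1] .
qed

section \<open>Even edge sets and walks\<close>

lemma up_pair: "up (x, y) = (x, y + 1)" and rt_pair: "rt (x, y) = (x + 1, y)"
  by (simp_all add: up_def rt_def)

lemma bd_pair:
  "hE (x, y) \<in> bd Y \<longleftrightarrow> ((x, y) \<in> Y) \<noteq> ((x, y + 1) \<in> Y)"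
  "vE (x, y) \<in> bd Y \<longleftrightarrow> ((x, y) \<in> Y) \<noteq> ((x + 1, y) \<in> Y)"
  by (simp_all add: up_pair rt_pair)

lemma int_set_crossings:
  fixes A :: "int set"
  assumes "finite A" "a \<in> A"
  shows "\<exists>x\<ge>a. (x \<in> A) \<noteq> (x + 1 \<in> A)" "\<exists>x<a. (x \<in> A) \<noteq> (x + 1 \<in> A)"
proof -
  have M: "Max A \<in> A" "Min A \<in> A" "a \<le> Max A" "Min A \<le> a" using assms by (auto intro: Max_in Min_in)
  have "Max A + 1 \<notin> A" using Max_ge[OF assms(1), of "Max A + 1"] by auto
  then show "\<exists>x\<ge>a. (x \<in> A) \<noteq> (x + 1 \<in> A)" using M by blast
  have "Min A - 1 \<notin> A" using Min_le[OF assms(1), of "Min A - 1"] by auto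
  then have "((Min A - 1) \<in> A) \<noteq> (Min A - 1 + 1 \<in> A)" using M by simp
  moreover have "Min A - 1 < a" using M by simp
  ultimately show "\<exists>x<a. (x \<in> A) \<noteq> (x + 1 \<in> A)" by blast
qed

lemma bd_crossings:
  assumes "finite G" "(a, b) \<in> G"
  shows "\<exists>x\<ge>a. vE (x, b) \<in> bd G" "\<exists>x<a. vE (x, b) \<in> bd G"
    "\<exists>y\<ge>b. hE (a, y) \<in> bd G" "\<exists>y<b. hE (a, y) \<in> bd G"
proof -
  have "{x. (x, b) \<in> G} \<subseteq> fst ` G" "{y. (a, y) \<in> G} \<subseteq> snd ` G" by force+
  then have "finite {x. (x, b) \<in> G}" "finite {y. (a, y) \<in> G}"
    using assms(1) by (auto intro: finite_subset)
  then show "\<exists>x\<ge>a. vE (x, b) \<in> bd G" "\<exists>x<a. vE (x, b) \<in> bd G"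
    "\<exists>y\<ge>b. hE (a, y) \<in> bd G" "\<exists>y<b. hE (a, y) \<in> bd G"
    using int_set_crossings[of "{x. (x, b) \<in> G}" a] int_set_crossings[of "{y. (a, y) \<in> G}" b] assms(2)
    unfolding bd_pair mem_Collect_eq by blast+
qed

lemma bd_inj:
  assumes "finite Y" "finite Z" "bd Y = bd Z" shows "Y = Z"
proof (rule ccontr)
  assume "Y \<noteq> Z"
  then obtain v where v: "v \<in> Y \<triangle> Z" by (auto simp: sdiff_def)
  have "finite (Y \<triangle> Z)" using assms by (simp add: sdiff_def)
  then have "bd (Y \<triangle> Z) \<noteq> {}" using bd_crossings(1)[of "Y \<triangle> Z" "fst v" "snd v"] v by (metis empty_iff prod.collapse)
  then show False using assms by (simp add: bd_sdiff sdiff_self)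
qed

lemma bd_remove:
  assumes "bd Z \<subseteq> bd Y" shows "bd (Y \<triangle> Z) = bd Y - bd Z"
proof -
  have "A \<triangle> B = A - B" if "B \<subseteq> A" for A B :: "dvert set set" using that by (auto simp: sdiff_def)
  then show ?thesis using assms by (simp only: bd_sdiff)
qed

text \<open>Every column of \<open>G\<close> owns a horizontal boundary edge, so there are at most
  \<open>card (bd G)\<close> columns.\<close>

lemma area_le:
  assumes "finite G" "finite R" "snd ` G \<subseteq> R"
  shows "card G \<le> card (bd G) * card R"
proof -
  have fb: "finite (bd G)"
  proof -
    have "bd G \<subseteq> hE ` (G \<union> {v. up v \<in> G}) \<union> vE ` (G \<union> {v. rt v \<in> G})" by (auto simp: bd_def)
    moreover have "finite {v. up v \<in> G}" "finite {v. rt v \<in> G}"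
      using finite_vimageI[OF assms(1), of up] finite_vimageI[OF assms(1), of rt]
      by (simp_all add: vimage_def inj_def)
    ultimately show ?thesis using assms(1) by (auto intro: finite_subset)
  qed
  have "\<forall>a\<in>fst ` G. \<exists>y. hE (a, y) \<in> bd G" using bd_crossings(3)[OF assms(1)] by fastforce
  then obtain Y where Y: "\<And>a. a \<in> fst ` G \<Longrightarrow> hE (a, Y a) \<in> bd G" by metis
  have c1: "card (fst ` G) \<le> card (bd G)"
    by (rule card_inj_on_le[where f = "\<lambda>a. hE (a, Y a)"]) (use Y fb in \<open>auto simp: inj_on_def simp del: in_bd\<close>)
  have "G \<subseteq> fst ` G \<times> R" using assms(3) by force
  then have "card G \<le> card (fst ` G \<times> R)" using assms by (intro card_mono) auto
  also have "\<dots> \<le> card (bd G) * card R" using c1 by (simp add: card_cartesian_product)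
  finally show ?thesis .
qed

lemma area_le_square:
  assumes "finite G" "finite (bd G)" shows "card G \<le> (card (bd G))^2"
proof -
  have "\<forall>b\<in>snd ` G. \<exists>x. vE (x, b) \<in> bd G" using bd_crossings(1)[OF assms(1)] by fastforce
  then obtain X where X: "\<And>b. b \<in> snd ` G \<Longrightarrow> vE (X b, b) \<in> bd G" by metis
  have "card (snd ` G) \<le> card (bd G)"
    by (rule card_inj_on_le[where f = "\<lambda>b. vE (X b, b)"]) (use X assms in \<open>auto simp: inj_on_def simp del: in_bd\<close>)
  then have "card (bd G) * card (snd ` G) \<le> (card (bd G))^2" by (simp add: power2_eq_square)
  then show ?thesis using area_le[OF assms(1), of "snd ` G"] assms by simp
qed

lemma first_crossing:
  assumes "finite G" "(a, b) \<in> G"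
  obtains k where "hE (a, b + int k) \<in> bd G" "\<And>j. j \<le> k \<Longrightarrow> (a, b + int j) \<in> G"
proof -
  have ex: "\<exists>k. hE (a, b + int k) \<in> bd G"
  proof -
    obtain y where "y \<ge> b" "hE (a, y) \<in> bd G" using bd_crossings(3)[OF assms] by blast
    then have "hE (a, b + int (nat (y - b))) \<in> bd G" by simp
    then show ?thesis ..
  qed
  define k where "k = (LEAST k. hE (a, b + int k) \<in> bd G)"
  have k: "hE (a, b + int k) \<in> bd G" unfolding k_def using ex by (rule LeastI_ex)
  have "(a, b + int j) \<in> G" if "j \<le> k" for j
    using that
  proof (induction j)
    case 0 then show ?case using assms by simp
  next
    case (Suc j)
    then have "hE (a, b + int j) \<notin> bd G" using not_less_Least[of j "\<lambda>k. hE (a, b + int k) \<in> bd G"] Suc.prems unfolding k_def by (metis Suc_le_lessD)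
    then have "(a, b + int j) \<in> G \<longleftrightarrow> (a, b + int j + 1) \<in> G" unfolding bd_pair by blast
    moreover have "b + int (Suc j) = b + int j + 1" by simp
    ultimately show ?case using Suc by (metis Suc_leD)
  qed
  then show ?thesis using that k by blast
qed

text \<open>Each of the \<open>k + 1\<close> rows is crossed by the boundary on the right and on the
  left, and the column of \<open>a\<close> above and below. A boundary whose first edge above a site
  is \<open>k\<close> rows away is therefore long, which makes the sum over \<open>k\<close>
  converge in the Peierls estimate.\<close>

lemma loop_length:
  assumes "finite G" "finite (bd G)" "hE (a, b + int k) \<in> bd G" "\<And>j. j \<le> k \<Longrightarrow> (a, b + int j) \<in> G"
  shows "2 * k + 4 \<le> card (bd G)"
proof -
  have "\<forall>j\<in>{..k}. \<exists>x\<ge>a. vE (x, b + int j) \<in> bd G" "\<forall>j\<in>{..k}. \<exists>x<a. vE (x, b + int j) \<in> bd G"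
    using bd_crossings(1,2)[OF assms(1) assms(4)] by auto
  then obtain R L where R: "\<And>j. j \<le> k \<Longrightarrow> R j \<ge> a \<and> vE (R j, b + int j) \<in> bd G"
    and L: "\<And>j. j \<le> k \<Longrightarrow> L j < a \<and> vE (L j, b + int j) \<in> bd G" by (metis atMost_iff)
  obtain y where y: "y < b" "hE (a, y) \<in> bd G" using bd_crossings(4)[OF assms(1), of a b] assms(4)[of 0] by auto
  define X where "X = (\<lambda>j. vE (R j, b + int j)) ` {..k} \<union> (\<lambda>j. vE (L j, b + int j)) ` {..k} \<union> {hE (a, b + int k), hE (a, y)}"
  have inj: "inj_on (\<lambda>j. vE (R j, b + int j)) {..k}" "inj_on (\<lambda>j. vE (L j, b + int j)) {..k}"
    by (auto simp: inj_on_def)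
  have d: "(\<lambda>j. vE (R j, b + int j)) ` {..k} \<inter> (\<lambda>j. vE (L j, b + int j)) ` {..k} = {}"
  proof -
    have "vE (R i, b + int i) \<noteq> vE (L j, b + int j)" if "i \<le> k" "j \<le> k" for i j
      using R[OF that(1)] L[OF that(2)] by auto
    then show ?thesis unfolding disjoint_iff by blast
  qed
  have "card X = card ((\<lambda>j. vE (R j, b + int j)) ` {..k} \<union> (\<lambda>j. vE (L j, b + int j)) ` {..k}) + card {hE (a, b + int k), hE (a, y)}"
    unfolding X_def by (intro card_Un_disjoint) auto
  also have "\<dots> = (k + 1) + (k + 1) + 2"
    using card_Un_disjoint[OF _ _ d] inj y(1) by (simp add: card_image)
  finally have "card X = 2 * k + 4" by simp
  moreover have "X \<subseteq> bd G" unfolding X_def using R L y assms(3) by auto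
  ultimately show ?thesis using card_mono[OF assms(2)] by metis
qed

text \<open>A site is put into \<open>Y\<close> if an odd number of horizontal edges of its column
  lie above it. The corner \<open>(int N, -1)\<close> is exempt from the parity condition: the
  argument sweeps the bottom row from the left and never has to cross it. For an interface this
  means that its right end need not be located beforehand.\<close>

lemma cycle_space:
  assumes E: "E \<subseteq> Ed N" and ev: "\<And>u. u \<noteq> (int N, -1) \<Longrightarrow> even (ddeg E u)"
  shows "\<exists>Y\<subseteq>box N. bd Y = E"
proof -
  have EL: "E \<subseteq> lattice_edges" using E Ed_lattice by blast
  define S where "S x y = {j. y \<le> j \<and> hE (x, j) \<in> E}" for x y
  have hin: "0 \<le> x \<and> x \<le> int N \<and> -1 \<le> j \<and> j \<le> int N" if "hE (x, j) \<in> E" for x j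
    using that E in_Ed(1)[of "(x, j)" N] by auto
  have vin: "-1 \<le> x \<and> x \<le> int N \<and> 0 \<le> j \<and> j \<le> int N" if "vE (x, j) \<in> E" for x j
    using that E in_Ed(2)[of "(x, j)" N] by auto
  have fin: "finite (S x y)" for x y
    by (rule finite_subset[of _ "{-1..int N}"]) (use hin in \<open>auto simp: S_def\<close>)
  have S_step: "card (S x y) = of_bool (hE (x, y) \<in> E) + card (S x (y + 1))" for x y
  proof -
    have "S x y = (if hE (x, y) \<in> E then insert y (S x (y + 1)) else S x (y + 1))"
      unfolding S_def by (auto simp: order_le_less)
    then show ?thesis using fin[of x "y + 1"] by (simp add: S_def)
  qed
  have S_top: "S x y = {}" if "y > int N" for x y
    using hin that by (force simp: S_def)
  \<comment> \<open>Downward induction from the empty region above the box; each step uses evenness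
    at the dual vertex between the two columns.\<close>
  have vpar: "(vE (x, y) \<in> E) \<longleftrightarrow> odd (card (S x y) + card (S (x + 1) y))" if "y \<ge> 0 \<or> (y = -1 \<and> x \<noteq> int N)" for x y
    using that
  proof (induction "nat (int N + 1 - y)" arbitrary: y)
    case 0
    then show ?case using S_top vin[of x y] by force
  next
    case (Suc n)
    then have IH: "(vE (x, y + 1) \<in> E) \<longleftrightarrow> odd (card (S x (y + 1)) + card (S (x + 1) (y + 1)))" by auto
    have "even (ddeg E (x, y))" using Suc.prems by (intro ev) auto
    then show ?case unfolding ddeg_sum[OF EL] up_pair rt_pair
      using IH S_step[of x y] S_step[of "x + 1" y]
      by (cases "vE (x, y + 1) \<in> E"; cases "vE (x, y) \<in> E"; cases "hE (x, y) \<in> E"; cases "hE (x + 1, y) \<in> E"; simp)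
  qed
  \<comment> \<open>There are no vertical edges in row \<open>-1\<close>, so neighbouring columns
    have equal parity, starting from the empty column \<open>-1\<close>.\<close>
  have col: "even (card (S x (-1)))" for x
  proof (cases "0 \<le> x \<and> x \<le> int N")
    case False
    then have "S x (-1) = {}" using hin by (force simp: S_def)
    then show ?thesis by simp
  next
    case True
    have "even (card (S (int n - 1) (-1)))" if "n \<le> Suc N" for n
      using that
    proof (induction n)
      case 0
      have "S (-1) (-1) = {}" using hin by (force simp: S_def)
      then show ?case by simp
    next
      case (Suc n)
      have "vE (int n - 1, -1) \<notin> E" using vin[of "int n - 1" "-1"] by auto
      moreover have "int n - 1 \<noteq> int N" using Suc.prems by auto
      ultimately show ?case using vpar[of "-1" "int n - 1"] Suc by simp
    qed
    moreover have "nat (x + 1) \<le> Suc N" "int (nat (x + 1)) - 1 = x" using True by auto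
    ultimately show ?thesis by metis
  qed
  define Y where "Y = {v. odd (card (S (fst v) (snd v)))}"
  have low: "S x y = S x (-1)" if "y \<le> -1" for x y
    unfolding S_def using that hin by force
  have Yb: "(x, y) \<in> box N" if "(x, y) \<in> Y" for x y
  proof -
    have o: "odd (card (S x y))" using that by (simp add: Y_def)
    then have ne: "S x y \<noteq> {}" by auto
    then obtain j where "hE (x, j) \<in> E" by (auto simp: S_def)
    moreover have "y \<le> int N" using S_top[of y x] ne by (cases "y \<le> int N") auto
    moreover have "\<not> y \<le> -1" using low[of y x] col[of x] o by metis
    ultimately show ?thesis using hin[of x j] by (simp add: box_def)
  qed
  then have Ybox: "Y \<subseteq> box N" by auto
  have "bd Y = E"
  proof (rule edge_set_eqI[OF bd_subset_lattice EL])
    fix v :: "int \<times> int"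
    obtain x y where v: "v = (x, y)" by (cases v)
    show "hE v \<in> bd Y \<longleftrightarrow> hE v \<in> E"
      unfolding v bd_pair Y_def mem_Collect_eq fst_conv snd_conv using S_step[of x y] by (cases "hE (x, y) \<in> E") auto
    show "vE v \<in> bd Y \<longleftrightarrow> vE v \<in> E"
    proof (cases "y \<ge> 0")
      case True
      then show ?thesis unfolding v bd_pair Y_def mem_Collect_eq fst_conv snd_conv using vpar[of y x] by auto
    next
      case False
      then have "(x, y) \<notin> Y" "(x + 1, y) \<notin> Y" using Yb[of x y] Yb[of "x + 1" y] by (auto simp: box_def)
      moreover have "vE (x, y) \<notin> E" using vin[of x y] False by auto
      ultimately show ?thesis unfolding v bd_pair by simp
    qed
  qed
  then show ?thesis using Ybox by blast
qed

section \<open>Components as non-backtracking walks\<close>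

definition nbrs :: "dvert \<Rightarrow> dvert set" where
  "nbrs u = {(fst u + 1, snd u), (fst u - 1, snd u), (fst u, snd u + 1), (fst u, snd u - 1)}"

lemma card_lattice_edge: "e \<in> lattice_edges \<Longrightarrow> card e = 2"
  by (auto elim!: lattice_edges_cases simp: hE_def vE_def prod_eq_iff card_insert_if)

lemma lattice_edge_other:
  assumes "e \<in> lattice_edges" "u \<in> e" shows "\<exists>c\<in>nbrs u. e = {u, c}"
proof -
  have "e \<in> star u" using assms star_iff by blast
  then consider "e = hE (rt u)" | "e = hE u" | "e = vE (up u)" | "e = vE u" by (auto simp: star_def)
  then show ?thesis by cases (auto simp: hE_def vE_def nbrs_def rt_def up_def)
qed

text \<open>A non-backtracking walk is recorded by its last vertex, the vertex before it, and the set of its edges.\<close>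

fun walks :: "dvert \<Rightarrow> dvert \<Rightarrow> nat \<Rightarrow> (dvert \<times> dvert \<times> dvert set set) set" where
  "walks a b 0 = {(b, a, {{a, b}})}"
| "walks a b (Suc n) = (\<Union>(v, u, K)\<in>walks a b n. (\<lambda>w. (w, v, insert {v, w} K)) ` (nbrs v - {u}))"

lemma walks_inv: "b \<in> nbrs a \<Longrightarrow> (v, u, K) \<in> walks a b n \<Longrightarrow> u \<in> nbrs v"
proof (induction n arbitrary: v u K)
  case 0
  then show ?case by (auto simp: nbrs_def)
next
  case (Suc n)
  then have "v \<in> nbrs u" by auto
  then show ?case by (auto simp: nbrs_def)
qed

lemma nbrs_simps [simp]: "finite (nbrs u)" "card (nbrs u) = 4"
  by (simp_all add: nbrs_def)

lemma finite_walks: "finite (walks a b n)"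
proof (induction n)
  case (Suc n)
  then show ?case unfolding walks.simps by (intro finite_UN_I) (simp_all split: prod.split)
qed simp

lemma card_walks: assumes "b \<in> nbrs a" shows "card (walks a b n) \<le> 3 ^ n"
proof (induction n)
  case (Suc n)
  have "card (walks a b (Suc n)) \<le> (\<Sum>x\<in>walks a b n. card ((\<lambda>(v, u, K). (\<lambda>w. (w, v, insert {v, w} K)) ` (nbrs v - {u})) x))"
    unfolding walks.simps by (rule card_UN_le[OF finite_walks])
  also have "\<dots> \<le> (\<Sum>x\<in>walks a b n. 3)"
  proof (rule sum_mono)
    fix x assume x: "x \<in> walks a b n"
    obtain v u K where vu: "x = (v, u, K)" by (cases x) blast
    then have "u \<in> nbrs v" using walks_inv[OF assms] x by blast
    then have "card (nbrs v - {u}) = 3" by simp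
    then show "card ((\<lambda>(v, u, K). (\<lambda>w. (w, v, insert {v, w} K)) ` (nbrs v - {u})) x) \<le> 3"
      using card_image_le[of "nbrs v - {u}" "\<lambda>w. (w, v, insert {v, w} K)"] by (simp add: vu)
  qed
  also have "\<dots> \<le> 3 ^ Suc n" using Suc by simp
  finally show ?case .
qed simp

definition walk_sets :: "dvert \<Rightarrow> dvert \<Rightarrow> nat \<Rightarrow> dvert set set set" where
  "walk_sets a b n = (\<lambda>(v, u, K). K) ` walks a b n"

lemma walk_sets: assumes "b \<in> nbrs a"
  shows "finite (walk_sets a b n)" "card (walk_sets a b n) \<le> 3 ^ n"
  using finite_walks[of a b n] card_walks[OF assms, of n] card_image_le[OF finite_walks, of "\<lambda>(v, u, K). K" a b n]
  by (simp_all add: walk_sets_def)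

lemma walks_path:
  assumes "\<And>i. i \<le> n \<Longrightarrow> p (Suc i) \<in> nbrs (p i)" "\<And>i. i < n \<Longrightarrow> p (Suc (Suc i)) \<noteq> p i"
  shows "(p (Suc n), p n, (\<lambda>i. {p i, p (Suc i)}) ` {..n}) \<in> walks (p 0) (p 1) n"
  using assms
proof (induction n)
  case (Suc n)
  then have "(p (Suc n), p n, (\<lambda>i. {p i, p (Suc i)}) ` {..n}) \<in> walks (p 0) (p 1) n" by simp
  moreover have "p (Suc (Suc n)) \<in> nbrs (p (Suc n)) - {p n}" using Suc.prems by simp
  moreover have "(\<lambda>i. {p i, p (Suc i)}) ` {..Suc n} = insert {p (Suc n), p (Suc (Suc n))} ((\<lambda>i. {p i, p (Suc i)}) ` {..n})"
    by (simp add: atMost_Suc)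
  ultimately show ?case unfolding walks.simps UN_iff
    by (intro bexI[of _ "(p (Suc n), p n, (\<lambda>i. {p i, p (Suc i)}) ` {..n})"]) simp_all
qed simp

definition trail :: "dvert set set \<Rightarrow> (nat \<Rightarrow> dvert) \<Rightarrow> nat \<Rightarrow> bool" where
  "trail E p m \<longleftrightarrow> (\<forall>i\<le>m. {p i, p (Suc i)} \<in> E) \<and> inj_on (\<lambda>i. {p i, p (Suc i)}) {..m} \<and>
     (\<forall>i<m. joined_at E (p (Suc i)) {p i, p (Suc i)} {p (Suc i), p (Suc (Suc i))})"

lemma trail_extend:
  assumes "E \<subseteq> lattice_edges" "trail E p m" "joined_at E (p (Suc m)) {p m, p (Suc m)} f" "f \<notin> (\<lambda>i. {p i, p (Suc i)}) ` {..m}"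
  shows "\<exists>q. trail E q (Suc m) \<and> (\<forall>i\<le>Suc m. q i = p i)"
proof -
  have "f \<in> E" "p (Suc m) \<in> f" using assms(3) by (simp_all add: joined_at_def)
  then obtain c where c: "f = {p (Suc m), c}" using lattice_edge_other[of f "p (Suc m)"] assms(1) by blast
  define q where "q = p(Suc (Suc m) := c)"
  have q: "q i = p i" if "i \<le> Suc m" for i using that by (simp add: q_def)
  have eq: "{q i, q (Suc i)} = {p i, p (Suc i)}" if "i \<le> m" for i using q that by simp
  have last: "{q (Suc m), q (Suc (Suc m))} = f" using c by (simp add: q_def)
  have "{q i, q (Suc i)} \<in> E" if "i \<le> Suc m" for i
    using that assms(2) eq[of i] last \<open>f \<in> E\<close> by (cases "i = Suc m") (auto simp: trail_def)
  moreover have "inj_on (\<lambda>i. {q i, q (Suc i)}) {..Suc m}"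
  proof -
    have "inj_on (\<lambda>i. {q i, q (Suc i)}) {..m} \<longleftrightarrow> inj_on (\<lambda>i. {p i, p (Suc i)}) {..m}"
      by (rule inj_on_cong) (use eq in auto)
    moreover have "(\<lambda>i. {q i, q (Suc i)}) ` {..m} = (\<lambda>i. {p i, p (Suc i)}) ` {..m}" by (rule image_cong) (use eq in auto)
    ultimately show ?thesis using assms(2,4) last by (auto simp: atMost_Suc trail_def)
  qed
  moreover have "joined_at E (q (Suc i)) {q i, q (Suc i)} {q (Suc i), q (Suc (Suc i))}" if "i < Suc m" for i
  proof (cases "i = m")
    case True
    then show ?thesis using assms(3) last eq[of m] q[of "Suc m"] by (simp only: order_refl)
  next
    case False
    then have "i < m" using that by simp
    then have "q i = p i" "q (Suc i) = p (Suc i)" "q (Suc (Suc i)) = p (Suc (Suc i))" using q by simp_all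
    then show ?thesis using assms(2) \<open>i < m\<close> by (simp add: trail_def)
  qed
  ultimately have "trail E q (Suc m)" by (simp add: trail_def)
  then show ?thesis using q by blast
qed

text \<open>A joined trail of maximal length either dies at a vertex without partner or closes up at its start,
  so it exhausts the component.\<close>

lemma comp_trail:
  assumes E: "E \<subseteq> lattice_edges" "finite E" and e0: "{a, b} \<in> E" "a \<noteq> b"
    and start: "(\<nexists>f. joined_at E a {a, b} f) \<or> (\<forall>e\<in>E. \<forall>u\<in>e. \<exists>f. joined_at E u e f)"
  shows "\<exists>p m. p 0 = a \<and> p 1 = b \<and> trail E p m \<and> comp E {a, b} = (\<lambda>i. {p i, p (Suc i)}) ` {..m}"
proof -
  define M where "M = {m. \<exists>p. p 0 = a \<and> p 1 = b \<and> trail E p m}"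
  have "m \<le> card E" if mM: "m \<in> M" for m
  proof -
    obtain p where "trail E p m" using mM unfolding M_def by blast
    then have "card {..m} \<le> card E" by (intro card_inj_on_le[where f = "\<lambda>i. {p i, p (Suc i)}"] E) (auto simp: trail_def)
    then show ?thesis by simp
  qed
  then have "M \<subseteq> {..card E}" by blast
  then have finM: "finite M" by (rule finite_subset) simp
  have "0 \<in> M" unfolding M_def mem_Collect_eq
    by (intro exI[of _ "\<lambda>i. if i = 0 then a else b"]) (use e0 in \<open>auto simp: trail_def\<close>)
  define m where "m = Max M"
  have "m \<in> M" unfolding m_def using Max_in[OF finM] \<open>0 \<in> M\<close> by blast
  then obtain p where p: "p 0 = a" "p 1 = b" "trail E p m" by (auto simp: M_def)
  define e where "e i = {p i, p (Suc i)}" for i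
  have eE: "e i \<in> E" if "i \<le> m" for i using p(3) that by (simp add: trail_def e_def)
  have inj: "i = j" if "i \<le> m" "j \<le> m" "e i = e j" for i j
    using p(3) that unfolding trail_def e_def inj_on_def by blast
  have jn: "joined_at E (p (Suc i)) (e i) (e (Suc i))" if "i < m" for i
    using p(3) that unfolding trail_def e_def by blast
  have last: "f \<in> e ` {..m}" if j: "joined_at E (p (Suc m)) (e m) f" for f
  proof (rule ccontr)
    assume "f \<notin> e ` {..m}"
    then obtain q where q: "trail E q (Suc m)" "\<forall>i\<le>Suc m. q i = p i"
      using trail_extend[OF E(1) p(3), of f] j by (auto simp: e_def[abs_def])
    then have "Suc m \<in> M" unfolding M_def mem_Collect_eq using p by (intro exI[of _ q]) auto
    then show False using Max_ge[OF finM, of "Suc m"] by (simp add: m_def)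
  qed
  note uniq = joined_at_unique[OF E(1)]
  have first: "f \<in> e ` {..m}" if f: "joined_at E (p 0) (e 0) f" for f
    using start
  proof
    assume "\<nexists>f. joined_at E a {a, b} f"
    then show ?thesis using f p(1,2) unfolding e_def by simp
  next
    assume "\<forall>e\<in>E. \<forall>u\<in>e. \<exists>f. joined_at E u e f"
    moreover have "p (Suc m) \<in> e m" by (simp add: e_def)
    moreover have "e m \<in> E" using eE by simp
    \<comment> \<open>The last edge has a partner, which by maximality lies on the trail. At all
      other vertices the partners are already taken, so it must be the first edge at its starting
      vertex, and the trail closes up.\<close>
    ultimately obtain g where g: "joined_at E (p (Suc m)) (e m) g" by blast
    then obtain j where j: "j \<le> m" "g = e j" using last by auto
    have g': "joined_at E (p (Suc m)) (e j) (e m)" using joined_at_sym[OF g] j by simp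
    have jm: "j \<noteq> m" using g j by (auto simp: joined_at_def)
    have "p (Suc m) \<in> e j" using g' by (simp add: joined_at_def)
    then consider "p (Suc m) = p (Suc j)" | "p (Suc m) = p j" by (auto simp: e_def)
    then show ?thesis
    proof cases
      case 1
      have "joined_at E (p (Suc j)) (e j) (e m)" using g' 1 by simp
      then have "e (Suc j) = e m" using jn[of j] j jm by (intro uniq[of "p (Suc j)" "e j"]) auto
      then have "Suc j = m" using inj[of "Suc j" m] j jm by auto
      then have "e m = {p m, p m}" using 1 by (simp add: e_def)
      moreover have "card (e m) = 2" using E(1) eE[of m] card_lattice_edge by blast
      ultimately show ?thesis by simp
    next
      case 2
      show ?thesis
      proof (cases j)
        case 0
        then have "joined_at E (p 0) (e 0) (e m)" using g' 2 by simp
        then have "f = e m" by (rule uniq[OF f])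
        then show ?thesis by blast
      next
        case (Suc i)
        have "joined_at E (p (Suc i)) (e (Suc i)) (e i)" using joined_at_sym[OF jn[of i]] j Suc by simp
        moreover have "joined_at E (p (Suc i)) (e (Suc i)) (e m)" using g' 2 Suc by simp
        ultimately have "e i = e m" by (rule uniq)
        then show ?thesis using inj[of i m] j Suc by auto
      qed
    qed
  qed
  have "jclosed E (e ` {..m})"
    unfolding jclosed_def
  proof (intro conjI ballI allI impI)
    show "e ` {..m} \<subseteq> E" using eE by auto
  next
    fix x f assume x: "x \<in> e ` {..m}" and "joined E x f"
    then obtain u where u: "joined_at E u x f" unfolding joined_def by blast
    obtain i where i: "i \<le> m" "x = e i" using x by blast
    have "u \<in> e i" using u i by (simp add: joined_at_def)
    then consider "u = p i" | "u = p (Suc i)" by (auto simp: e_def)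
    then show "f \<in> e ` {..m}"
    proof cases
      case 1
      show ?thesis
      proof (cases i)
        case 0
        then show ?thesis using first[of f] u i 1 by simp
      next
        case (Suc k)
        have "joined_at E (p (Suc k)) (e (Suc k)) (e k)" using joined_at_sym[OF jn[of k]] i Suc by simp
        moreover have "joined_at E (p (Suc k)) (e (Suc k)) f" using u i 1 Suc by simp
        ultimately have "e k = f" by (rule uniq)
        then show ?thesis using i Suc by auto
      qed
    next
      case 2
      show ?thesis
      proof (cases "i = m")
        case True
        then show ?thesis using last[of f] u i 2 by simp
      next
        case False
        then have "f = e (Suc i)" using uniq[of "p (Suc i)" "e i" f "e (Suc i)"] jn[of i] u i 2 by simp
        then show ?thesis using i False by auto
      qed
    qed
  qed
  moreover have e0e: "e 0 = {a, b}" using p by (simp add: e_def)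
  moreover have "e 0 \<in> e ` {..m}" by (rule imageI) simp
  ultimately have "comp E {a, b} \<subseteq> e ` {..m}" using comp_minimal[of E "e ` {..m}" "{a, b}"] by argo
  moreover have "e i \<in> comp E {a, b}" if "i \<le> m" for i
    using that
  proof (induction i)
    case (Suc i)
    then have "joined E (e i) (e (Suc i))" using jn[of i] Suc.prems unfolding joined_def by (metis Suc_le_lessD)
    then show ?case using Suc comp_step by simp
  qed (simp add: e0e)
  ultimately have "comp E {a, b} = e ` {..m}" by (intro equalityI image_subsetI) simp_all
  then show ?thesis using p unfolding e_def by blast
qed

text \<open>The walk determines the component, so counting walks counts components. The bound on
  heights is recorded because the fingers are later shown to be long by their vertical
  extent.\<close>

lemma comp_walk_sets:
  assumes E: "E \<subseteq> lattice_edges" "finite E" and e0: "{a, b} \<in> E" "b \<in> nbrs a"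
    and start: "(\<nexists>f. joined_at E a {a, b} f) \<or> (\<forall>e\<in>E. \<forall>u\<in>e. \<exists>f. joined_at E u e f)"
  shows "\<exists>m. comp E {a, b} \<in> walk_sets a b m \<and> card (comp E {a, b}) = Suc m
    \<and> (\<forall>e\<in>comp E {a, b}. \<forall>u\<in>e. \<bar>snd u - snd a\<bar> \<le> int (Suc m))"
proof -
  have "a \<noteq> b" using e0(2) by (auto simp: nbrs_def prod_eq_iff)
  then obtain p m where p: "p 0 = a" "p 1 = b" "trail E p m" and C: "comp E {a, b} = (\<lambda>i. {p i, p (Suc i)}) ` {..m}"
    using comp_trail[OF E e0(1) _ start] by blast
  have nb: "p (Suc i) \<in> nbrs (p i)" if "i \<le> m" for i
  proof -
    have "{p i, p (Suc i)} \<in> lattice_edges" using p(3) E(1) that by (auto simp: trail_def)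
    then obtain c where c: "c \<in> nbrs (p i)" "{p i, p (Suc i)} = {p i, c}" using lattice_edge_other[of _ "p i"] by blast
    moreover have "c \<noteq> p i" using c by (auto simp: nbrs_def prod_eq_iff)
    ultimately show ?thesis by (auto simp: doubleton_eq_iff)
  qed
  have inj: "inj_on (\<lambda>i. {p i, p (Suc i)}) {..m}" using p(3) by (simp add: trail_def)
  have nr: "p (Suc (Suc i)) \<noteq> p i" if "i < m" for i
  proof
    assume "p (Suc (Suc i)) = p i"
    then have "{p (Suc i), p (Suc (Suc i))} = {p i, p (Suc i)}" by auto
    then show False using inj_onD[OF inj, of "Suc i" i] that by simp
  qed
  have "(p (Suc m), p m, comp E {a, b}) \<in> walks a b m" using walks_path[of m p, OF nb nr] p(1,2) C by simp
  then have W: "comp E {a, b} \<in> walk_sets a b m" unfolding walk_sets_def by force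
  have c: "card (comp E {a, b}) = Suc m" unfolding C by (simp add: card_image[OF inj])
  have "\<bar>snd (p i) - snd a\<bar> \<le> int i" if "i \<le> Suc m" for i
    using that
  proof (induction i)
    case (Suc i)
    then have "p (Suc i) \<in> nbrs (p i)" using nb by simp
    then have "\<bar>snd (p (Suc i)) - snd (p i)\<bar> \<le> 1" by (auto simp: nbrs_def)
    then show ?case using Suc by auto
  qed (simp add: p)
  then have d: "\<bar>snd (p i) - snd a\<bar> \<le> int (Suc m)" if "i \<le> Suc m" for i using that by force
  have "\<bar>snd u - snd a\<bar> \<le> int (Suc m)" if e: "e \<in> comp E {a, b}" "u \<in> e" for e u
  proof -
    obtain i where "i \<le> m" "e = {p i, p (Suc i)}" using e(1) unfolding C by blast
    then show ?thesis using d[of i] d[of "Suc i"] e(2) by auto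
  qed
  then show ?thesis using W c by blast
qed

section \<open>Peierls estimates\<close>

text \<open>A loop is represented by the set of sites that it bounds, since this is the set to be
  flipped in the Peierls argument.\<close>

definition is_loop :: "nat \<Rightarrow> site set \<Rightarrow> bool" where
  "is_loop N G \<longleftrightarrow> G \<subseteq> box N \<and> (\<exists>Y\<subseteq>box N. \<exists>e\<in>bd Y. bd G = comp (bd Y) e)"

lemma finite_sub_box: "Y \<subseteq> box N \<Longrightarrow> finite Y"
  by (rule finite_subset[OF _ finite_box])

lemma bd_inj_box: "Y \<subseteq> box N \<Longrightarrow> Z \<subseteq> box N \<Longrightarrow> bd Y = bd Z \<Longrightarrow> Y = Z"
  by (rule bd_inj) (auto intro: finite_sub_box)

lemma closed_part_is_boundary:
  assumes Y: "Y \<subseteq> box N" and K: "jclosed (bd Y) K"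
  shows "\<exists>G\<subseteq>box N. bd G = K"
proof (rule cycle_space)
  show "K \<subseteq> Ed N" using jclosedD(1)[OF K] bd_subset_Ed[OF Y] by blast
  show "even (ddeg K u)" for u
    by (rule jclosed_even[OF split_ok_bd[OF Y] K even_ddeg_bd])
qed

lemma comp_is_loop:
  assumes "Y \<subseteq> box N" "e \<in> bd Y" shows "\<exists>G. is_loop N G \<and> bd G = comp (bd Y) e"
  using closed_part_is_boundary[OF assms(1) jclosed_comp[OF assms(2)]] assms unfolding is_loop_def by blast

lemma partner_exists:
  assumes "Y \<subseteq> box N" shows "\<forall>e\<in>bd Y. \<forall>u\<in>e. \<exists>f. joined_at (bd Y) u e f"
proof (intro ballI)
  fix e u assume e: "e \<in> bd Y" "u \<in> e"
  note S = split_okD[OF split_ok_bd[OF assms]]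
  have "e \<in> bd Y \<inter> star u" using e star_iff[of e u] bd_subset_lattice by blast
  then have "ddeg (bd Y) u \<noteq> 0" unfolding ddeg_star[OF S(1)] using S(2) by auto
  then have "ddeg (bd Y) u = 2 \<or> ddeg (bd Y) u = 4" using S(3)[of u] even_ddeg_bd[of Y u] by auto
  then show "\<exists>f. joined_at (bd Y) u e f" by (rule joined_at_exists[OF S(1) _ e])
qed

lemma is_loop_walk:
  assumes G: "is_loop N G" and e: "{a, b} \<in> bd G" "b \<in> nbrs a"
  shows "\<exists>m. bd G \<in> walk_sets a b m \<and> card (bd G) = Suc m \<and> (\<forall>e\<in>bd G. \<forall>u\<in>e. \<bar>snd u - snd a\<bar> \<le> int (Suc m))"
proof -
  obtain Y f where Y: "Y \<subseteq> box N" "f \<in> bd Y" "bd G = comp (bd Y) f" using G unfolding is_loop_def by blast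
  have c: "comp (bd Y) {a, b} = bd G" using comp_eq[of "{a, b}" "bd Y" f] e Y(3) by simp
  have "{a, b} \<in> bd Y" using comp_subset[OF Y(2)] Y(3) e(1) by blast
  then show ?thesis
    using comp_walk_sets[OF bd_subset_lattice finite_bd[OF Y(1)] _ e(2)] partner_exists[OF Y(1)] unfolding c by blast
qed

definition loops_at :: "nat \<Rightarrow> dvert set \<Rightarrow> nat \<Rightarrow> site set set" where
  "loops_at N e m = {G. is_loop N G \<and> e \<in> bd G \<and> card (bd G) = Suc m}"

lemma loops_at_sub: "G \<in> loops_at N e m \<Longrightarrow> G \<subseteq> box N \<and> e \<in> bd G \<and> card (bd G) = Suc m \<and> is_loop N G"
  by (simp add: loops_at_def is_loop_def)

lemma card_loops_at: "finite (loops_at N e m)" "card (loops_at N e m) \<le> 3 ^ m"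
proof -
  show fin: "finite (loops_at N e m)"
    by (rule finite_subset[of _ "Pow (box N)"]) (use loops_at_sub finite_box in \<open>blast, simp\<close>)
  show "card (loops_at N e m) \<le> 3 ^ m"
  proof (cases "e \<in> lattice_edges")
    case False
    then have "loops_at N e m = {}" using bd_subset_lattice loops_at_sub[of _ N e m] by blast
    then show ?thesis by simp
  next
    case True
    then have "e \<noteq> {}" using card_lattice_edge[OF True] by auto
    then obtain u where "u \<in> e" by blast
    then obtain a b where ab: "e = {a, b}" "b \<in> nbrs a" using lattice_edge_other[OF True] by blast
    have "inj_on bd (loops_at N e m)"
    proof (rule inj_onI)
      fix G G' assume "G \<in> loops_at N e m" "G' \<in> loops_at N e m" "bd G = bd G'"
      then show "G = G'" using bd_inj_box[of G N G'] loops_at_sub[of G N e m] loops_at_sub[of G' N e m] by simp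
    qed
    moreover have "bd ` loops_at N e m \<subseteq> walk_sets a b m"
    proof
      fix K assume "K \<in> bd ` loops_at N e m"
      then obtain G where "G \<in> loops_at N e m" and GK: "K = bd G" by blast
      then have G: "is_loop N G" "{a, b} \<in> bd G" "card (bd G) = Suc m" "K = bd G" using loops_at_sub[of G N e m] unfolding ab(1) by simp_all
      obtain m' where "bd G \<in> walk_sets a b m'" "card (bd G) = Suc m'" using is_loop_walk[OF G(1,2) ab(2)] by blast
      then show "K \<in> walk_sets a b m" using G(3,4) by simp
    qed
    ultimately have "card (loops_at N e m) \<le> card (walk_sets a b m)"
      by (rule card_inj_on_le[OF _ _ walk_sets(1)[OF ab(2)]])
    also have "\<dots> \<le> 3 ^ m" by (rule walk_sets[OF ab(2)])
    finally show ?thesis .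
  qed
qed

lemma sum_Sigma:
  assumes "finite A" "\<And>a. a \<in> A \<Longrightarrow> finite (B a)"
  shows "(\<Sum>t\<in>Sigma A B. f t) = (\<Sum>a\<in>A. \<Sum>b\<in>B a. f (a, b))"
  using assms by (subst sum.Sigma) (auto simp: case_prod_unfold)

lemma weighted_union_bound:
  fixes w f :: "'a \<Rightarrow> real"
  assumes "finite A" "finite T" "\<And>Y. Y \<in> A \<Longrightarrow> 0 \<le> w Y" "\<And>t. t \<in> T \<Longrightarrow> 0 \<le> c t"
    "\<And>Y. Y \<in> A \<Longrightarrow> P Y \<Longrightarrow> \<exists>t\<in>T. Q t Y \<and> f Y \<le> c t * w Y"
  shows "(\<Sum>Y\<in>{Y\<in>A. P Y}. f Y) \<le> (\<Sum>t\<in>T. c t * (\<Sum>Y\<in>{Y\<in>A. Q t Y}. w Y))"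
proof -
  have "(\<Sum>Y\<in>{Y\<in>A. P Y}. f Y) = (\<Sum>Y\<in>A. if P Y then f Y else 0)"
    using assms(1) by (rule sum.inter_filter)
  also have "\<dots> \<le> (\<Sum>Y\<in>A. \<Sum>t\<in>T. if Q t Y then c t * w Y else 0)"
  proof (rule sum_mono)
    fix Y assume Y: "Y \<in> A"
    have nn: "0 \<le> (\<Sum>t\<in>T. if Q t Y then c t * w Y else 0)" using assms(3)[OF Y] assms(4) by (intro sum_nonneg) auto
    show "(if P Y then f Y else 0) \<le> (\<Sum>t\<in>T. if Q t Y then c t * w Y else 0)"
    proof (cases "P Y")
      case True
      then obtain t where t: "t \<in> T" "Q t Y" "f Y \<le> c t * w Y" using assms(5)[OF Y] by blast
      have "(if Q t Y then c t * w Y else 0) \<le> (\<Sum>t\<in>T. if Q t Y then c t * w Y else 0)"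
        using assms(2-4) t(1) Y by (intro member_le_sum) auto
      then show ?thesis using True t by simp
    qed (use nn in simp)
  qed
  also have "\<dots> = (\<Sum>t\<in>T. \<Sum>Y\<in>A. if Q t Y then c t * w Y else 0)" by (rule sum.swap)
  also have "\<dots> = (\<Sum>t\<in>T. \<Sum>Y\<in>{Y\<in>A. Q t Y}. c t * w Y)"
    using assms(1) by (intro sum.cong refl sum.inter_filter[symmetric])
  finally show ?thesis by (simp add: sum_distrib_left)
qed

lemma union_bound:
  fixes w :: "'a \<Rightarrow> real"
  assumes "finite A" "finite T" "\<And>Y. Y \<in> A \<Longrightarrow> 0 \<le> w Y" "\<And>Y. Y \<in> A \<Longrightarrow> P Y \<Longrightarrow> \<exists>t\<in>T. Q t Y"
  shows "(\<Sum>Y\<in>{Y\<in>A. P Y}. w Y) \<le> (\<Sum>t\<in>T. \<Sum>Y\<in>{Y\<in>A. Q t Y}. w Y)"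
  using weighted_union_bound[of A T w "\<lambda>_. 1" P Q w] assms by simp

lemma pw_nonneg: "(\<And>e. e \<in> E \<Longrightarrow> 0 \<le> q e) \<Longrightarrow> 0 \<le> pw q E"
  unfolding pw_def by (rule prod_nonneg)

lemma pw_le_power:
  assumes "\<And>e. e \<in> E \<Longrightarrow> 0 \<le> q e \<and> q e \<le> z" shows "pw q E \<le> z ^ card E"
  unfolding pw_def using prod_mono[of E q "\<lambda>_. z"] assms by simp

lemma field_flip_le:
  assumes "G \<subseteq> box N" "\<And>v. v \<in> G \<Longrightarrow> \<bar>h v\<bar> \<le> l"
  shows "field N h Y \<le> field N h (Y \<triangle> G) + 2 * l * real (card G)"
proof -
  have "field N h Y - field N h (Y \<triangle> G) = (\<Sum>v\<in>box N. h v * chi {v} Y * (1 - chi {v} G))"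
    unfolding field_def sum_subtractf[symmetric] by (rule sum.cong) (simp_all add: chi_sdiff_right algebra_simps del: chi_singleton)
  also have "\<dots> = (\<Sum>v\<in>G. h v * chi {v} Y * (1 - chi {v} G))"
    using assms(1) finite_box by (intro sum.mono_neutral_right) auto
  also have "\<dots> \<le> (\<Sum>v\<in>G. 2 * l)"
  proof (rule sum_mono)
    fix v assume v: "v \<in> G"
    then show "h v * chi {v} Y * (1 - chi {v} G) \<le> 2 * l" using assms(2)[OF v] by auto
  qed
  finally show ?thesis by (simp add: algebra_simps)
qed

text \<open>Peierls' map sends \<open>Y\<close> to \<open>Y \<triangle> G\<close>. It is injective,
  erases the edges of \<open>bd G\<close>, and changes the field energy by at most
  \<open>2 * l\<close> per site of \<open>G\<close>.\<close>

lemma loop_removal: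
  assumes q: "\<And>e. 0 \<le> q e \<and> q e \<le> z" and h: "\<And>v. v \<in> box N \<Longrightarrow> \<bar>h v\<bar> \<le> l" and G: "G \<subseteq> box N"
  shows "(\<Sum>Y\<in>{Y\<in>Pow (box N). bd G \<subseteq> bd Y}. pw q (bd Y) * exp (field N h Y))
      \<le> z ^ card (bd G) * exp (2 * l * real (card G)) * Xi N q h"
proof -
  let ?A = "{Y\<in>Pow (box N). bd G \<subseteq> bd Y}" and ?c = "z ^ card (bd G) * exp (2 * l * real (card G))"
  let ?w = "\<lambda>Y. pw q (bd Y) * exp (field N h Y)"
  have z: "0 \<le> z" using q order_trans by blast
  have w: "?w Y \<le> ?c * ?w (Y \<triangle> G)" if Y: "Y \<in> ?A" for Y
  proof -
    have fin: "finite (bd Y)" using Y finite_bd by blast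
    have "pw q (bd Y) = pw q (bd Y - bd G) * pw q (bd G)"
      unfolding pw_def using Y fin prod.subset_diff[of "bd G" "bd Y" q] by simp
    also have "\<dots> \<le> pw q (bd Y - bd G) * z ^ card (bd G)"
      using q pw_le_power[of "bd G" q z] by (intro mult_left_mono pw_nonneg) auto
    finally have 1: "pw q (bd Y) \<le> z ^ card (bd G) * pw q (bd (Y \<triangle> G))"
      using Y by (simp add: bd_remove mult.commute)
    have "\<bar>h v\<bar> \<le> l" if "v \<in> G" for v using h G that by blast
    then have "exp (field N h Y) \<le> exp (field N h (Y \<triangle> G) + 2 * l * real (card G))"
      using field_flip_le[OF G, of h l Y] by simp
    then have 2: "exp (field N h Y) \<le> exp (2 * l * real (card G)) * exp (field N h (Y \<triangle> G))"
      by (simp add: exp_add mult.commute)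
    have "?w Y \<le> (z ^ card (bd G) * pw q (bd (Y \<triangle> G))) * (exp (2 * l * real (card G)) * exp (field N h (Y \<triangle> G)))"
      using 1 2 q z by (intro mult_mono mult_nonneg_nonneg pw_nonneg) auto
    then show ?thesis by (simp add: mult_ac)
  qed
  have "(\<Sum>Y\<in>?A. ?w Y) \<le> (\<Sum>Y\<in>?A. ?c * ?w (Y \<triangle> G))" using w by (rule sum_mono)
  also have "\<dots> \<le> (\<Sum>Y\<in>Pow (box N). ?c * ?w (Y \<triangle> G))"
    using q z by (intro sum_mono2 mult_nonneg_nonneg pw_nonneg) auto
  also have "\<dots> = ?c * Xi N q h"
    unfolding Xi_def sum_distrib_left using sum.reindex_bij_betw[OF bij_betw_sdiff_Pow[OF G], of "\<lambda>Y. ?c * ?w Y"] by simp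
  finally show ?thesis .
qed

text \<open>Loops can be erased one at a time by flipping the sets they bound. As long as the erased
  loop does not contain \<open>v\<close>, the site stays minus while the boundary shrinks.\<close>

lemma surrounding_loop:
  assumes "Y \<subseteq> box N" "v \<in> Y"
  shows "\<exists>G. is_loop N G \<and> v \<in> G \<and> bd G \<subseteq> bd Y"
  using assms
proof (induction "card (bd Y)" arbitrary: Y rule: less_induct)
  case less
  have fin: "finite Y" by (rule finite_sub_box[OF less.prems(1)])
  obtain x where "hE (fst v, x) \<in> bd Y" using bd_crossings(3)[OF fin, of "fst v" "snd v"] less.prems(2) by auto
  then obtain e where e: "e \<in> bd Y" by blast
  obtain G where G: "is_loop N G" "bd G = comp (bd Y) e" using comp_is_loop[OF less.prems(1) e] by blast
  have GY: "bd G \<subseteq> bd Y" unfolding G(2) by (rule comp_subset[OF e])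
  show ?case
  proof (cases "v \<in> G")
    case True
    then show ?thesis using G GY by blast
  next
    case False
    have Gb: "G \<subseteq> box N" using G by (simp add: is_loop_def)
    have r: "bd (Y \<triangle> G) = bd Y - bd G" by (rule bd_remove[OF GY])
    have "e \<in> bd G" unfolding G(2) by simp
    then have "card (bd (Y \<triangle> G)) < card (bd Y)"
      unfolding r using e finite_bd[OF less.prems(1)] by (intro psubset_card_mono) blast+
    moreover have "v \<in> Y \<triangle> G" using False less.prems(2) by simp
    ultimately obtain G' where "is_loop N G'" "v \<in> G'" "bd G' \<subseteq> bd (Y \<triangle> G)"
      using less.hyps sdiff_subset[OF less.prems(1) Gb] by blast
    then show ?thesis unfolding r by blast
  qed
qed

text \<open>The linear bound keeps the field energy proportional to the length when the field is of
  order \<open>1 / N\<close>; the quadratic bound is independent of \<open>N\<close> and serves the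
  estimate of mean areas.\<close>

lemma loop_area:
  assumes "G \<subseteq> box N" shows "card G \<le> card (bd G) * Suc N" "card G \<le> (card (bd G))\<^sup>2"
proof -
  have "snd ` G \<subseteq> {0..int N}" using assms by (auto simp: box_def)
  moreover have "card {0..int N} = Suc N" by simp
  ultimately show "card G \<le> card (bd G) * Suc N" using area_le[of G "{0..int N}"] finite_sub_box[OF assms] by (metis finite_atLeastAtMost_int)
  show "card G \<le> (card (bd G))\<^sup>2" by (rule area_le_square[OF finite_sub_box[OF assms] finite_bd[OF assms]])
qed

lemma geometric_tail_le:
  fixes r :: real
  assumes "0 \<le> r" "r < 1" shows "(\<Sum>m\<in>{a..b}. r ^ m) \<le> r ^ a / (1 - r)"
proof -
  have "(\<Sum>m\<in>{a..b}. r ^ m) \<le> (\<Sum>m. r ^ (m + a))"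
  proof -
    have "(\<Sum>m\<in>{a..b}. r ^ m) \<le> (\<Sum>m\<in>{0+a..b+a}. r ^ m)" using assms by (intro sum_mono2) auto
    also have "\<dots> = (\<Sum>m\<in>{0..b}. r ^ (m + a))" by (rule sum.shift_bounds_cl_nat_ivl)
    also have "\<dots> \<le> (\<Sum>m. r ^ (m + a))"
      using assms by (intro sum_le_suminf) (auto simp: power_add intro!: summable_mult2 summable_geometric)
    finally show ?thesis .
  qed
  also have "\<dots> = (\<Sum>m. r ^ m) * r ^ a" using assms by (simp add: power_add suminf_mult2 summable_geometric)
  also have "\<dots> = r ^ a / (1 - r)" using assms by (simp add: suminf_geometric)
  finally show ?thesis .
qed

text \<open>Peierls sum over the first crossing, \<open>k\<close> rows above \<open>v\<close>, and
  over the loops of length \<open>m + 1 \<ge> 2 * k + 4\<close> through it. With \<open>r\<close>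
  three times the weight per edge, field energy included, the sum is \<open>r / 3\<close> times a
  double geometric series below 5/4. The result 1/4 is what a magnetization of at least 1/2
  requires.\<close>

lemma minus_probability:
  assumes q: "\<And>e. 0 \<le> q e \<and> q e \<le> z" and h: "\<And>v. v \<in> box N \<Longrightarrow> \<bar>h v\<bar> \<le> l" and v: "v \<in> box N"
    and l: "0 \<le> l" and small: "3 * (z * exp (2 * l * (real N + 1))) \<le> 3 / 5"
  shows "(\<Sum>Y\<in>{Y\<in>Pow (box N). v \<in> Y}. pw q (bd Y) * exp (field N h Y)) \<le> 1 / 4 * Xi N q h"
proof -
  define r where "r = 3 * (z * exp (2 * l * (real N + 1)))"
  define y where "y = z * exp (2 * l * (real N + 1))"
  have z: "0 \<le> z" using q order_trans by blast
  have r: "0 \<le> r" "r \<le> 3 / 5" using z small by (simp_all add: r_def)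
  define M where "M = card (Ed N)"
  let ?w = "\<lambda>Y. pw q (bd Y) * exp (field N h Y)"
  have w: "0 \<le> ?w Y" for Y using q by (intro mult_nonneg_nonneg pw_nonneg) auto
  have Xi: "0 \<le> Xi N q h" unfolding Xi_def using w by (rule sum_nonneg)
  define T where "T = (SIGMA k:{..M}. SIGMA m:{2 * k + 3..M}. loops_at N (hE (fst v, snd v + int k)) m)"
  have finT: "finite T" unfolding T_def using card_loops_at(1) by (intro finite_SigmaI) auto
  have "(\<Sum>Y\<in>{Y\<in>Pow (box N). v \<in> Y}. ?w Y) \<le> (\<Sum>t\<in>T. \<Sum>Y\<in>{Y\<in>Pow (box N). bd (snd (snd t)) \<subseteq> bd Y}. ?w Y)"
  proof (rule union_bound[OF _ finT])
    fix Y assume Y: "Y \<in> Pow (box N)" "v \<in> Y"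
    then obtain G where G: "is_loop N G" "v \<in> G" "bd G \<subseteq> bd Y" using surrounding_loop by blast
    have Gb: "G \<subseteq> box N" using G by (simp add: is_loop_def)
    have "(fst v, snd v) \<in> G" using G by simp
    then obtain k where k: "hE (fst v, snd v + int k) \<in> bd G" "\<And>j. j \<le> k \<Longrightarrow> (fst v, snd v + int j) \<in> G"
      using first_crossing[OF finite_sub_box[OF Gb]] by metis
    have len: "2 * k + 4 \<le> card (bd G)" by (rule loop_length[OF finite_sub_box[OF Gb] finite_bd[OF Gb] k])
    have "card (bd G) \<le> M" unfolding M_def by (rule card_mono[OF finite_Ed bd_subset_Ed[OF Gb]])
    then have "k \<in> {..M}" "card (bd G) - 1 \<in> {2 * k + 3..M}" "Suc (card (bd G) - 1) = card (bd G)" using len by auto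
    then have "(k, card (bd G) - 1, G) \<in> T" unfolding T_def using k(1) G(1) by (simp add: loops_at_def del: in_bd)
    then show "\<exists>t\<in>T. bd (snd (snd t)) \<subseteq> bd Y" using G(3) by (intro bexI) simp_all
  qed (use w finite_box in auto)
  also have "\<dots> \<le> (\<Sum>t\<in>T. y ^ Suc (fst (snd t)) * Xi N q h)"
  proof (rule sum_mono)
    fix t assume "t \<in> T"
    then obtain k m G where t: "t = (k, m, G)" "G \<in> loops_at N (hE (fst v, snd v + int k)) m"
      unfolding T_def by auto
    have Gb: "G \<subseteq> box N" "card (bd G) = Suc m" using loops_at_sub[OF t(2)] by auto
    have "real (card G) \<le> real (card (bd G) * Suc N)" using loop_area(1)[OF Gb(1)] by (rule of_nat_mono)
    then have "2 * l * real (card G) \<le> 2 * l * real (card (bd G) * Suc N)" using l by (intro mult_left_mono) auto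
    also have "\<dots> = real (Suc m) * (2 * l * (real N + 1))" by (simp add: Gb(2) algebra_simps)
    finally have "exp (2 * l * real (card G)) \<le> exp (2 * l * (real N + 1)) ^ Suc m"
      by (simp only: exp_of_nat_mult[symmetric] exp_le_cancel_iff)
    then have "z ^ Suc m * exp (2 * l * real (card G)) \<le> y ^ Suc m"
      unfolding y_def power_mult_distrib using z by (intro mult_left_mono) auto
    then have "z ^ card (bd G) * exp (2 * l * real (card G)) * Xi N q h \<le> y ^ Suc m * Xi N q h"
      unfolding Gb(2) by (rule mult_right_mono[OF _ Xi])
    then show "(\<Sum>Y\<in>{Y\<in>Pow (box N). bd (snd (snd t)) \<subseteq> bd Y}. ?w Y) \<le> y ^ Suc (fst (snd t)) * Xi N q h"
      using loop_removal[of q z N h l G, OF q h Gb(1)] unfolding t(1) by simp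
  qed
  also have "\<dots> = (\<Sum>k\<le>M. \<Sum>m\<in>{2 * k + 3..M}. \<Sum>G\<in>loops_at N (hE (fst v, snd v + int k)) m. y ^ Suc m * Xi N q h)"
    unfolding T_def by (simp add: sum_Sigma card_loops_at(1) del: sum_constant)
  also have "\<dots> \<le> (\<Sum>k\<le>M. \<Sum>m\<in>{2 * k + 3..M}. r * r ^ m * (Xi N q h / 3))"
  proof (intro sum_mono)
    fix k m
    have "(\<Sum>G\<in>loops_at N (hE (fst v, snd v + int k)) m. y ^ Suc m * Xi N q h) \<le> 3 ^ m * (y ^ Suc m * Xi N q h)"
    proof -
      have "real (card (loops_at N (hE (fst v, snd v + int k)) m)) \<le> 3 ^ m"
        using card_loops_at(2)[of N _ m] by (metis of_nat_le_iff of_nat_numeral of_nat_power)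
      then show ?thesis using z Xi by (simp add: y_def mult_right_mono)
    qed
    also have "\<dots> = r * r ^ m * (Xi N q h / 3)" unfolding r_def y_def by (simp add: power_mult_distrib)
    finally show "(\<Sum>G\<in>loops_at N (hE (fst v, snd v + int k)) m. y ^ Suc m * Xi N q h) \<le> r * r ^ m * (Xi N q h / 3)" .
  qed
  also have "\<dots> = r * (Xi N q h / 3) * (\<Sum>k\<le>M. \<Sum>m\<in>{2 * k + 3..M}. r ^ m)"
    by (simp add: sum_distrib_left mult_ac)
  also have "\<dots> \<le> (3/5) * (Xi N q h / 3) * (5/4)"
  proof (intro mult_mono)
    have "(\<Sum>k\<le>M. \<Sum>m\<in>{2 * k + 3..M}. r ^ m) \<le> (\<Sum>k\<le>M. r ^ 3 / (1 - r) * (r\<^sup>2) ^ k)"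
    proof (rule sum_mono)
      fix k
      show "(\<Sum>m\<in>{2 * k + 3..M}. r ^ m) \<le> r ^ 3 / (1 - r) * (r\<^sup>2) ^ k"
        using geometric_tail_le[of r "2 * k + 3" M] r unfolding power_add power_mult by (simp only: mult_ac times_divide_eq_right times_divide_eq_left)
    qed
    also have "\<dots> \<le> r ^ 3 / (1 - r) * ((r\<^sup>2) ^ 0 / (1 - r\<^sup>2))"
      unfolding sum_distrib_left[symmetric]
    proof (rule mult_left_mono)
      have "r\<^sup>2 < 1" using r by (simp add: power_less_one_iff)
      then show "(\<Sum>k\<le>M. (r\<^sup>2) ^ k) \<le> (r\<^sup>2) ^ 0 / (1 - r\<^sup>2)"
        using geometric_tail_le[of "r\<^sup>2" 0 M] by (simp add: atMost_atLeast0)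
    qed (use r in auto)
    also have "\<dots> \<le> (3/5) ^ 3 / (1 - 3/5) * (1 / (1 - (3/5)\<^sup>2))"
    proof -
      have "r\<^sup>2 \<le> (3/5)\<^sup>2" "r ^ 3 \<le> (3/5) ^ 3" using r by (intro power_mono; simp)+
      then show ?thesis using r by (intro mult_mono frac_le) (auto simp: power2_eq_square)
    qed
    finally show "(\<Sum>k\<le>M. \<Sum>m\<in>{2 * k + 3..M}. r ^ m) \<le> 5/4" by (simp add: power2_eq_square power3_eq_cube)
  qed (use r Xi in \<open>auto intro!: sum_nonneg\<close>)
  finally show ?thesis by simp
qed

lemma magnetization_ge:
  assumes q: "\<And>e. 0 \<le> q e \<and> q e \<le> z" and h: "\<And>v. v \<in> box N \<Longrightarrow> \<bar>h v\<bar> \<le> l" and v: "v \<in> box N"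
    and l: "0 \<le> l" and small: "3 * (z * exp (2 * l * (real N + 1))) \<le> 3 / 5"
  shows "(\<Sum>Y\<in>Pow (box N). pw q (bd Y) * exp (field N h Y) * chi {v} Y) \<ge> 1 / 2 * Xi N q h"
proof -
  let ?w = "\<lambda>Y. pw q (bd Y) * exp (field N h Y)"
  have "(\<Sum>Y\<in>Pow (box N). ?w Y * chi {v} Y) = (\<Sum>Y\<in>Pow (box N). ?w Y - 2 * (if v \<in> Y then ?w Y else 0))"
    by (rule sum.cong) auto
  also have "\<dots> = Xi N q h - 2 * (\<Sum>Y\<in>{Y\<in>Pow (box N). v \<in> Y}. ?w Y)"
    unfolding Xi_def sum_subtractf sum_distrib_left[symmetric] using finite_box by (subst sum.inter_filter) auto
  finally show ?thesis using minus_probability[of q z N h l v, OF assms] by simp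
qed

text \<open>Bound for the mean area of the loop through a given edge: at most \<open>3 ^ m\<close>
  loops of length \<open>m + 1\<close>, each of weight at most \<open>z ^ m\<close> and of area at
  most the squared length.\<close>

definition loop_const :: "real \<Rightarrow> real" where
  "loop_const z = (\<Sum>m. (real m + 1)\<^sup>2 * (3 * z) ^ m)"

lemma loop_const_summable:
  assumes "0 \<le> z" "3 * z \<le> 3 / 5" shows "summable (\<lambda>m. (real m + 1)\<^sup>2 * (3 * z) ^ m)"
proof (rule summable_ratio_test[where c = "9 / 10" and N = 5])
  fix m :: nat assume m: "m \<ge> 5"
  \<comment> \<open>From \<open>m = 5\<close> on the ratio of consecutive squares is at most 3/2,
    and \<open>3 / 2 * (3 / 5) = 9 / 10\<close>.\<close>
  have "2 * (real (Suc m) + 1)\<^sup>2 \<le> 3 * (real m + 1)\<^sup>2"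
  proof -
    have "real m * real m \<ge> 5 * real m" using m by (intro mult_right_mono) auto
    moreover have "real m \<ge> 5" using m by simp
    ultimately have "5 + real m * 2 \<le> real m * real m" by linarith
    then show ?thesis by (simp add: power2_eq_square algebra_simps)
  qed
  moreover have "3 * z * (real (Suc m) + 1)\<^sup>2 \<le> 3 / 5 * (real (Suc m) + 1)\<^sup>2"
    using assms by (intro mult_right_mono) auto
  ultimately have "3 * z * (real (Suc m) + 1)\<^sup>2 \<le> 9 / 10 * (real m + 1)\<^sup>2" by linarith
  then have "(3 * z * (real (Suc m) + 1)\<^sup>2) * (3 * z) ^ m \<le> (9 / 10 * (real m + 1)\<^sup>2) * (3 * z) ^ m"
    using assms by (intro mult_right_mono) auto
  then show "norm ((real (Suc m) + 1)\<^sup>2 * (3 * z) ^ Suc m) \<le> 9 / 10 * norm ((real m + 1)\<^sup>2 * (3 * z) ^ m)"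
    using assms by (simp add: abs_mult mult_ac)
qed simp

lemma loop_const_nonneg: "0 \<le> z \<Longrightarrow> 3 * z \<le> 3 / 5 \<Longrightarrow> 0 \<le> loop_const z"
  unfolding loop_const_def by (rule suminf_nonneg[OF loop_const_summable]) auto

definition inside :: "nat \<Rightarrow> dvert set set \<Rightarrow> site set" where
  "inside N K = (THE G. G \<subseteq> box N \<and> bd G = K)"

lemma inside_bd [simp]: "G \<subseteq> box N \<Longrightarrow> inside N (bd G) = G"
  unfolding inside_def using bd_inj_box by (intro the_equality) auto

lemma inside_jclosed:
  assumes "Y \<subseteq> box N" "jclosed (bd Y) K" shows "inside N K \<subseteq> box N" "bd (inside N K) = K"
  using closed_part_is_boundary[OF assms] by auto

lemma touching_area:
  assumes q: "\<And>e. 0 \<le> q e \<and> q e \<le> z" and z: "3 * z \<le> 3 / 5"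
  shows "(\<Sum>Y\<in>{Y\<in>Pow (box N). e \<in> bd Y}. pw q (bd Y) * real (card (inside N (comp (bd Y) e))))
    \<le> loop_const z * Xi N q (\<lambda>_. 0)"
proof -
  have z0: "0 \<le> z" using q order_trans by blast
  define M where "M = card (Ed N)"
  define T where "T = (SIGMA m:{..M}. loops_at N e m)"
  have finT: "finite T" unfolding T_def using card_loops_at(1) by (intro finite_SigmaI) auto
  have w: "0 \<le> pw q (bd Y)" for Y using q by (intro pw_nonneg) auto
  have Xi: "0 \<le> Xi N q (\<lambda>_. 0)" unfolding Xi_zero using w by (rule sum_nonneg)
  have "(\<Sum>Y\<in>{Y\<in>Pow (box N). e \<in> bd Y}. pw q (bd Y) * real (card (inside N (comp (bd Y) e))))
    \<le> (\<Sum>t\<in>T. real (card (snd t)) * (\<Sum>Y\<in>{Y\<in>Pow (box N). bd (snd t) \<subseteq> bd Y}. pw q (bd Y)))"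
  proof (rule weighted_union_bound[OF _ finT])
    fix Y assume Y: "Y \<in> Pow (box N)" "e \<in> bd Y"
    then obtain G where G: "is_loop N G" "bd G = comp (bd Y) e" using comp_is_loop by blast
    have Gb: "G \<subseteq> box N" using G by (simp add: is_loop_def)
    have eG: "e \<in> bd G" unfolding G(2) by simp
    then have "card (bd G) \<noteq> 0" using finite_bd[OF Gb] by auto
    moreover have "card (bd G) \<le> M" unfolding M_def by (rule card_mono[OF finite_Ed bd_subset_Ed[OF Gb]])
    ultimately have "(card (bd G) - 1, G) \<in> T" unfolding T_def using G(1) eG by (simp add: loops_at_def)
    moreover have "bd G \<subseteq> bd Y" unfolding G(2) by (rule comp_subset[OF Y(2)])
    moreover have "inside N (comp (bd Y) e) = G" unfolding G(2)[symmetric] by (rule inside_bd[OF Gb])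
    ultimately show "\<exists>t\<in>T. bd (snd t) \<subseteq> bd Y \<and> pw q (bd Y) * real (card (inside N (comp (bd Y) e))) \<le> real (card (snd t)) * pw q (bd Y)"
      by (intro bexI[of _ "(card (bd G) - 1, G)"]) simp_all
  qed (use w finite_box in auto)
  also have "\<dots> \<le> (\<Sum>t\<in>T. (real (fst t) + 1)\<^sup>2 * z ^ fst t * Xi N q (\<lambda>_. 0))"
  proof (rule sum_mono)
    fix t assume "t \<in> T"
    then obtain m G where t: "t = (m, G)" "G \<in> loops_at N e m" unfolding T_def by auto
    have Gb: "G \<subseteq> box N" "card (bd G) = Suc m" using loops_at_sub[OF t(2)] by auto
    have "real (card G) \<le> real ((Suc m)\<^sup>2)" using loop_area(2)[OF Gb(1)] unfolding Gb(2) by (rule of_nat_mono)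
    then have c: "real (card G) \<le> (real m + 1)\<^sup>2" by (simp add: add.commute)
    have "(\<Sum>Y\<in>{Y\<in>Pow (box N). bd G \<subseteq> bd Y}. pw q (bd Y)) \<le> z ^ Suc m * Xi N q (\<lambda>_. 0)"
      using loop_removal[of q z N "\<lambda>_. 0" 0 G, OF q _ Gb(1)] by (simp add: Gb(2) field_def)
    also have "\<dots> \<le> z ^ m * Xi N q (\<lambda>_. 0)" using z0 z Xi by (intro mult_right_mono) (auto intro: mult_left_le_one_le)
    finally have "real (card G) * (\<Sum>Y\<in>{Y\<in>Pow (box N). bd G \<subseteq> bd Y}. pw q (bd Y)) \<le> (real m + 1)\<^sup>2 * (z ^ m * Xi N q (\<lambda>_. 0))"
      using c w by (intro mult_mono) (auto intro!: sum_nonneg)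
    then show "real (card (snd t)) * (\<Sum>Y\<in>{Y\<in>Pow (box N). bd (snd t) \<subseteq> bd Y}. pw q (bd Y)) \<le> (real (fst t) + 1)\<^sup>2 * z ^ fst t * Xi N q (\<lambda>_. 0)"
      unfolding t(1) by (simp add: mult_ac)
  qed
  also have "\<dots> = (\<Sum>m\<le>M. \<Sum>G\<in>loops_at N e m. (real m + 1)\<^sup>2 * z ^ m * Xi N q (\<lambda>_. 0))"
    unfolding T_def by (simp add: sum_Sigma card_loops_at(1) del: sum_constant)
  also have "\<dots> = (\<Sum>m\<le>M. real (card (loops_at N e m)) * ((real m + 1)\<^sup>2 * z ^ m * Xi N q (\<lambda>_. 0)))"
    by simp
  also have "\<dots> \<le> (\<Sum>m\<le>M. 3 ^ m * ((real m + 1)\<^sup>2 * z ^ m * Xi N q (\<lambda>_. 0)))"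
  proof (rule sum_mono)
    fix m
    have "real (card (loops_at N e m)) \<le> 3 ^ m"
      using card_loops_at(2)[of N e m] by (metis of_nat_le_iff of_nat_numeral of_nat_power)
    then show "real (card (loops_at N e m)) * ((real m + 1)\<^sup>2 * z ^ m * Xi N q (\<lambda>_. 0)) \<le> 3 ^ m * ((real m + 1)\<^sup>2 * z ^ m * Xi N q (\<lambda>_. 0))"
      using z0 Xi by (intro mult_right_mono) auto
  qed
  also have "\<dots> = (\<Sum>m\<le>M. (real m + 1)\<^sup>2 * (3 * z) ^ m) * Xi N q (\<lambda>_. 0)"
    unfolding sum_distrib_right by (rule sum.cong) (simp_all add: power_mult_distrib mult_ac)
  also have "\<dots> \<le> loop_const z * Xi N q (\<lambda>_. 0)"
    unfolding loop_const_def using z0 by (intro mult_right_mono[OF _ Xi] sum_le_suminf loop_const_summable[OF z0 z]) auto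
  finally show ?thesis .
qed

section \<open>Conditioning on the interface\<close>

text \<open>Used in two ways: with the star of the corner it singles out the interface, and with a
  general \<open>D\<close> it collects the loops to be revealed before the edges of \<open>D\<close>
  can be frozen.\<close>

definition touching :: "dvert set set \<Rightarrow> dvert set set \<Rightarrow> dvert set set" where
  "touching D S = (\<Union>e\<in>D \<inter> S. comp S e)"

lemma jclosed_touching: "jclosed S (touching D S)"
  unfolding touching_def by (rule jclosed_Union) (use jclosed_comp in blast)

lemma touching_subset: "touching D S \<subseteq> S" "D \<inter> S \<subseteq> touching D S"
  using jclosedD(1)[OF jclosed_touching] by (auto simp: touching_def)

lemma touching_Un:
  assumes "K \<subseteq> lattice_edges" "F \<subseteq> lattice_edges" "finite K" "finite F" "F \<inter> (D \<union> Dl K) = {}"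
  shows "touching D (K \<union> F) = touching D K"
proof -
  have F: "F \<inter> Dl K = {}" "D \<inter> (K \<union> F) = D \<inter> K" using assms(5) by blast+
  show ?thesis unfolding touching_def F(2) using joined_Un_Dl(3)[OF assms(1-4) F(1)] by auto
qed

lemma touching_avoids:
  assumes "split_ok S" "K = touching D S" shows "(S - K) \<inter> (D \<union> Dl K) = {}"
  using jclosed_avoids_Dl[OF assms(1) jclosed_touching[of S D]] touching_subset(2)[of D S] assms(2) by blast

text \<open>The event becomes a condition on \<open>K\<close> and one on \<open>S - K\<close>, to
  which weights can be adapted edge by edge. The witness \<open>S0\<close> guarantees that
  \<open>K\<close> is a possible value.\<close>

lemma touching_eq_iff:
  assumes S: "split_ok S" and S0: "split_ok S0" "K = touching D S0"
  shows "touching D S = K \<longleftrightarrow> K \<subseteq> S \<and> (S - K) \<inter> (D \<union> Dl K) = {}"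
proof
  assume "touching D S = K"
  then show "K \<subseteq> S \<and> (S - K) \<inter> (D \<union> Dl K) = {}" using touching_avoids[OF S, of K D] touching_subset(1)[of D S] by simp
next
  assume a: "K \<subseteq> S \<and> (S - K) \<inter> (D \<union> Dl K) = {}"
  note L = split_okD(1,2)[OF S] split_okD(1,2)[OF S0(1)]
  have K0: "K \<subseteq> S0" using touching_subset(1) S0(2) by blast
  have fin: "finite K" "K \<subseteq> lattice_edges" using K0 L finite_subset by blast+
  have "touching D (K \<union> (S - K)) = touching D K"
    by (rule touching_Un) (use a fin L in auto)
  moreover have "touching D (K \<union> (S0 - K)) = touching D K"
    by (rule touching_Un) (use touching_avoids[OF S0] fin L in auto)
  moreover have "K \<union> (S - K) = S" "K \<union> (S0 - K) = S0" using a K0 by auto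
  ultimately show "touching D S = K" using S0(2) by simp
qed

definition off :: "(dvert set \<Rightarrow> real) \<Rightarrow> dvert set set \<Rightarrow> dvert set \<Rightarrow> real" where
  "off q D e = (if e \<in> D then 0 else q e)"

lemma pw_off: assumes "finite E" shows "pw (off q D) E = (if E \<inter> D = {} then pw q E else 0)"
proof (cases "E \<inter> D = {}")
  case True
  then have "pw (off q D) E = (\<Prod>e\<in>E. q e)" unfolding pw_def by (intro prod.cong) (auto simp: off_def)
  then show ?thesis using True by (simp add: pw_def)
next
  case False
  then show ?thesis unfolding pw_def using assms by (auto simp: off_def intro!: prod_zero)
qed

lemma pw_const [simp]: "pw (\<lambda>_. z) E = z ^ card E"
  by (simp add: pw_def)

definition signed :: "real \<Rightarrow> site set \<Rightarrow> site \<Rightarrow> real" where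
  "signed l L v = (if v \<in> L then - l else l)"

lemma field_signed: "field N (\<lambda>_. l) (W \<triangle> L) = field N (signed l L) W"
  unfolding field_def by (rule sum.cong) (auto simp: signed_def)

lemma sdiff_split_iff:
  assumes "K \<subseteq> X"
  shows "K \<subseteq> K \<triangle> W \<and> (K \<triangle> W - K) \<inter> X = {} \<longleftrightarrow> W \<inter> X = {}"
  using assms unfolding sdiff_def by blast

text \<open>Conditioning on the components through \<open>D\<close> leaves an Ising model with plus boundary condition,
  whose couplings on \<open>D \<union> Dl K\<close> are infinite and whose field is reversed inside \<open>L\<close>.\<close>

lemma touching_sum:
  assumes ok: "\<And>Y. Y \<subseteq> box N \<Longrightarrow> split_ok (bd Y \<triangle> B)"
    and Y0: "Y0 \<subseteq> box N" and K: "K = touching D (bd Y0 \<triangle> B)" and L: "L \<subseteq> box N" "bd L \<triangle> B = K"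
  shows "(\<Sum>Y\<in>{Y\<in>Pow (box N). touching D (bd Y \<triangle> B) = K}. pw q (bd Y \<triangle> B) * exp (field N (\<lambda>_. l) Y))
    = pw q K * Xi N (off q (D \<union> Dl K)) (signed l L)"
proof -
  let ?X = "D \<union> Dl K"
  have KX: "K \<subseteq> ?X" by (auto simp: Dl_def)
  have finK: "finite K" using split_okD(2)[OF ok[OF L(1)]] L(2) by simp
  have shift: "bd (W \<triangle> L) \<triangle> B = K \<triangle> bd W" for W
  proof -
    have "bd (W \<triangle> L) \<triangle> B = bd W \<triangle> (bd L \<triangle> B)" by (simp only: bd_sdiff sdiff_assoc)
    then show ?thesis unfolding L(2) by (simp only: sdiff_commute)
  qed
  have iff: "touching D (bd (W \<triangle> L) \<triangle> B) = K \<longleftrightarrow> bd W \<inter> ?X = {}" if W: "W \<subseteq> box N" for W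
    unfolding touching_eq_iff[OF ok[OF sdiff_subset[OF W L(1)]] ok[OF Y0] K] unfolding shift
    by (rule sdiff_split_iff[OF KX])
  have "(\<Sum>Y\<in>{Y\<in>Pow (box N). touching D (bd Y \<triangle> B) = K}. pw q (bd Y \<triangle> B) * exp (field N (\<lambda>_. l) Y))
    = (\<Sum>Y\<in>Pow (box N). if touching D (bd Y \<triangle> B) = K then pw q (bd Y \<triangle> B) * exp (field N (\<lambda>_. l) Y) else 0)"
    using finite_box by (intro sum.inter_filter) auto
  also have "\<dots> = (\<Sum>W\<in>Pow (box N). if touching D (bd (W \<triangle> L) \<triangle> B) = K then pw q (bd (W \<triangle> L) \<triangle> B) * exp (field N (\<lambda>_. l) (W \<triangle> L)) else 0)"
    by (rule sum.reindex_bij_betw[OF bij_betw_sdiff_Pow[OF L(1)], symmetric])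
  also have "\<dots> = (\<Sum>W\<in>Pow (box N). pw q K * (pw (off q ?X) (bd W) * exp (field N (signed l L) W)))"
  proof (rule sum.cong[OF refl])
    fix W assume "W \<in> Pow (box N)"
    then have W: "W \<subseteq> box N" by simp
    have i: "touching D (K \<triangle> bd W) = K \<longleftrightarrow> bd W \<inter> ?X = {}" using iff[OF W] unfolding shift .
    show "(if touching D (bd (W \<triangle> L) \<triangle> B) = K then pw q (bd (W \<triangle> L) \<triangle> B) * exp (field N (\<lambda>_. l) (W \<triangle> L)) else 0)
      = pw q K * (pw (off q ?X) (bd W) * exp (field N (signed l L) W))"
    proof (cases "bd W \<inter> ?X = {}")
      case True
      have "pw q (K \<triangle> bd W) = pw q K * pw q (bd W)"
        using True KX finK finite_bd[OF W] unfolding pw_def by (subst sdiff_disjoint, blast) (intro prod.union_disjoint; blast)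
      then show ?thesis using True unfolding shift i field_signed pw_off[OF finite_bd[OF W]] by simp
    next
      case False
      then show ?thesis unfolding shift i pw_off[OF finite_bd[OF W]] by simp
    qed
  qed
  finally show ?thesis unfolding Xi_def sum_distrib_left .
qed

definition corner :: dvert where "corner = (-1, -1)"

text \<open>The star of the corner contains exactly one separating edge, so this is a single
  component.\<close>

definition iface :: "nat \<Rightarrow> site set \<Rightarrow> dvert set set" where
  "iface N Y = touching (star corner) (bd Y \<triangle> Bot N)"

definition below :: "nat \<Rightarrow> dvert set set \<Rightarrow> site set" where
  "below N I = inside N (I \<triangle> Bot N)"

lemma corner_edge:
  assumes "Y \<subseteq> box N"
  shows "\<exists>e. star corner \<inter> (bd Y \<triangle> Bot N) = {e} \<and> corner \<in> e"
proof -
  have "ddeg (bd Y \<triangle> Bot N) corner = 1" unfolding corner_def by (rule dob_edges(3)[OF assms]) simp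
  then have "card ((bd Y \<triangle> Bot N) \<inter> star corner) = 1"
    using ddeg_star[OF split_okD(1)[OF dob_edges(4)[OF assms]]] by metis
  then obtain e where e: "(bd Y \<triangle> Bot N) \<inter> star corner = {e}" by (auto simp: card_1_singleton_iff)
  then have "corner \<in> e" using star_iff[of e corner] star_lattice by blast
  then show ?thesis using e by (auto simp: Int_commute)
qed

text \<open>The interface together with \<open>Bot N\<close> has to be an even set. At the left
  corner this holds because the only separating edge there belongs to the interface; elsewhere
  joined pairs are kept whole; and the right corner is the vertex exempted in
  \<open>cycle_space\<close>.\<close>

lemma below_iface:
  assumes Y: "Y \<subseteq> box N"
  shows "below N (iface N Y) \<subseteq> box N" "bd (below N (iface N Y)) \<triangle> Bot N = iface N Y"
proof -
  let ?S = "bd Y \<triangle> Bot N" and ?K = "iface N Y"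
  note S = split_okD[OF dob_edges(4)[OF Y]]
  have j: "jclosed ?S ?K" unfolding iface_def by (rule jclosed_touching)
  have KS: "?K \<subseteq> ?S" by (rule jclosedD(1)[OF j])
  have KL: "?K \<subseteq> lattice_edges" using KS S(1) by blast
  have "\<exists>L\<subseteq>box N. bd L = ?K \<triangle> Bot N"
  proof (rule cycle_space)
    show "?K \<triangle> Bot N \<subseteq> Ed N" using KS dob_edges(1)[OF Y] Bot_subset by (intro sdiff_subset) blast+
  next
    fix u :: dvert assume u: "u \<noteq> (int N, -1)"
    show "even (ddeg (?K \<triangle> Bot N) u)"
    proof (cases "u = (-1, -1)")
      case True
      have "star corner \<inter> ?S \<subseteq> ?K" unfolding iface_def by (rule touching_subset)
      then have "?K \<inter> star corner = ?S \<inter> star corner" using KS by blast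
      then have "ddeg ?K u = ddeg ?S u" unfolding ddeg_star[OF KL] ddeg_star[OF S(1)] True corner_def by simp
      also have "\<dots> = 1" using True by (intro dob_edges(3)[OF Y]) simp
      finally show ?thesis unfolding even_ddeg_sdiff[OF KL Bot_lattice] using odd_ddeg_Bot[of N u] True by simp
    next
      case False
      then have "even (ddeg ?S u)" using dob_edges(2)[OF Y, of u] u by blast
      then have "even (ddeg ?K u)" by (rule jclosed_even[OF dob_edges(4)[OF Y] j])
      moreover have "even (ddeg (Bot N) u)" using odd_ddeg_Bot[of N u] u False by blast
      ultimately show ?thesis unfolding even_ddeg_sdiff[OF KL Bot_lattice] by simp
    qed
  qed
  then obtain L where L: "L \<subseteq> box N" "bd L = ?K \<triangle> Bot N" by blast
  then have "below N ?K = L" unfolding below_def L(2)[symmetric] by simp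
  then show "below N ?K \<subseteq> box N" "bd (below N ?K) \<triangle> Bot N = ?K" using L by simp_all
qed

lemma iface_sum:
  assumes Y0: "Y0 \<subseteq> box N"
  defines "K \<equiv> iface N Y0"
  shows "(\<Sum>Y\<in>{Y\<in>Pow (box N). iface N Y = K}. pw q (bd Y \<triangle> Bot N) * exp (field N (\<lambda>_. l) Y))
    = pw q K * Xi N (off q (star corner \<union> Dl K)) (signed l (below N K))"
  unfolding iface_def
  by (rule touching_sum[OF dob_edges(4) Y0]) (use below_iface[OF Y0] in \<open>simp_all add: K_def iface_def\<close>)

section \<open>Dictionary between spin configurations and sets of minus sites\<close>

definition conf :: "nat \<Rightarrow> site set \<Rightarrow> site \<Rightarrow> int" where
  "conf N Y v = (if v \<in> Y then -1 else if v \<in> box N then 1 else dob v)"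

lemma configs_conf: "bij_betw (conf N) (Pow (box N)) (configs N)"
proof (rule bij_betwI[where g = "\<lambda>\<sigma>. {v\<in>box N. \<sigma> v = -1}"])
  show "conf N \<in> Pow (box N) \<rightarrow> configs N"
  proof
    fix Y assume "Y \<in> Pow (box N)"
    then have "v \<notin> box N \<Longrightarrow> v \<notin> Y" for v by blast
    then show "conf N Y \<in> configs N" unfolding configs_def conf_def mem_Collect_eq by simp
  qed
  show "(\<lambda>\<sigma>. {v \<in> box N. \<sigma> v = - 1}) \<in> configs N \<rightarrow> Pow (box N)" by auto
  show "{v \<in> box N. conf N Y v = - 1} = Y" if "Y \<in> Pow (box N)" for Y using that by (auto simp: conf_def)
  show "conf N {v \<in> box N. \<sigma> v = - 1} = \<sigma>" if "\<sigma> \<in> configs N" for \<sigma>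
  proof
    fix v
    have "v \<notin> box N \<Longrightarrow> \<sigma> v = dob v" "v \<in> box N \<Longrightarrow> \<sigma> v \<in> {-1, 1}" using that unfolding configs_def by blast+
    then show "conf N {v \<in> box N. \<sigma> v = - 1} v = \<sigma> v"
      unfolding conf_def by (cases "v \<in> box N") auto
  qed
qed

lemma minus_conf: "Y \<subseteq> box N \<Longrightarrow> {v \<in> box N. conf N Y v = - 1} = Y"
  by (auto simp: conf_def)

lemma nn_edges_cases:
  "(v, w) \<in> nn_edges N \<longleftrightarrow> (w = rt v \<or> w = up v) \<and> (v \<in> box N \<or> w \<in> box N)"
  unfolding nn_edges_def rt_def up_def by auto

lemma dual_edge_simps: "dual_edge v (rt v) = vE v" "dual_edge v (up v) = hE v"
  by (auto simp: dual_edge_def vE_def hE_def rt_def up_def)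

lemma dual_edge_inj:
  "(v, w) \<in> nn_edges N \<Longrightarrow> (v', w') \<in> nn_edges N \<Longrightarrow> dual_edge v w = dual_edge v' w' \<Longrightarrow> v = v' \<and> w = w'"
  unfolding nn_edges_cases by (elim conjE disjE) (simp_all add: dual_edge_simps)

lemma conf_differ:
  assumes "Y \<subseteq> box N"
  shows "(v \<in> box N \<or> up v \<in> box N) \<and> conf N Y v \<noteq> conf N Y (up v) \<longleftrightarrow> hE v \<in> bd Y \<triangle> Bot N"
    "(v \<in> box N \<or> rt v \<in> box N) \<and> conf N Y v \<noteq> conf N Y (rt v) \<longleftrightarrow> vE v \<in> bd Y \<triangle> Bot N"
proof -
  have s: "w \<in> Y \<Longrightarrow> w \<in> box N" for w using assms by blast
  obtain x y where v: "v = (x, y)" by (cases v)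
  show "(v \<in> box N \<or> up v \<in> box N) \<and> conf N Y v \<noteq> conf N Y (up v) \<longleftrightarrow> hE v \<in> bd Y \<triangle> Bot N"
    using s[of v] s[of "up v"] unfolding in_sdiff in_bd hE_Bot
    by (cases "v \<in> Y"; cases "up v \<in> Y"; simp add: conf_def v up_def box_def dob_def; linarith?)
  show "(v \<in> box N \<or> rt v \<in> box N) \<and> conf N Y v \<noteq> conf N Y (rt v) \<longleftrightarrow> vE v \<in> bd Y \<triangle> Bot N"
    using s[of v] s[of "rt v"] unfolding in_sdiff in_bd
    by (cases "v \<in> Y"; cases "rt v \<in> Y"; simp add: conf_def v rt_def box_def dob_def; linarith?)
qed

lemma sep_edges_conf: assumes "Y \<subseteq> box N" shows "sep_edges N (conf N Y) = bd Y \<triangle> Bot N"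
proof (rule edge_set_eqI)
  show "bd Y \<triangle> Bot N \<subseteq> lattice_edges" by (rule split_okD(1)[OF dob_edges(4)[OF assms]])
  have "dual_edge v w \<in> lattice_edges" if "(v, w) \<in> nn_edges N" for v w
    using that unfolding nn_edges_cases by (auto simp: dual_edge_simps lattice_edges_def)
  then show "sep_edges N (conf N Y) \<subseteq> lattice_edges" unfolding sep_edges_def by blast
  have sep: "e \<in> sep_edges N (conf N Y) \<longleftrightarrow> (\<exists>v. e = vE v \<and> (v \<in> box N \<or> rt v \<in> box N) \<and> conf N Y v \<noteq> conf N Y (rt v))
     \<or> (\<exists>v. e = hE v \<and> (v \<in> box N \<or> up v \<in> box N) \<and> conf N Y v \<noteq> conf N Y (up v))" for e
    unfolding sep_edges_def mem_Collect_eq nn_edges_cases using dual_edge_simps by metis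
  show "hE v \<in> sep_edges N (conf N Y) \<longleftrightarrow> hE v \<in> bd Y \<triangle> Bot N" for v
    unfolding sep conf_differ[OF assms] by (metis edge_inject)
  show "vE v \<in> sep_edges N (conf N Y) \<longleftrightarrow> vE v \<in> bd Y \<triangle> Bot N" for v
    unfolding sep conf_differ[OF assms] by (metis edge_inject)
qed

lemma hamiltonian_conf: "hamiltonian N \<sigma> = real (card (sep_edges N \<sigma>))"
proof -
  let ?A = "{(v, w) \<in> nn_edges N. \<sigma> v \<noteq> \<sigma> w}"
  have inj: "inj_on (\<lambda>(v, w). dual_edge v w) ?A"
  proof (rule inj_onI)
    fix p p' assume p: "p \<in> ?A" "p' \<in> ?A" "(\<lambda>(v, w). dual_edge v w) p = (\<lambda>(v, w). dual_edge v w) p'"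
    obtain v w v' w' where q: "p = (v, w)" "p' = (v', w')" by (cases p; cases p') blast
    show "p = p'" using p dual_edge_inj[of v w N v' w'] unfolding q by simp
  qed
  have img: "(\<lambda>(v, w). dual_edge v w) ` ?A = sep_edges N \<sigma>"
  proof
    show "(\<lambda>(v, w). dual_edge v w) ` ?A \<subseteq> sep_edges N \<sigma>"
    proof
      fix e assume "e \<in> (\<lambda>(v, w). dual_edge v w) ` ?A"
      then obtain p where p: "p \<in> ?A" "e = (\<lambda>(v, w). dual_edge v w) p" by (rule imageE)
      obtain v w where "p = (v, w)" by (cases p) blast
      then have "(v, w) \<in> nn_edges N \<and> \<sigma> v \<noteq> \<sigma> w" "e = dual_edge v w" using p by simp_all
      then show "e \<in> sep_edges N \<sigma>" unfolding sep_edges_def mem_Collect_eq by blast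
    qed
    show "sep_edges N \<sigma> \<subseteq> (\<lambda>(v, w). dual_edge v w) ` ?A"
    proof
      fix e assume "e \<in> sep_edges N \<sigma>"
      then obtain v w where "e = dual_edge v w" "(v, w) \<in> nn_edges N" "\<sigma> v \<noteq> \<sigma> w"
        unfolding sep_edges_def mem_Collect_eq by blast
      then show "e \<in> (\<lambda>(v, w). dual_edge v w) ` ?A" by (intro image_eqI[of _ _ "(v, w)"]) simp_all
    qed
  qed
  show ?thesis unfolding hamiltonian_def card_image[OF inj, symmetric] img ..
qed

lemma ising_weight_conf:
  assumes "Y \<subseteq> box N"
  shows "ising_weight \<beta> lam N (conf N Y) = exp (- 2 * \<beta>) ^ card (bd Y \<triangle> Bot N) * exp (field N (\<lambda>_. lam) Y)"
proof -
  have "real_of_int (conf N Y v) = chi {v} Y" if "v \<in> box N" for v using that by (simp add: conf_def)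
  then have "lam * (\<Sum>v\<in>box N. real_of_int (conf N Y v)) = field N (\<lambda>_. lam) Y"
    unfolding field_def sum_distrib_left by (intro sum.cong) auto
  then show ?thesis
    unfolding ising_weight_def hamiltonian_conf sep_edges_conf[OF assms] exp_add
    by (metis exp_of_nat_mult mult.commute)
qed

lemma ising_prob_conf:
  "ising_prob \<beta> lam N A = (\<Sum>Y\<in>{Y\<in>Pow (box N). conf N Y \<in> A}. exp (- 2 * \<beta>) ^ card (bd Y \<triangle> Bot N) * exp (field N (\<lambda>_. lam) Y))
    / Zd N (\<lambda>_. exp (- 2 * \<beta>)) (\<lambda>_. lam)"
proof -
  let ?w = "\<lambda>Y. exp (- 2 * \<beta>) ^ card (bd Y \<triangle> Bot N) * exp (field N (\<lambda>_. lam) Y)"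
  have 1: "(\<Sum>\<sigma>\<in>configs N \<inter> A. ising_weight \<beta> lam N \<sigma>) = (\<Sum>Y\<in>{Y\<in>Pow (box N). conf N Y \<in> A}. ?w Y)" for A
  proof (rule sum.reindex_cong[of "conf N"])
    show "inj_on (conf N) {Y \<in> Pow (box N). conf N Y \<in> A}"
      using configs_conf[of N] by (auto simp: bij_betw_def intro: inj_on_subset)
    show "configs N \<inter> A = conf N ` {Y \<in> Pow (box N). conf N Y \<in> A}"
    proof -
      have P: "configs N = conf N ` Pow (box N)" using configs_conf[of N] by (simp add: bij_betw_def)
      show ?thesis unfolding P by blast
    qed
  qed (simp add: ising_weight_conf)
  have "(\<Sum>\<sigma>\<in>configs N. ising_weight \<beta> lam N \<sigma>) = Zd N (\<lambda>_. exp (- 2 * \<beta>)) (\<lambda>_. lam)"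
    using 1[of UNIV] unfolding Zd_def pw_def by (simp add: Pow_def)
  then show ?thesis unfolding ising_prob_def 1 by simp
qed

lemma interface_conf: assumes Y: "Y \<subseteq> box N" shows "interface N (conf N Y) = iface N Y"
proof -
  let ?S = "bd Y \<triangle> Bot N"
  have iff: "e \<in> ?S \<and> corner \<in> e \<and> P \<longleftrightarrow> e \<in> star corner \<inter> ?S \<and> P" for e P
    using star_iff[of e corner] split_okD(1)[OF dob_edges(4)[OF Y]] by blast
  show ?thesis
    unfolding interface_def sep_edges_conf[OF Y] iface_def touching_def comp_def corner_def[symmetric] iff by blast
qed

text \<open>The definite description is resolved by injectivity of \<open>bd\<close> on subsets of
  the box.\<close>

lemma minus_region_conf: assumes Y: "Y \<subseteq> box N" shows "minus_region N (conf N Y) = below N (iface N Y)"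
proof -
  define L where "L = below N (iface N Y)"
  have L: "L \<subseteq> box N" "bd L \<triangle> Bot N = iface N Y" using below_iface[OF Y] by (simp_all add: L_def)
  have "(THE \<tau>. \<tau> \<in> configs N \<and> sep_edges N \<tau> = iface N Y) = conf N L"
  proof (rule the_equality)
    show "conf N L \<in> configs N \<and> sep_edges N (conf N L) = iface N Y"
      using bij_betwE[OF configs_conf[of N]] L by (simp add: sep_edges_conf)
  next
    fix \<tau> assume t: "\<tau> \<in> configs N \<and> sep_edges N \<tau> = iface N Y"
    then obtain X where X: "X \<subseteq> box N" "\<tau> = conf N X" using configs_conf[of N] unfolding bij_betw_def by blast
    then have "bd X \<triangle> Bot N = bd L \<triangle> Bot N" using t L by (simp add: sep_edges_conf)
    then have "bd X \<triangle> Bot N \<triangle> Bot N = bd L \<triangle> Bot N \<triangle> Bot N" by (rule arg_cong)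
    then have "bd X = bd L" by (simp only: sdiff_cancel)
    then show "\<tau> = conf N L" using bd_inj_box[OF X(1) L(1)] X(2) by simp
  qed
  then show ?thesis unfolding minus_region_def interface_conf[OF Y] Let_def using minus_conf[OF L(1)] by (simp add: L_def)
qed

lemma iface_walk:
  assumes Y: "Y \<subseteq> box N"
  shows "\<exists>b\<in>nbrs corner. \<exists>m. iface N Y \<in> walk_sets corner b m \<and> card (iface N Y) = Suc m"
proof -
  let ?S = "bd Y \<triangle> Bot N"
  note S = split_okD[OF dob_edges(4)[OF Y]]
  obtain e where e: "star corner \<inter> ?S = {e}" "corner \<in> e" using corner_edge[OF Y] by blast
  have "e \<in> ?S" using e by blast
  then have "e \<in> lattice_edges" using S(1) by blast
  then obtain b where b: "b \<in> nbrs corner" "e = {corner, b}" using lattice_edge_other[OF _ e(2)] by blast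
  have K: "iface N Y = comp ?S {corner, b}" unfolding iface_def touching_def e(1) b(2) by simp
  have "\<not> joined_at ?S corner {corner, b} f" for f
  proof
    assume "joined_at ?S corner {corner, b} f"
    then have "{corner, b} \<in> star corner \<inter> ?S" "f \<in> star corner \<inter> ?S" "{corner, b} \<noteq> f"
      using joined_at_star[OF S(1)] by blast+
    then show False unfolding e(1) by simp
  qed
  then have "\<nexists>f. joined_at ?S corner {corner, b} f" by simp
  moreover have "{corner, b} \<in> ?S" using \<open>e \<in> ?S\<close> b(2) by simp
  ultimately obtain m where "comp ?S {corner, b} \<in> walk_sets corner b m" "card (comp ?S {corner, b}) = Suc m"
    using comp_walk_sets[OF S(1,2) _ b(1)] by metis
  then show ?thesis using b(1) unfolding K by blast
qed

section \<open>The effect of the field\<close>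

text \<open>A factor \<open>q\<close> for a separating edge and 1 otherwise is
  \<open>(1 + q) / 2 + (1 - q) / 2 * sg e\<close>; this brings the partition function into the form
  required by the correlation inequalities.\<close>

lemma Xi_GW:
  "(\<Sum>Y\<in>Pow (box N). pw q (bd Y) * exp (field N h Y) * f Y)
    = (\<Sum>Y\<in>Pow (box N). GW N (\<lambda>e. (1 + q e) / 2) (\<lambda>e. (1 - q e) / 2) h Y * f Y)"
proof (rule sum.cong[OF refl])
  fix Y assume "Y \<in> Pow (box N)"
  then have Y: "bd Y \<subseteq> Ed N" using bd_subset_Ed by blast
  have "pw q (bd Y) = (\<Prod>e\<in>Ed N. if e \<in> bd Y then q e else 1)"
    unfolding pw_def using Y finite_Ed by (simp add: prod.inter_restrict[symmetric] Int_absorb1)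
  also have "\<dots> = (\<Prod>e\<in>Ed N. (1 + q e) / 2 + (1 - q e) / 2 * sg e Y)"
    by (rule prod.cong) (simp_all add: sg_def field_simps del: in_bd)
  finally show "pw q (bd Y) * exp (field N h Y) * f Y = GW N (\<lambda>e. (1 + q e) / 2) (\<lambda>e. (1 - q e) / 2) h Y * f Y"
    by (simp add: GW_def)
qed

lemma Zd_GW:
  "(\<Sum>Y\<in>Pow (box N). pw q (bd Y \<triangle> Bot N) * exp (field N h Y) * f Y)
    = (\<Sum>Y\<in>Pow (box N). GW N (\<lambda>e. (1 + q e) / 2) (\<lambda>e. if e \<in> Bot N then - ((1 - q e) / 2) else (1 - q e) / 2) h Y * f Y)"
proof (rule sum.cong[OF refl])
  fix Y assume "Y \<in> Pow (box N)"
  then have Y: "bd Y \<triangle> Bot N \<subseteq> Ed N" using dob_edges(1) by blast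
  have "pw q (bd Y \<triangle> Bot N) = (\<Prod>e\<in>Ed N. if e \<in> bd Y \<triangle> Bot N then q e else 1)"
    unfolding pw_def using Y finite_Ed by (simp add: prod.inter_restrict[symmetric] Int_absorb1 del: in_sdiff)
  also have "\<dots> = (\<Prod>e\<in>Ed N. (1 + q e) / 2 + (if e \<in> Bot N then - ((1 - q e) / 2) else (1 - q e) / 2) * sg e Y)"
    unfolding in_sdiff sg_def
  proof (rule prod.cong[OF refl])
    fix e
    show "(if (e \<in> bd Y) \<noteq> (e \<in> Bot N) then q e else 1)
      = (1 + q e) / 2 + (if e \<in> Bot N then - ((1 - q e) / 2) else (1 - q e) / 2) * (if e \<in> bd Y then - 1 else 1)"
      by (cases "e \<in> bd Y"; cases "e \<in> Bot N"; simp add: field_simps del: in_bd)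
  qed
  finally show "pw q (bd Y \<triangle> Bot N) * exp (field N h Y) * f Y
    = GW N (\<lambda>e. (1 + q e) / 2) (\<lambda>e. if e \<in> Bot N then - ((1 - q e) / 2) else (1 - q e) / 2) h Y * f Y"
    by (simp add: GW_def)
qed

text \<open>Smaller \<open>q\<close> means stronger ferromagnetic coupling, which increases the
  expectation of every function in \<open>pd\<close>.\<close>

lemma gks_plus:
  assumes q: "\<And>e. 0 \<le> q' e \<and> q' e \<le> q e \<and> q e \<le> 1" and f: "f \<in> pd"
  shows "(\<Sum>Y\<in>Pow (box N). pw q (bd Y) * f Y) * Xi N q' (\<lambda>_. 0) \<le> (\<Sum>Y\<in>Pow (box N). pw q' (bd Y) * f Y) * Xi N q (\<lambda>_. 0)"
proof -
  have "\<bar>(1 - q' e) / 2 * ((1 - q e) / 2)\<bar> \<le> (1 + q' e) / 2 * ((1 + q e) / 2) \<and>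
      \<bar>(1 + q' e) / 2 * ((1 - q e) / 2)\<bar> \<le> (1 - q' e) / 2 * ((1 + q e) / 2)" for e
  proof -
    have b: "0 \<le> q' e" "q' e \<le> q e" "q e \<le> 1" using q by auto
    have n: "0 \<le> (1 - q' e) / 2 * ((1 - q e) / 2)" "0 \<le> (1 + q' e) / 2 * ((1 - q e) / 2)" using b by (intro mult_nonneg_nonneg; simp)+
    have "(1 + q' e) * (1 - q e) \<le> (1 - q' e) * (1 + q e)" using b by (simp add: algebra_simps)
    moreover have "(1 - q' e) / 2 * ((1 - q e) / 2) \<le> (1 + q' e) / 2 * ((1 + q e) / 2)" using b by (intro mult_mono) auto
    ultimately show ?thesis unfolding abs_of_nonneg[OF n(1)] abs_of_nonneg[OF n(2)] by simp
  qed
  then show ?thesis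
    using gks_ratio[where N = N and be = "\<lambda>e. (1 - q' e) / 2" and be' = "\<lambda>e. (1 - q e) / 2" and al = "\<lambda>e. (1 + q' e) / 2"
        and al' = "\<lambda>e. (1 + q e) / 2" and h = "\<lambda>_. 0" and h' = "\<lambda>_. 0" and f = f] f
      Xi_GW[where N = N and q = q and h = "\<lambda>_. 0" and f = f] Xi_GW[where N = N and q = q' and h = "\<lambda>_. 0" and f = f]
      Xi_GW[where N = N and q = q and h = "\<lambda>_. 0" and f = "\<lambda>_. 1"] Xi_GW[where N = N and q = q' and h = "\<lambda>_. 0" and f = "\<lambda>_. 1"]
    by (simp add: Xi_zero field_def)
qed

text \<open>The exponential of a nonnegative field lies in \<open>pd\<close>, so stronger couplings
  strengthen the response to the field.\<close>

lemma field_coupling_monotone: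
  assumes q: "\<And>e. 0 \<le> q' e \<and> q' e \<le> q e \<and> q e \<le> 1" and k: "0 \<le> k"
  shows "Xi N q (\<lambda>_. k) * Xi N q' (\<lambda>_. 0) \<le> Xi N q' (\<lambda>_. k) * Xi N q (\<lambda>_. 0)"
proof -
  have "(\<lambda>Y. exp (field N (\<lambda>_. k) Y)) \<in> pd" unfolding field_def using finite_box k by (intro pd_exp_sum)
  from gks_plus[OF q this] show ?thesis unfolding Xi_def .
qed

text \<open>The indicator that no edge of \<open>D\<close> separates is a product of factors
  \<open>(1 + sg e) / 2\<close> and so lies in \<open>pd\<close>. This is needed because weakening
  horizontal edges also changes the partition function of the surroundings of an interface.\<close>

lemma avoidance_monotone:
  assumes q: "\<And>e. 0 \<le> q' e \<and> q' e \<le> q e \<and> q e \<le> 1"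
  shows "Xi N (off q D) (\<lambda>_. 0) * Xi N q' (\<lambda>_. 0) \<le> Xi N (off q' D) (\<lambda>_. 0) * Xi N q (\<lambda>_. 0)"
proof -
  define f where "f Y = (\<Prod>e\<in>D \<inter> Ed N. 1 / 2 + 1 / 2 * sg e Y)" for Y
  have "f \<in> pd" unfolding f_def[abs_def] using Ed_lattice by (intro pd_prod pd_sg) auto
  moreover have "Xi N (off p D) (\<lambda>_. 0) = (\<Sum>Y\<in>Pow (box N). pw p (bd Y) * f Y)" for p
    unfolding Xi_zero
  proof (rule sum.cong[OF refl])
    fix Y assume "Y \<in> Pow (box N)"
    then have Y: "bd Y \<subseteq> Ed N" "finite (bd Y)" using bd_subset_Ed finite_bd by auto
    show "pw (off p D) (bd Y) = pw p (bd Y) * f Y"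
    proof (cases "bd Y \<inter> D = {}")
      case True
      then have "pw (off p D) (bd Y) = pw p (bd Y)" unfolding pw_def by (intro prod.cong) (auto simp: off_def)
      moreover have "f Y = 1" unfolding f_def using True by (intro prod.neutral) (auto simp: sg_def simp del: in_bd)
      ultimately show ?thesis by simp
    next
      case False
      then obtain e where e: "e \<in> bd Y" "e \<in> D" by blast
      have "pw (off p D) (bd Y) = 0" unfolding pw_def using Y e by (intro prod_zero) (auto simp: off_def)
      moreover have "f Y = 0" unfolding f_def using e Y finite_Ed by (intro prod_zero) (auto simp: sg_def simp del: in_bd intro!: bexI[of _ e])
      ultimately show ?thesis by simp
    qed
  qed
  ultimately show ?thesis using gks_plus[OF q] by simp
qed

lemma field_const:
  assumes "Y \<subseteq> box N" shows "field N (\<lambda>_. l) Y = l * (real (card (box N)) - 2 * real (card Y))"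
proof -
  have "field N (\<lambda>_. l) Y = (\<Sum>v\<in>box N. l - 2 * l * of_bool (v \<in> Y))" unfolding field_def by (rule sum.cong) auto
  also have "(\<Sum>v\<in>box N. of_bool (v \<in> Y)) = real (card Y)"
    using assms finite_box by (simp add: Int_absorb1 flip: sum.inter_restrict)
  then have "(\<Sum>v\<in>box N. l - 2 * l * of_bool (v \<in> Y)) = l * real (card (box N)) - 2 * l * real (card Y)"
    by (simp add: sum_subtractf flip: sum_distrib_left)
  finally show ?thesis by (simp add: algebra_simps)
qed

text \<open>The indicator that all sites above the strip are plus lies in \<open>pd\<close>, so it
  is at most as likely under the Dobrushin condition as under the plus condition. Read backwards,
  this bounds \<open>Zd\<close> from below by the plus partition function at the same field. Within
  the strip the field varies little, which is the exponential prefactor.\<close>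

lemma strip_restriction:
  assumes z: "0 \<le> z" "z \<le> 1" and l: "0 \<le> l" and m: "m \<le> Suc N"
  shows "exp (- 2 * l * ((real N + 1) * real m)) * (\<Sum>Y\<in>Pow (strip N m). pw (\<lambda>_. z) (bd Y \<triangle> Bot N)) * Xi N (\<lambda>_. z) (\<lambda>_. l)
    \<le> (\<Sum>Y\<in>Pow (strip N m). pw (\<lambda>_. z) (bd Y)) * Zd N (\<lambda>_. z) (\<lambda>_. l)"
proof -
  let ?q = "\<lambda>_::dvert set. z" and ?E = "exp (l * real (card (box N)))"
  let ?SD = "\<Sum>Y\<in>Pow (strip N m). pw ?q (bd Y \<triangle> Bot N)" and ?SP = "\<Sum>Y\<in>Pow (strip N m). pw ?q (bd Y)"
  have sub: "strip N m \<subseteq> box N" using m by (auto simp: strip_def box_def)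
  define f where "f Y = (\<Prod>v\<in>box N - strip N m. 1 / 2 + 1 / 2 * chi {v} Y)" for Y
  have fpd: "f \<in> pd" unfolding f_def[abs_def] by (intro pd_prod pd_affine) auto
  have f: "f Y = of_bool (Y \<subseteq> strip N m)" if Y: "Y \<subseteq> box N" for Y
  proof (cases "Y \<subseteq> strip N m")
    case True
    then show ?thesis unfolding f_def by (subst prod.neutral) auto
  next
    case False
    then obtain v where "v \<in> Y" "v \<in> box N - strip N m" using Y by blast
    then have "f Y = 0" unfolding f_def using finite_box by (intro prod_zero) (auto intro!: bexI[of _ v])
    then show ?thesis using False by simp
  qed
  have restrict: "(\<Sum>Y\<in>Pow (box N). g Y * f Y) = (\<Sum>Y\<in>Pow (strip N m). g Y)" for g :: "site set \<Rightarrow> real"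
  proof -
    have "(\<Sum>Y\<in>Pow (box N). g Y * f Y) = (\<Sum>Y\<in>Pow (strip N m). g Y * f Y)"
      by (rule sum.mono_neutral_right) (use sub f finite_box in auto)
    also have "\<dots> = (\<Sum>Y\<in>Pow (strip N m). g Y)" by (rule sum.cong) (use sub f in auto)
    finally show ?thesis .
  qed
  have "\<bar>(1 - z) / 2 * (if e \<in> Bot N then - ((1 - z) / 2) else (1 - z) / 2)\<bar> \<le> (1 + z) / 2 * ((1 + z) / 2) \<and>
      \<bar>(1 + z) / 2 * (if e \<in> Bot N then - ((1 - z) / 2) else (1 - z) / 2)\<bar> \<le> (1 - z) / 2 * ((1 + z) / 2)" for e
  proof -
    have a: "\<bar>if e \<in> Bot N then - ((1 - z) / 2) else (1 - z) / 2\<bar> = (1 - z) / 2" using z by simp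
    have "(1 - z) / 2 * ((1 - z) / 2) \<le> (1 + z) / 2 * ((1 + z) / 2)" using z by (intro mult_mono) auto
    then show ?thesis unfolding abs_mult a using z by simp
  qed
  from gks_ratio[where N = N and be = "\<lambda>_. (1 - z) / 2" and be' = "\<lambda>e. if e \<in> Bot N then - ((1 - z) / 2) else (1 - z) / 2"
      and al = "\<lambda>_. (1 + z) / 2" and al' = "\<lambda>_. (1 + z) / 2" and h = "\<lambda>_. l" and h' = "\<lambda>_. l" and f = f, OF this _ fpd] l
  have main: "(\<Sum>Y\<in>Pow (strip N m). pw ?q (bd Y \<triangle> Bot N) * exp (field N (\<lambda>_. l) Y)) * Xi N ?q (\<lambda>_. l)
      \<le> (\<Sum>Y\<in>Pow (strip N m). pw ?q (bd Y) * exp (field N (\<lambda>_. l) Y)) * Zd N ?q (\<lambda>_. l)"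
    using Xi_GW[where N = N and q = ?q and h = "\<lambda>_. l" and f = f] Xi_GW[where N = N and q = ?q and h = "\<lambda>_. l" and f = "\<lambda>_. 1"]
      Zd_GW[where N = N and q = ?q and h = "\<lambda>_. l" and f = f] Zd_GW[where N = N and q = ?q and h = "\<lambda>_. l" and f = "\<lambda>_. 1"]
    by (simp add: restrict Xi_def Zd_def)
  have w: "0 \<le> pw ?q E" for E using z by (intro pw_nonneg) auto
  have nn: "0 \<le> Xi N ?q (\<lambda>_. l)" "0 \<le> Zd N ?q (\<lambda>_. l)" unfolding Xi_def Zd_def using w by (auto intro!: sum_nonneg)
  have "(\<Sum>Y\<in>Pow (strip N m). pw ?q (bd Y) * exp (field N (\<lambda>_. l) Y)) \<le> (\<Sum>Y\<in>Pow (strip N m). pw ?q (bd Y) * ?E)"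
  proof (intro sum_mono mult_left_mono w)
    fix Y assume "Y \<in> Pow (strip N m)"
    then have "Y \<subseteq> box N" using sub by auto
    then show "exp (field N (\<lambda>_. l) Y) \<le> ?E" using l by (simp add: field_const mult_left_mono)
  qed
  then have P: "(\<Sum>Y\<in>Pow (strip N m). pw ?q (bd Y) * exp (field N (\<lambda>_. l) Y)) \<le> ?E * ?SP"
    by (simp add: sum_distrib_left mult.commute)
  have "(\<Sum>Y\<in>Pow (strip N m). pw ?q (bd Y \<triangle> Bot N) * (?E * exp (- 2 * l * ((real N + 1) * real m)))) \<le> (\<Sum>Y\<in>Pow (strip N m). pw ?q (bd Y \<triangle> Bot N) * exp (field N (\<lambda>_. l) Y))"
  proof (intro sum_mono mult_left_mono w)
    fix Y assume Y: "Y \<in> Pow (strip N m)"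
    then have Yb: "Y \<subseteq> box N" using sub by auto
    have "card Y \<le> card (strip N m)" using Y finite_subset[OF sub finite_box] by (intro card_mono) auto
    also have "\<dots> = Suc N * m" by (simp add: strip_def card_cartesian_product nat_add_distrib)
    finally have "real (card Y) \<le> real (Suc N * m)" by (rule of_nat_mono)
    then have "real (card Y) \<le> (real N + 1) * real m" by (simp add: algebra_simps)
    then have "l * real (card Y) \<le> l * ((real N + 1) * real m)" using l by (rule mult_left_mono)
    then show "?E * exp (- 2 * l * ((real N + 1) * real m)) \<le> exp (field N (\<lambda>_. l) Y)"
      unfolding field_const[OF Yb] exp_add[symmetric] exp_le_cancel_iff by (simp add: algebra_simps)
  qed
  then have D: "?E * exp (- 2 * l * ((real N + 1) * real m)) * ?SD \<le> (\<Sum>Y\<in>Pow (strip N m). pw ?q (bd Y \<triangle> Bot N) * exp (field N (\<lambda>_. l) Y))"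
    unfolding sum_distrib_right[symmetric] by (simp only: mult.commute[of ?SD])
  have "?E * exp (- 2 * l * ((real N + 1) * real m)) * ?SD * Xi N ?q (\<lambda>_. l) \<le> ?E * ?SP * Zd N ?q (\<lambda>_. l)"
    by (rule order_trans[OF mult_right_mono[OF D nn(1)] order_trans[OF main mult_right_mono[OF P nn(2)]]])
  then have "?E * (exp (- 2 * l * ((real N + 1) * real m)) * ?SD * Xi N ?q (\<lambda>_. l)) \<le> ?E * (?SP * Zd N ?q (\<lambda>_. l))"
    by (simp only: mult.assoc)
  then show ?thesis by (simp only: mult_le_cancel_left_pos[OF exp_gt_zero])
qed

text \<open>Jensen's inequality, from the tangent of \<open>exp\<close> at \<open>c\<close>.\<close>

lemma jensen_exp:
  fixes w f :: "'a \<Rightarrow> real"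
  assumes "\<And>x. x \<in> A \<Longrightarrow> 0 \<le> w x" "0 < sum w A" "(\<Sum>x\<in>A. w x * f x) \<ge> c * sum w A"
  shows "sum w A * exp c \<le> (\<Sum>x\<in>A. w x * exp (f x))"
proof -
  have "0 \<le> exp c * ((\<Sum>x\<in>A. w x * f x) - c * sum w A)" using assms(3) by simp
  also have "\<dots> + sum w A * exp c = (\<Sum>x\<in>A. w x * (exp c * (1 + (f x - c))))"
    by (simp add: algebra_simps sum.distrib sum_subtractf flip: sum_distrib_left sum_distrib_right)
  also have "\<dots> \<le> (\<Sum>x\<in>A. w x * exp (f x))"
  proof (intro sum_mono mult_left_mono assms(1))
    fix x
    have "exp c * (1 + (f x - c)) \<le> exp c * exp (f x - c)" by (intro mult_left_mono exp_ge_add_one_self) simp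
    then show "exp c * (1 + (f x - c)) \<le> exp (f x)" by (simp flip: exp_add)
  qed
  finally show ?thesis by simp
qed

lemma off_bounds: "0 \<le> z \<Longrightarrow> 0 \<le> off (\<lambda>_. z) D e \<and> off (\<lambda>_. z) D e \<le> z"
  by (simp add: off_def)

lemma Xi_pos:
  assumes "\<And>e. 0 \<le> q e" shows "0 < Xi N q h"
proof -
  have "0 < pw q (bd {}) * exp (field N h {})" by (simp add: pw_def bd_def)
  also have "\<dots> \<le> Xi N q h"
    unfolding Xi_def using assms finite_box by (intro member_le_sum mult_nonneg_nonneg pw_nonneg) auto
  finally show ?thesis .
qed

text \<open>By \<open>ginibre_field_flip\<close> it is enough to compare the fields
  \<open>l0\<close> and \<open>- l0\<close> on \<open>L\<close>. Their quotient is the mean of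
  \<open>exp\<close> of \<open>2 * l0\<close> times the spin sum over \<open>L\<close> in the field
  \<open>- l0\<close>; the magnetization is still at least 1/2 there, and Jensen's inequality gives
  \<open>exp (l0 * card L)\<close>.\<close>

lemma reversed_field_cost:
  assumes z: "0 \<le> z" "z \<le> 1" and l: "0 \<le> l0" "l0 \<le> l" and L: "L \<subseteq> box N"
    and small: "3 * (z * exp (2 * l0 * (real N + 1))) \<le> 3 / 5"
  shows "Xi N (off (\<lambda>_. z) D) (signed l L) \<le> exp (- l0 * real (card L)) * Xi N (off (\<lambda>_. z) D) (\<lambda>_. l)"
proof -
  let ?q = "off (\<lambda>_. z) D"
  define hp where "hp = (\<lambda>v. if v \<in> L then l0 else 0)"
  define hm where "hm = (\<lambda>v. if v \<in> L then - l0 else 0)"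
  note q = off_bounds[OF z(1), of D]
  have qn: "0 \<le> ?q e" for e using q by blast
  have pos: "0 < Xi N ?q h" for h by (rule Xi_pos[OF qn])
  have "\<bar>(1 - ?q e) / 2\<bar> \<le> (1 + ?q e) / 2 \<and> 0 \<le> (1 - ?q e) / 2" for e
    using q[of e] z by auto
  from ginibre_field_flip[where N = N and be = "\<lambda>e. (1 - ?q e) / 2" and al = "\<lambda>e. (1 + ?q e) / 2", OF this l L]
  have g: "Xi N ?q (signed l L) * Xi N ?q hp \<le> Xi N ?q (\<lambda>_. l) * Xi N ?q hm"
    using Xi_GW[where N = N and q = ?q and f = "\<lambda>_. 1"] by (simp add: Xi_def signed_def[abs_def] hp_def hm_def)
  let ?w = "\<lambda>Y. pw ?q (bd Y) * exp (field N hm Y)"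
  have finL: "finite L" by (rule finite_sub_box[OF L])
  have w: "0 \<le> ?w Y" for Y using qn by (intro mult_nonneg_nonneg pw_nonneg) auto
  have shift: "field N hp Y = field N hm Y + 2 * l0 * (\<Sum>v\<in>L. chi {v} Y)" for Y
  proof -
    have "field N hp Y - field N hm Y = (\<Sum>v\<in>box N. if v \<in> L then 2 * l0 * chi {v} Y else 0)"
      unfolding field_def sum_subtractf[symmetric] by (rule sum.cong) (auto simp: hp_def hm_def)
    also have "\<dots> = (\<Sum>v\<in>L. 2 * l0 * chi {v} Y)"
      using L finite_box by (simp add: sum.inter_restrict[symmetric] Int_absorb1)
    finally show ?thesis by (simp add: sum_distrib_left)
  qed
  have "Xi N ?q hm * exp (l0 * real (card L)) \<le> (\<Sum>Y\<in>Pow (box N). ?w Y * exp (2 * l0 * (\<Sum>v\<in>L. chi {v} Y)))"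
    unfolding Xi_def
  proof (rule jensen_exp)
    show "0 < sum ?w (Pow (box N))" using pos[of hm] by (simp add: Xi_def)
    have m: "1 / 2 * Xi N ?q hm \<le> (\<Sum>Y\<in>Pow (box N). ?w Y * chi {v} Y)" if "v \<in> L" for v
      by (rule magnetization_ge[of ?q z N hm l0 v]) (use q l small that L in \<open>auto simp: hm_def\<close>)
    have "(\<Sum>v\<in>L. 1 / 2 * Xi N ?q hm) \<le> (\<Sum>v\<in>L. \<Sum>Y\<in>Pow (box N). ?w Y * chi {v} Y)" using m by (rule sum_mono)
    also have "\<dots> = (\<Sum>Y\<in>Pow (box N). ?w Y * (\<Sum>v\<in>L. chi {v} Y))"
      unfolding sum_distrib_left by (rule sum.swap)
    finally have "2 * l0 * (real (card L) * (1 / 2 * Xi N ?q hm)) \<le> 2 * l0 * (\<Sum>Y\<in>Pow (box N). ?w Y * (\<Sum>v\<in>L. chi {v} Y))"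
      using l by (intro mult_left_mono) auto
    then show "l0 * real (card L) * sum ?w (Pow (box N)) \<le> (\<Sum>Y\<in>Pow (box N). ?w Y * (2 * l0 * (\<Sum>v\<in>L. chi {v} Y)))"
      unfolding Xi_def[symmetric] by (simp add: sum_distrib_left mult_ac)
  qed (rule w)
  also have "\<dots> = Xi N ?q hp" unfolding Xi_def shift exp_add by (simp add: mult_ac)
  finally have a: "Xi N ?q hm * exp (l0 * real (card L)) \<le> Xi N ?q hp" .
  have "Xi N ?q (signed l L) * (Xi N ?q hm * exp (l0 * real (card L))) \<le> Xi N ?q (\<lambda>_. l) * Xi N ?q hm"
    using mult_left_mono[OF a, of "Xi N ?q (signed l L)"] g pos[of "signed l L"] by linarith
  then have "Xi N ?q hm * (Xi N ?q (signed l L) * exp (l0 * real (card L))) \<le> Xi N ?q hm * Xi N ?q (\<lambda>_. l)"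
    by (simp only: mult_ac)
  then have "Xi N ?q (signed l L) * exp (l0 * real (card L)) \<le> Xi N ?q (\<lambda>_. l)"
    by (simp only: mult_le_cancel_left_pos[OF pos])
  then show ?thesis by (simp add: exp_minus field_simps)
qed

text \<open>Different components are disjoint, so the region bounded by their union is the symmetric
  difference of the single regions and is contained in their union.\<close>

lemma inside_touching:
  assumes Y: "Y \<subseteq> box N" and D: "finite D"
  shows "real (card (inside N (touching D (bd Y)))) \<le> (\<Sum>e\<in>D \<inter> bd Y. real (card (inside N (comp (bd Y) e))))"
proof -
  have sub: "\<exists>H\<subseteq>box N. bd H = \<Union>\<C> \<and> H \<subseteq> (\<Union>K\<in>\<C>. inside N K)" if "finite \<C>" "\<C> \<subseteq> comp (bd Y) ` bd Y" for \<C>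
    using that
  proof (induction \<C>)
    case empty
    show ?case by (intro exI[of _ "{}"]) (auto simp: bd_def)
  next
    case (insert K \<C>)
    then obtain H where H: "H \<subseteq> box N" "bd H = \<Union>\<C>" "H \<subseteq> (\<Union>K\<in>\<C>. inside N K)" by auto
    obtain e where e: "e \<in> bd Y" "K = comp (bd Y) e" using insert.prems by auto
    have K: "inside N K \<subseteq> box N" "bd (inside N K) = K" using inside_jclosed[OF Y jclosed_comp[OF e(1)]] e(2) by simp_all
    have "\<Union>\<C> \<inter> K = {}"
    proof (rule ccontr)
      assume "\<Union>\<C> \<inter> K \<noteq> {}"
      then obtain C g where g: "g \<in> C" "C \<in> \<C>" "g \<in> K" by blast
      obtain e' where e': "C = comp (bd Y) e'" using insert.prems g(2) by auto
      have "C = comp (bd Y) g" "K = comp (bd Y) g" using comp_eq[of g "bd Y" e'] comp_eq[of g "bd Y" e] g e e' by simp_all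
      then show False using g(2) insert.hyps(2) by simp
    qed
    then have "bd (H \<triangle> inside N K) = \<Union>(insert K \<C>)"
      unfolding bd_sdiff H(2) K(2) by (subst sdiff_disjoint) auto
    moreover have "H \<triangle> inside N K \<subseteq> (\<Union>K\<in>insert K \<C>. inside N K)" using H(3) unfolding sdiff_def by auto
    ultimately show ?case using sdiff_subset[OF H(1) K(1)] by blast
  qed
  let ?C = "comp (bd Y) ` (D \<inter> bd Y)"
  have C: "finite ?C" "?C \<subseteq> comp (bd Y) ` bd Y" using D by auto
  obtain H where H: "H \<subseteq> box N" "bd H = \<Union>?C" "H \<subseteq> (\<Union>K\<in>?C. inside N K)" using sub[OF C] by blast
  have "inside N (touching D (bd Y)) = H" unfolding touching_def H(2)[symmetric] by (rule inside_bd[OF H(1)])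
  moreover have fin: "finite (\<Union>e\<in>D \<inter> bd Y. inside N (comp (bd Y) e))"
  proof (rule finite_UN_I)
    fix e assume "e \<in> D \<inter> bd Y"
    then have "e \<in> bd Y" by blast
    then show "finite (inside N (comp (bd Y) e))" by (rule finite_sub_box[OF inside_jclosed(1)[OF Y jclosed_comp]])
  qed (use D in simp)
  ultimately have "card (inside N (touching D (bd Y))) \<le> card (\<Union>e\<in>D \<inter> bd Y. inside N (comp (bd Y) e))"
    using H(3) by (intro card_mono) auto
  also have "\<dots> \<le> (\<Sum>e\<in>D \<inter> bd Y. card (inside N (comp (bd Y) e)))"
    using D by (intro card_UN_le) auto
  finally show ?thesis by (metis of_nat_le_iff of_nat_sum)
qed

text \<open>Freezing the edges of \<open>D\<close> changes the response to the field only through the area enclosed by the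
  loops that meet \<open>D\<close>.\<close>

lemma frozen_field_response:
  assumes z: "0 \<le> z" "3 * z \<le> 3 / 5" and l: "0 \<le> l" and D: "finite D"
  shows "Xi N (off (\<lambda>_. z) D) (\<lambda>_. l) * Xi N (\<lambda>_. z) (\<lambda>_. 0)
    \<le> exp (2 * l * (loop_const z * real (card D))) * Xi N (\<lambda>_. z) (\<lambda>_. l) * Xi N (off (\<lambda>_. z) D) (\<lambda>_. 0)"
proof -
  let ?P = "Pow (box N)" and ?q = "\<lambda>_::dvert set. z" and ?off = "off (\<lambda>_. z)"
  let ?X = "\<lambda>K. D \<union> Dl K" and ?G = "\<lambda>Y. inside N (touching D (bd Y))"
  define KK where "KK = (\<lambda>Y. touching D (bd Y)) ` ?P"
  have finK: "finite KK" unfolding KK_def using finite_box by simp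
  have z1: "z \<le> 1" using z by simp
  have w: "0 \<le> z ^ n" for n using z by simp
  have ok: "split_ok (bd Y \<triangle> {})" if "Y \<subseteq> box N" for Y using split_ok_bd[OF that] by simp
  have G: "?G Y \<subseteq> box N" "bd (?G Y) = touching D (bd Y)" if "Y \<subseteq> box N" for Y
    using inside_jclosed[OF that jclosed_touching] by auto
  \<comment> \<open>A partition according to the components that meet \<open>D\<close>, valid at
    every field: \<open>k = l\<close> will recover the partition function, and \<open>k = 0\<close>
    the mean of \<open>F\<close>.\<close>
  have part: "(\<Sum>Y\<in>?P. z ^ card (bd Y) * exp (field N (\<lambda>_. k) Y) * F (touching D (bd Y)))
      = (\<Sum>K\<in>KK. F K * (z ^ card K * Xi N (?off (?X K)) (signed k (inside N K))))" for F :: "dvert set set \<Rightarrow> real" and k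
  proof -
    have "(\<Sum>Y\<in>?P. z ^ card (bd Y) * exp (field N (\<lambda>_. k) Y) * F (touching D (bd Y)))
      = (\<Sum>K\<in>KK. \<Sum>Y\<in>{Y\<in>?P. touching D (bd Y) = K}. z ^ card (bd Y) * exp (field N (\<lambda>_. k) Y) * F (touching D (bd Y)))"
      unfolding KK_def using finite_box by (intro sum.image_gen) simp
    also have "\<dots> = (\<Sum>K\<in>KK. F K * (z ^ card K * Xi N (?off (?X K)) (signed k (inside N K))))"
    proof (rule sum.cong[OF refl])
      fix K assume "K \<in> KK"
      then obtain Y0 where Y0: "Y0 \<subseteq> box N" "K = touching D (bd Y0)" by (auto simp: KK_def)
      have "(\<Sum>Y\<in>{Y\<in>?P. touching D (bd Y) = K}. z ^ card (bd Y) * exp (field N (\<lambda>_. k) Y))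
         = z ^ card K * Xi N (?off (?X K)) (signed k (inside N K))"
        using touching_sum[OF ok Y0(1), of K D "inside N K" ?q k] Y0 G[OF Y0(1)] by simp
      then show "(\<Sum>Y\<in>{Y\<in>?P. touching D (bd Y) = K}. z ^ card (bd Y) * exp (field N (\<lambda>_. k) Y) * F (touching D (bd Y)))
         = F K * (z ^ card K * Xi N (?off (?X K)) (signed k (inside N K)))"
        by (simp add: sum_distrib_left[symmetric] sum_distrib_right[symmetric] mult.commute)
    qed
    finally show ?thesis .
  qed
  have Xiq: "Xi N ?q h = (\<Sum>Y\<in>?P. z ^ card (bd Y) * exp (field N h Y))" for h
    unfolding Xi_def by (simp add: pw_def)
  let ?R = "Xi N (?off D) (\<lambda>_. l)" and ?S = "Xi N (?off D) (\<lambda>_. 0)" and ?Z = "Xi N ?q (\<lambda>_. 0)"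
  have nn: "0 \<le> ?off A e" for A e using off_bounds[OF z(1)] by blast
  have pos: "0 < Xi N (?off A) h" for A h by (rule Xi_pos[OF nn])
  have X0: "0 < ?Z" using z by (intro Xi_pos)
  define F where "F K = exp (- 2 * l * real (card (inside N K)))" for K
  have signed0: "Xi N p (signed 0 A) = Xi N p (\<lambda>_. 0)" for p A
  proof -
    have "signed 0 A = (\<lambda>_. 0)" by (rule ext) (simp add: signed_def)
    then show ?thesis by simp
  qed
  \<comment> \<open>Revealing \<open>K\<close> reverses the field inside it, which costs at most the
    factor \<open>F K\<close>; the additional frozen edges of \<open>Dl K\<close> only strengthen
    the response to the field.\<close>
  have summand: "?R * (F K * (z ^ card K * Xi N (?off (?X K)) (signed 0 (inside N K)))) \<le> z ^ card K * Xi N (?off (?X K)) (signed l (inside N K)) * ?S"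
    if "K \<in> KK" for K
  proof -
    have sub: "inside N K \<subseteq> box N" using that G by (auto simp: KK_def)
    have "F K * Xi N (?off (?X K)) (\<lambda>_. l) \<le> Xi N (?off (?X K)) (signed l (inside N K))"
      unfolding Xi_def sum_distrib_left
    proof (rule sum_mono)
      fix W
      have "field N (\<lambda>_. l) W \<le> field N (signed l (inside N K)) W + 2 * l * real (card (inside N K))"
        unfolding field_signed[symmetric] by (rule field_flip_le[OF sub]) (use l in simp)
      then have "F K * exp (field N (\<lambda>_. l) W) \<le> exp (field N (signed l (inside N K)) W)"
        unfolding F_def by (simp flip: exp_add)
      then have "pw (?off (?X K)) (bd W) * (F K * exp (field N (\<lambda>_. l) W)) \<le> pw (?off (?X K)) (bd W) * exp (field N (signed l (inside N K)) W)"
        using nn by (intro mult_left_mono pw_nonneg)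
      then show "F K * (pw (?off (?X K)) (bd W) * exp (field N (\<lambda>_. l) W)) \<le> pw (?off (?X K)) (bd W) * exp (field N (signed l (inside N K)) W)"
        by (simp only: mult.left_commute)
    qed
    then have "F K * Xi N (?off (?X K)) (\<lambda>_. l) * ?S \<le> Xi N (?off (?X K)) (signed l (inside N K)) * ?S"
      using pos[of D "\<lambda>_. 0"] by (intro mult_right_mono) auto
    moreover have "F K * (?R * Xi N (?off (?X K)) (\<lambda>_. 0)) \<le> F K * (Xi N (?off (?X K)) (\<lambda>_. l) * ?S)"
    proof (rule mult_left_mono)
      show "?R * Xi N (?off (?X K)) (\<lambda>_. 0) \<le> Xi N (?off (?X K)) (\<lambda>_. l) * ?S"
        by (rule field_coupling_monotone[OF _ l]) (use z z1 in \<open>auto simp: off_def\<close>)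
    qed (simp add: F_def)
    ultimately have "F K * (?R * Xi N (?off (?X K)) (\<lambda>_. 0)) \<le> Xi N (?off (?X K)) (signed l (inside N K)) * ?S"
      by (simp only: mult.assoc)
    then have "z ^ card K * (F K * (?R * Xi N (?off (?X K)) (\<lambda>_. 0))) \<le> z ^ card K * (Xi N (?off (?X K)) (signed l (inside N K)) * ?S)"
      using w by (rule mult_left_mono)
    then show ?thesis unfolding signed0 by (simp only: mult_ac)
  qed
  have "?R * (\<Sum>Y\<in>?P. z ^ card (bd Y) * exp (field N (\<lambda>_. 0) Y) * F (touching D (bd Y))) \<le> Xi N ?q (\<lambda>_. l) * ?S"
  proof -
    have "?R * (\<Sum>Y\<in>?P. z ^ card (bd Y) * exp (field N (\<lambda>_. 0) Y) * F (touching D (bd Y)))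
      = (\<Sum>K\<in>KK. ?R * (F K * (z ^ card K * Xi N (?off (?X K)) (signed 0 (inside N K)))))"
      unfolding part sum_distrib_left ..
    also have "\<dots> \<le> (\<Sum>K\<in>KK. z ^ card K * Xi N (?off (?X K)) (signed l (inside N K)) * ?S)" using summand by (rule sum_mono)
    also have "\<dots> = Xi N ?q (\<lambda>_. l) * ?S"
      using part[of l "\<lambda>_. 1"] by (simp add: Xiq sum_distrib_right)
    finally show ?thesis .
  qed
  \<comment> \<open>Jensen's inequality moves the mean area into the exponent, where it is bounded
    edge by edge with \<open>touching_area\<close>.\<close>
  moreover have "?Z * exp (- 2 * l * (loop_const z * real (card D))) \<le> (\<Sum>Y\<in>?P. z ^ card (bd Y) * exp (- 2 * l * real (card (?G Y))))"
    unfolding Xi_zero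
  proof (rule order_trans[OF jensen_exp])
    show "0 < (\<Sum>Y\<in>?P. pw ?q (bd Y))" using X0 by (simp add: Xi_zero)
    have "(\<Sum>Y\<in>?P. pw ?q (bd Y) * real (card (?G Y))) \<le> (\<Sum>Y\<in>?P. \<Sum>e\<in>D. if e \<in> bd Y then pw ?q (bd Y) * real (card (inside N (comp (bd Y) e))) else 0)"
    proof (rule sum_mono)
      fix Y assume Y: "Y \<in> ?P"
      have "pw ?q (bd Y) * real (card (?G Y)) \<le> pw ?q (bd Y) * (\<Sum>e\<in>D \<inter> bd Y. real (card (inside N (comp (bd Y) e))))"
        using inside_touching[OF _ D] Y z by (intro mult_left_mono pw_nonneg) auto
      also have "\<dots> = (\<Sum>e\<in>D. if e \<in> bd Y then pw ?q (bd Y) * real (card (inside N (comp (bd Y) e))) else 0)"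
        unfolding sum_distrib_left using D by (rule sum.inter_restrict)
      finally show "pw ?q (bd Y) * real (card (?G Y)) \<le> (\<Sum>e\<in>D. if e \<in> bd Y then pw ?q (bd Y) * real (card (inside N (comp (bd Y) e))) else 0)" .
    qed
    also have "\<dots> = (\<Sum>e\<in>D. \<Sum>Y\<in>?P. if e \<in> bd Y then pw ?q (bd Y) * real (card (inside N (comp (bd Y) e))) else 0)" by (rule sum.swap)
    also have "\<dots> = (\<Sum>e\<in>D. \<Sum>Y\<in>{Y\<in>?P. e \<in> bd Y}. pw ?q (bd Y) * real (card (inside N (comp (bd Y) e))))"
      using finite_box by (intro sum.cong refl sum.inter_filter[symmetric]) simp
    also have "\<dots> \<le> (\<Sum>e\<in>D. loop_const z * ?Z)" using touching_area[of ?q z N] z by (intro sum_mono) auto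
    finally have a: "(\<Sum>Y\<in>?P. pw ?q (bd Y) * real (card (?G Y))) \<le> real (card D) * (loop_const z * ?Z)" by simp
    have "2 * l * (\<Sum>Y\<in>?P. pw ?q (bd Y) * real (card (?G Y))) \<le> 2 * l * (real (card D) * (loop_const z * ?Z))"
      using a l by (intro mult_left_mono) auto
    then show "- 2 * l * (loop_const z * real (card D)) * (\<Sum>Y\<in>?P. pw ?q (bd Y)) \<le> (\<Sum>Y\<in>?P. pw ?q (bd Y) * (- 2 * l * real (card (?G Y))))"
      unfolding Xi_zero[symmetric] by (simp add: sum_distrib_left sum_negf mult_ac)
  qed (use z in \<open>auto simp: pw_def\<close>)
  then have "?R * (?Z * exp (- 2 * l * (loop_const z * real (card D)))) \<le> ?R * (\<Sum>Y\<in>?P. z ^ card (bd Y) * exp (field N (\<lambda>_. 0) Y) * F (touching D (bd Y)))"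
    using pos[of D "\<lambda>_. l"] by (intro mult_left_mono) (auto simp: F_def field_def)
  ultimately have "?R * (?Z * exp (- 2 * l * (loop_const z * real (card D)))) \<le> Xi N ?q (\<lambda>_. l) * ?S" by linarith
  then have "exp (2 * l * (loop_const z * real (card D))) * (?R * (?Z * exp (- 2 * l * (loop_const z * real (card D))))) \<le> exp (2 * l * (loop_const z * real (card D))) * (Xi N ?q (\<lambda>_. l) * ?S)"
    by (intro mult_left_mono) auto
  then show ?thesis by (simp add: exp_minus field_simps)
qed

section \<open>Sums over interfaces\<close>

definition ifaces :: "nat \<Rightarrow> dvert set set set" where "ifaces N = iface N ` Pow (box N)"

text \<open>By \<open>iface_sum\<close> this is the total weight of the configurations with
  interface \<open>I\<close>.\<close>

definition NI :: "nat \<Rightarrow> (dvert set \<Rightarrow> real) \<Rightarrow> real \<Rightarrow> dvert set set \<Rightarrow> real" where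
  "NI N q l I = pw q I * Xi N (off q (star corner \<union> Dl I)) (signed l (below N I))"

lemma finite_ifaces: "finite (ifaces N)"
  unfolding ifaces_def using finite_box by simp

lemma iface_partition:
  "(\<Sum>Y\<in>{Y\<in>Pow (box N). P (iface N Y)}. pw q (bd Y \<triangle> Bot N) * exp (field N (\<lambda>_. l) Y)) = (\<Sum>I\<in>{I\<in>ifaces N. P I}. NI N q l I)"
proof -
  let ?w = "\<lambda>Y. pw q (bd Y \<triangle> Bot N) * exp (field N (\<lambda>_. l) Y)" and ?A = "{Y\<in>Pow (box N). P (iface N Y)}"
  have fin: "finite ?A" using finite_box by simp
  have img: "iface N ` ?A = {I\<in>ifaces N. P I}" unfolding ifaces_def by blast
  have "sum ?w ?A = (\<Sum>I\<in>{I\<in>ifaces N. P I}. sum ?w {Y\<in>?A. iface N Y = I})"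
    unfolding img[symmetric] by (rule sum.image_gen[OF fin])
  also have "\<dots> = (\<Sum>I\<in>{I\<in>ifaces N. P I}. NI N q l I)"
  proof (rule sum.cong[OF refl])
    fix I assume I: "I \<in> {I\<in>ifaces N. P I}"
    then obtain Y0 where Y0: "Y0 \<subseteq> box N" "I = iface N Y0" by (auto simp: ifaces_def)
    have "{Y\<in>?A. iface N Y = I} = {Y\<in>Pow (box N). iface N Y = I}" using I by blast
    then show "sum ?w {Y\<in>?A. iface N Y = I} = NI N q l I"
      using iface_sum[OF Y0(1), of q l] unfolding NI_def Y0(2) by simp
  qed
  finally show ?thesis .
qed

lemma NI_sum: "(\<Sum>I\<in>ifaces N. NI N q l I) = Zd N q (\<lambda>_. l)"
  using iface_partition[where P = "\<lambda>_. True" and N = N and q = q and l = l] by (simp add: Zd_def Pow_def)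

lemma ifaces_subset: "I \<in> ifaces N \<Longrightarrow> I \<subseteq> Ed N \<and> finite I"
proof -
  assume "I \<in> ifaces N"
  then obtain Y where Y: "Y \<subseteq> box N" "I = iface N Y" by (auto simp: ifaces_def)
  have "I \<subseteq> bd Y \<triangle> Bot N" unfolding Y(2) iface_def by (rule touching_subset)
  then have "I \<subseteq> Ed N" using dob_edges(1)[OF Y(1)] by blast
  then show ?thesis using finite_subset[OF _ finite_Ed] by blast
qed

lemma ifaces_card: "card {I \<in> ifaces N. card I = Suc m} \<le> 4 * 3 ^ m" "I \<in> ifaces N \<Longrightarrow> 1 \<le> card I"
proof -
  have w: "\<exists>b\<in>nbrs corner. \<exists>m. I \<in> walk_sets corner b m \<and> card I = Suc m" if "I \<in> ifaces N" for I
    using that iface_walk unfolding ifaces_def by blast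
  have "{I \<in> ifaces N. card I = Suc m} \<subseteq> (\<Union>b\<in>nbrs corner. walk_sets corner b m)"
  proof
    fix I assume I: "I \<in> {I \<in> ifaces N. card I = Suc m}"
    then obtain b m' where "b \<in> nbrs corner" "I \<in> walk_sets corner b m'" "card I = Suc m'" using w by blast
    then show "I \<in> (\<Union>b\<in>nbrs corner. walk_sets corner b m)" using I by auto
  qed
  moreover have "finite (\<Union>b\<in>nbrs corner. walk_sets corner b m)"
    using walk_sets(1) by (intro finite_UN_I) (auto simp: nbrs_simps)
  ultimately have "card {I \<in> ifaces N. card I = Suc m} \<le> card (\<Union>b\<in>nbrs corner. walk_sets corner b m)" by (rule card_mono[rotated])
  also have "\<dots> \<le> (\<Sum>b\<in>nbrs corner. card (walk_sets corner b m))" by (rule card_UN_le) simp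
  also have "\<dots> \<le> (\<Sum>b\<in>nbrs corner. 3 ^ m)" using walk_sets(2) by (intro sum_mono) auto
  finally show "card {I \<in> ifaces N. card I = Suc m} \<le> 4 * 3 ^ m" by simp
  show "I \<in> ifaces N \<Longrightarrow> 1 \<le> card I" using w by fastforce
qed

text \<open>Four starting edges and three continuations per step: \<open>4 * z * (3 * z) ^ m\<close>
  is dominated by a geometric series of ratio 3/5.\<close>

lemma long_interfaces:
  fixes z :: real
  assumes z: "0 \<le> z" "z \<le> 1 / 5"
  shows "(\<Sum>I\<in>{I\<in>ifaces N. n < card I}. z ^ card I) \<le> 2 * (3 / 5) ^ n"
proof -
  define M where "M = card (Ed N)"
  have fin: "finite {I\<in>ifaces N. n < card I}" using finite_ifaces by simp
  have "(\<Sum>I\<in>{I\<in>ifaces N. n < card I}. z ^ card I) = (\<Sum>m\<in>{n..M}. \<Sum>I\<in>{I\<in>{I\<in>ifaces N. n < card I}. card I - 1 = m}. z ^ card I)"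
  proof (rule sum.group[symmetric, OF fin])
    show "(\<lambda>I. card I - 1) ` {I\<in>ifaces N. n < card I} \<subseteq> {n..M}"
    proof
      fix k assume "k \<in> (\<lambda>I. card I - 1) ` {I\<in>ifaces N. n < card I}"
      then obtain I where I: "I \<in> ifaces N" "n < card I" "k = card I - 1" by auto
      have "card I \<le> M" unfolding M_def using ifaces_subset[OF I(1)] finite_Ed by (intro card_mono) auto
      then show "k \<in> {n..M}" using I by auto
    qed
  qed simp
  also have "\<dots> \<le> (\<Sum>m\<in>{n..M}. 4 / 5 * (3 / 5) ^ m)"
  proof (rule sum_mono)
    fix m assume m: "m \<in> {n..M}"
    have eq: "{I\<in>{I\<in>ifaces N. n < card I}. card I - 1 = m} = {I \<in> ifaces N. card I = Suc m}"
      using m by auto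
    have "(\<Sum>I\<in>{I \<in> ifaces N. card I = Suc m}. z ^ card I) = real (card {I \<in> ifaces N. card I = Suc m}) * z ^ Suc m" by simp
    also have "\<dots> \<le> real (4 * 3 ^ m) * z ^ Suc m"
      using ifaces_card(1)[of N m] z by (intro mult_right_mono of_nat_mono) auto
    also have "\<dots> = (4 * z) * (3 * z) ^ m" by (simp add: power_mult_distrib)
    also have "\<dots> \<le> 4 / 5 * (3 / 5) ^ m" using z by (intro mult_mono power_mono) auto
    finally show "(\<Sum>I\<in>{I\<in>{I\<in>ifaces N. n < card I}. card I - 1 = m}. z ^ card I) \<le> 4 / 5 * (3 / 5) ^ m" unfolding eq .
  qed
  also have "\<dots> \<le> 4 / 5 * ((3 / 5) ^ n / (1 - 3 / 5))"
    unfolding sum_distrib_left[symmetric] by (intro mult_left_mono geometric_tail_le) auto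
  finally show ?thesis by simp
qed

lemma Xi_off_le:
  assumes "0 \<le> z" shows "Xi N (off (\<lambda>_. z) D) h \<le> Xi N (\<lambda>_. z) h"
  unfolding Xi_def
proof (intro sum_mono mult_right_mono)
  fix Y show "pw (off (\<lambda>_. z) D) (bd Y) \<le> pw (\<lambda>_. z) (bd Y)"
    unfolding pw_def using assms by (intro prod_mono) (auto simp: off_def)
qed simp

lemma NI_le:
  assumes z: "0 \<le> z" "z \<le> 1 / 5" and l: "0 \<le> l" and I: "I \<in> ifaces N"
  shows "NI N (\<lambda>_. z) l I \<le> z ^ card I * Xi N (\<lambda>_. z) (\<lambda>_. l)"
    "0 \<le> l0 \<Longrightarrow> l0 \<le> l \<Longrightarrow> 3 * (z * exp (2 * l0 * (real N + 1))) \<le> 3 / 5 \<Longrightarrow>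
      NI N (\<lambda>_. z) l I * Xi N (\<lambda>_. z) (\<lambda>_. 0)
      \<le> exp (26 * l * loop_const z * real (card I)) * exp (- l0 * real (card (below N I))) * (Xi N (\<lambda>_. z) (\<lambda>_. l) * NI N (\<lambda>_. z) 0 I)"
proof -
  let ?D = "star corner \<union> Dl I" and ?q = "\<lambda>_::dvert set. z"
  have z1: "z \<le> 1" using z by simp
  have z3: "3 * z \<le> 3 / 5" using z by simp
  obtain Y where Y: "Y \<subseteq> box N" "I = iface N Y" using I by (auto simp: ifaces_def)
  have L: "below N I \<subseteq> box N" unfolding Y(2) by (rule below_iface[OF Y(1)])
  have R: "Xi N (off ?q ?D) (signed l (below N I)) \<le> exp (- l0 * real (card (below N I))) * Xi N (off ?q ?D) (\<lambda>_. l)"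
    if "0 \<le> l0" "l0 \<le> l" "3 * (z * exp (2 * l0 * (real N + 1))) \<le> 3 / 5" for l0
    by (rule reversed_field_cost[OF z(1) z1 that(1,2) L that(3)])
  have "Xi N (off ?q ?D) (signed l (below N I)) \<le> Xi N ?q (\<lambda>_. l)"
    using R[of 0] l z3 Xi_off_le[OF z(1), of N ?D "\<lambda>_. l"] by simp
  then show "NI N ?q l I \<le> z ^ card I * Xi N ?q (\<lambda>_. l)"
    unfolding NI_def pw_const using z by (intro mult_left_mono) auto
  assume l0: "0 \<le> l0" "l0 \<le> l" "3 * (z * exp (2 * l0 * (real N + 1))) \<le> 3 / 5"
  have IL: "I \<subseteq> lattice_edges" "finite I" using ifaces_subset[OF I] Ed_lattice by blast+
  have D: "finite ?D" using card_Dl(1)[OF IL(2,1)] by simp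
  have "card ?D \<le> card (star corner) + card (Dl I)" by (rule card_Un_le)
  then have "card ?D \<le> 13 * card I" using card_Dl(2)[OF IL(2,1)] ifaces_card(2)[OF I] by (simp add: card_star)
  then have cD: "real (card ?D) \<le> 13 * real (card I)" by (metis of_nat_le_iff of_nat_mult of_nat_numeral)
  have lc: "0 \<le> loop_const z" by (rule loop_const_nonneg[OF z(1) z3])
  have "2 * l * (loop_const z * real (card ?D)) \<le> 2 * l * (loop_const z * (13 * real (card I)))"
    using cD lc l by (intro mult_left_mono) auto
  then have "exp (2 * l * (loop_const z * real (card ?D))) \<le> exp (26 * l * loop_const z * real (card I))"
    by (simp add: mult_ac)
  moreover have pos: "0 < Xi N (off ?q A) h" "0 < Xi N ?q h" for A h using z by (auto intro!: Xi_pos simp: off_def)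
  ultimately have F: "Xi N (off ?q ?D) (\<lambda>_. l) * Xi N ?q (\<lambda>_. 0)
      \<le> exp (26 * l * loop_const z * real (card I)) * (Xi N ?q (\<lambda>_. l) * Xi N (off ?q ?D) (\<lambda>_. 0))"
    using frozen_field_response[OF z(1) z3 l D, of N] pos
    by (smt (verit, best) mult.assoc mult_right_mono mult_pos_pos)
  have "Xi N (off ?q ?D) (signed l (below N I)) * Xi N ?q (\<lambda>_. 0)
      \<le> exp (- l0 * real (card (below N I))) * (Xi N (off ?q ?D) (\<lambda>_. l) * Xi N ?q (\<lambda>_. 0))"
    using mult_right_mono[OF R[OF l0], of "Xi N ?q (\<lambda>_. 0)"] pos(2)[of "\<lambda>_. 0"] by (simp add: mult.assoc)
  also have "\<dots> \<le> exp (- l0 * real (card (below N I))) * (exp (26 * l * loop_const z * real (card I)) * (Xi N ?q (\<lambda>_. l) * Xi N (off ?q ?D) (\<lambda>_. 0)))"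
    using F by (intro mult_left_mono) auto
  finally have "z ^ card I * (Xi N (off ?q ?D) (signed l (below N I)) * Xi N ?q (\<lambda>_. 0))
      \<le> z ^ card I * (exp (- l0 * real (card (below N I))) * (exp (26 * l * loop_const z * real (card I)) * (Xi N ?q (\<lambda>_. l) * Xi N (off ?q ?D) (\<lambda>_. 0))))"
    using z by (intro mult_left_mono) auto
  moreover have "signed 0 (below N I) = (\<lambda>_. 0)" by (rule ext) (simp add: signed_def)
  ultimately show "NI N ?q l I * Xi N ?q (\<lambda>_. 0)
      \<le> exp (26 * l * loop_const z * real (card I)) * exp (- l0 * real (card (below N I))) * (Xi N ?q (\<lambda>_. l) * NI N ?q 0 I)"
    unfolding NI_def pw_const by (simp add: mult_ac)
qed

text \<open>Long interfaces are ruled out by counting; for the others the field acts like a factor \<open>exp (- l0 * area)\<close>.\<close>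

lemma interface_event_bound:
  assumes z: "0 \<le> z" "z \<le> 1 / 5" and l: "0 \<le> l0" "l0 \<le> l" and small: "3 * (z * exp (2 * l0 * (real N + 1))) \<le> 3 / 5"
    and P: "\<And>I. I \<in> ifaces N \<Longrightarrow> P I \<Longrightarrow> A \<le> real (card (below N I))"
  shows "(\<Sum>I\<in>{I\<in>ifaces N. P I}. NI N (\<lambda>_. z) l I) * Xi N (\<lambda>_. z) (\<lambda>_. 0)
    \<le> Xi N (\<lambda>_. z) (\<lambda>_. l) * (2 * (3 / 5) ^ n * Xi N (\<lambda>_. z) (\<lambda>_. 0)
        + exp (26 * l * loop_const z * real n) * exp (- l0 * A) * (\<Sum>I\<in>{I\<in>ifaces N. P I}. NI N (\<lambda>_. z) 0 I))"
proof -
  let ?q = "\<lambda>_::dvert set. z"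
  let ?X = "Xi N ?q (\<lambda>_. l)" and ?Z = "Xi N ?q (\<lambda>_. 0)" and ?E = "exp (26 * l * loop_const z * real n) * exp (- l0 * A)"
  have pos: "0 < Xi N ?q h" for h using z by (intro Xi_pos) auto
  have l': "0 \<le> l" using l by simp
  have lc: "0 \<le> loop_const z" by (rule loop_const_nonneg) (use z in auto)
  have nn: "0 \<le> NI N ?q 0 I" for I
    unfolding NI_def pw_const using z Xi_pos[of "off ?q (star corner \<union> Dl I)" N "signed 0 (below N I)"] by (intro mult_nonneg_nonneg) (auto simp: off_def less_imp_le)
  have "(\<Sum>I\<in>{I\<in>ifaces N. P I}. NI N ?q l I) * ?Z = (\<Sum>I\<in>{I\<in>ifaces N. P I}. NI N ?q l I * ?Z)" by (rule sum_distrib_right)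
  also have "\<dots> \<le> (\<Sum>I\<in>{I\<in>ifaces N. P I}. (if n < card I then z ^ card I else 0) * (?X * ?Z) + ?X * (?E * NI N ?q 0 I))"
  proof (rule sum_mono)
    fix I assume "I \<in> {I\<in>ifaces N. P I}"
    then have I: "I \<in> ifaces N" "P I" by auto
    have n2: "0 \<le> ?X * (?E * NI N ?q 0 I)" using pos[of "\<lambda>_. l"] nn[of I] by (intro mult_nonneg_nonneg) auto
    show "NI N ?q l I * ?Z \<le> (if n < card I then z ^ card I else 0) * (?X * ?Z) + ?X * (?E * NI N ?q 0 I)"
    proof (cases "n < card I")
      case True
      have "NI N ?q l I * ?Z \<le> z ^ card I * ?X * ?Z"
        using NI_le(1)[OF z l' I(1)] pos[of "\<lambda>_. 0"] by (intro mult_right_mono) auto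
      then show ?thesis using True n2 by (simp add: mult.assoc)
    next
      case False
      have "26 * l * loop_const z * real (card I) \<le> 26 * l * loop_const z * real n"
        using False l' lc by (intro mult_left_mono) auto
      moreover have "l0 * A \<le> l0 * real (card (below N I))" using P[OF I] l by (intro mult_left_mono) auto
      ultimately have e: "exp (26 * l * loop_const z * real (card I)) * exp (- l0 * real (card (below N I))) \<le> ?E"
        by (intro mult_mono) auto
      have "NI N ?q l I * ?Z \<le> exp (26 * l * loop_const z * real (card I)) * exp (- l0 * real (card (below N I))) * (?X * NI N ?q 0 I)"
        by (rule NI_le(2)[OF z l' I(1) l small])
      also have "\<dots> \<le> ?E * (?X * NI N ?q 0 I)"
        using e pos[of "\<lambda>_. l"] nn[of I] by (intro mult_right_mono mult_nonneg_nonneg) auto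
      also have "\<dots> = ?X * (?E * NI N ?q 0 I)" by (simp only: mult_ac)
      finally show ?thesis using False by simp
    qed
  qed
  also have "\<dots> = (\<Sum>I\<in>{I\<in>ifaces N. P I}. if n < card I then z ^ card I else 0) * (?X * ?Z) + ?X * (?E * (\<Sum>I\<in>{I\<in>ifaces N. P I}. NI N ?q 0 I))"
    by (simp only: sum.distrib sum_distrib_left sum_distrib_right)
  also have "\<dots> \<le> 2 * (3 / 5) ^ n * (?X * ?Z) + ?X * (?E * (\<Sum>I\<in>{I\<in>ifaces N. P I}. NI N ?q 0 I))"
  proof -
    have "(\<Sum>I\<in>{I\<in>ifaces N. P I}. if n < card I then z ^ card I else 0) \<le> (\<Sum>I\<in>ifaces N. if n < card I then z ^ card I else 0)"
      using finite_ifaces z by (intro sum_mono2) auto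
    also have "\<dots> = (\<Sum>I\<in>{I\<in>ifaces N. n < card I}. z ^ card I)" by (rule sum.inter_filter[OF finite_ifaces, symmetric])
    also have "\<dots> \<le> 2 * (3 / 5) ^ n" by (rule long_interfaces[OF z])
    finally show ?thesis using pos[of "\<lambda>_. l"] pos[of "\<lambda>_. 0"] by (intro add_right_mono mult_right_mono) auto
  qed
  also have "\<dots> = ?X * (2 * (3 / 5) ^ n * ?Z + ?E * (\<Sum>I\<in>{I\<in>ifaces N. P I}. NI N ?q 0 I))"
    by (simp add: algebra_simps)
  finally show ?thesis .
qed

section \<open>Interfaces with few high edges\<close>

definition high :: "nat \<Rightarrow> dvert set set \<Rightarrow> dvert set set" where
  "high J I = I \<inter> hE ` {v. snd v + 1 \<ge> int J}"

lemma pw_layered: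
  assumes "finite I" shows "z ^ card I = pw (layered z \<theta> J) I * exp (2 * \<theta> * real (card (high J I)))"
proof -
  have "z = layered z \<theta> J e * (if e \<in> hE ` {v. snd v + 1 \<ge> int J} then exp (2 * \<theta>) else 1)" for e
    by (simp add: layered_def flip: exp_add)
  then have "(\<Prod>e\<in>I. z) = (\<Prod>e\<in>I. layered z \<theta> J e * (if e \<in> hE ` {v. snd v + 1 \<ge> int J} then exp (2 * \<theta>) else 1))"
    by (intro prod.cong) auto
  also have "\<dots> = pw (layered z \<theta> J) I * (\<Prod>e\<in>high J I. exp (2 * \<theta>))"
    unfolding prod.distrib pw_def high_def using assms by (simp only: prod.inter_restrict)
  also have "(\<Prod>e\<in>high J I. exp (2 * \<theta>)) = exp (2 * \<theta> * real (card (high J I)))"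
    by (simp add: exp_of_nat_mult[symmetric] mult.commute)
  finally show ?thesis by simp
qed

text \<open>Passing from \<open>z\<close> to the layered weight loses a factor
  \<open>exp (2 / J^2)\<close> per high edge and gains the better rate of
  \<open>dobrushin_layered_upper\<close>. The factor for the surroundings is carried over by
  \<open>avoidance_monotone\<close>.\<close>

lemma low_interfaces:
  assumes z: "0 < z" "z \<le> 1 / 5" and J: "1 \<le> J" "J \<le> N + 2"
  shows "(\<Sum>I\<in>{I\<in>ifaces N. card (high J I) \<le> H}. NI N (\<lambda>_. z) 0 I)
    \<le> exp (2 * real H / (real J)\<^sup>2) * (1 / z * sqrt (real N + 2) * exp (- (tau z + gap z / (real J)\<^sup>2) * (real N + 1))) * Xi N (\<lambda>_. z) (\<lambda>_. 0)"
proof -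
  define \<theta> where "\<theta> = 1 / (real J)\<^sup>2"
  define q where "q = layered z \<theta> J"
  let ?q = "\<lambda>_::dvert set. z" and ?D = "\<lambda>I. star corner \<union> Dl I"
  let ?Z = "Xi N ?q (\<lambda>_. 0)" and ?Q = "Xi N q (\<lambda>_. 0)" and ?E = "exp (2 * real H / (real J)\<^sup>2)"
  have th: "0 \<le> \<theta>" by (simp add: \<theta>_def)
  have qb: "0 \<le> q e \<and> q e \<le> z" for e unfolding q_def layered_def using z th by simp
  have Q: "0 < ?Q" using qb by (intro Xi_pos) auto
  have Z: "0 < ?Z" using z by (intro Xi_pos) auto
  have s0: "signed 0 A = (\<lambda>_. 0)" for A by (rule ext) (simp add: signed_def)
  have each: "NI N ?q 0 I * ?Q \<le> ?E * ?Z * NI N q 0 I" if I: "I \<in> ifaces N" "card (high J I) \<le> H" for I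
  proof -
    have p: "0 \<le> pw q I" using qb by (intro pw_nonneg) auto
    have off: "Xi N (off ?q (?D I)) (\<lambda>_. 0) * ?Q \<le> Xi N (off q (?D I)) (\<lambda>_. 0) * ?Z"
      by (rule avoidance_monotone) (use qb z order_trans in force)
    have offp: "0 < Xi N (off q (?D I)) (\<lambda>_. 0)" using qb by (intro Xi_pos) (auto simp: off_def)
    have "2 * \<theta> * real (card (high J I)) \<le> 2 * \<theta> * real H" using I(2) th by (intro mult_left_mono) auto
    then have e: "exp (2 * \<theta> * real (card (high J I))) \<le> ?E" by (simp add: \<theta>_def)
    have "z ^ card I \<le> pw q I * ?E"
      unfolding pw_layered[of I z \<theta> J, OF conjunct2[OF ifaces_subset[OF I(1)]]] q_def[symmetric]
      using e p by (rule mult_left_mono)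
    then have "z ^ card I * (Xi N (off ?q (?D I)) (\<lambda>_. 0) * ?Q) \<le> pw q I * ?E * (Xi N (off q (?D I)) (\<lambda>_. 0) * ?Z)"
    proof (rule mult_mono[OF _ off])
      have "0 < Xi N (off ?q (?D I)) (\<lambda>_. 0)" using z by (intro Xi_pos) (auto simp: off_def)
      then show "0 \<le> Xi N (off ?q (?D I)) (\<lambda>_. 0) * ?Q" using Q by simp
    qed (use p in simp)
    then show ?thesis unfolding NI_def s0 pw_const by (simp only: mult_ac)
  qed
  have NI0: "0 \<le> NI N q 0 I" for I
    unfolding NI_def s0 using qb Xi_pos[of "off q (?D I)" N "\<lambda>_. 0"] by (intro mult_nonneg_nonneg pw_nonneg) (auto simp: off_def less_imp_le)
  have "(\<Sum>I\<in>{I\<in>ifaces N. card (high J I) \<le> H}. NI N ?q 0 I) * ?Q \<le> (\<Sum>I\<in>{I\<in>ifaces N. card (high J I) \<le> H}. ?E * ?Z * NI N q 0 I)"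
    unfolding sum_distrib_right using each by (intro sum_mono) auto
  also have "\<dots> \<le> (\<Sum>I\<in>ifaces N. ?E * ?Z * NI N q 0 I)"
    using finite_ifaces NI0 Z by (intro sum_mono2) auto
  also have "\<dots> = ?E * ?Z * Zd N q (\<lambda>_. 0)" by (simp add: NI_sum flip: sum_distrib_left)
  also have "\<dots> \<le> ?E * ?Z * (1 / z * sqrt (real N + 2) * exp (- (tau z + gap z / (real J)\<^sup>2) * (real N + 1)) * ?Q)"
    using dobrushin_layered_upper[OF z J] Z unfolding q_def \<theta>_def by (intro mult_left_mono) auto
  finally have "(\<Sum>I\<in>{I\<in>ifaces N. card (high J I) \<le> H}. NI N ?q 0 I) * ?Q
     \<le> (?E * (1 / z * sqrt (real N + 2) * exp (- (tau z + gap z / (real J)\<^sup>2) * (real N + 1))) * ?Z) * ?Q"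
    by (simp only: mult_ac)
  then show ?thesis by (simp only: mult_le_cancel_right_pos[OF Q])
qed

section \<open>Sums over families of long fingers\<close>

definition polys :: "nat \<Rightarrow> nat \<Rightarrow> dvert set set set" where
  "polys N n = {bd G |G. is_loop N G \<and> n \<le> card (bd G)}"

lemma finite_polys: "finite (polys N n)"
  by (rule finite_subset[of _ "bd ` Pow (box N)"]) (use finite_box in \<open>auto simp: polys_def is_loop_def\<close>)

text \<open>The weight 1/4 per edge is the share of \<open>z\<close> reserved for entropy: with
  three continuations per step the ratio is 3/4.\<close>

lemma polys_sum:
  assumes n: "1 \<le> n"
  shows "(\<Sum>\<gamma>\<in>polys N n. (1 / 4) ^ card \<gamma>) \<le> 3 * (real N + 2)\<^sup>2 * (3 / 4 :: real) ^ n"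
proof -
  define M where "M = card (Ed N)"
  define T where "T = (SIGMA e:Ed N. SIGMA m:{n - 1..M}. loops_at N e m)"
  have finT: "finite T" unfolding T_def using card_loops_at(1) finite_Ed by (intro finite_SigmaI) auto
  have "(\<Sum>\<gamma>\<in>polys N n. (1 / 4 :: real) ^ card \<gamma>) \<le> (\<Sum>t\<in>T. (1 / 4) ^ Suc (fst (snd t)))"
  proof (rule sum_le_included[OF finite_polys finT, where i = "\<lambda>t. bd (snd (snd t))"])
    show "\<forall>\<gamma>\<in>polys N n. \<exists>t\<in>T. bd (snd (snd t)) = \<gamma> \<and> (1 / 4 :: real) ^ card \<gamma> \<le> (1 / 4) ^ Suc (fst (snd t))"
    proof
      fix \<gamma> assume "\<gamma> \<in> polys N n"
      then obtain G where G: "is_loop N G" "\<gamma> = bd G" "n \<le> card (bd G)" by (auto simp: polys_def)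
      have Gb: "G \<subseteq> box N" using G by (simp add: is_loop_def)
      have "bd G \<noteq> {}" using G(3) n by auto
      then obtain e where e: "e \<in> bd G" by blast
      have "card (bd G) \<le> M" unfolding M_def by (rule card_mono[OF finite_Ed bd_subset_Ed[OF Gb]])
      then have "e \<in> Ed N" "card (bd G) - 1 \<in> {n - 1..M}" "Suc (card (bd G) - 1) = card (bd G)"
        using e bd_subset_Ed[OF Gb] G(3) n by auto
      then have "(e, card (bd G) - 1, G) \<in> T" unfolding T_def using e G(1) by (simp add: loops_at_def)
      then show "\<exists>t\<in>T. bd (snd (snd t)) = \<gamma> \<and> (1 / 4 :: real) ^ card \<gamma> \<le> (1 / 4) ^ Suc (fst (snd t))"
        using G(2) \<open>Suc (card (bd G) - 1) = card (bd G)\<close> by (intro bexI[of _ "(e, card (bd G) - 1, G)"]) simp_all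
    qed
  qed simp
  also have "\<dots> = (\<Sum>e\<in>Ed N. \<Sum>m\<in>{n - 1..M}. \<Sum>G\<in>loops_at N e m. (1 / 4) ^ Suc m)"
    unfolding T_def by (simp add: sum_Sigma card_loops_at(1) finite_Ed del: sum_constant)
  also have "\<dots> \<le> (\<Sum>e\<in>Ed N. \<Sum>m\<in>{n - 1..M}. 1 / 4 * (3 / 4) ^ m)"
  proof (intro sum_mono)
    fix e m
    have "real (card (loops_at N e m)) \<le> 3 ^ m"
      using card_loops_at(2)[of N e m] by (metis of_nat_le_iff of_nat_numeral of_nat_power)
    then have "real (card (loops_at N e m)) * (1 / 4) ^ Suc m \<le> 3 ^ m * (1 / 4) ^ Suc m" by (intro mult_right_mono) auto
    also have "\<dots> = 1 / 4 * (3 / 4) ^ m" by (simp add: power_divide)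
    finally show "(\<Sum>G\<in>loops_at N e m. (1 / 4) ^ Suc m) \<le> 1 / 4 * (3 / 4 :: real) ^ m" by simp
  qed
  also have "\<dots> \<le> (\<Sum>e\<in>Ed N. (3 / 4) ^ (n - 1))"
  proof (rule sum_mono)
    show "(\<Sum>m\<in>{n - 1..M}. 1 / 4 * (3 / 4 :: real) ^ m) \<le> (3 / 4) ^ (n - 1)" for e :: "dvert set"
      unfolding sum_distrib_left[symmetric] using geometric_tail_le[of "3 / 4 :: real" "n - 1" M] by simp
  qed
  also have "\<dots> = real (card (Ed N)) * (4 / 3 * (3 / 4) ^ n)" using n by (cases n) auto
  also have "\<dots> \<le> real (2 * (N + 2)\<^sup>2) * (4 / 3 * (3 / 4) ^ n)"
    using card_Ed[of N] by (intro mult_right_mono of_nat_mono) auto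
  also have "\<dots> = 8 / 3 * (real N + 2)\<^sup>2 * (3 / 4) ^ n" by (simp add: add.commute)
  also have "\<dots> \<le> 3 * (real N + 2)\<^sup>2 * (3 / 4) ^ n" by (intro mult_right_mono) auto
  finally show ?thesis .
qed

lemma comps_disjoint:
  assumes "C \<in> comp E ` X" "K \<in> comp E ` X" "C \<noteq> K" shows "C \<inter> K = {}"
proof (rule ccontr)
  assume "C \<inter> K \<noteq> {}"
  then obtain g where g: "g \<in> C" "g \<in> K" by blast
  obtain e e' where "C = comp E e" "K = comp E e'" using assms by auto
  then have "C = comp E g" "K = comp E g" using g comp_eq[of g E e] comp_eq[of g E e'] by simp_all
  then show False using assms(3) by simp
qed

text \<open>The interface is one component among all separating edges; by
  \<open>joined_Un_Dl\<close> deleting the other edges does not disconnect it.\<close>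

lemma iface_connected:
  assumes Y: "Y \<subseteq> box N"
  shows "\<exists>e0. corner \<in> e0 \<and> iface N Y = comp (iface N Y) e0 \<and> e0 \<in> iface N Y"
proof -
  let ?S = "bd Y \<triangle> Bot N" and ?I = "iface N Y"
  note S = split_okD[OF dob_edges(4)[OF Y]]
  obtain e where e: "star corner \<inter> ?S = {e}" "corner \<in> e" using corner_edge[OF Y] by blast
  have K: "?I = comp ?S e" unfolding iface_def touching_def e(1) by simp
  have IS: "?I \<subseteq> ?S" unfolding iface_def by (rule touching_subset)
  have "jclosed ?S ?I" unfolding iface_def by (rule jclosed_touching)
  then have a: "(?S - ?I) \<inter> Dl ?I = {}" by (rule jclosed_avoids_Dl[OF dob_edges(4)[OF Y]])
  have "e \<in> ?I" unfolding K by simp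
  have "comp (?I \<union> (?S - ?I)) e = comp ?I e"
    by (rule joined_Un_Dl(3)[OF _ _ _ _ a \<open>e \<in> ?I\<close>]) (use IS S finite_subset in blast)+
  moreover have "?I \<union> (?S - ?I) = ?S" using IS by blast
  ultimately show ?thesis using K e(2) \<open>e \<in> ?I\<close> by metis
qed

lemma joined_at_cong:
  assumes "E \<subseteq> lattice_edges" "F \<subseteq> lattice_edges" "E \<inter> star u = F \<inter> star u"
  shows "joined_at E u e f \<longleftrightarrow> joined_at F u e f"
proof -
  have d: "ddeg E u = ddeg F u" using assms by (simp add: ddeg_star)
  have m: "e \<in> E \<and> u \<in> e \<longleftrightarrow> e \<in> F \<and> u \<in> e" for e
    using assms star_iff[of e u] by blast
  show ?thesis unfolding joined_at_def d using m[of e] m[of f] by argo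
qed

text \<open>A component of the cut-off region that reaches height \<open>4 * j\<close> must come down to the cut: otherwise it
  would be a component of the interface itself, which starts at the corner.\<close>

lemma finger_decomposition:
  assumes Y: "Y \<subseteq> box N" and j: "1 \<le> j"
    and area: "card (below N (iface N Y)) \<le> j * b" and H: "H \<le> card (high (4 * j) (iface N Y))"
  shows "\<exists>\<G>\<subseteq>polys N (2 * j). \<exists>G\<subseteq>box N. bd G = \<Union>\<G> \<and> card (\<Union>\<G>) = (\<Sum>\<gamma>\<in>\<G>. card \<gamma>) \<and> H \<le> card (\<Union>\<G>)
     \<and> card (bd (Y \<triangle> G) \<triangle> Bot N) + card (\<Union>\<G>) \<le> card (bd Y \<triangle> Bot N) + 2 * b"
proof -
  define I where "I = iface N Y"
  define L where "L = below N I"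
  let ?S = "bd Y \<triangle> Bot N"
  have L: "L \<subseteq> box N" "bd L \<triangle> Bot N = I" using below_iface[OF Y] by (simp_all add: L_def I_def)
  have finL: "finite L" by (rule finite_sub_box[OF L(1)])
  have IS: "I \<subseteq> ?S" unfolding I_def iface_def by (rule touching_subset)
  note S = split_okD[OF dob_edges(4)[OF Y]]
  have IL: "I \<subseteq> lattice_edges" using IS S by blast
  \<comment> \<open>Pigeonhole: the rows from \<open>j\<close> to \<open>2 * j - 1\<close> contain
    at most \<open>j * b\<close> sites of \<open>L\<close>, so one of these \<open>j\<close> rows
    has at most \<open>b\<close> of them. The region is cut just below that row.\<close>
  have "\<exists>h\<in>{int j..<2 * int j}. card {v\<in>L. snd v = h} \<le> b"
  proof (rule ccontr)
    assume "\<not> ?thesis"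
    then have "Suc b \<le> card {v\<in>L. snd v = h}" if "h \<in> {int j..<2 * int j}" for h using that by force
    then have "(\<Sum>h\<in>{int j..<2 * int j}. Suc b) \<le> (\<Sum>h\<in>{int j..<2 * int j}. card {v\<in>L. snd v = h})" by (rule sum_mono)
    also have "\<dots> = card (\<Union>h\<in>{int j..<2 * int j}. {v\<in>L. snd v = h})"
      using finL by (intro card_UN_disjoint[symmetric]) auto
    also have "\<dots> \<le> card L" using finL by (intro card_mono) auto
    finally show False using area j by (simp add: L_def I_def)
  qed
  then obtain h where h: "int j \<le> h" "h < 2 * int j" "card {v\<in>L. snd v = h} \<le> b" by auto
  define Q where "Q = {v\<in>L. snd v \<ge> h}"
  have Qb: "Q \<subseteq> box N" using L(1) by (auto simp: Q_def)
  have hj: "h \<ge> 1" using h j by simp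
  have hE_eq: "hE v \<in> bd Q \<longleftrightarrow> hE v \<in> I" if "snd v \<ge> h" for v
    unfolding L(2)[symmetric] in_sdiff using that hj by (auto simp: Q_def up_def)
  have vE_eq: "vE v \<in> bd Q \<longleftrightarrow> vE v \<in> I" if "snd v \<ge> h" for v
    unfolding L(2)[symmetric] in_sdiff using that hj by (auto simp: Q_def rt_def)
  have star_eq: "bd Q \<inter> star u = I \<inter> star u" if "snd u \<ge> h" for u
  proof -
    have "snd (rt u) \<ge> h" "snd (up u) \<ge> h" using that by (simp_all add: rt_def up_def)
    then have "e \<in> bd Q \<longleftrightarrow> e \<in> I" if "e \<in> star u" for e
      using that hE_eq[of "rt u"] hE_eq[of u] vE_eq[of "up u"] vE_eq[of u] \<open>snd u \<ge> h\<close> unfolding star_def by blast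
    then show ?thesis by blast
  qed
  \<comment> \<open>New boundary edges arise only along the cut, at most one for each site of
    \<open>L\<close> in row \<open>h\<close>.\<close>
  have base: "bd Q - I \<subseteq> (\<lambda>w. hE (fst w, snd w - 1)) ` {v\<in>L. snd v = h}"
  proof
    fix e assume e: "e \<in> bd Q - I"
    then have "e \<in> lattice_edges" using bd_subset_lattice by blast
    then show "e \<in> (\<lambda>w. hE (fst w, snd w - 1)) ` {v\<in>L. snd v = h}"
    proof (cases rule: lattice_edges_cases)
      case (1 v)
      then have lt: "snd v < h" using hE_eq[of v] e by force
      then have "v \<notin> Q" by (simp add: Q_def)
      then have "up v \<in> Q" using e unfolding 1 by simp
      then have "up v \<in> {v\<in>L. snd v = h}" using lt by (auto simp: Q_def up_def)
      moreover have "e = hE (fst (up v), snd (up v) - 1)" unfolding 1 by (simp add: up_def)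
      ultimately show ?thesis by blast
    next
      case (2 v)
      then have lt: "snd v < h" using vE_eq[of v] e by force
      then have "v \<notin> Q" "rt v \<notin> Q" by (simp_all add: Q_def rt_def)
      then show ?thesis using e unfolding 2 by simp
    qed
  qed
  have "card (bd Q - I) \<le> card ((\<lambda>w. hE (fst w, snd w - 1)) ` {v\<in>L. snd v = h})"
    using base finL by (intro card_mono) auto
  also have "\<dots> \<le> card {v\<in>L. snd v = h}" using finL by (intro card_image_le) auto
  finally have cbase: "card (bd Q - I) \<le> b" using h(3) by simp
  define Hs where "Hs = high (4 * j) I"
  have HsQ: "Hs \<subseteq> bd Q"
  proof
    fix e assume "e \<in> Hs"
    then obtain v where v: "e = hE v" "snd v + 1 \<ge> int (4 * j)" "hE v \<in> I" by (auto simp: Hs_def high_def)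
    have "snd v \<ge> h" using v(2) h(2) j by simp
    then show "e \<in> bd Q" using hE_eq[of v] v by simp
  qed
  define \<G> where "\<G> = comp (bd Q) ` Hs"
  have finHs: "finite Hs" by (rule finite_subset[OF HsQ finite_bd[OF Qb]])
  have UG: "\<Union>\<G> = touching Hs (bd Q)" using HsQ unfolding \<G>_def touching_def by (simp add: Int_absorb2)
  have polys: "\<gamma> \<in> polys N (2 * j)" if \<gamma>: "\<gamma> \<in> \<G>" for \<gamma>
  proof -
    obtain e where e: "e \<in> Hs" "\<gamma> = comp (bd Q) e" using \<gamma> by (auto simp: \<G>_def)
    have eQ: "e \<in> bd Q" using e HsQ by blast
    obtain v where v: "e = hE v" "snd v + 1 \<ge> int (4 * j)" "hE v \<in> I" using e(1) by (auto simp: Hs_def high_def)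
    have \<gamma>Q: "\<gamma> \<subseteq> bd Q" unfolding e(2) by (rule comp_subset[OF eQ])
    have down: "\<exists>e'\<in>\<gamma>. \<exists>u\<in>e'. snd u < h"
    proof (rule ccontr)
      assume "\<not> ?thesis"
      then have above: "snd u \<ge> h" if "e' \<in> \<gamma>" "u \<in> e'" for e' u using that by force
      have inI: "e' \<in> I" if e': "e' \<in> \<gamma>" for e'
      proof -
        have l: "e' \<in> lattice_edges" using e' \<gamma>Q bd_subset_lattice by blast
        then have "e' \<noteq> {}" using card_lattice_edge[OF l] by auto
        then obtain u where u: "u \<in> e'" by blast
        have "e' \<in> bd Q \<inter> star u" using star_iff[OF l] u e' \<gamma>Q by blast
        then show ?thesis unfolding star_eq[OF above[OF e' u]] by blast
      qed
      have "jclosed I \<gamma>" unfolding jclosed_def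
      proof (intro conjI ballI allI impI)
        show "\<gamma> \<subseteq> I" using inI by blast
      next
        fix e' f assume e': "e' \<in> \<gamma>" and "joined I e' f"
        then obtain u where u: "joined_at I u e' f" unfolding joined_def by blast
        then have "u \<in> e'" by (simp add: joined_at_def)
        then have "joined_at (bd Q) u e' f"
          using joined_at_cong[OF bd_subset_lattice IL star_eq[OF above[OF e']]] u by blast
        then show "f \<in> \<gamma>" using e' comp_step unfolding e(2) joined_def by blast
      qed
      moreover have "e \<in> \<gamma>" unfolding e(2) by simp
      ultimately have sub: "comp I e \<subseteq> \<gamma>" by (rule comp_minimal)
      obtain e0 where e0: "corner \<in> e0" "I = comp I e0" "e0 \<in> I" using iface_connected[OF Y] unfolding I_def by blast
      have "e \<in> comp I e0" using v e0(2) by simp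
      then have "comp I e = I" using comp_eq[of e I e0] e0(2) by simp
      then have "e0 \<in> \<gamma>" using sub e0(3) by blast
      then show False using above[OF _ e0(1)] hj by (auto simp: corner_def)
    qed
    then obtain e' u where eu: "e' \<in> \<gamma>" "u \<in> e'" "snd u < h" by blast
    obtain G where G: "is_loop N G" "bd G = \<gamma>" using comp_is_loop[OF Qb eQ] e(2) by blast
    let ?a = "(fst v - 1, snd v)"
    have "{?a, v} \<in> bd G" unfolding G(2) e(2) using v(1) by (simp add: hE_def)
    moreover have "v \<in> nbrs ?a" by (simp add: nbrs_def)
    ultimately obtain m where m: "card (bd G) = Suc m" "\<forall>e\<in>bd G. \<forall>u\<in>e. \<bar>snd u - snd ?a\<bar> \<le> int (Suc m)"
      using is_loop_walk[OF G(1)] by blast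
    \<comment> \<open>The loop descends from row \<open>4 * j - 1\<close> or higher to below
      \<open>h < 2 * j\<close>, which forces its length.\<close>
    have "\<bar>snd u - snd v\<bar> \<le> int (card (bd G))" using m eu(1,2) unfolding G(2) by fastforce
    then have "2 * j \<le> card (bd G)" using eu(3) h(2) v(2) by simp
    then show ?thesis using G unfolding polys_def by blast
  qed
  have jc: "jclosed (bd Q) (\<Union>\<G>)" unfolding UG by (rule jclosed_touching)
  obtain G where G: "G \<subseteq> box N" "bd G = \<Union>\<G>" using closed_part_is_boundary[OF Qb jc] by metis
  have finG: "finite (\<Union>\<G>)" unfolding G(2)[symmetric] by (rule finite_bd[OF G(1)])
  have "card (\<Union>\<G>) = (\<Sum>\<gamma>\<in>\<G>. card \<gamma>)"
  proof (rule card_Union_disjoint)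
    show "pairwise disjnt \<G>"
    proof (rule pairwiseI)
      fix C K assume "C \<in> \<G>" "K \<in> \<G>" "C \<noteq> K"
      then show "disjnt C K" unfolding disjnt_def \<G>_def by (rule comps_disjoint)
    qed
    show "finite A" if "A \<in> \<G>" for A by (rule finite_subset[OF Union_upper[OF that] finG])
  qed
  moreover have "H \<le> card (\<Union>\<G>)"
  proof -
    have "Hs \<subseteq> \<Union>\<G>"
    proof
      fix e assume "e \<in> Hs"
      then have "comp (bd Q) e \<in> \<G>" unfolding \<G>_def by (rule imageI)
      then show "e \<in> \<Union>\<G>" by (rule UnionI) (rule comp_refl)
    qed
    then have "card Hs \<le> card (\<Union>\<G>)" by (rule card_mono[OF finG])
    then show ?thesis using H unfolding Hs_def I_def by (rule order_trans[rotated])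
  qed
  \<comment> \<open>Cut edges count twice, because flipping adds them and they do not contribute to
    the removed edges; hence \<open>2 * b\<close>.\<close>
  moreover have "card (bd (Y \<triangle> G) \<triangle> Bot N) + card (\<Union>\<G>) \<le> card ?S + 2 * b"
  proof -
    have "bd (Y \<triangle> G) \<triangle> Bot N = ?S \<triangle> \<Union>\<G>"
      unfolding bd_sdiff G(2) sdiff_assoc by (simp only: sdiff_commute[of "\<Union>\<G>" "Bot N"])
    then have "card (bd (Y \<triangle> G) \<triangle> Bot N) = card (?S \<triangle> \<Union>\<G>)" by (rule arg_cong)
    moreover have "card (?S \<triangle> \<Union>\<G>) = card (?S - \<Union>\<G>) + card (\<Union>\<G> - ?S)"
      unfolding sdiff_def[of ?S] using S(2) finG by (intro card_Un_disjoint) auto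
    moreover have "card ?S = card (?S - \<Union>\<G>) + card (?S \<inter> \<Union>\<G>)"
    proof -
      have "?S = (?S - \<Union>\<G>) \<union> (?S \<inter> \<Union>\<G>)" "(?S - \<Union>\<G>) \<inter> (?S \<inter> \<Union>\<G>) = {}" by blast+
      then show ?thesis using S(2) card_Un_disjoint[of "?S - \<Union>\<G>" "?S \<inter> \<Union>\<G>"] by (metis finite_Diff finite_Int)
    qed
    moreover have "card (\<Union>\<G>) = card (\<Union>\<G> - ?S) + card (?S \<inter> \<Union>\<G>)"
    proof -
      have "\<Union>\<G> = (\<Union>\<G> - ?S) \<union> (?S \<inter> \<Union>\<G>)" "(\<Union>\<G> - ?S) \<inter> (?S \<inter> \<Union>\<G>) = {}" by blast+
      then show ?thesis using finG S(2) card_Un_disjoint[of "\<Union>\<G> - ?S" "?S \<inter> \<Union>\<G>"] by (metis finite_Diff finite_Int)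
    qed
    moreover have "card (\<Union>\<G> - ?S) \<le> b"
    proof -
      have "\<Union>\<G> - ?S \<subseteq> bd Q - I" using jclosedD(1)[OF jc] IS by blast
      then have "card (\<Union>\<G> - ?S) \<le> card (bd Q - I)" using finite_bd[OF Qb] by (intro card_mono) auto
      then show ?thesis using cbase by simp
    qed
    ultimately show ?thesis by linarith
  qed
  moreover have "\<G> \<subseteq> polys N (2 * j)" using polys by (rule subsetI)
  ultimately show ?thesis using G by metis
qed

text \<open>The family of fingers and the flipped configuration determine \<open>Y\<close>. The flip
  gains \<open>z\<close> to the power of the total length of the fingers, which is at least
  \<open>H\<close>, up to the cost \<open>z ^ (2 * b)\<close> of the cut. Writing
  \<open>z = (4 * z) * (1 / 4)\<close> yields the decay \<open>(4 / 5) ^ H\<close> from one factor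
  and a controlled sum over families from the other.\<close>

lemma high_interfaces:
  assumes z: "0 \<le> z" "z \<le> 1 / 5" and j: "1 \<le> j"
  shows "z ^ (2 * b) * (\<Sum>I\<in>{I\<in>ifaces N. card (below N I) \<le> j * b \<and> H \<le> card (high (4 * j) I)}. NI N (\<lambda>_. z) 0 I)
    \<le> (4 / 5) ^ H * exp (3 * (real N + 2)\<^sup>2 * (3 / 4) ^ (2 * j)) * Zd N (\<lambda>_. z) (\<lambda>_. 0)"
proof -
  let ?P = "\<lambda>I. card (below N I) \<le> j * b \<and> H \<le> card (high (4 * j) I)"
  let ?S = "\<lambda>Y. bd Y \<triangle> Bot N" and ?Z = "Zd N (\<lambda>_. z) (\<lambda>_. 0)"
  define T where "T = {\<G> \<in> Pow (polys N (2 * j)). H \<le> (\<Sum>\<gamma>\<in>\<G>. card \<gamma>) \<and> inside N (\<Union>\<G>) \<subseteq> box N}"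
  have finT: "finite T" unfolding T_def using finite_polys by simp
  have z1: "z \<le> 1" using z by simp
  have Zs: "?Z = (\<Sum>Y\<in>Pow (box N). z ^ card (?S Y))" by (simp add: Zd_zero)
  have Z: "0 \<le> ?Z" unfolding Zs using z by (intro sum_nonneg) auto
  let ?c = "\<lambda>\<G>. z ^ (\<Sum>\<gamma>\<in>\<G>. card \<gamma>)"
  let ?w = "\<lambda>\<G> Y. ?c \<G> * z ^ card (?S (Y \<triangle> inside N (\<Union>\<G>)))"
  have "z ^ (2 * b) * (\<Sum>I\<in>{I\<in>ifaces N. ?P I}. NI N (\<lambda>_. z) 0 I) = (\<Sum>Y\<in>{Y\<in>Pow (box N). ?P (iface N Y)}. z ^ (2 * b) * z ^ card (?S Y))"
    unfolding iface_partition[symmetric] sum_distrib_left by (simp add: field_def)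
  also have "\<dots> \<le> (\<Sum>Y\<in>{Y\<in>Pow (box N). ?P (iface N Y)}. \<Sum>\<G>\<in>T. ?w \<G> Y)"
  proof (rule sum_mono)
    fix Y assume "Y \<in> {Y\<in>Pow (box N). ?P (iface N Y)}"
    then have Y: "Y \<subseteq> box N" "card (below N (iface N Y)) \<le> j * b" "H \<le> card (high (4 * j) (iface N Y))" by auto
    obtain \<G> G where g: "\<G> \<subseteq> polys N (2 * j)" "G \<subseteq> box N" "bd G = \<Union>\<G>" "card (\<Union>\<G>) = (\<Sum>\<gamma>\<in>\<G>. card \<gamma>)" "H \<le> card (\<Union>\<G>)"
      "card (?S (Y \<triangle> G)) + card (\<Union>\<G>) \<le> card (?S Y) + 2 * b"
      using finger_decomposition[OF Y(1) j Y(2,3)] by blast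
    have i: "inside N (\<Union>\<G>) = G" unfolding g(3)[symmetric] by (rule inside_bd[OF g(2)])
    have T: "\<G> \<in> T" unfolding T_def using g i by simp
    have "z ^ (2 * b) * z ^ card (?S Y) = z ^ (card (?S Y) + 2 * b)" by (simp add: power_add mult.commute)
    also have "\<dots> \<le> z ^ (card (?S (Y \<triangle> G)) + card (\<Union>\<G>))" by (rule power_decreasing[OF g(6) z(1) z1])
    also have "\<dots> = ?w \<G> Y" unfolding i g(4) by (simp add: power_add mult.commute)
    also have "\<dots> \<le> (\<Sum>\<G>\<in>T. ?w \<G> Y)" using T finT z by (intro member_le_sum) auto
    finally show "z ^ (2 * b) * z ^ card (?S Y) \<le> (\<Sum>\<G>\<in>T. ?w \<G> Y)" .
  qed
  also have "\<dots> \<le> (\<Sum>Y\<in>Pow (box N). \<Sum>\<G>\<in>T. ?w \<G> Y)"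
  proof (rule sum_mono2)
    fix Y
    show "0 \<le> (\<Sum>\<G>\<in>T. ?w \<G> Y)" using z by (intro sum_nonneg) simp
  qed (use finite_box in auto)
  also have "\<dots> = (\<Sum>\<G>\<in>T. \<Sum>Y\<in>Pow (box N). ?w \<G> Y)" by (rule sum.swap)
  also have "\<dots> = (\<Sum>\<G>\<in>T. ?c \<G> * ?Z)"
  proof (rule sum.cong[OF refl])
    fix \<G> assume "\<G> \<in> T"
    then have "inside N (\<Union>\<G>) \<subseteq> box N" by (simp add: T_def)
    then have "(\<Sum>Y\<in>Pow (box N). z ^ card (?S (Y \<triangle> inside N (\<Union>\<G>)))) = ?Z"
      unfolding Zs by (rule sum.reindex_bij_betw[OF bij_betw_sdiff_Pow, where g = "\<lambda>Y. z ^ card (?S Y)"])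
    then show "(\<Sum>Y\<in>Pow (box N). ?w \<G> Y) = ?c \<G> * ?Z" by (simp only: sum_distrib_left[symmetric])
  qed
  also have "\<dots> \<le> (\<Sum>\<G>\<in>T. (4 / 5) ^ H * (\<Prod>\<gamma>\<in>\<G>. (1 / 4) ^ card \<gamma>) * ?Z)"
  proof (intro sum_mono mult_right_mono Z)
    fix \<G> assume "\<G> \<in> T"
    then have H: "H \<le> (\<Sum>\<gamma>\<in>\<G>. card \<gamma>)" by (simp add: T_def)
    have "?c \<G> = (4 * z) ^ (\<Sum>\<gamma>\<in>\<G>. card \<gamma>) * (1 / 4) ^ (\<Sum>\<gamma>\<in>\<G>. card \<gamma>)" unfolding power_mult_distrib[symmetric] by simp
    also have "\<dots> \<le> (4 / 5) ^ H * (1 / 4) ^ (\<Sum>\<gamma>\<in>\<G>. card \<gamma>)"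
    proof (rule mult_right_mono)
      have "(4 * z) ^ (\<Sum>\<gamma>\<in>\<G>. card \<gamma>) \<le> (4 / 5) ^ (\<Sum>\<gamma>\<in>\<G>. card \<gamma>)" using z by (intro power_mono) auto
      also have "\<dots> \<le> (4 / 5) ^ H" using H by (intro power_decreasing) auto
      finally show "(4 * z) ^ (\<Sum>\<gamma>\<in>\<G>. card \<gamma>) \<le> (4 / 5) ^ H" .
    qed simp
    finally show "?c \<G> \<le> (4 / 5) ^ H * (\<Prod>\<gamma>\<in>\<G>. (1 / 4) ^ card \<gamma>)" by (simp add: power_sum)
  qed
  also have "\<dots> = (4 / 5) ^ H * (\<Sum>\<G>\<in>T. \<Prod>\<gamma>\<in>\<G>. (1 / 4) ^ card \<gamma>) * ?Z"
    by (simp only: sum_distrib_left sum_distrib_right)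
  also have "\<dots> \<le> (4 / 5) ^ H * exp (3 * (real N + 2)\<^sup>2 * (3 / 4) ^ (2 * j)) * ?Z"
  proof (intro mult_right_mono[OF _ Z] mult_left_mono)
    \<comment> \<open>Over all subfamilies the sum factors into a product of terms
      \<open>1 + x \<le> exp x\<close>.\<close>
    have "(\<Sum>\<G>\<in>T. \<Prod>\<gamma>\<in>\<G>. (1 / 4 :: real) ^ card \<gamma>) \<le> (\<Sum>\<G>\<in>Pow (polys N (2 * j)). \<Prod>\<gamma>\<in>\<G>. (1 / 4) ^ card \<gamma>)"
      using finite_polys by (intro sum_mono2) (auto simp: T_def intro!: prod_nonneg)
    also have "\<dots> = (\<Prod>\<gamma>\<in>polys N (2 * j). (1 / 4) ^ card \<gamma> + 1)"
      using prod_add[OF finite_polys, of "\<lambda>\<gamma>. (1 / 4 :: real) ^ card \<gamma>" "\<lambda>_. 1" N "2 * j"] by simp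
    also have "\<dots> \<le> (\<Prod>\<gamma>\<in>polys N (2 * j). exp ((1 / 4) ^ card \<gamma>))"
    proof (rule prod_mono)
      fix \<gamma> :: "dvert set set"
      show "0 \<le> (1 / 4 :: real) ^ card \<gamma> + 1 \<and> (1 / 4 :: real) ^ card \<gamma> + 1 \<le> exp ((1 / 4) ^ card \<gamma>)"
        using exp_ge_add_one_self[of "(1 / 4 :: real) ^ card \<gamma>"] by (simp add: add_nonneg_nonneg add.commute)
    qed
    also have "\<dots> = exp (\<Sum>\<gamma>\<in>polys N (2 * j). (1 / 4) ^ card \<gamma>)" by (rule exp_sum[OF finite_polys, symmetric])
    also have "\<dots> \<le> exp (3 * (real N + 2)\<^sup>2 * (3 / 4) ^ (2 * j))"
      unfolding exp_le_cancel_iff by (rule polys_sum) (use j in simp)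
    finally show "(\<Sum>\<G>\<in>T. \<Prod>\<gamma>\<in>\<G>. (1 / 4 :: real) ^ card \<gamma>) \<le> exp (3 * (real N + 2)\<^sup>2 * (3 / 4) ^ (2 * j))" .
  qed simp
  finally show ?thesis .
qed

section \<open>Tail estimates\<close>

text \<open>The height scale of the interface; \<open>real N * cr N\<close> is the scale of the
  area.\<close>

definition cr :: "nat \<Rightarrow> real" where "cr N = real N powr (1 / 3)"

lemma cr_facts:
  assumes "N \<ge> 1"
  shows "1 \<le> cr N" "cr N \<le> real N" "cr N * (cr N * cr N) = real N"
    "real N * cr N = real N powr (4 / 3)" "real N powr (- 4 / 3) = 1 / (real N * cr N)"
proof -
  have N: "real N \<ge> 1" using assms by simp
  show "1 \<le> cr N" unfolding cr_def using N by (simp add: ge_one_powr_ge_zero)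
  have "real N powr (1 / 3) \<le> real N powr 1" using N by (intro powr_mono) auto
  then show "cr N \<le> real N" using N by (simp add: cr_def)
  have "cr N * (cr N * cr N) = real N powr (1 / 3 + (1 / 3 + 1 / 3))" unfolding cr_def by (simp only: powr_add)
  then show "cr N * (cr N * cr N) = real N" using N by simp
  have "real N powr 1 * real N powr (1 / 3) = real N powr (1 + 1 / 3)" by (simp only: powr_add)
  then show nt: "real N * cr N = real N powr (4 / 3)" unfolding cr_def using N by simp
  show "real N powr (- 4 / 3) = 1 / (real N * cr N)" unfolding nt by (simp add: powr_minus_divide)
qed

text \<open>Confinement to height \<open>m\<close> costs \<open>N / m^2\<close> through the lowest
  mode and \<open>m\<close> through the field and the end corrections; the choice \<open>m\<close>
  about \<open>cr N\<close> balances the two.\<close>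

lemma field_partition_lower:
  assumes z: "0 < z" "z \<le> 1 / 5" and c: "0 < c"
  shows "\<exists>C>0. \<forall>\<^sub>F N in sequentially.
    exp (- tau z * real N - C * cr N) * Xi N (\<lambda>_. z) (\<lambda>_. c / real N) \<le> Zd N (\<lambda>_. z) (\<lambda>_. c / real N)"
proof -
  let ?q = "\<lambda>_::dvert set. z"
  define Lz where "Lz = - ln z"
  \<comment> \<open>In units of \<open>cr N\<close>: \<open>8 * c\<close> for the field in the
    strip, 8 for the lowest mode, \<open>10 * Lz\<close> for the end corrections
    \<open>z ^ (4 * m + 2)\<close>, \<open>2 * ln 4\<close> for \<open>4 ^ m\<close>, and 1 for
    polynomial factors.\<close>
  define C where "C = 8 * c + 9 + 10 * Lz + 2 * ln 4"
  have Lz: "0 < Lz" using z by (simp add: Lz_def)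
  have C0: "0 < C" using c Lz by (simp add: C_def add_pos_pos)
  have "\<forall>\<^sub>F N in sequentially. 10 * (real N + 1) * (real N powr (1 / 3) + 2) \<le> exp (real N powr (1 / 3))" by real_asymp
  then have "\<forall>\<^sub>F N in sequentially. exp (- tau z * real N - C * cr N) * Xi N ?q (\<lambda>_. c / real N) \<le> Zd N ?q (\<lambda>_. c / real N)"
    using eventually_ge_at_top[of 1]
  proof eventually_elim
    case (elim N)
    define t where "t = cr N"
    note t = cr_facts[OF elim(2), folded t_def]
    define m where "m = nat \<lceil>t\<rceil>"
    have m: "t \<le> real m" "real m \<le> t + 1" "1 \<le> m" "m \<le> Suc N" using t(1,2) unfolding m_def by linarith+
    define l where "l = c / real N"
    have N: "real N \<ge> 1" using elim by simp
    have l: "0 \<le> l" using c by (simp add: l_def)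
    let ?SP = "\<Sum>Y\<in>Pow (strip N m). pw ?q (bd Y)" and ?SD = "\<Sum>Y\<in>Pow (strip N m). pw ?q (bd Y \<triangle> Bot N)"
    have fin: "finite (strip N m)" by (simp add: strip_def)
    have SP: "0 < ?SP"
    proof -
      have "0 < pw ?q (bd {})" by (simp add: bd_def)
      also have "\<dots> \<le> ?SP" using fin z by (intro member_le_sum pw_nonneg) auto
      finally show ?thesis .
    qed
    define a where "a = exp (- 2 * l * ((real N + 1) * real m))"
    define e where "e = exp (- (tau z + (pi / (real m + 1))\<^sup>2 / 2) * real N) * (z ^ (2 * m + 1))\<^sup>2"
    define D where "D = 4 ^ m * (10 * (real N + 1) * (real m + 1))"
    have D: "0 < D" by (simp add: D_def add_pos_pos)
    have 1: "a * ?SD * Xi N ?q (\<lambda>_. l) \<le> ?SP * Zd N ?q (\<lambda>_. l)"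
      unfolding a_def using strip_restriction[of z l m N] z l m(4) by simp
    have 2: "?SP * e \<le> D * ?SD"
      using dobrushin_strip_lower[OF z m(3,4) elim(2)] unfolding e_def D_def by (simp only: mult.assoc)
    have X: "0 < Xi N ?q (\<lambda>_. l)" using z by (intro Xi_pos) auto
    have "(a * Xi N ?q (\<lambda>_. l)) * (?SP * e) \<le> (a * Xi N ?q (\<lambda>_. l)) * (D * ?SD)"
      using 2 X by (intro mult_left_mono) (auto simp: a_def)
    also have "\<dots> = D * (a * ?SD * Xi N ?q (\<lambda>_. l))" by (simp only: mult_ac)
    also have "\<dots> \<le> D * (?SP * Zd N ?q (\<lambda>_. l))" using 1 D by (intro mult_left_mono) auto
    finally have "?SP * (a * e * Xi N ?q (\<lambda>_. l)) \<le> ?SP * (D * Zd N ?q (\<lambda>_. l))" by (simp only: mult_ac)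
    then have main: "a * e * Xi N ?q (\<lambda>_. l) \<le> D * Zd N ?q (\<lambda>_. l)" by (simp only: mult_le_cancel_left_pos[OF SP])
    have "D * exp (- tau z * real N - C * t) \<le> a * e"
    proof -
      have m2: "real m \<le> 2 * t" using m(2) t(1) by linarith
      have "2 * l * ((real N + 1) * real m) \<le> 8 * c * t"
      proof -
        have "l * (real N + 1) \<le> 2 * c" unfolding l_def using N c by (simp add: field_simps)
        then have "(l * (real N + 1)) * real m \<le> (2 * c) * (2 * t)" by (rule mult_mono[OF _ m2]) (use c in auto)
        moreover have "2 * l * ((real N + 1) * real m) = 2 * ((l * (real N + 1)) * real m)" by (simp only: mult_ac)
        ultimately show ?thesis by linarith
      qed
      then have a1: "exp (- 8 * c * t) \<le> a" unfolding a_def by simp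
      have p: "(pi / (real m + 1))\<^sup>2 / 2 * real N \<le> 8 * t"
      proof -
        have "pi / (real m + 1) \<le> 4 / t" using pi_less_4 m t(1) by (intro frac_le) auto
        then have "(pi / (real m + 1))\<^sup>2 \<le> (4 / t)\<^sup>2" using pi_gt_zero by (intro power_mono) auto
        then have "(pi / (real m + 1))\<^sup>2 / 2 * real N \<le> (4 / t)\<^sup>2 / 2 * real N" by (intro mult_right_mono) auto
        also have "\<dots> = 8 * t" unfolding t(3)[symmetric] using t(1) by (simp add: power2_eq_square field_simps)
        finally show ?thesis .
      qed
      have zz: "(z ^ (2 * m + 1))\<^sup>2 = exp (- Lz * real (4 * m + 2))"
      proof -
        have pz: "z ^ k = exp (- Lz * real k)" for k using z by (simp add: Lz_def exp_of_nat_mult mult.commute[of "ln z"])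
        have "(z ^ (2 * m + 1))\<^sup>2 = z ^ ((2 * m + 1) * 2)" by (rule power_mult[symmetric])
        then show ?thesis unfolding pz by (simp add: algebra_simps)
      qed
      have "Lz * real (4 * m + 2) \<le> Lz * (10 * t)" using m(2) t(1) Lz by (intro mult_left_mono) auto
      then have e1: "exp (- tau z * real N - 8 * t - 10 * Lz * t) \<le> e"
        unfolding e_def zz using p by (simp add: algebra_simps flip: exp_add)
      have D1: "D \<le> exp (2 * ln 4 * t + t)"
      proof -
        have "(4::real) ^ m = exp (real m * ln 4)" by (simp add: exp_of_nat_mult)
        also have "\<dots> \<le> exp (2 * t * ln 4)" using m2 by (simp add: mult_right_mono)
        finally have "(4::real) ^ m \<le> exp (2 * t * ln 4)" .
        moreover have "10 * (real N + 1) * (real m + 1) \<le> exp t"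
        proof -
          have "10 * (real N + 1) * (real m + 1) \<le> 10 * (real N + 1) * (t + 2)" using m(2) by (intro mult_left_mono) auto
          also have "\<dots> \<le> exp t" using elim(1) by (simp only: t_def cr_def)
          finally show ?thesis .
        qed
        ultimately have "D \<le> exp (2 * t * ln 4) * exp t" unfolding D_def by (intro mult_mono) auto
        then show ?thesis unfolding exp_add by (simp only: mult_ac)
      qed
      have "D * exp (- tau z * real N - C * t) \<le> exp (2 * ln 4 * t + t) * exp (- tau z * real N - C * t)"
        using D1 by (intro mult_right_mono) auto
      also have "\<dots> = exp (- 8 * c * t) * exp (- tau z * real N - 8 * t - 10 * Lz * t)"
        unfolding exp_add[symmetric] C_def by (simp add: algebra_simps)
      also have "\<dots> \<le> a * e" using a1 e1 by (intro mult_mono) (auto simp: a_def)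
      finally show ?thesis .
    qed
    then have "D * exp (- tau z * real N - C * t) * Xi N ?q (\<lambda>_. l) \<le> a * e * Xi N ?q (\<lambda>_. l)"
      using X by (intro mult_right_mono) auto
    then have "D * (exp (- tau z * real N - C * t) * Xi N ?q (\<lambda>_. l)) \<le> D * Zd N ?q (\<lambda>_. l)"
      using main by (simp only: mult.assoc)
    then show ?case unfolding mult_le_cancel_left_pos[OF D] by (simp only: t_def l_def)
  qed
  then show ?thesis using C0 by blast
qed

lemma ising_prob_ifaces:
  "ising_prob \<beta> lam N {\<sigma>. P (card (minus_region N \<sigma>))}
    = (\<Sum>I\<in>{I\<in>ifaces N. P (card (below N I))}. NI N (\<lambda>_. exp (- 2 * \<beta>)) lam I) / Zd N (\<lambda>_. exp (- 2 * \<beta>)) (\<lambda>_. lam)"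
proof -
  have "{Y\<in>Pow (box N). conf N Y \<in> {\<sigma>. P (card (minus_region N \<sigma>))}} = {Y\<in>Pow (box N). P (card (below N (iface N Y)))}"
    using minus_region_conf by auto
  then show ?thesis unfolding ising_prob_conf by (simp only: iface_partition[symmetric] pw_const)
qed

text \<open>The common form of both tail estimates: the remaining factor is an expectation at zero field.\<close>

lemma event_probability:
  assumes z: "0 < z" "z < 1 / 5" "z = exp (- 2 * \<beta>)" and c: "0 < c"
  shows "\<exists>C>0. \<exists>C2. \<forall>\<^sub>F N in sequentially. \<forall>P A l0. 0 \<le> l0 \<and> l0 \<le> c / real N \<and> 3 * (z * exp (2 * l0 * (real N + 1))) \<le> 3 / 5
      \<and> (\<forall>I\<in>ifaces N. P (card (below N I)) \<longrightarrow> A \<le> real (card (below N I))) \<longrightarrow>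
     ising_prob \<beta> (c / real N) N {\<sigma>. P (card (minus_region N \<sigma>))}
      \<le> 2 * exp (- 2 * cr N) + exp (C2 - l0 * A) * ((\<Sum>I\<in>{I\<in>ifaces N. P (card (below N I))}. NI N (\<lambda>_. z) 0 I) / Xi N (\<lambda>_. z) (\<lambda>_. 0)) * exp (tau z * real N + C * cr N)"
proof -
  let ?q = "\<lambda>_::dvert set. z"
  have z': "0 < z" "z \<le> 1 / 5" "0 \<le> z" using z by auto
  obtain C where C: "0 < C" "\<forall>\<^sub>F N in sequentially. exp (- tau z * real N - C * cr N) * Xi N ?q (\<lambda>_. c / real N) \<le> Zd N ?q (\<lambda>_. c / real N)"
    using field_partition_lower[OF z'(1,2) c] by blast
  \<comment> \<open>Interfaces longer than about \<open>K * N\<close> are discarded: there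
    \<open>(3 / 5) ^ n\<close> outweighs the factor \<open>exp (tau z * N + C * cr N)\<close> from
    the lower bound of the partition function, with \<open>exp (- 2 * cr N)\<close> to
    spare.\<close>
  define K where "K = (tau z + C + 2) / ln (5 / 3)"
  have tau: "1 \<le> tau z" by (rule tau_bounds[OF z'(1,2)])
  have K: "0 \<le> K" using tau C by (simp add: K_def)
  have lc: "0 \<le> loop_const z" by (rule loop_const_nonneg) (use z in auto)
  \<comment> \<open>The field \<open>c / N\<close> times a length of at most
    \<open>(K + 1) * N\<close>: the price of freezing the surroundings of an interface does not
    depend on \<open>N\<close>.\<close>
  define C2 where "C2 = 26 * c * loop_const z * (K + 1)"
  have "\<forall>\<^sub>F N in sequentially. \<forall>P A l0. 0 \<le> l0 \<and> l0 \<le> c / real N \<and> 3 * (z * exp (2 * l0 * (real N + 1))) \<le> 3 / 5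
      \<and> (\<forall>I\<in>ifaces N. P (card (below N I)) \<longrightarrow> A \<le> real (card (below N I))) \<longrightarrow>
     ising_prob \<beta> (c / real N) N {\<sigma>. P (card (minus_region N \<sigma>))}
      \<le> 2 * exp (- 2 * cr N) + exp (C2 - l0 * A) * ((\<Sum>I\<in>{I\<in>ifaces N. P (card (below N I))}. NI N ?q 0 I) / Xi N ?q (\<lambda>_. 0)) * exp (tau z * real N + C * cr N)"
    using C(2) eventually_ge_at_top[of 1]
  proof eventually_elim
    case (elim N)
    define t where "t = cr N"
    note t = cr_facts[OF elim(2), folded t_def]
    have N: "real N \<ge> 1" using elim by simp
    define l where "l = c / real N"
    define n where "n = nat \<lceil>K * real N\<rceil>"
    have n: "K * real N \<le> real n" "real n \<le> (K + 1) * real N"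
      using K N unfolding n_def by (auto simp: algebra_simps) linarith+
    have X: "0 < Xi N ?q h" for h using z by (intro Xi_pos) auto
    have low: "exp (- tau z * real N - C * t) * Xi N ?q (\<lambda>_. l) \<le> Zd N ?q (\<lambda>_. l)" using elim(1) by (simp add: t_def l_def)
    have Zp: "0 < Zd N ?q (\<lambda>_. l)" using low X[of "\<lambda>_. l"] by (smt (verit) exp_gt_zero mult_pos_pos)
    have F: "26 * l * loop_const z * real n \<le> C2"
    proof -
      have "l * real n \<le> l * ((K + 1) * real N)" using n(2) c N by (intro mult_left_mono) (auto simp: l_def)
      also have "\<dots> = c * (K + 1)" using N by (simp add: l_def)
      finally have "l * real n \<le> c * (K + 1)" .
      then have "26 * loop_const z * (l * real n) \<le> 26 * loop_const z * (c * (K + 1))" using lc by (intro mult_left_mono) auto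
      then show ?thesis by (simp add: C2_def mult_ac)
    qed
    have small: "(3 / 5 :: real) ^ n * exp (tau z * real N + C * t) \<le> exp (- 2 * t)"
    proof -
      have "(3 / 5 :: real) ^ n = exp (- (ln (5 / 3) * real n))"
        by (simp add: exp_of_nat_mult mult.commute[of "ln _"] ln_div exp_minus power_divide) (simp add: ln_div exp_of_nat_mult mult.commute exp_diff power_divide)
      also have "\<dots> \<le> exp (- (tau z + C + 2) * real N)"
      proof -
        have "ln (5 / 3) * (K * real N) \<le> ln (5 / 3) * real n" using n(1) by (intro mult_left_mono) auto
        moreover have "ln (5 / 3) * K = tau z + C + 2" by (simp add: K_def)
        ultimately have "(tau z + C + 2) * real N \<le> ln (5 / 3) * real n" by (metis mult.assoc)
        then have "- (ln (5 / 3) * real n) \<le> - ((tau z + C + 2) * real N)" by (rule le_imp_neg_le)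
        then show ?thesis by (simp only: exp_le_cancel_iff mult_minus_left)
      qed
      finally have "(3 / 5 :: real) ^ n * exp (tau z * real N + C * t) \<le> exp (- (tau z + C + 2) * real N) * exp (tau z * real N + C * t)"
        by (intro mult_right_mono) auto
      also have "\<dots> = exp (C * (t - real N) - 2 * real N)" unfolding exp_add[symmetric] by (simp add: algebra_simps)
      also have "\<dots> \<le> exp (- 2 * t)"
      proof -
        have "C * (t - real N) \<le> 0" using C(1) t(2) by (intro mult_nonneg_nonpos) auto
        then show ?thesis using t(2) by simp
      qed
      finally show ?thesis .
    qed
    show ?case
    proof (intro allI impI)
      fix P A l0
      assume a: "0 \<le> l0 \<and> l0 \<le> c / real N \<and> 3 * (z * exp (2 * l0 * (real N + 1))) \<le> 3 / 5
        \<and> (\<forall>I\<in>ifaces N. P (card (below N I)) \<longrightarrow> A \<le> real (card (below N I)))"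
      let ?S = "\<lambda>k. \<Sum>I\<in>{I\<in>ifaces N. P (card (below N I))}. NI N ?q k I"
      have nn: "0 \<le> ?S k" for k
        unfolding iface_partition[symmetric] using z by (intro sum_nonneg) auto
      have b: "?S l * Xi N ?q (\<lambda>_. 0) \<le> Xi N ?q (\<lambda>_. l) * (2 * (3 / 5) ^ n * Xi N ?q (\<lambda>_. 0)
          + exp (26 * l * loop_const z * real n) * exp (- l0 * A) * ?S 0)"
        by (rule interface_event_bound[OF z'(3,2)]) (use a in \<open>auto simp: l_def\<close>)
      have "?S l / Xi N ?q (\<lambda>_. l) \<le> 2 * (3 / 5) ^ n + exp (26 * l * loop_const z * real n) * exp (- l0 * A) * (?S 0 / Xi N ?q (\<lambda>_. 0))"
        using b X[of "\<lambda>_. 0"] X[of "\<lambda>_. l"] by (simp add: field_simps)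
      also have "\<dots> \<le> 2 * (3 / 5) ^ n + exp (C2 - l0 * A) * (?S 0 / Xi N ?q (\<lambda>_. 0))"
      proof (intro add_left_mono mult_right_mono)
        show "exp (26 * l * loop_const z * real n) * exp (- l0 * A) \<le> exp (C2 - l0 * A)"
          using F by (simp flip: exp_add)
        show "0 \<le> ?S 0 / Xi N ?q (\<lambda>_. 0)" using nn X less_imp_le by (intro divide_nonneg_nonneg) blast+
      qed
      finally have 1: "?S l / Xi N ?q (\<lambda>_. l) \<le> 2 * (3 / 5) ^ n + exp (C2 - l0 * A) * (?S 0 / Xi N ?q (\<lambda>_. 0))" .
      have 2: "Xi N ?q (\<lambda>_. l) / Zd N ?q (\<lambda>_. l) \<le> exp (tau z * real N + C * t)"
      proof -
        have "exp (tau z * real N + C * t) * (exp (- tau z * real N - C * t) * Xi N ?q (\<lambda>_. l)) \<le> exp (tau z * real N + C * t) * Zd N ?q (\<lambda>_. l)"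
          using low by (intro mult_left_mono) auto
        moreover have "exp (tau z * real N + C * t) * exp (- tau z * real N - C * t) = 1" unfolding exp_add[symmetric] by simp
        ultimately have "Xi N ?q (\<lambda>_. l) \<le> exp (tau z * real N + C * t) * Zd N ?q (\<lambda>_. l)" by (simp only: mult.assoc[symmetric] mult_1_left)
        then show ?thesis using Zp by (simp only: pos_divide_le_eq)
      qed
      have "ising_prob \<beta> (c / real N) N {\<sigma>. P (card (minus_region N \<sigma>))} = ?S l / Zd N ?q (\<lambda>_. l)"
        unfolding ising_prob_ifaces z(3) l_def ..
      also have "\<dots> = ?S l / Xi N ?q (\<lambda>_. l) * (Xi N ?q (\<lambda>_. l) / Zd N ?q (\<lambda>_. l))" using X[of "\<lambda>_. l"] by simp
      also have "\<dots> \<le> (2 * (3 / 5) ^ n + exp (C2 - l0 * A) * (?S 0 / Xi N ?q (\<lambda>_. 0))) * exp (tau z * real N + C * t)"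
      proof (rule mult_mono[OF 1 2])
        have "0 \<le> ?S 0 / Xi N ?q (\<lambda>_. 0)" using nn X less_imp_le by (intro divide_nonneg_nonneg) blast+
        then have "0 \<le> exp (C2 - l0 * A) * (?S 0 / Xi N ?q (\<lambda>_. 0))" by (rule mult_nonneg_nonneg[OF exp_ge_zero])
        then show "0 \<le> 2 * (3 / 5) ^ n + exp (C2 - l0 * A) * (?S 0 / Xi N ?q (\<lambda>_. 0))" by (rule add_nonneg_nonneg[rotated]) simp
        show "0 \<le> Xi N ?q (\<lambda>_. l) / Zd N ?q (\<lambda>_. l)" using X[of "\<lambda>_. l"] Zp by simp
      qed
      also have "\<dots> = 2 * ((3 / 5) ^ n * exp (tau z * real N + C * t)) + exp (C2 - l0 * A) * (?S 0 / Xi N ?q (\<lambda>_. 0)) * exp (tau z * real N + C * t)"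
        by (simp only: distrib_right mult.assoc)
      also have "\<dots> \<le> 2 * exp (- 2 * t) + exp (C2 - l0 * A) * (?S 0 / Xi N ?q (\<lambda>_. 0)) * exp (tau z * real N + C * t)"
        using small by simp
      finally show "ising_prob \<beta> (c / real N) N {\<sigma>. P (card (minus_region N \<sigma>))}
         \<le> 2 * exp (- 2 * cr N) + exp (C2 - l0 * A) * (?S 0 / Xi N ?q (\<lambda>_. 0)) * exp (tau z * real N + C * cr N)"
        unfolding t_def .
    qed
  qed
  then show ?thesis using C(1) by blast
qed

lemma zero_field_total:
  assumes z: "0 < z" "z \<le> 1 / 5"
  shows "Zd N (\<lambda>_. z) (\<lambda>_. 0) / Xi N (\<lambda>_. z) (\<lambda>_. 0) \<le> 1 / z * sqrt (real N + 2) * exp (- tau z * real N)"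
proof -
  have X: "0 < Xi N (\<lambda>_. z) (\<lambda>_. 0)" using z by (intro Xi_pos) auto
  have "Zd N (\<lambda>_. z) (\<lambda>_. 0) / Xi N (\<lambda>_. z) (\<lambda>_. 0) \<le> 1 / z * sqrt (real N + 2) * exp (- tau z * (real N + 1))"
    using dobrushin_upper[OF z, of N] X by (simp add: pos_divide_le_eq)
  also have "\<dots> \<le> 1 / z * sqrt (real N + 2) * exp (- tau z * real N)"
    using tau_bounds(1)[OF z] z by (intro mult_left_mono) (auto simp: algebra_simps)
  finally show ?thesis .
qed

lemma upper_tail:
  assumes z: "0 < z" "z < 1 / 5" "z = exp (- 2 * \<beta>)" and c: "0 < c"
  shows "\<exists>K>0. \<forall>\<^sub>F N in sequentially.
    ising_prob \<beta> (c / real N) N {\<sigma>. real (card (minus_region N \<sigma>)) > K * (real N * cr N)} \<le> 3 * exp (- 2 * cr N)"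
proof -
  let ?q = "\<lambda>_::dvert set. z"
  have z': "0 < z" "z \<le> 1 / 5" using z by auto
  obtain C C2 where C: "0 < C" and ev: "\<forall>\<^sub>F N in sequentially. \<forall>P A l0. 0 \<le> l0 \<and> l0 \<le> c / real N \<and> 3 * (z * exp (2 * l0 * (real N + 1))) \<le> 3 / 5
      \<and> (\<forall>I\<in>ifaces N. P (card (below N I)) \<longrightarrow> A \<le> real (card (below N I))) \<longrightarrow>
     ising_prob \<beta> (c / real N) N {\<sigma>. P (card (minus_region N \<sigma>))}
      \<le> 2 * exp (- 2 * cr N) + exp (C2 - l0 * A) * ((\<Sum>I\<in>{I\<in>ifaces N. P (card (below N I))}. NI N ?q 0 I) / Xi N ?q (\<lambda>_. 0)) * exp (tau z * real N + C * cr N)"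
    using event_probability[OF z c] by (elim exE conjE)
  \<comment> \<open>Because of \<open>2 * l0 * (N + 1) \<le> 4 * c0\<close> the Peierls condition
    \<open>z * exp (2 * l0 * (N + 1)) \<le> 1 / 5\<close> holds; \<open>c0\<close> is positive since
    \<open>5 * z < 1\<close>.\<close>
  define c0 where "c0 = min c (ln (1 / (5 * z)) / 4)"
  have "1 < 1 / (5 * z)" using z by simp
  then have "0 < ln (1 / (5 * z))" by (rule ln_gt_zero)
  then have c0: "0 < c0" "c0 \<le> c" "4 * c0 \<le> ln (1 / (5 * z))" using c by (auto simp: c0_def)
  \<comment> \<open>The gain \<open>(C + 3) * cr N\<close> has to pay \<open>C * cr N\<close> for
    the lower bound of the partition function, \<open>cr N\<close> for polynomial factors, and the
    target \<open>2 * cr N\<close>.\<close>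
  define K where "K = (C + 3) / c0"
  have K: "0 < K" using C c0 by (simp add: K_def)
  define d where "d = exp C2 / z"
  have "0 < d" using z by (simp add: d_def)
  then have "\<forall>\<^sub>F N in sequentially. d * sqrt (real N + 2) \<le> exp (real N powr (1 / 3))" by real_asymp
  then have "\<forall>\<^sub>F N in sequentially.
    ising_prob \<beta> (c / real N) N {\<sigma>. real (card (minus_region N \<sigma>)) > K * (real N * cr N)} \<le> 3 * exp (- 2 * cr N)"
    using ev eventually_ge_at_top[of 1]
  proof eventually_elim
    case (elim N)
    define t where "t = cr N"
    note t = cr_facts[OF elim(3), folded t_def]
    have N: "real N \<ge> 1" using elim by simp
    define l0 where "l0 = c0 / real N"
    define A where "A = K * (real N * t)"
    define P where "P a \<longleftrightarrow> real a > A" for a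
    let ?S = "(\<Sum>I\<in>{I\<in>ifaces N. P (card (below N I))}. NI N ?q 0 I)"
    have sm: "3 * (z * exp (2 * l0 * (real N + 1))) \<le> 3 / 5"
    proof -
      have "2 * l0 * (real N + 1) \<le> 4 * c0" unfolding l0_def using N c0 by (simp add: field_simps)
      then have "exp (2 * l0 * (real N + 1)) \<le> exp (ln (1 / (5 * z)))" using c0(3) by simp
      also have "\<dots> = 1 / (5 * z)" using z by simp
      finally have "z * exp (2 * l0 * (real N + 1)) \<le> z * (1 / (5 * z))" using z by (intro mult_left_mono) auto
      then show ?thesis using z by simp
    qed
    have "l0 \<le> c / real N" "0 \<le> l0" unfolding l0_def using c0 N by (auto intro!: divide_right_mono)
    then have p: "ising_prob \<beta> (c / real N) N {\<sigma>. P (card (minus_region N \<sigma>))}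
      \<le> 2 * exp (- 2 * t) + exp (C2 - l0 * A) * (?S / Xi N ?q (\<lambda>_. 0)) * exp (tau z * real N + C * t)"
      unfolding t_def
      by (intro elim(2)[THEN spec[of _ P], THEN spec[of _ A], THEN spec[of _ l0], THEN mp] conjI sm) (simp_all add: P_def)
    have lA: "l0 * A = (C + 3) * t" unfolding l0_def A_def K_def using c0 N by (simp add: field_simps)
    have X: "0 < Xi N ?q (\<lambda>_. 0)" using z by (intro Xi_pos) auto
    have "?S \<le> Zd N ?q (\<lambda>_. 0)"
      unfolding iface_partition[symmetric] Zd_def using finite_box z by (intro sum_mono2) auto
    then have "?S / Xi N ?q (\<lambda>_. 0) \<le> Zd N ?q (\<lambda>_. 0) / Xi N ?q (\<lambda>_. 0)" using X by (intro divide_right_mono) auto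
    also have "\<dots> \<le> 1 / z * sqrt (real N + 2) * exp (- tau z * real N)" by (rule zero_field_total[OF z'])
    finally have "exp (C2 - l0 * A) * (?S / Xi N ?q (\<lambda>_. 0)) * exp (tau z * real N + C * t)
      \<le> exp (C2 - l0 * A) * (1 / z * sqrt (real N + 2) * exp (- tau z * real N)) * exp (tau z * real N + C * t)"
      by (intro mult_right_mono mult_left_mono) auto
    also have "\<dots> = (d * sqrt (real N + 2)) * exp (C * t - l0 * A)"
    proof -
      have "exp (C2 - l0 * A) * exp (- tau z * real N) * exp (tau z * real N + C * t) = exp C2 * exp (C * t - l0 * A)"
        unfolding exp_add[symmetric] by (simp add: algebra_simps)
      then show ?thesis unfolding d_def by (simp add: mult_ac)
    qed
    also have "\<dots> \<le> exp t * exp (C * t - l0 * A)"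
      using elim(1) by (intro mult_right_mono) (auto simp: t_def cr_def)
    also have "\<dots> = exp (- 2 * t)" unfolding lA exp_add[symmetric] by (simp add: algebra_simps)
    finally have "ising_prob \<beta> (c / real N) N {\<sigma>. P (card (minus_region N \<sigma>))} \<le> 3 * exp (- 2 * t)" using p by linarith
    then show ?case by (simp only: t_def P_def A_def)
  qed
  then show ?thesis using K by blast
qed

lemma sum_cover_le:
  fixes f :: "'a \<Rightarrow> real"
  assumes "finite A" "finite B" "\<And>x. 0 \<le> f x" "C \<subseteq> A \<union> B"
  shows "sum f C \<le> sum f A + sum f B"
proof -
  have "sum f C \<le> sum f (A \<union> B)" using assms by (intro sum_mono2) auto
  also have "\<dots> = sum f A + sum f (B - A)" using assms sum.union_disjoint[of A "B - A" f] by (simp add: Un_Diff_cancel)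
  also have "sum f (B - A) \<le> sum f B" using assms by (intro sum_mono2) auto
  finally show ?thesis by simp
qed

text \<open>The field gives no gain for small areas, so \<open>event_probability\<close> is applied
  with \<open>l0 = 0\<close> and the smallness comes from the zero-field estimates. The constants
  depend on one another in this order: \<open>\<eta>\<close> on \<open>C\<close>, the threshold
  \<open>H\<close> on the gap, and finally \<open>e\<close>, so small that cutting the fingers
  consumes only half of what flipping them gains.\<close>

lemma lower_tail:
  assumes z: "0 < z" "z < 1 / 5" "z = exp (- 2 * \<beta>)" and c: "0 < c"
  shows "\<exists>e>0. \<forall>\<^sub>F N in sequentially.
    ising_prob \<beta> (c / real N) N {\<sigma>. real (card (minus_region N \<sigma>)) < e * (real N * cr N)} \<le> 4 * exp (- 2 * cr N)"
proof -
  let ?q = "\<lambda>_::dvert set. z"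
  have z': "0 < z" "z \<le> 1 / 5" "0 \<le> z" using z(1,2) by auto
  obtain C C2 where C: "0 < C" and ev: "\<forall>\<^sub>F N in sequentially. \<forall>P A l0. 0 \<le> l0 \<and> l0 \<le> c / real N \<and> 3 * (z * exp (2 * l0 * (real N + 1))) \<le> 3 / 5
      \<and> (\<forall>I\<in>ifaces N. P (card (below N I)) \<longrightarrow> A \<le> real (card (below N I))) \<longrightarrow>
     ising_prob \<beta> (c / real N) N {\<sigma>. P (card (minus_region N \<sigma>))}
      \<le> 2 * exp (- 2 * cr N) + exp (C2 - l0 * A) * ((\<Sum>I\<in>{I\<in>ifaces N. P (card (below N I))}. NI N ?q 0 I) / Xi N ?q (\<lambda>_. 0)) * exp (tau z * real N + C * cr N)"
    using event_probability[OF z c] by (elim exE conjE)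
  define g where "g = gap z"
  have g: "0 < g" by (simp add: g_def gap_pos)
  define Lz where "Lz = - ln z"
  have Lz: "0 < Lz" using z(1,2) by (simp add: Lz_def)
  \<comment> \<open>For \<open>J \<le> \<eta> * cr N\<close> half of the gap term,
    \<open>g * N / (2 * J^2)\<close>, is at least \<open>(C + 4) * cr N\<close>; the other half pays
    for up to \<open>g * N / 4\<close> high edges.\<close>
  define \<eta> where "\<eta> = sqrt (g / (2 * (C + 4)))"
  have \<eta>: "0 < \<eta>" using g C by (simp add: \<eta>_def)
  have \<eta>2: "g = 2 * (C + 4) * (\<eta> * \<eta>)" using g C by (simp add: \<eta>_def)
  \<comment> \<open>This makes the cost of the cut, \<open>2 * Lz * (8 * e * N / \<eta>)\<close>,
    equal to \<open>\<kappa> * N\<close>, half of the exponent \<open>2 * \<kappa> * N\<close>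
    gained from \<open>(4 / 5) ^ H\<close>.\<close>
  define e where "e = \<eta> * ln (5 / 4) * g / (128 * Lz)"
  have e: "0 < e" using \<eta> g Lz by (simp add: e_def)
  define \<kappa> where "\<kappa> = ln (5 / 4) * g / 8"
  have \<kappa>: "0 < \<kappa>" using g by (simp add: \<kappa>_def)
  \<comment> \<open>From \<open>2 * j \<ge> \<eta> * cr N / 4\<close> it follows that
    \<open>(3 / 4) ^ (2 * j)\<close> is at most \<open>exp (- a * cr N)\<close>.\<close>
  define a where "a = ln (4 / 3) * \<eta> / 4"
  have a: "0 < a" using \<eta> by (simp add: a_def)
  define d where "d = exp C2 / z"
  have d: "0 < d" using z(1,2) by (simp add: d_def)
  define d2 where "d2 = exp (C2 + 2 * Lz + 2) / z"
  have d2: "0 < d2" using z(1,2) by (simp add: d2_def)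
  have "\<forall>\<^sub>F N in sequentially. 8 \<le> \<eta> * real N powr (1 / 3)" using \<eta> by real_asymp
  moreover have "\<forall>\<^sub>F N in sequentially. \<eta> * real N powr (1 / 3) \<le> real N" using \<eta> by real_asymp
  moreover have "\<forall>\<^sub>F N in sequentially. 3 * (real N + 2)\<^sup>2 * exp (- a * real N powr (1 / 3)) \<le> 1" using a by real_asymp
  moreover have "\<forall>\<^sub>F N in sequentially. d * sqrt (real N + 2) \<le> exp (real N powr (1 / 3))" using d by real_asymp
  moreover have "\<forall>\<^sub>F N in sequentially. d2 * sqrt (real N + 2) * exp (C * real N powr (1 / 3) - \<kappa> * real N) \<le> exp (- 2 * real N powr (1 / 3))"
    using d2 C \<kappa> by real_asymp
  ultimately have "\<forall>\<^sub>F N in sequentially.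
    ising_prob \<beta> (c / real N) N {\<sigma>. real (card (minus_region N \<sigma>)) < e * (real N * cr N)} \<le> 4 * exp (- 2 * cr N)"
    using ev eventually_ge_at_top[of 1]
  proof eventually_elim
    case (elim N)
    define t where "t = cr N"
    note t = cr_facts[OF elim(7), folded t_def]
    have N: "real N \<ge> 1" using elim by simp
    have E: "8 \<le> \<eta> * t" "\<eta> * t \<le> real N" "3 * (real N + 2)\<^sup>2 * exp (- a * t) \<le> 1" "d * sqrt (real N + 2) \<le> exp t"
      "d2 * sqrt (real N + 2) * exp (C * t - \<kappa> * real N) \<le> exp (- 2 * t)"
      using elim(1-5) by (simp_all only: t_def cr_def)
    define P where "P k \<longleftrightarrow> real k < e * (real N * t)" for k
    let ?S = "(\<Sum>I\<in>{I\<in>ifaces N. P (card (below N I))}. NI N ?q 0 I)" and ?Z = "Xi N ?q (\<lambda>_. 0)"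
    have X: "0 < ?Z" using z(1,2) by (intro Xi_pos) auto
    have p: "ising_prob \<beta> (c / real N) N {\<sigma>. P (card (minus_region N \<sigma>))}
      \<le> 2 * exp (- 2 * t) + exp (C2 - 0 * 0) * (?S / ?Z) * exp (tau z * real N + C * t)"
      unfolding t_def
      by (intro elim(6)[THEN spec[of _ P], THEN spec[of _ 0], THEN spec[of _ 0], THEN mp] conjI) (use c z(1,2) N in simp_all)
    define j where "j = nat \<lfloor>\<eta> * t / 4\<rfloor>"
    define H where "H = nat \<lfloor>g * real N / 4\<rfloor>"
    \<comment> \<open>The area threshold divided by the lower bound \<open>\<eta> * t / 8\<close>
      for \<open>j\<close>, so that a small area is at most \<open>j * b\<close>.\<close>
    define b where "b = nat \<lceil>8 * e * real N / \<eta>\<rceil>"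
    have j: "real j \<le> \<eta> * t / 4" "\<eta> * t / 8 \<le> real j" "1 \<le> j"
      using E(1) unfolding j_def by linarith+
    have H: "real H \<le> g * real N / 4" "g * real N / 4 - 1 \<le> real H"
    proof -
      have "0 \<le> g * real N / 4" using g by simp
      then show "real H \<le> g * real N / 4" "g * real N / 4 - 1 \<le> real H" unfolding H_def by linarith+
    qed
    have b: "8 * e * real N / \<eta> \<le> real b" "real b \<le> 8 * e * real N / \<eta> + 1"
    proof -
      have "0 \<le> 8 * e * real N / \<eta>" using e \<eta> by simp
      then show "8 * e * real N / \<eta> \<le> real b" "real b \<le> 8 * e * real N / \<eta> + 1" unfolding b_def by linarith+
    qed
    have J: "1 \<le> 4 * j" "4 * j \<le> N + 2"
    proof -
      have "real (4 * j) \<le> real N" using j(1) E(2) by simp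
      then show "4 * j \<le> N + 2" by linarith
    qed (use j in simp)
    let ?A = "{I\<in>ifaces N. card (high (4 * j) I) \<le> H}"
    let ?B = "{I\<in>ifaces N. card (below N I) \<le> j * b \<and> H \<le> card (high (4 * j) I)}"
    have jb: "e * (real N * t) \<le> real (j * b)"
    proof -
      have "e * (real N * t) = (\<eta> * t / 8) * (8 * e * real N / \<eta>)" using \<eta> by (simp add: field_simps)
      also have "\<dots> \<le> real j * real b" by (rule mult_mono[OF j(2) b(1)]) (use e N \<eta> in auto)
      finally show ?thesis by simp
    qed
    \<comment> \<open>Either there are at most \<open>H\<close> high edges and the layered estimate
      applies, or the interface has long fingers above a narrow row.\<close>
    have cover: "{I\<in>ifaces N. P (card (below N I))} \<subseteq> ?A \<union> ?B"
    proof
      fix I assume I: "I \<in> {I\<in>ifaces N. P (card (below N I))}"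
      then have "real (card (below N I)) \<le> real (j * b)" using jb unfolding P_def by simp
      then have "card (below N I) \<le> j * b" by (simp only: of_nat_le_iff)
      then show "I \<in> ?A \<union> ?B" using I by auto
    qed
    have NI0: "0 \<le> NI N ?q 0 I" for I
      unfolding NI_def pw_const using z(1,2) Xi_pos[of "off ?q (star corner \<union> Dl I)" N "signed 0 (below N I)"]
      by (intro mult_nonneg_nonneg) (auto simp: off_def less_imp_le)
    have S: "?S \<le> (\<Sum>I\<in>?A. NI N ?q 0 I) + (\<Sum>I\<in>?B. NI N ?q 0 I)"
      by (rule sum_cover_le[OF _ _ NI0 cover]) (use finite_ifaces in auto)
    have A: "(\<Sum>I\<in>?A. NI N ?q 0 I) \<le> 1 / z * sqrt (real N + 2) * exp (- tau z * real N - (C + 4) * t) * ?Z"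
    proof -
      let ?J = "(real (4 * j))\<^sup>2"
      have Jp: "0 < ?J" using j(3) by simp
      have "2 * real H / ?J \<le> 2 * (g * real N / 4) / ?J" using H(1) Jp by (intro divide_right_mono) auto
      moreover have "(C + 4) * t \<le> g * real N / (2 * ?J)"
      proof -
        have "real (4 * j) \<le> \<eta> * t" using j(1) by simp
        then have "?J \<le> (\<eta> * t)\<^sup>2" by (intro power_mono) auto
        then have "(C + 4) * t * (2 * ?J) \<le> (C + 4) * t * (2 * (\<eta> * t)\<^sup>2)" using C t(1) by (intro mult_left_mono) auto
        also have "\<dots> = g * real N" unfolding \<eta>2 t(3)[symmetric] by (simp add: power2_eq_square mult_ac)
        finally show ?thesis using Jp by (simp add: pos_le_divide_eq)
      qed
      moreover have "(tau z + g / ?J) * real N \<le> (tau z + g / ?J) * (real N + 1)"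
        using tau_bounds(1)[OF z'(1,2)] g Jp by (intro mult_left_mono) auto
      ultimately have "2 * real H / ?J + - (tau z + g / ?J) * (real N + 1) \<le> - tau z * real N - (C + 4) * t"
        by (simp add: field_simps)
      then have "exp (2 * real H / ?J) * exp (- (tau z + g / ?J) * (real N + 1)) \<le> exp (- tau z * real N - (C + 4) * t)"
        unfolding exp_add[symmetric] by simp
      then have "(1 / z * sqrt (real N + 2)) * (exp (2 * real H / ?J) * exp (- (tau z + g / ?J) * (real N + 1))) * ?Z
         \<le> (1 / z * sqrt (real N + 2)) * exp (- tau z * real N - (C + 4) * t) * ?Z"
        using z(1,2) X by (intro mult_right_mono mult_left_mono) auto
      then show ?thesis using low_interfaces[OF z'(1,2) J, of H] unfolding g_def by (simp only: mult_ac)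
    qed
    have B: "(\<Sum>I\<in>?B. NI N ?q 0 I) \<le> exp (2 * Lz + 2 - \<kappa> * real N) * Zd N ?q (\<lambda>_. 0)"
    proof -
      have Zd: "0 \<le> Zd N ?q (\<lambda>_. 0)" unfolding Zd_zero using z(1,2) by (intro sum_nonneg) auto
      have pz: "z ^ k = exp (- Lz * real k)" for k using z(1,2) by (simp add: Lz_def exp_of_nat_mult mult.commute[of "ln z"])
      have "(3 / 4 :: real) ^ (2 * j) \<le> exp (- a * t)"
      proof -
        have "(3 / 4 :: real) = exp (- ln (4 / 3))" by (simp add: exp_minus)
        then have "(3 / 4 :: real) ^ (2 * j) = exp (real (2 * j) * - ln (4 / 3))" by (simp only: exp_of_nat_mult)
        moreover have "ln (4 / 3) * (\<eta> * t / 8) \<le> ln (4 / 3) * real j" using j(2) by (intro mult_left_mono) auto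
        ultimately show ?thesis unfolding a_def by (simp add: field_simps)
      qed
      then have "3 * (real N + 2)\<^sup>2 * (3 / 4) ^ (2 * j) \<le> 3 * (real N + 2)\<^sup>2 * exp (- a * t)" by (intro mult_left_mono) auto
      from this E(3) have "3 * (real N + 2)\<^sup>2 * (3 / 4) ^ (2 * j) \<le> 1" by (rule order_trans)
      then have e3: "exp (3 * (real N + 2)\<^sup>2 * (3 / 4) ^ (2 * j)) \<le> exp 1" by (simp only: exp_le_cancel_iff)
      have e2: "(4 / 5 :: real) ^ H \<le> exp (1 - 2 * \<kappa> * real N)"
      proof -
        have "(4 / 5 :: real) = exp (- ln (5 / 4))" by (simp add: exp_minus)
        then have "(4 / 5 :: real) ^ H = exp (real H * - ln (5 / 4))" by (simp only: exp_of_nat_mult)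
        moreover have "ln (5 / 4) * (g * real N / 4 - 1) \<le> ln (5 / 4) * real H" using H(2) by (intro mult_left_mono) auto
        moreover have "ln (5 / 4 :: real) \<le> 1" using ln_le_minus_one[of "5 / 4 :: real"] by simp
        ultimately show ?thesis unfolding \<kappa>_def by (simp add: field_simps)
      qed
      have e1: "exp (2 * Lz * real b) \<le> exp (\<kappa> * real N + 2 * Lz)"
      proof -
        have "2 * Lz * real b \<le> 2 * Lz * (8 * e * real N / \<eta> + 1)" using b(2) Lz by (intro mult_left_mono) auto
        also have "\<dots> = \<kappa> * real N + 2 * Lz" unfolding e_def \<kappa>_def using Lz \<eta> by (simp add: field_simps)
        finally show ?thesis by simp
      qed
      have "(\<Sum>I\<in>?B. NI N ?q 0 I) = exp (2 * Lz * real b) * (z ^ (2 * b) * (\<Sum>I\<in>?B. NI N ?q 0 I))"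
      proof -
        have "exp (2 * Lz * real b) * z ^ (2 * b) = 1" unfolding pz exp_add[symmetric] by simp
        then show ?thesis by (simp only: mult.assoc[symmetric] mult_1_left)
      qed
      also have "\<dots> \<le> exp (2 * Lz * real b) * ((4 / 5) ^ H * exp (3 * (real N + 2)\<^sup>2 * (3 / 4) ^ (2 * j)) * Zd N ?q (\<lambda>_. 0))"
        by (rule mult_left_mono[OF high_interfaces[OF z'(3,2) j(3)]]) simp
      also have "\<dots> \<le> exp (\<kappa> * real N + 2 * Lz) * (exp (1 - 2 * \<kappa> * real N) * exp 1 * Zd N ?q (\<lambda>_. 0))"
        by (rule mult_mono[OF e1 mult_right_mono[OF mult_mono[OF e2 e3] Zd]]) (use Zd in auto)
      also have "\<dots> = exp ((\<kappa> * real N + 2 * Lz) + (1 - 2 * \<kappa> * real N) + 1) * Zd N ?q (\<lambda>_. 0)"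
        by (simp only: exp_add mult_ac)
      also have "(\<kappa> * real N + 2 * Lz) + (1 - 2 * \<kappa> * real N) + 1 = 2 * Lz + 2 - \<kappa> * real N" by simp
      finally show ?thesis .
    qed
    let ?T = "exp (tau z * real N + C * t)" and ?r = "1 / z * sqrt (real N + 2)"
    have "?S / ?Z \<le> ?r * exp (- tau z * real N - (C + 4) * t) + exp (2 * Lz + 2 - \<kappa> * real N) * (?r * exp (- tau z * real N))"
    proof -
      have "?S \<le> ?r * exp (- tau z * real N - (C + 4) * t) * ?Z + exp (2 * Lz + 2 - \<kappa> * real N) * Zd N ?q (\<lambda>_. 0)"
        using S A B by linarith
      then have "?S / ?Z \<le> ?r * exp (- tau z * real N - (C + 4) * t) + exp (2 * Lz + 2 - \<kappa> * real N) * (Zd N ?q (\<lambda>_. 0) / ?Z)"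
        using X by (simp add: pos_divide_le_eq distrib_right)
      also have "\<dots> \<le> ?r * exp (- tau z * real N - (C + 4) * t) + exp (2 * Lz + 2 - \<kappa> * real N) * (?r * exp (- tau z * real N))"
        by (intro add_left_mono mult_left_mono zero_field_total[OF z'(1,2)]) simp
      finally show ?thesis .
    qed
    from mult_right_mono[OF mult_left_mono[OF this exp_ge_zero[of C2]] exp_ge_zero[of "tau z * real N + C * t"]]
    have "exp (C2 - 0 * 0) * (?S / ?Z) * ?T
      \<le> exp C2 * (?r * exp (- tau z * real N - (C + 4) * t) + exp (2 * Lz + 2 - \<kappa> * real N) * (?r * exp (- tau z * real N))) * ?T"
      by (simp only: mult_zero_left diff_zero)
    also have "\<dots> = (d * sqrt (real N + 2)) * exp (- 4 * t) + d2 * sqrt (real N + 2) * exp (C * t - \<kappa> * real N)"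
    proof -
      have x: "exp (- tau z * real N - (C + 4) * t) * ?T = exp (- 4 * t)" "exp (- tau z * real N) * ?T = exp (C * t)"
        unfolding exp_add[symmetric] by (simp_all add: algebra_simps)
      have y: "exp C2 * exp (2 * Lz + 2 - \<kappa> * real N) * exp (C * t) = exp (C2 + 2 * Lz + 2) * exp (C * t - \<kappa> * real N)"
        unfolding exp_add[symmetric] by (simp add: algebra_simps)
      have "exp C2 * (?r * exp (- tau z * real N - (C + 4) * t) + exp (2 * Lz + 2 - \<kappa> * real N) * (?r * exp (- tau z * real N))) * ?T
        = exp C2 * ?r * (exp (- tau z * real N - (C + 4) * t) * ?T) + ?r * (exp C2 * exp (2 * Lz + 2 - \<kappa> * real N) * (exp (- tau z * real N) * ?T))"
        by (simp only: distrib_left distrib_right mult_ac)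
      then show ?thesis unfolding x y d_def d2_def by (simp add: mult_ac)
    qed
    also have "\<dots> \<le> exp (- 2 * t) + exp (- 2 * t)"
    proof (rule add_mono[OF _ E(5)])
      have "d * sqrt (real N + 2) * exp (- 4 * t) \<le> exp t * exp (- 4 * t)" using E(4) by (intro mult_right_mono) auto
      also have "\<dots> \<le> exp (- 2 * t)" unfolding exp_add[symmetric] using t(1) by simp
      finally show "d * sqrt (real N + 2) * exp (- 4 * t) \<le> exp (- 2 * t)" .
    qed
    finally have "ising_prob \<beta> (c / real N) N {\<sigma>. P (card (minus_region N \<sigma>))} \<le> 4 * exp (- 2 * t)" using p by linarith
    then show ?case by (simp only: t_def P_def)
  qed
  then show ?thesis using e by blast
qed

section \<open>Assembling the two tails\<close>

lemma finite_configs: "finite (configs N)"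
  using bij_betw_finite[OF configs_conf[of N]] finite_box by simp

lemma ising_prob_Un_le:
  assumes "A \<inter> configs N \<subseteq> B \<union> C" shows "ising_prob \<beta> lam N A \<le> ising_prob \<beta> lam N B + ising_prob \<beta> lam N C"
proof -
  have w: "0 \<le> ising_weight \<beta> lam N \<sigma>" for \<sigma> by (simp add: ising_weight_def)
  have "(\<Sum>\<sigma>\<in>configs N \<inter> A. ising_weight \<beta> lam N \<sigma>) \<le> (\<Sum>\<sigma>\<in>configs N \<inter> B. ising_weight \<beta> lam N \<sigma>) + (\<Sum>\<sigma>\<in>configs N \<inter> C. ising_weight \<beta> lam N \<sigma>)"
    by (rule sum_cover_le[OF _ _ w]) (use finite_configs assms in auto)
  then show ?thesis unfolding ising_prob_def add_divide_distrib[symmetric] using w by (intro divide_right_mono sum_nonneg) auto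
qed

lemma ising_prob_mono: "A \<inter> configs N \<subseteq> B \<Longrightarrow> ising_prob \<beta> lam N A \<le> ising_prob \<beta> lam N B"
  using ising_prob_Un_le[of A N B "{}" \<beta> lam] by (simp add: ising_prob_def)

lemma card_minus_region: "card (minus_region N \<sigma>) \<le> (N + 1)\<^sup>2"
proof -
  have "card (minus_region N \<sigma>) \<le> card (box N)"
    unfolding minus_region_def Let_def using finite_box by (intro card_mono) auto
  also have "card (box N) = (N + 1)\<^sup>2" by (simp add: box_def card_cartesian_product nat_add_distrib power2_eq_square)
  finally show ?thesis .
qed

text \<open>\<open>(1 + sqrt 2)^2 = 3 + 2 * sqrt 2 > 5\<close>.\<close>

lemma weight_small:
  assumes "\<beta> > beta_c" shows "exp (- 2 * \<beta>) < 1 / 5"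
proof -
  have s: "1 < sqrt 2" by simp
  have p: "(0::real) < 1 + sqrt 2" by (simp add: add_pos_pos)
  have "5 < (1 + sqrt 2)\<^sup>2" using s by (simp add: power2_eq_square algebra_simps)
  also have "(1 + sqrt 2)\<^sup>2 = exp (2 * beta_c)" unfolding beta_c_def using p by (simp add: exp_double)
  also have "\<dots> < exp (2 * \<beta>)" using assms by simp
  finally have "1 / exp (2 * \<beta>) < 1 / 5" by (intro divide_strict_left_mono) auto
  then show ?thesis by (simp add: exp_minus inverse_eq_divide)
qed

theorem theorem1p2:
  fixes \<beta> c_lam :: real
  assumes "\<beta> > beta_c" and "c_lam > 0"
  shows "(\<forall>\<epsilon>>0. \<exists>K. \<forall>N::nat. N \<ge> 1 \<longrightarrow>
            ising_prob \<beta> (c_lam / real N) N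
              {\<sigma>. real N powr (-4/3) * real (card (minus_region N \<sigma>)) > K} \<le> \<epsilon>)
       \<and> (\<exists>K>0. \<exists>\<delta>::nat \<Rightarrow> real. \<delta> \<longlonglongrightarrow> 0 \<and>
            (\<forall>\<^sub>F N in sequentially.
               ising_prob \<beta> (c_lam / real N) N
                 {\<sigma>. real N powr (-4/3) * real (card (minus_region N \<sigma>)) \<notin> {1/K..K}}
               \<le> exp (- (real N powr (1/3 - \<delta> N)))))"
proof -
  define z where "z = exp (- 2 * \<beta>)"
  have z: "0 < z" "z < 1 / 5" "z = exp (- 2 * \<beta>)" using weight_small[OF assms(1)] by (simp_all add: z_def)
  let ?pr = "\<lambda>N. ising_prob \<beta> (c_lam / real N) N" and ?a = "\<lambda>N \<sigma>. real (card (minus_region N \<sigma>))"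
  obtain K1 where K1: "0 < K1" "\<forall>\<^sub>F N in sequentially. ?pr N {\<sigma>. ?a N \<sigma> > K1 * (real N * cr N)} \<le> 3 * exp (- 2 * cr N)"
    using upper_tail[OF z assms(2)] by (elim exE conjE)
  obtain e where e: "0 < e" "\<forall>\<^sub>F N in sequentially. ?pr N {\<sigma>. ?a N \<sigma> < e * (real N * cr N)} \<le> 4 * exp (- 2 * cr N)"
    using lower_tail[OF z assms(2)] by (elim exE conjE)
  define K where "K = max K1 (1 / e)"
  have K: "0 < K" "K1 \<le> K" "1 / K \<le> e"
  proof -
    show "0 < K" "K1 \<le> K" using K1 by (auto simp: K_def)
    have "1 / e \<le> K" by (simp add: K_def)
    then show "1 / K \<le> e" using e(1) \<open>0 < K\<close> by (simp add: field_simps)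
  qed
  have "\<forall>\<^sub>F N in sequentially. 7 * exp (- 2 * real N powr (1 / 3)) \<le> exp (- (real N powr (1 / 3)))" by real_asymp
  then have main: "\<forall>\<^sub>F N in sequentially. ?pr N {\<sigma>. real N powr (-4/3) * ?a N \<sigma> \<notin> {1/K..K}} \<le> exp (- (real N powr (1/3)))"
    using K1(2) e(2) eventually_ge_at_top[of 1]
  proof eventually_elim
    case (elim N)
    have r: "0 < real N * cr N" using cr_facts(1)[OF elim(4)] elim(4) by simp
    have "{\<sigma>. real N powr (-4/3) * ?a N \<sigma> \<notin> {1/K..K}} \<subseteq> {\<sigma>. ?a N \<sigma> > K1 * (real N * cr N)} \<union> {\<sigma>. ?a N \<sigma> < e * (real N * cr N)}"
    proof
      fix \<sigma> assume "\<sigma> \<in> {\<sigma>. real N powr (-4/3) * ?a N \<sigma> \<notin> {1/K..K}}"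
      then have "?a N \<sigma> / (real N * cr N) < 1 / K \<or> K < ?a N \<sigma> / (real N * cr N)" unfolding cr_facts(5)[OF elim(4)] by auto
      then have "?a N \<sigma> / (real N * cr N) < e \<or> K1 < ?a N \<sigma> / (real N * cr N)" using K by linarith
      then show "\<sigma> \<in> {\<sigma>. ?a N \<sigma> > K1 * (real N * cr N)} \<union> {\<sigma>. ?a N \<sigma> < e * (real N * cr N)}"
        using r by (auto simp: pos_divide_less_eq pos_less_divide_eq)
    qed
    then have "?pr N {\<sigma>. real N powr (-4/3) * ?a N \<sigma> \<notin> {1/K..K}} \<le> 3 * exp (- 2 * cr N) + 4 * exp (- 2 * cr N)"
      using ising_prob_Un_le[of "{\<sigma>. real N powr (-4/3) * ?a N \<sigma> \<notin> {1/K..K}}" N "{\<sigma>. ?a N \<sigma> > K1 * (real N * cr N)}" "{\<sigma>. ?a N \<sigma> < e * (real N * cr N)}" \<beta> "c_lam / real N"]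
        elim(2,3) by (intro order_trans[OF _ add_mono[OF elim(2,3)]]) blast
    also have "\<dots> \<le> exp (- (real N powr (1/3)))" using elim(1) by (simp add: cr_def)
    finally show ?case .
  qed
  have part2: "\<exists>K>0. \<exists>\<delta>::nat \<Rightarrow> real. \<delta> \<longlonglongrightarrow> 0 \<and>
      (\<forall>\<^sub>F N in sequentially. ?pr N {\<sigma>. real N powr (-4/3) * ?a N \<sigma> \<notin> {1/K..K}} \<le> exp (- (real N powr (1/3 - \<delta> N))))"
    using K(1) main by (intro exI[of _ K] conjI exI[of _ "\<lambda>_. 0"]) simp_all
  have part1: "\<exists>K. \<forall>N::nat. N \<ge> 1 \<longrightarrow> ?pr N {\<sigma>. real N powr (-4/3) * ?a N \<sigma> > K} \<le> \<epsilon>" if \<epsilon>: "\<epsilon> > 0" for \<epsilon>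
  proof -
    have "\<forall>\<^sub>F N in sequentially. exp (- (real N powr (1 / 3))) \<le> \<epsilon>" using \<epsilon> by real_asymp
    with main have "\<forall>\<^sub>F N in sequentially. ?pr N {\<sigma>. real N powr (-4/3) * ?a N \<sigma> \<notin> {1/K..K}} \<le> \<epsilon>"
      by eventually_elim linarith
    then obtain N0 where N0: "\<And>N. N \<ge> N0 \<Longrightarrow> ?pr N {\<sigma>. real N powr (-4/3) * ?a N \<sigma> \<notin> {1/K..K}} \<le> \<epsilon>"
      unfolding eventually_sequentially by blast
    \<comment> \<open>For the finitely many \<open>N < N0\<close> the rescaled area is at most the
      number of sites of the box, so enlarging the constant makes the event empty.\<close>
    define K' where "K' = max K (real ((N0 + 1)\<^sup>2))"
    have "?pr N {\<sigma>. real N powr (-4/3) * ?a N \<sigma> > K'} \<le> \<epsilon>" if N: "N \<ge> 1" for N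
    proof (cases "N \<ge> N0")
      case True
      have "?pr N {\<sigma>. real N powr (-4/3) * ?a N \<sigma> > K'} \<le> ?pr N {\<sigma>. real N powr (-4/3) * ?a N \<sigma> \<notin> {1/K..K}}"
        by (rule ising_prob_mono) (auto simp: K'_def)
      then show ?thesis using N0[OF True] by linarith
    next
      case False
      have "real N powr (-4/3) * ?a N \<sigma> \<le> K'" for \<sigma>
      proof -
        have "real N powr (-4/3) \<le> real N powr 0" using N by (intro powr_mono) auto
        then have "real N powr (-4/3) * ?a N \<sigma> \<le> 1 * ?a N \<sigma>" using N by (intro mult_right_mono) auto
        also have "\<dots> \<le> real ((N + 1)\<^sup>2)" using card_minus_region[of N \<sigma>] by (simp only: of_nat_le_iff mult_1_left)
        also have "\<dots> \<le> real ((N0 + 1)\<^sup>2)" using False by (intro of_nat_mono power_mono) auto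
        also have "\<dots> \<le> K'" by (simp only: K'_def max.cobounded2)
        finally show ?thesis .
      qed
      then have "{\<sigma>. real N powr (-4/3) * ?a N \<sigma> > K'} = {}" by (auto simp: not_less)
      then show ?thesis using \<epsilon> by (simp add: ising_prob_def)
    qed
    then show ?thesis by blast
  qed
  show ?thesis using part1 part2 by blast
qed

end
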